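(* Consider the fitted two-subdomain setting described in the context, with $\mu_2h_1\ge\mu_1h_2$. There exists a constant $\beta>0$ such that for all functions $u_h\in V_h^k$ $$\beta\,|||u_h|||\le \sup_{v_h\in V_h^k,\ v_h\neq 0}\frac{A_h(u_h,v_h)}{|||v_h|||}.$$
   Context: Geometry. $\Omega_1,\Omega_2\subset\mathbb{R}^2$ are disjoint convex bounded domains with polygonal boundaries sharing an interface $\Gamma=\overline{\Omega}_1\cap\overline{\Omega}_2$; $\Omega$ is the domain composed of $\Omega_1$ and $\Omega_2$ (the interior of $\overline\Omega_1\cup\overline\Omega_2$), with boundary $\partial\Omega$. $n_i$ is the outward unit normal of $\Omega_i$, and $n:=n_1=-n_2$ on $\Gamma$. $\mu_1,\mu_2>0$ are constants (diffusivities). Meshes. For $i=1,2$, $\{\mathcal{T}_h^i\}_h$ is a family of quasi-uniform, shape regular triangulations fitted to $\Omega_i$ (shape regular: $h_K/\rho_K\le c_\rho$ for all triangles $K$, where $h_K=\mathrm{diam}(K)$ and $\rho_K$ is the radius of the largest inscribed circle). The two meshes are independent and need not match on $\Gamma$. $h_i:=\max_{K\in\mathcal{T}_h^i}h_K$, $h:=\max(h_1,h_2)$. Standing assumption: $\mu_2h_1\ge\mu_1h_2$. Spaces. $V_i:=\{v\in H^1(\Omega_i): v=0\text{ on }\partial\Omega\cap\partial\Omega_i\}$; for $k\ge1$, $V_i^{kh}:=\{v\in V_i: v|_K\in\mathbb{P}_k(K)\ \forall K\in\mathcal{T}_h^i\}$; $V_h^k:=V_1^{kh}\times V_2^{kh}$,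 with elements $v_h=(v_h^1,v_h^2)$. Notation. $[\![w]\!]=w^1-w^2$ on $\Gamma$; $\omega_1=\frac{h_1\mu_2}{h_1\mu_2+h_2\mu_1}$, $\omega_2=\frac{h_2\mu_1}{h_1\mu_2+h_2\mu_1}$, $\gamma=\frac{\mu_1\mu_2}{h_1\mu_2+h_2\mu_1}$; $\{\mu\nabla w\cdot n\}=\omega_1\mu_1\nabla w^1\cdot n+\omega_2\mu_2\nabla w^2\cdot n$. $\|\cdot\|_\Theta$ is the $L^2(\Theta)$-norm, $(\cdot,\cdot)_{\Omega_i}$ and $\langle\cdot,\cdot\rangle_\Gamma$ are $L^2$ inner products. Bilinear form: $A_h(u,v)=\sum_{i=1}^2(\mu_i\nabla u^i,\nabla v^i)_{\Omega_i}-\langle\{\mu\nabla u\cdot n\},[\![v]\!]\rangle_\Gamma+\langle\{\mu\nabla v\cdot n\},[\![u]\!]\rangle_\Gamma$. Norm: $|||w|||^2=\sum_{i=1}^2\|\mu_i^{1/2}\nabla w^i\|_{\Omega_i}^2+\|\gamma^{1/2}[\![w]\!]\|_\Gamma^2$. Constants: $\beta$ is independent of $u_h$ and of the absolute mesh sizes; it may depend on $\mu_1,\mu_2$, $k$, the domains and the geometry of the meshes (shape regularity, quasi-uniformity, ratio $h_1/h_2$). *)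

theory Defs
  imports "HOL-Analysis.Analysis"
begin

type_synonym pt = "real ^ 2"

section \<open>Geometry\<close>

(* The closure of a convex bounded open set with polygonal boundary is a polytope, and conversely. *)
definition convex_polygonal_domain :: "pt set \<Rightarrow> bool" where
  "convex_polygonal_domain \<Omega> \<longleftrightarrow>
     \<Omega> \<noteq> {} \<and> open \<Omega> \<and> connected \<Omega> \<and> bounded \<Omega> \<and> convex \<Omega> \<and> polytope (closure \<Omega>)"

definition composed_domain :: "pt set \<Rightarrow> pt set \<Rightarrow> pt set" where
  "composed_domain \<Omega>1 \<Omega>2 = interior (closure \<Omega>1 \<union> closure \<Omega>2)"

(* Outward unit normal at a boundary point of a convex set: a unit vector of the normal cone.
   It is unique except at corners. *)
definition outward_unit_normal :: "pt set \<Rightarrow> pt \<Rightarrow> pt \<Rightarrow> bool" where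
  "outward_unit_normal \<Omega> x \<nu> \<longleftrightarrow> norm \<nu> = 1 \<and> (\<forall>y\<in>\<Omega>. \<nu> \<bullet> (y - x) \<le> 0)"

(* Integral with respect to arc length along the segment from p to q. *)
definition segment_integral :: "pt \<Rightarrow> pt \<Rightarrow> (pt \<Rightarrow> real) \<Rightarrow> real" where
  "segment_integral p q f = norm (q - p) * (LINT t|lebesgue_on {0..1}. f (linepath p q t))"

section \<open>Sobolev space and traces\<close>

definition square_integrable :: "pt set \<Rightarrow> (pt \<Rightarrow> 'b::euclidean_space) \<Rightarrow> bool" where
  "square_integrable \<Omega> f \<longleftrightarrow>
     f \<in> borel_measurable (lebesgue_on \<Omega>) \<and> integrable (lebesgue_on \<Omega>) (\<lambda>x. (norm (f x))\<^sup>2)"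

(* \<psi> is the gradient field of \<phi>.  Testing with compactly supported C^1 functions gives the same
   weak gradients as testing with smooth ones. *)
definition test_function :: "pt set \<Rightarrow> (pt \<Rightarrow> real) \<Rightarrow> (pt \<Rightarrow> pt) \<Rightarrow> bool" where
  "test_function \<Omega> \<phi> \<psi> \<longleftrightarrow>
     (\<forall>x. GDERIV \<phi> x :> \<psi> x) \<and> continuous_on UNIV \<psi> \<and>
     (\<exists>C. compact C \<and> C \<subseteq> \<Omega> \<and> (\<forall>x. x \<notin> C \<longrightarrow> \<phi> x = 0))"

definition weak_gradient :: "pt set \<Rightarrow> (pt \<Rightarrow> real) \<Rightarrow> (pt \<Rightarrow> pt) \<Rightarrow> bool" where
  "weak_gradient \<Omega> v g \<longleftrightarrow>
     (\<forall>\<phi> \<psi>. test_function \<Omega> \<phi> \<psi> \<longrightarrow>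
        (LINT x|lebesgue_on \<Omega>. v x *\<^sub>R \<psi> x) = - (LINT x|lebesgue_on \<Omega>. \<phi> x *\<^sub>R g x))"

definition H1_with_gradient :: "pt set \<Rightarrow> (pt \<Rightarrow> real) \<Rightarrow> (pt \<Rightarrow> pt) \<Rightarrow> bool" where
  "H1_with_gradient \<Omega> v g \<longleftrightarrow>
     square_integrable \<Omega> v \<and> square_integrable \<Omega> g \<and> weak_gradient \<Omega> v g"

definition H1 :: "pt set \<Rightarrow> (pt \<Rightarrow> real) set" where
  "H1 \<Omega> = {v. \<exists>g. H1_with_gradient \<Omega> v g}"

(* The trace operator is the bounded extension to H^1(\<Omega>) of the restriction of functions in
   H^1(\<Omega>) that are continuous on the closure of \<Omega>.  So v has zero trace on a part S of the
   (polygonal) boundary iff v is the H^1-limit of such functions whose restrictions tend to 0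
   in L^2(S), i.e. in L^2 of each of the segments contained in S. *)
definition zero_trace_on :: "pt set \<Rightarrow> pt set \<Rightarrow> (pt \<Rightarrow> real) \<Rightarrow> bool" where
  "zero_trace_on \<Omega> S v \<longleftrightarrow>
     (\<exists>g \<phi> \<psi>. H1_with_gradient \<Omega> v g \<and>
        (\<forall>m::nat. H1_with_gradient \<Omega> (\<phi> m) (\<psi> m) \<and> continuous_on (closure \<Omega>) (\<phi> m)) \<and>
        (\<lambda>m. LINT x|lebesgue_on \<Omega>. (\<phi> m x - v x)\<^sup>2) \<longlonglongrightarrow> 0 \<and>
        (\<lambda>m. LINT x|lebesgue_on \<Omega>. (norm (\<psi> m x - g x))\<^sup>2) \<longlonglongrightarrow> 0 \<and>
        (\<forall>p q. closed_segment p q \<subseteq> S \<longrightarrow>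
           (\<lambda>m. segment_integral p q (\<lambda>x. (\<phi> m x)\<^sup>2)) \<longlonglongrightarrow> 0))"

definition V_space :: "pt set \<Rightarrow> pt set \<Rightarrow> (pt \<Rightarrow> real) set" where
  "V_space \<Omega> \<Omega>i = {v \<in> H1 \<Omega>i. zero_trace_on \<Omega>i (frontier \<Omega> \<inter> frontier \<Omega>i) v}"

section \<open>Meshes\<close>

(* The library's triangulation provides finiteness and conformity
   (two cells meet in a common, possibly empty, face). *)
definition fitted_mesh :: "pt set \<Rightarrow> pt set set \<Rightarrow> bool" where
  "fitted_mesh \<Omega> \<T> \<longleftrightarrow> triangulation \<T> \<and> (\<forall>K\<in>\<T>. 2 simplex K) \<and> \<Union>\<T> = closure \<Omega>"

definition inradius :: "pt set \<Rightarrow> real" where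
  "inradius K = Sup {r. 0 < r \<and> (\<exists>c. cball c r \<subseteq> K)}"

definition mesh_size :: "pt set set \<Rightarrow> real" where
  "mesh_size \<T> = Max (diameter ` \<T>)"

definition shape_regular :: "real \<Rightarrow> pt set set \<Rightarrow> bool" where
  "shape_regular c \<T> \<longleftrightarrow> (\<forall>K\<in>\<T>. diameter K / inradius K \<le> c)"

definition quasi_uniform :: "real \<Rightarrow> pt set set \<Rightarrow> bool" where
  "quasi_uniform c \<T> \<longleftrightarrow> (\<forall>K\<in>\<T>. mesh_size \<T> \<le> c * diameter K)"

section \<open>Finite element spaces\<close>

definition polys :: "nat \<Rightarrow> (pt \<Rightarrow> real) set" where
  "polys k = {p. \<exists>c :: nat \<Rightarrow> nat \<Rightarrow> real.
                   \<forall>x. p x = (\<Sum>i\<le>k. \<Sum>j\<le>k - i. c i j * (x $ 1) ^ i * (x $ 2) ^ j)}"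

(* The elements are honest functions rather than classes: the triangles K are closed, so each
   class is represented by its continuous representative on the closure of \<Omega>i, whose restriction
   to the boundary is its trace.  Extending it by zero makes the representative unique. *)
definition FE_space :: "nat \<Rightarrow> pt set \<Rightarrow> pt set \<Rightarrow> pt set set \<Rightarrow> (pt \<Rightarrow> real) set" where
  "FE_space k \<Omega> \<Omega>i \<T> =
     {v \<in> V_space \<Omega> \<Omega>i. (\<forall>K\<in>\<T>. \<exists>p\<in>polys k. \<forall>x\<in>K. v x = p x) \<and>
                        (\<forall>x. x \<notin> closure \<Omega>i \<longrightarrow> v x = 0)}"

definition FE_product ::
  "nat \<Rightarrow> pt set \<Rightarrow> pt set \<Rightarrow> pt set set \<Rightarrow> pt set set \<Rightarrow> ((pt \<Rightarrow> real) \<times> (pt \<Rightarrow> real)) set" where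
  "FE_product k \<Omega>1 \<Omega>2 \<T>1 \<T>2 =
     FE_space k (composed_domain \<Omega>1 \<Omega>2) \<Omega>1 \<T>1 \<times> FE_space k (composed_domain \<Omega>1 \<Omega>2) \<Omega>2 \<T>2"

abbreviation zero_pair :: "(pt \<Rightarrow> real) \<times> (pt \<Rightarrow> real)" where
  "zero_pair \<equiv> ((\<lambda>_. 0), (\<lambda>_. 0))"

section \<open>Bilinear form and norm\<close>

(* Gradient of w at x relative to the closed subdomain S.  For w in a finite element space it is
   the gradient of the polynomial piece at every point of S off the mesh edges, where it
   represents the weak gradient, and also at every boundary point that is interior to a boundary
   edge; at the latter it is the one-sided limit of the gradient from within S. *)
definition grad_on :: "pt set \<Rightarrow> (pt \<Rightarrow> real) \<Rightarrow> pt \<Rightarrow> pt" where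
  "grad_on S w x = (\<chi> i. frechet_derivative w (at x within S) (axis i 1))"

definition weight1 :: "real \<Rightarrow> real \<Rightarrow> real \<Rightarrow> real \<Rightarrow> real" where
  "weight1 \<mu>1 \<mu>2 h1 h2 = h1 * \<mu>2 / (h1 * \<mu>2 + h2 * \<mu>1)"

definition weight2 :: "real \<Rightarrow> real \<Rightarrow> real \<Rightarrow> real \<Rightarrow> real" where
  "weight2 \<mu>1 \<mu>2 h1 h2 = h2 * \<mu>1 / (h1 * \<mu>2 + h2 * \<mu>1)"

definition gamma_coeff :: "real \<Rightarrow> real \<Rightarrow> real \<Rightarrow> real \<Rightarrow> real" where
  "gamma_coeff \<mu>1 \<mu>2 h1 h2 = \<mu>1 * \<mu>2 / (h1 * \<mu>2 + h2 * \<mu>1)"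

definition jump :: "(pt \<Rightarrow> real) \<times> (pt \<Rightarrow> real) \<Rightarrow> pt \<Rightarrow> real" where
  "jump w x = fst w x - snd w x"

definition flux_average ::
  "pt set \<Rightarrow> pt set \<Rightarrow> pt \<Rightarrow> real \<Rightarrow> real \<Rightarrow> real \<Rightarrow> real \<Rightarrow>
   (pt \<Rightarrow> real) \<times> (pt \<Rightarrow> real) \<Rightarrow> pt \<Rightarrow> real" where
  "flux_average \<Omega>1 \<Omega>2 n \<mu>1 \<mu>2 h1 h2 w x =
     weight1 \<mu>1 \<mu>2 h1 h2 * \<mu>1 * (grad_on (closure \<Omega>1) (fst w) x \<bullet> n) +
     weight2 \<mu>1 \<mu>2 h1 h2 * \<mu>2 * (grad_on (closure \<Omega>2) (snd w) x \<bullet> n)"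

(* The interface is the segment from a to b, with constant unit normal n. *)
definition nitsche_form ::
  "pt set \<Rightarrow> pt set \<Rightarrow> pt \<Rightarrow> pt \<Rightarrow> pt \<Rightarrow> real \<Rightarrow> real \<Rightarrow> real \<Rightarrow> real \<Rightarrow>
   (pt \<Rightarrow> real) \<times> (pt \<Rightarrow> real) \<Rightarrow> (pt \<Rightarrow> real) \<times> (pt \<Rightarrow> real) \<Rightarrow> real" where
  "nitsche_form \<Omega>1 \<Omega>2 a b n \<mu>1 \<mu>2 h1 h2 u v =
     (LINT x|lebesgue_on \<Omega>1.
        (\<mu>1 *\<^sub>R grad_on (closure \<Omega>1) (fst u) x) \<bullet> grad_on (closure \<Omega>1) (fst v) x) +
     (LINT x|lebesgue_on \<Omega>2.
        (\<mu>2 *\<^sub>R grad_on (closure \<Omega>2) (snd u) x) \<bullet> grad_on (closure \<Omega>2) (snd v) x) -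
     segment_integral a b (\<lambda>x. flux_average \<Omega>1 \<Omega>2 n \<mu>1 \<mu>2 h1 h2 u x * jump v x) +
     segment_integral a b (\<lambda>x. flux_average \<Omega>1 \<Omega>2 n \<mu>1 \<mu>2 h1 h2 v x * jump u x)"

definition triple_norm ::
  "pt set \<Rightarrow> pt set \<Rightarrow> pt \<Rightarrow> pt \<Rightarrow> real \<Rightarrow> real \<Rightarrow> real \<Rightarrow> real \<Rightarrow>
   (pt \<Rightarrow> real) \<times> (pt \<Rightarrow> real) \<Rightarrow> real" where
  "triple_norm \<Omega>1 \<Omega>2 a b \<mu>1 \<mu>2 h1 h2 w = sqrt (
     (LINT x|lebesgue_on \<Omega>1. (norm (sqrt \<mu>1 *\<^sub>R grad_on (closure \<Omega>1) (fst w) x))\<^sup>2) +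
     (LINT x|lebesgue_on \<Omega>2. (norm (sqrt \<mu>2 *\<^sub>R grad_on (closure \<Omega>2) (snd w) x))\<^sup>2) +
     segment_integral a b (\<lambda>x. (sqrt (gamma_coeff \<mu>1 \<mu>2 h1 h2) * jump w x)\<^sup>2))"

end

theory Submission
  imports Defs "HOL-Computational_Algebra.Polynomial"
begin

text \<open>In \<open>A\<^sub>h(u, u)\<close> the two flux terms cancel and only the energy of the gradients remains,
  so it is enough to control the jump.  Choose patches of length comparable to \<open>h\<^sub>1\<close> on the
  interface and in each patch one triangle of the first mesh with an edge on the interface and its
  apex inside \<open>\<Omega>\<^sub>1\<close>.  The test function vanishes on \<open>\<Omega>\<^sub>2\<close> and at all nodes of the first mesh except
  these apexes, where its value is minus the jump at the patch centre.  Then \<open>v = 0\<close> on \<open>\<Gamma>\<close>, and the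
  normal derivative of \<open>v\<close> on \<open>\<Gamma>\<close> has the sign of the jump at the patch centre, so the flux of \<open>v\<close>
  against the jump bounds these values from below; \<open>\<mu>\<^sub>1 h\<^sub>2 \<le> \<mu>\<^sub>2 h\<^sub>1\<close> gives
  \<open>\<omega>\<^sub>1 \<ge> 1/2\<close>.  The variation of the jump inside a patch is bounded by the gradients through the
  inverse trace inequality.  On meshes too coarse for a single patch the jump is bounded by its
  variation alone, since the traces vanish at an endpoint of \<open>\<Gamma>\<close>.\<close>

section \<open>Integration in the plane\<close>

text \<open>The meshes need not match on \<Gamma>, so in general the jump is not piecewise
  polynomial with respect to either of them. Hence only its values at patch centres are tested, and
  the second mesh enters through the inverse trace inequality alone; there the scale
  \<open>h2\<close> is exchanged for \<open>h1\<close>, which is where the bound on their ratio is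
  spent. The test function is not \<open>u\<close> plus a correction: depending on whether the
  gradients or the centre values dominate, it is \<open>u\<close> or the correction alone. Much of
  the work comes from the spaces. The correction must have a weak gradient and zero trace, so its
  apexes have to lie in the open set \<Omega>1; for this the patches are long compared with
  \<open>h1\<close> and the apex is taken near the patch centre. Conversely, that \<open>u\<close>
  vanishes at an endpoint of \<Gamma> must be extracted from an H^1-limit of functions whose
  boundary values tend to 0 only in L^2. Weighted means over thin strips along a boundary segment,
  stable in H^1 uniformly in the width, carry this information to the limit.\<close>

lemma lborel_vec2:
  "(lborel :: (real ^ 2) measure) =
     distr (lborel \<Otimes>\<^sub>M lborel) borel (\<lambda>z. fst z *\<^sub>R axis 1 1 + snd z *\<^sub>R axis 2 1)"
proof (rule lborel_eqI)
  have Basis2: "Basis = {axis 1 1, axis 2 1 :: real^2}"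
    by (auto simp: Basis_vec_def exhaust_2) (metis exhaust_2)
  have ne: "axis 1 1 \<noteq> (axis 2 1 :: real^2)"
    by (simp add: axis_eq_axis)
  fix l u :: "real^2"
  assume le: "\<And>b. b \<in> Basis \<Longrightarrow> l \<bullet> b \<le> u \<bullet> b"
  have "(\<lambda>z. fst z *\<^sub>R axis 1 1 + snd z *\<^sub>R axis 2 1) -` box l u =
      box (l $ 1) (u $ 1) \<times> box (l $ 2) (u $ 2)"
    unfolding box_def Basis2 by (auto simp: inner_axis' axis_def inner_vec_def sum_2)
  then show "emeasure (distr (lborel \<Otimes>\<^sub>M lborel) borel
        (\<lambda>z. fst z *\<^sub>R axis 1 1 + snd z *\<^sub>R axis 2 1)) (box l u) = ennreal (\<Prod>b\<in>Basis. (u - l) \<bullet> b)"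
    using le[of "axis 1 1"] le[of "axis 2 1"] ne
    by (subst emeasure_distr)
      (auto simp: borel_prod space_pair_measure lborel.emeasure_pair_measure_Times Basis2
        inner_axis ennreal_mult[symmetric])
qed simp

lemma nn_integral_vec2:
  fixes f :: "real ^ 2 \<Rightarrow> ennreal"
  assumes [measurable]: "f \<in> borel_measurable borel"
  shows "(\<integral>\<^sup>+x. f x \<partial>lborel) =
    (\<integral>\<^sup>+s. \<integral>\<^sup>+t. f (s *\<^sub>R axis 1 1 + t *\<^sub>R axis 2 1) \<partial>lborel \<partial>lborel)"
proof -
  have "(\<integral>\<^sup>+x. f x \<partial>lborel) =
     (\<integral>\<^sup>+z. f (fst z *\<^sub>R axis 1 1 + snd z *\<^sub>R axis 2 1) \<partial>(lborel \<Otimes>\<^sub>M lborel))"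
    by (subst lborel_vec2, subst nn_integral_distr) auto
  also have "\<dots> = (\<integral>\<^sup>+s. \<integral>\<^sup>+t. f (s *\<^sub>R axis 1 1 + t *\<^sub>R axis 2 1) \<partial>lborel \<partial>lborel)"
    by (subst lborel.nn_integral_fst[symmetric]) auto
  finally show ?thesis .
qed

text \<open>A linear change of variables by two one-dimensional ones: at fixed \<open>t\<close> the
  first coordinate replaces \<open>s\<close> with factor \<open>u1\<close>; at a fixed first
  coordinate the second one depends on \<open>t\<close> with slope \<open>d\<close>. The product of
  both factors is the determinant.\<close>

lemma nn_integral_parallelogram_aux:
  fixes F :: "real \<times> real \<Rightarrow> ennreal"
  assumes [measurable]: "F \<in> borel_measurable borel" and u1: "u1 \<noteq> (0::real)"
    and det: "u1 * w2 - u2 * w1 \<noteq> (0::real)"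
  shows "(\<integral>\<^sup>+s. \<integral>\<^sup>+t. F (s, t) \<partial>lborel \<partial>lborel) = ennreal \<bar>u1 * w2 - u2 * w1\<bar> *
     (\<integral>\<^sup>+s. \<integral>\<^sup>+t. F (p1 + s * u1 + t * w1, p2 + s * u2 + t * w2) \<partial>lborel \<partial>lborel)"
proof -
  define d where "d = (u1 * w2 - u2 * w1) / u1"
  have d: "d \<noteq> 0" using u1 det by (simp add: d_def)
  have [measurable]: "F \<in> borel_measurable (borel \<Otimes>\<^sub>M borel)"
    by (simp add: borel_prod)
  have e1: "(\<integral>\<^sup>+s. \<integral>\<^sup>+t. F (p1 + s * u1 + t * w1, p2 + s * u2 + t * w2) \<partial>lborel \<partial>lborel) =
     (\<integral>\<^sup>+t. \<integral>\<^sup>+s. F (p1 + s * u1 + t * w1, p2 + s * u2 + t * w2) \<partial>lborel \<partial>lborel)"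
    by (rule lborel_pair.Fubini') measurable
  have "ennreal \<bar>u1\<bar> * (\<integral>\<^sup>+t. \<integral>\<^sup>+s. F (p1 + s * u1 + t * w1, p2 + s * u2 + t * w2) \<partial>lborel \<partial>lborel) =
     (\<integral>\<^sup>+t. ennreal \<bar>u1\<bar> * (\<integral>\<^sup>+s. F (p1 + s * u1 + t * w1, p2 + s * u2 + t * w2) \<partial>lborel) \<partial>lborel)"
    by (rule nn_integral_cmult[symmetric]) measurable
  also have "\<dots> = (\<integral>\<^sup>+t. \<integral>\<^sup>+x. F (x, p2 + (x - p1 - t * w1) / u1 * u2 + t * w2) \<partial>lborel \<partial>lborel)"
  proof (rule nn_integral_cong)
    fix t :: real
    show "ennreal \<bar>u1\<bar> * (\<integral>\<^sup>+s. F (p1 + s * u1 + t * w1, p2 + s * u2 + t * w2) \<partial>lborel) =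
      (\<integral>\<^sup>+x. F (x, p2 + (x - p1 - t * w1) / u1 * u2 + t * w2) \<partial>lborel)"
    proof (rule trans[OF _ nn_integral_real_affine[OF _ u1, of _ "p1 + t * w1", symmetric]])
      show "(\<lambda>x. F (x, p2 + (x - p1 - t * w1) / u1 * u2 + t * w2)) \<in> borel_measurable borel"
        by measurable
      have "(p1 + s * u1 + t * w1, p2 + s * u2 + t * w2) = (p1 + t * w1 + u1 * s,
          p2 + (p1 + t * w1 + u1 * s - p1 - t * w1) / u1 * u2 + t * w2)" for s
        using u1 by simp
      then show "ennreal \<bar>u1\<bar> * (\<integral>\<^sup>+s. F (p1 + s * u1 + t * w1, p2 + s * u2 + t * w2) \<partial>lborel) =
        ennreal \<bar>u1\<bar> * (\<integral>\<^sup>+s. F (p1 + t * w1 + u1 * s,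
          p2 + (p1 + t * w1 + u1 * s - p1 - t * w1) / u1 * u2 + t * w2) \<partial>lborel)"
        by (simp only:)
    qed
  qed
  also have "\<dots> = (\<integral>\<^sup>+x. \<integral>\<^sup>+t. F (x, p2 + (x - p1 - t * w1) / u1 * u2 + t * w2) \<partial>lborel \<partial>lborel)"
    by (rule lborel_pair.Fubini') measurable
  also have "\<dots> = (\<integral>\<^sup>+x. \<integral>\<^sup>+t. F (x, p2 + (x - p1) / u1 * u2 + d * t) \<partial>lborel \<partial>lborel)"
    unfolding d_def using u1 by (intro nn_integral_cong arg_cong[where f=F]) (simp add: field_simps)
  finally have e2: "ennreal \<bar>u1\<bar> * (\<integral>\<^sup>+t. \<integral>\<^sup>+s. F (p1 + s * u1 + t * w1, p2 + s * u2 + t * w2) \<partial>lborel \<partial>lborel) =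
      (\<integral>\<^sup>+x. \<integral>\<^sup>+t. F (x, p2 + (x - p1) / u1 * u2 + d * t) \<partial>lborel \<partial>lborel)" .
  have "ennreal \<bar>d\<bar> * (\<integral>\<^sup>+x. \<integral>\<^sup>+t. F (x, p2 + (x - p1) / u1 * u2 + d * t) \<partial>lborel \<partial>lborel) =
      (\<integral>\<^sup>+x. ennreal \<bar>d\<bar> * (\<integral>\<^sup>+t. F (x, p2 + (x - p1) / u1 * u2 + d * t) \<partial>lborel) \<partial>lborel)"
    by (rule nn_integral_cmult[symmetric]) measurable
  also have "\<dots> = (\<integral>\<^sup>+x. \<integral>\<^sup>+y. F (x, y) \<partial>lborel \<partial>lborel)"
  proof (rule nn_integral_cong)
    fix x :: real
    show "ennreal \<bar>d\<bar> * (\<integral>\<^sup>+t. F (x, p2 + (x - p1) / u1 * u2 + d * t) \<partial>lborel) = (\<integral>\<^sup>+y. F (x, y) \<partial>lborel)"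
      by (rule nn_integral_real_affine[OF _ d, symmetric]) measurable
  qed
  finally have "(\<integral>\<^sup>+x. \<integral>\<^sup>+y. F (x, y) \<partial>lborel \<partial>lborel) = ennreal \<bar>d\<bar> * (ennreal \<bar>u1\<bar> *
     (\<integral>\<^sup>+s. \<integral>\<^sup>+t. F (p1 + s * u1 + t * w1, p2 + s * u2 + t * w2) \<partial>lborel \<partial>lborel))"
    unfolding e1 e2 by (rule sym)
  moreover have "ennreal \<bar>d\<bar> * ennreal \<bar>u1\<bar> = ennreal \<bar>u1 * w2 - u2 * w1\<bar>"
    using u1 by (simp add: d_def ennreal_mult[symmetric] abs_divide)
  ultimately show ?thesis by (simp add: mult.assoc[symmetric])
qed

definition cross2 :: "pt \<Rightarrow> pt \<Rightarrow> real" where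
  "cross2 u w = u $ 1 * w $ 2 - u $ 2 * w $ 1"

text \<open>A vanishing first component of \<open>u\<close> is handled by exchanging
  \<open>u\<close> and \<open>w\<close>, which only changes the sign of the determinant.\<close>

lemma nn_integral_parallelogram:
  fixes f :: "pt \<Rightarrow> ennreal"
  assumes [measurable]: "f \<in> borel_measurable borel" and det: "cross2 u w \<noteq> 0"
  shows "(\<integral>\<^sup>+x. f x \<partial>lborel) = ennreal \<bar>cross2 u w\<bar> *
     (\<integral>\<^sup>+s. \<integral>\<^sup>+t. f (p + s *\<^sub>R u + t *\<^sub>R w) \<partial>lborel \<partial>lborel)"
proof -
  define F where "F z = f (fst z *\<^sub>R axis 1 1 + snd z *\<^sub>R axis 2 1)" for z :: "real \<times> real"
  have [measurable]: "F \<in> borel_measurable borel"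
    unfolding F_def by (intro measurable_compose[OF _ assms(1)] borel_measurable_continuous_onI continuous_intros)
  have vec: "q = q $ 1 *\<^sub>R axis 1 1 + q $ 2 *\<^sub>R axis 2 1" for q :: pt
    by (simp add: vec_eq_iff forall_2 axis_def)
  have f: "f q = F (q $ 1, q $ 2)" for q
    unfolding F_def using vec[of q] by simp
  have 1: "(\<integral>\<^sup>+x. f x \<partial>lborel) = (\<integral>\<^sup>+s. \<integral>\<^sup>+t. F (s, t) \<partial>lborel \<partial>lborel)"
    by (subst nn_integral_vec2) (auto simp: F_def)
  show ?thesis
  proof (cases "u $ 1 = 0")
    case False
    from nn_integral_parallelogram_aux[OF _ this det[unfolded cross2_def], of F "p $ 1" "p $ 2"]
    show ?thesis unfolding 1 by (simp add: cross2_def f)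
  next
    case True
    have [measurable]: "F \<in> borel_measurable (borel \<Otimes>\<^sub>M borel)"
      by (simp add: borel_prod)
    have "w $ 1 \<noteq> 0" using det True by (auto simp: cross2_def)
    then have "(\<integral>\<^sup>+s. \<integral>\<^sup>+t. F (s, t) \<partial>lborel \<partial>lborel) =
       ennreal \<bar>w $ 1 * u $ 2 - w $ 2 * u $ 1\<bar> *
     (\<integral>\<^sup>+s. \<integral>\<^sup>+t. F (p $ 1 + s * w $ 1 + t * u $ 1, p $ 2 + s * w $ 2 + t * u $ 2) \<partial>lborel \<partial>lborel)"
      using det by (rule_tac nn_integral_parallelogram_aux) (auto simp: cross2_def mult.commute)
    also have "(\<integral>\<^sup>+s. \<integral>\<^sup>+t. F (p $ 1 + s * w $ 1 + t * u $ 1, p $ 2 + s * w $ 2 + t * u $ 2) \<partial>lborel \<partial>lborel)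
      = (\<integral>\<^sup>+t. \<integral>\<^sup>+s. F (p $ 1 + s * w $ 1 + t * u $ 1, p $ 2 + s * w $ 2 + t * u $ 2) \<partial>lborel \<partial>lborel)"
      by (rule lborel_pair.Fubini') measurable
    also have "ennreal \<bar>w $ 1 * u $ 2 - w $ 2 * u $ 1\<bar> = ennreal \<bar>cross2 u w\<bar>"
      by (simp add: cross2_def abs_minus_commute mult.commute)
    finally have "(\<integral>\<^sup>+s. \<integral>\<^sup>+t. F (s, t) \<partial>lborel \<partial>lborel) = ennreal \<bar>cross2 u w\<bar> *
       (\<integral>\<^sup>+t. \<integral>\<^sup>+s. F (p $ 1 + s * w $ 1 + t * u $ 1, p $ 2 + s * w $ 2 + t * u $ 2) \<partial>lborel \<partial>lborel)" .
    moreover have "F (p $ 1 + s * w $ 1 + t * u $ 1, p $ 2 + s * w $ 2 + t * u $ 2) = f (p + t *\<^sub>R u + s *\<^sub>R w)" for s t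
      unfolding f by (intro arg_cong[where f=F]) simp
    ultimately show ?thesis unfolding 1 by (simp only:)
  qed
qed

text \<open>Gradients of piecewise polynomials are described only off a null set. What happens there
  is irrelevant because Lebesgue measure is complete: in the base case of the induction
  \<open>S\<close> itself is negligible.\<close>

lemma borel_measurable_lebesgue_on_pieces:
  fixes f :: "'a::euclidean_space \<Rightarrow> 'b::euclidean_space"
  assumes fin: "finite I" and S: "S \<in> sets lebesgue"
    and A: "\<And>i. i \<in> I \<Longrightarrow> A i \<in> sets lebesgue"
    and g: "\<And>i. i \<in> I \<Longrightarrow> continuous_on UNIV (g i)"
    and eq: "\<And>i x. i \<in> I \<Longrightarrow> x \<in> A i \<Longrightarrow> x \<in> S \<Longrightarrow> f x = g i x"
    and neg: "negligible (S - (\<Union>i\<in>I. A i))"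
  shows "f \<in> borel_measurable (lebesgue_on S)"
  using fin S A g eq neg
proof (induction I arbitrary: S rule: finite_induct)
  case empty
  then have N: "negligible S" by simp
  show ?case
  proof (rule measurableI)
    fix X :: "'b set"
    have "f -` X \<inter> space (lebesgue_on S) \<subseteq> S" by auto
    then have "negligible (f -` X \<inter> space (lebesgue_on S))"
      using N negligible_subset by blast
    then show "f -` X \<inter> space (lebesgue_on S) \<in> sets (lebesgue_on S)"
      using negligible_imp_sets[OF N] negligible_imp_sets by (subst sets_restrict_space_iff) auto
  qed simp
next
  case (insert i I)
  have 1: "f \<in> borel_measurable (lebesgue_on (S - A i))"
  proof (rule insert.IH)
    show "negligible (S - A i - (\<Union>i\<in>I. A i))"
      using insert.prems(5) by (rule negligible_subset) auto
  qed (use insert.prems in auto)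
  have "g i \<in> borel_measurable (lebesgue_on (S \<inter> A i))"
    using insert.prems(3)[of i] insert.prems(1,2)
    by (intro continuous_imp_measurable_on_sets_lebesgue) (auto intro: continuous_on_subset)
  then have 2: "f \<in> borel_measurable (lebesgue_on (S \<inter> A i))"
    by (rule measurable_cong[THEN iffD1, rotated]) (use insert.prems(4)[of i] in \<open>auto dest: sym\<close>)
  have *: "(\<lambda>x. if x \<in> S - A i then f x else 0) \<in> borel_measurable lebesgue"
     "(\<lambda>x. if x \<in> S \<inter> A i then f x else 0) \<in> borel_measurable lebesgue"
    using 1 2 insert.prems(1,2) by (simp_all only: borel_measurable_if sets.Diff sets.Int insertI1)
  have "(\<lambda>x. (if x \<in> S - A i then f x else 0) + (if x \<in> S \<inter> A i then f x else 0))
      \<in> borel_measurable lebesgue"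
    by (rule borel_measurable_add[OF *])
  also have "(\<lambda>x. (if x \<in> S - A i then f x else 0) + (if x \<in> S \<inter> A i then f x else 0)) =
      (\<lambda>x. if x \<in> S then f x else 0)" by auto
  finally show ?case using insert.prems(1) by (simp only: borel_measurable_if)
qed

text \<open>The quadratic form given by the integral of
  \<open>(\<alpha> * f x + \<beta> * g x)\<^sup>2\<close> is nonnegative, so its discriminant is not
  positive; the degenerate case \<open>C = 0\<close> is separate.\<close>

lemma integral_Cauchy_Schwarz:
  fixes f g :: "'a \<Rightarrow> real"
  assumes f: "integrable M (\<lambda>x. (f x)\<^sup>2)" and g: "integrable M (\<lambda>x. (g x)\<^sup>2)"
    and fg: "integrable M (\<lambda>x. f x * g x)"
  shows "(LINT x|M. f x * g x)\<^sup>2 \<le> (LINT x|M. (f x)\<^sup>2) * (LINT x|M. (g x)\<^sup>2)"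
proof -
  define A B C where "A = (LINT x|M. (f x)\<^sup>2)" and "B = (LINT x|M. f x * g x)"
    and "C = (LINT x|M. (g x)\<^sup>2)"
  have "0 \<le> \<alpha>\<^sup>2 * A + 2 * \<alpha> * \<beta> * B + \<beta>\<^sup>2 * C" for \<alpha> \<beta>
  proof -
    have "0 \<le> (LINT x|M. (\<alpha> * f x + \<beta> * g x)\<^sup>2)" by simp
    also have "\<dots> = (LINT x|M. \<alpha>\<^sup>2 * (f x)\<^sup>2 + 2 * \<alpha> * \<beta> * (f x * g x) + \<beta>\<^sup>2 * (g x)\<^sup>2)"
      by (rule Bochner_Integration.integral_cong) (auto simp: power2_eq_square algebra_simps)
    also have "\<dots> = \<alpha>\<^sup>2 * A + 2 * \<alpha> * \<beta> * B + \<beta>\<^sup>2 * C"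
      unfolding A_def B_def C_def using f g fg
      by (subst Bochner_Integration.integral_add, simp, simp)+ simp
    finally show ?thesis .
  qed
  note q = this
  have A: "0 \<le> A" and C: "0 \<le> C" by (auto simp: A_def C_def)
  have "B\<^sup>2 \<le> A * C"
  proof (cases "C = 0")
    case True
    have "B = 0"
    proof (rule ccontr)
      assume "B \<noteq> 0"
      \<comment> \<open>This choice gives the quadratic form the value -1.\<close>
      then show False using q[of 1 "- (A + 1) / (2 * B)"] True A by (simp add: field_simps)
    qed
    then show ?thesis using True by simp
  next
    case False
    have "0 \<le> C * (C * A - B\<^sup>2)"
      using q[of C "- B"] by (simp add: power2_eq_square algebra_simps)
    then show ?thesis using False C by (simp add: zero_le_mult_iff mult.commute)
  qed
  then show ?thesis by (simp add: A_def B_def C_def)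
qed

section \<open>Smooth cut-off functions\<close>

lemma DERIV_pos_part_power:
  "((\<lambda>x::real. (max 0 x) ^ Suc (Suc n)) has_real_derivative (real n + 2) * (max 0 x) ^ Suc n) (at x)"
proof -
  consider "x > 0" | "x < 0" | "x = 0" by linarith
  then show ?thesis
  proof cases
    case 1
    have "((\<lambda>x::real. x ^ Suc (Suc n)) has_real_derivative (real n + 2) * x ^ Suc n) (at x)"
      by (rule derivative_eq_intros refl)+ (simp add: algebra_simps)
    then have "((\<lambda>x::real. (max 0 x) ^ Suc (Suc n)) has_real_derivative (real n + 2) * x ^ Suc n) (at x)"
      by (rule has_field_derivative_transform_within_open[of _ _ _ "{0<..}"]) (use 1 in auto)
    then show ?thesis using 1 by simp
  next
    case 2
    have "((\<lambda>x::real. 0) has_real_derivative 0) (at x)" by simp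
    then have "((\<lambda>x::real. (max 0 x) ^ Suc (Suc n)) has_real_derivative 0) (at x)"
      by (rule has_field_derivative_transform_within_open[of _ _ _ "{..<0}"]) (use 2 in auto)
    then show ?thesis using 2 by simp
  next
    case 3
    have "((\<lambda>h::real. (max 0 h) ^ Suc n) \<longlongrightarrow> (max 0 0) ^ Suc n) (at 0)"
      by (intro tendsto_intros)
    moreover have "((max 0 (0 + h)) ^ Suc (Suc n) - (max 0 0) ^ Suc (Suc n)) / h = (max 0 h) ^ Suc n"
      if "h \<noteq> 0" for h :: real using that by (auto simp: max_def)
    ultimately have "((\<lambda>h::real. ((max 0 (0 + h)) ^ Suc (Suc n) - (max 0 0) ^ Suc (Suc n)) / h) \<longlongrightarrow> 0) (at 0)"
      by (subst tendsto_cong[where g="\<lambda>h. (max 0 h) ^ Suc n"]) (auto simp: eventually_at_filter)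
    then show ?thesis using 3 by (simp add: DERIV_def)
  qed
qed

text \<open>Truncated powers, the standard basis of splines: from exponent 2 on they are
  continuously differentiable across the knot, so the piecewise polynomials below need no
  gluing.\<close>

definition trunc_pow :: "real \<Rightarrow> nat \<Rightarrow> real \<Rightarrow> real" where
  "trunc_pow c n t = max 0 (t - c) ^ n"

lemma DERIV_trunc_pow:
  assumes "n \<ge> 2"
  shows "((\<lambda>t. trunc_pow c n t) has_real_derivative real n * trunc_pow c (n - 1) t) (at t)"
proof -
  obtain k where n: "n = Suc (Suc k)"
    using assms by (metis numeral_2_eq_2 le_Suc_ex add_Suc)
  have "((\<lambda>t. (\<lambda>x. max 0 x ^ Suc (Suc k)) (t + - c)) has_real_derivative
     (real k + 2) * max 0 (t + - c) ^ Suc k) (at t)"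
    using DERIV_pos_part_power[of k "t + - c"] by (subst (asm) DERIV_shift)
  then show ?thesis by (simp add: n trunc_pow_def[abs_def] algebra_simps)
qed

lemma continuous_trunc_pow [continuous_intros]: "continuous_on A (trunc_pow c n)"
  unfolding trunc_pow_def[abs_def] by (intro continuous_intros)

text \<open>The quintic that rises from 0 to 1 on [1,2] with two vanishing derivatives at either
  end, constant outside. The second group of coefficients is its Taylor expansion about 2 without
  the constant term 1. Degree five makes the derivative \<open>bump\<close> still C^1, as test
  functions require. The interval [1,2] stays away from 0, so that after rescaling the support stays
  away from the boundary.\<close>

definition smooth_step :: "real \<Rightarrow> real" where
  "smooth_step t = 10 * trunc_pow 1 3 t - 15 * trunc_pow 1 4 t + 6 * trunc_pow 1 5 t -
     (10 * trunc_pow 2 3 t + 15 * trunc_pow 2 4 t + 6 * trunc_pow 2 5 t)"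

definition bump :: "real \<Rightarrow> real" where
  "bump t = 30 * trunc_pow 1 2 t - 60 * trunc_pow 1 3 t + 30 * trunc_pow 1 4 t -
     (30 * trunc_pow 2 2 t + 60 * trunc_pow 2 3 t + 30 * trunc_pow 2 4 t)"

definition bump' :: "real \<Rightarrow> real" where
  "bump' t = 60 * trunc_pow 1 1 t - 180 * trunc_pow 1 2 t + 120 * trunc_pow 1 3 t -
     (60 * trunc_pow 2 1 t + 180 * trunc_pow 2 2 t + 120 * trunc_pow 2 3 t)"

lemma DERIV_smooth_step: "(smooth_step has_real_derivative bump t) (at t)"
  unfolding smooth_step_def[abs_def] bump_def
  by (rule derivative_eq_intros DERIV_trunc_pow refl | simp)+

lemma DERIV_bump: "(bump has_real_derivative bump' t) (at t)"
  unfolding bump_def[abs_def] bump'_def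
  by (rule derivative_eq_intros DERIV_trunc_pow refl | simp)+

lemma continuous_on_bump' [continuous_intros]: "continuous_on A bump'"
  unfolding bump'_def[abs_def] by (intro continuous_intros)

lemma continuous_on_bump [continuous_intros]: "continuous_on A bump"
  unfolding bump_def[abs_def] by (intro continuous_intros)

lemma continuous_on_smooth_step [continuous_intros]: "continuous_on A smooth_step"
  unfolding smooth_step_def[abs_def] by (intro continuous_intros)

lemma bump_outside: "t \<le> 1 \<or> t \<ge> 2 \<Longrightarrow> bump t = 0"
  by (auto simp: bump_def trunc_pow_def max_def) algebra

lemma bump_inside: "1 \<le> t \<Longrightarrow> t \<le> 2 \<Longrightarrow> bump t = 30 * ((t - 1) * (2 - t))\<^sup>2"
  by (auto simp: bump_def trunc_pow_def max_def eval_nat_numeral algebra_simps)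

lemma bump_nonneg: "0 \<le> bump t"
  using bump_outside[of t] bump_inside[of t] by (cases "1 \<le> t \<and> t \<le> 2") auto

lemma bump_le: "bump t \<le> 2"
proof (cases "1 \<le> t \<and> t \<le> 2")
  case True
  have "(t - 1) * (2 - t) \<le> 1 / 4"
    using zero_le_power2[of "t - 3 / 2"] by (simp add: power2_eq_square algebra_simps)
  then have "((t - 1) * (2 - t))\<^sup>2 \<le> (1 / 4)\<^sup>2"
    using True by (intro power_mono) auto
  then have "30 * ((t - 1) * (2 - t))\<^sup>2 \<le> 30 * (1 / 4)\<^sup>2" by (rule mult_left_mono) simp
  then show ?thesis unfolding bump_inside[OF True[THEN conjunct1] True[THEN conjunct2]]
    by (rule order_trans) (simp add: power2_eq_square)
qed (use bump_outside[of t] in auto)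

lemma bump_abs_le: "\<bar>bump t\<bar> \<le> 2"
  using bump_nonneg[of t] bump_le[of t] by linarith

lemma smooth_step_low: "t \<le> 1 \<Longrightarrow> smooth_step t = 0"
  by (simp add: smooth_step_def trunc_pow_def)

lemma smooth_step_high: "t \<ge> 2 \<Longrightarrow> smooth_step t = 1"
  by (auto simp: smooth_step_def trunc_pow_def max_def) algebra

lemma smooth_step_bounds: "0 \<le> smooth_step t" "smooth_step t \<le> 1"
proof -
  have "smooth_step x \<le> smooth_step y" if "x \<le> y" for x y
    by (rule DERIV_nonneg_imp_nondecreasing[OF that]) (use DERIV_smooth_step bump_nonneg in blast)
  from this[of "min t 1" t] this[of t "max t 2"]
  show "0 \<le> smooth_step t" "smooth_step t \<le> 1"
    using smooth_step_low[of "min t 1"] smooth_step_high[of "max t 2"] by auto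
qed

lemma bump_has_integral: "(bump has_integral 1) UNIV"
proof -
  have "(bump has_integral (smooth_step 2 - smooth_step 1)) {1..2}"
    by (rule fundamental_theorem_of_calculus)
      (auto intro!:
        DERIV_subset[OF DERIV_smooth_step]
        simp: has_real_derivative_iff_has_vector_derivative[symmetric])
  then have "(bump has_integral 1) {1..2}"
    by (simp add: smooth_step_low smooth_step_high)
  then show ?thesis
    by (rule has_integral_on_superset) (auto intro: bump_outside)
qed

lemma nn_integral_bump:
  assumes "\<epsilon> > 0"
  shows "(\<integral>\<^sup>+t. ennreal (bump (t / \<epsilon>) / \<epsilon>) \<partial>lborel) = 1"
proof -
  have [measurable]: "bump \<in> borel_measurable borel"
    by (intro borel_measurable_continuous_onI continuous_intros)
  have "(\<integral>\<^sup>+t. ennreal (bump (t / \<epsilon>) / \<epsilon>) \<partial>lborel) =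
      ennreal \<bar>\<epsilon>\<bar> * (\<integral>\<^sup>+t. ennreal (bump ((0 + \<epsilon> * t) / \<epsilon>) / \<epsilon>) \<partial>lborel)"
    by (rule nn_integral_real_affine) (use assms in auto)
  also have "\<dots> = (\<integral>\<^sup>+t. ennreal \<bar>\<epsilon>\<bar> * ennreal (bump ((0 + \<epsilon> * t) / \<epsilon>) / \<epsilon>) \<partial>lborel)"
    by (rule nn_integral_cmult[symmetric]) measurable
  also have "\<dots> = (\<integral>\<^sup>+t. ennreal (bump t) \<partial>lborel)"
    using assms bump_nonneg by (intro nn_integral_cong) (simp add: ennreal_mult[symmetric])
  also have "\<dots> = 1"
    using nn_integral_has_integral_lborel[OF _ bump_nonneg bump_has_integral] by simp
  finally show ?thesis .
qed

section \<open>Square integrable functions with bounded weights on sets of finite measure\<close>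

lemma integrable_lebesgue_on_const:
  "\<Omega> \<in> lmeasurable \<Longrightarrow> integrable (lebesgue_on \<Omega>) (\<lambda>x. c :: real)"
  by (intro finite_measure.integrable_const finite_measure_lebesgue_on)

text \<open>On a set of finite measure \<open>1 + (norm (f x))\<^sup>2\<close> is an integrable
  majorant of \<open>norm (f x)\<close>.\<close>

lemma integrable_bounded_mult:
  fixes f :: "pt \<Rightarrow> 'b::euclidean_space"
  assumes f: "square_integrable \<Omega> f" and k: "k \<in> borel_measurable (lebesgue_on \<Omega>)"
    and bound: "\<And>x. \<bar>k x\<bar> \<le> C" and \<Omega>: "\<Omega> \<in> lmeasurable"
  shows "integrable (lebesgue_on \<Omega>) (\<lambda>x. k x *\<^sub>R f x)"
proof (rule Bochner_Integration.integrable_bound)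
  have "C \<ge> 0" using bound[of undefined] by linarith
  show "integrable (lebesgue_on \<Omega>) (\<lambda>x. C * (1 + (norm (f x))\<^sup>2))"
    using f integrable_lebesgue_on_const[OF \<Omega>]
    by (intro integrable_mult_right Bochner_Integration.integrable_add) (auto simp: square_integrable_def)
  show "(\<lambda>x. k x *\<^sub>R f x) \<in> borel_measurable (lebesgue_on \<Omega>)"
    using f k by (auto simp: square_integrable_def)
  have "norm (k x *\<^sub>R f x) \<le> norm (C * (1 + (norm (f x))\<^sup>2))" for x
  proof -
    have "norm (f x) \<le> 1 + (norm (f x))\<^sup>2"
      using zero_le_power2[of "norm (f x) - 1"] norm_ge_zero[of "f x"]
      unfolding power2_diff by (simp; linarith)
    then show ?thesis using bound[of x] \<open>C \<ge> 0\<close>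
      by (auto simp: abs_mult intro!: mult_mono)
  qed
  then show "AE x in lebesgue_on \<Omega>. norm (k x *\<^sub>R f x) \<le> norm (C * (1 + (norm (f x))\<^sup>2))"
    by simp
qed

lemma square_integrable_diff:
  fixes f g :: "pt \<Rightarrow> 'b::euclidean_space"
  assumes "square_integrable \<Omega> f" "square_integrable \<Omega> g"
  shows "square_integrable \<Omega> (\<lambda>x. f x - g x)"
  unfolding square_integrable_def
proof (intro conjI)
  show m: "(\<lambda>x. f x - g x) \<in> borel_measurable (lebesgue_on \<Omega>)"
    using assms by (auto simp: square_integrable_def)
  show "integrable (lebesgue_on \<Omega>) (\<lambda>x. (norm (f x - g x))\<^sup>2)"
  proof (rule Bochner_Integration.integrable_bound)
    show "integrable (lebesgue_on \<Omega>) (\<lambda>x. 2 * (norm (f x))\<^sup>2 + 2 * (norm (g x))\<^sup>2)"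
      using assms by (auto simp: square_integrable_def)
    have "norm ((norm (f x - g x))\<^sup>2) \<le> norm (2 * (norm (f x))\<^sup>2 + 2 * (norm (g x))\<^sup>2)" for x
    proof -
      have "(norm (f x - g x))\<^sup>2 \<le> (norm (f x) + norm (g x))\<^sup>2"
        by (intro power_mono norm_triangle_ineq4) auto
      also have "\<dots> \<le> 2 * (norm (f x))\<^sup>2 + 2 * (norm (g x))\<^sup>2"
        using zero_le_power2[of "norm (f x) - norm (g x)"] by (simp add: power2_eq_square algebra_simps)
      finally show ?thesis by simp
    qed
    then show "AE x in lebesgue_on \<Omega>. norm ((norm (f x - g x))\<^sup>2) \<le>
        norm (2 * (norm (f x))\<^sup>2 + 2 * (norm (g x))\<^sup>2)" by simp
  qed (use m in measurable)
qed

lemma integral_bounded_mult_le: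
  fixes h :: "pt \<Rightarrow> real"
  assumes h: "square_integrable \<Omega> h" and k: "k \<in> borel_measurable (lebesgue_on \<Omega>)"
    and bound: "\<And>x. \<bar>k x\<bar> \<le> C" and \<Omega>: "\<Omega> \<in> lmeasurable"
  shows "\<bar>LINT x|lebesgue_on \<Omega>. k x * h x\<bar> \<le>
    C * sqrt (measure lebesgue \<Omega>) * sqrt (LINT x|lebesgue_on \<Omega>. (h x)\<^sup>2)"
proof -
  have C: "C \<ge> 0" using bound[of undefined] by linarith
  have k2: "(k x)\<^sup>2 \<le> C\<^sup>2" for x
    using bound[of x] by (simp add: abs_le_square_iff[symmetric])
  have c: "integrable (lebesgue_on \<Omega>) (\<lambda>x. C\<^sup>2)"
    by (rule integrable_lebesgue_on_const[OF \<Omega>])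
  have ik: "integrable (lebesgue_on \<Omega>) (\<lambda>x. (k x)\<^sup>2)"
    by (rule Bochner_Integration.integrable_bound[OF c]) (use k k2 in auto)
  have "(LINT x|lebesgue_on \<Omega>. k x * h x)\<^sup>2 \<le>
    (LINT x|lebesgue_on \<Omega>. (k x)\<^sup>2) * (LINT x|lebesgue_on \<Omega>. (h x)\<^sup>2)"
    by (rule integral_Cauchy_Schwarz)
      (use ik h integrable_bounded_mult[OF h k bound \<Omega>] in \<open>auto simp: square_integrable_def\<close>)
  also have "(LINT x|lebesgue_on \<Omega>. (k x)\<^sup>2) * (LINT x|lebesgue_on \<Omega>. (h x)\<^sup>2) \<le>
      C\<^sup>2 * measure lebesgue \<Omega> * (LINT x|lebesgue_on \<Omega>. (h x)\<^sup>2)"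
  proof (rule mult_right_mono)
    have "(LINT x|lebesgue_on \<Omega>. (k x)\<^sup>2) \<le> (LINT x|lebesgue_on \<Omega>. C\<^sup>2)"
      by (rule integral_mono[OF ik c k2])
    also have "\<dots> = C\<^sup>2 * measure lebesgue \<Omega>"
      using \<Omega> by (subst lebesgue_integral_const) (auto simp: measure_restrict_space)
    finally show "(LINT x|lebesgue_on \<Omega>. (k x)\<^sup>2) \<le> C\<^sup>2 * measure lebesgue \<Omega>" .
  qed simp
  finally have "(LINT x|lebesgue_on \<Omega>. k x * h x)\<^sup>2 \<le>
     C\<^sup>2 * measure lebesgue \<Omega> * (LINT x|lebesgue_on \<Omega>. (h x)\<^sup>2)" .
  then have "sqrt ((LINT x|lebesgue_on \<Omega>. k x * h x)\<^sup>2) \<le>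
     sqrt (C\<^sup>2 * measure lebesgue \<Omega> * (LINT x|lebesgue_on \<Omega>. (h x)\<^sup>2))"
    by (rule real_sqrt_le_mono)
  then show ?thesis using C by (simp add: real_sqrt_mult)
qed

section \<open>Zero traces at the end points of the interface\<close>

text \<open>Oblique coordinates at the corner \<open>a\<close>: \<open>u\<close> runs along a
  boundary segment, \<open>w\<close> points into the domain, and \<sigma>, \<tau> form the dual
  basis that reads off the coordinates. By \<open>inside\<close> an open triangle with corner
  \<open>a\<close> lies in \<Omega>, so cut-offs with compact support in it are admissible test
  functions.\<close>

locale boundary_strip =
  fixes \<Omega> :: "pt set" and a u w \<sigma> \<tau> :: pt
  assumes open_domain: "open \<Omega>" and bounded_domain: "bounded \<Omega>"
    and cross_ne: "cross2 u w \<noteq> 0"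
    and dual: "u \<bullet> \<sigma> = 1" "u \<bullet> \<tau> = 0" "w \<bullet> \<sigma> = 0" "w \<bullet> \<tau> = 1"
    and expand: "\<And>x. (x \<bullet> \<sigma>) *\<^sub>R u + (x \<bullet> \<tau>) *\<^sub>R w = x"
    and inside: "\<And>s t. 0 < s \<Longrightarrow> 0 < t \<Longrightarrow> s + t < 1 \<Longrightarrow> a + s *\<^sub>R u + t *\<^sub>R w \<in> \<Omega>"
    and edge: "\<And>s. 0 \<le> s \<Longrightarrow> s \<le> 1 \<Longrightarrow> a + s *\<^sub>R u \<in> closure \<Omega>"
begin

definition sc :: "pt \<Rightarrow> real" where "sc x = (x - a) \<bullet> \<sigma>"
definition tc :: "pt \<Rightarrow> real" where "tc x = (x - a) \<bullet> \<tau>"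

lemma coords: "a + sc x *\<^sub>R u + tc x *\<^sub>R w = x"
  using expand[of "x - a"] by (simp add: sc_def tc_def algebra_simps)

lemma sc_coords: "sc (a + s *\<^sub>R u + t *\<^sub>R w) = s" "tc (a + s *\<^sub>R u + t *\<^sub>R w) = t"
  using dual by (simp_all add: sc_def tc_def inner_add_left algebra_simps)

lemma in_domain: "0 < sc x \<Longrightarrow> 0 < tc x \<Longrightarrow> sc x + tc x < 1 \<Longrightarrow> x \<in> \<Omega>"
  using inside[of "sc x" "tc x"] by (simp add: coords)

lemma continuous_sc [continuous_intros]: "continuous_on A sc"
  unfolding sc_def[abs_def] by (intro continuous_intros)

lemma continuous_tc [continuous_intros]: "continuous_on A tc"
  unfolding tc_def[abs_def] by (intro continuous_intros)

lemma lmeasurable_domain: "\<Omega> \<in> lmeasurable"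
  using open_domain bounded_domain by (simp add: lmeasurable_open)

lemma continuous_measurable:
  "continuous_on UNIV k \<Longrightarrow> k \<in> borel_measurable (lebesgue_on \<Omega>)"
  for k :: "pt \<Rightarrow> 'b::euclidean_space"
  using open_domain
  by (intro continuous_imp_measurable_on_sets_lebesgue) (auto intro: continuous_on_subset)

text \<open>Compact support comes from the difference of two steps: for small \<epsilon> it vanishes
  at depth below \<epsilon> and again above 1/4. Its derivative along \<open>w\<close> is a
  difference of two mollifiers, one at depth about \<epsilon> and one at the fixed depth
  1/8.\<close>

definition test_weight :: "real \<Rightarrow> real \<Rightarrow> pt \<Rightarrow> real" where
  "test_weight \<delta> \<epsilon> x = bump (sc x / \<delta>) * (smooth_step (tc x / \<epsilon>) - smooth_step (tc x / (1/8)))"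

definition test_gradient :: "real \<Rightarrow> real \<Rightarrow> pt \<Rightarrow> pt" where
  "test_gradient \<delta> \<epsilon> x =
     (bump' (sc x / \<delta>) / \<delta> * (smooth_step (tc x / \<epsilon>) - smooth_step (tc x / (1/8)))) *\<^sub>R \<sigma> +
     (bump (sc x / \<delta>) * (bump (tc x / \<epsilon>) / \<epsilon> - bump (tc x / (1/8)) / (1/8))) *\<^sub>R \<tau>"

lemma test_function_weight:
  assumes \<delta>: "0 < \<delta>" "\<delta> \<le> 1/8" and \<epsilon>: "0 < \<epsilon>" "\<epsilon> \<le> 1/16"
  shows "test_function \<Omega> (test_weight \<delta> \<epsilon>) (test_gradient \<delta> \<epsilon>)"
  unfolding test_function_def
proof (intro conjI allI exI)
  fix x
  have bu: "((\<lambda>x. bump (sc x / \<delta>)) has_derivative (\<lambda>h. bump' (sc x / \<delta>) * (h \<bullet> \<sigma> / \<delta>))) (at x)"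
    by (rule DERIV_bump[THEN has_field_derivative_imp_has_derivative, THEN has_derivative_compose[rotated], THEN has_derivative_eq_rhs])
      (use \<delta> in \<open>auto simp: sc_def intro!: derivative_eq_intros\<close>)
  have st: "((\<lambda>x. smooth_step (tc x / c)) has_derivative (\<lambda>h. bump (tc x / c) * (h \<bullet> \<tau> / c))) (at x)" if "c \<noteq> 0" for c
    by (rule DERIV_smooth_step[THEN has_field_derivative_imp_has_derivative, THEN has_derivative_compose[rotated], THEN has_derivative_eq_rhs])
      (use that in \<open>auto simp: tc_def intro!: derivative_eq_intros\<close>)
  show "GDERIV (test_weight \<delta> \<epsilon>) x :> test_gradient \<delta> \<epsilon> x"
    unfolding gderiv_def test_weight_def[abs_def] test_gradient_def
    by (rule has_derivative_eq_rhs[OF has_derivative_mult[OF bu has_derivative_diff[OF st st]]])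
      (use \<epsilon> in \<open>auto simp: inner_add_right algebra_simps\<close>)
next
  show "continuous_on UNIV (test_gradient \<delta> \<epsilon>)"
    unfolding test_gradient_def[abs_def]
    by (intro continuous_intros continuous_on_compose2[OF continuous_on_bump[of UNIV]]
        continuous_on_compose2[OF continuous_on_bump'[of UNIV]]
        continuous_on_compose2[OF continuous_on_smooth_step[of UNIV]]) (use \<delta> \<epsilon> in auto)
next
  \<comment> \<open>A rectangle in the oblique coordinates; as \<open>2 * \<delta>\<close> is at
    most 1/4, its image lies in the triangle.\<close>
  define C where "C = (\<lambda>z. a + fst z *\<^sub>R u + snd z *\<^sub>R w) ` ({\<delta>..2*\<delta>} \<times> {\<epsilon>..1/4})"
  show "compact C" unfolding C_def
    by (intro compact_continuous_image continuous_intros compact_Times) auto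
  show "C \<subseteq> \<Omega>" unfolding C_def using \<delta> \<epsilon> by (auto intro!: inside)
  fix x
  show "x \<notin> C \<longrightarrow> test_weight \<delta> \<epsilon> x = 0"
  proof (rule impI, rule ccontr)
    assume x: "x \<notin> C" and nz: "test_weight \<delta> \<epsilon> x \<noteq> 0"
    then have "bump (sc x / \<delta>) \<noteq> 0" "smooth_step (tc x / \<epsilon>) \<noteq> smooth_step (tc x / (1/8))"
      by (auto simp: test_weight_def)
    then have "1 < sc x / \<delta>" "sc x / \<delta> < 2"
      using bump_outside[of "sc x / \<delta>"] by force+
    moreover have "\<epsilon> \<le> tc x"
    proof (rule ccontr)
      assume "\<not> \<epsilon> \<le> tc x"
      then have "tc x / \<epsilon> \<le> 1" "tc x / (1/8) \<le> 1" using \<epsilon> by auto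
      then show False using smooth_step_low nz by (auto simp: test_weight_def)
    qed
    moreover have "tc x \<le> 1/4"
    proof (rule ccontr)
      assume "\<not> tc x \<le> 1/4"
      then have "tc x / \<epsilon> \<ge> 2" "tc x / (1/8) \<ge> 2" using \<epsilon> by (auto simp: field_simps)
      then show False using smooth_step_high nz by (auto simp: test_weight_def)
    qed
    ultimately have "(sc x, tc x) \<in> {\<delta>..2*\<delta>} \<times> {\<epsilon>..1/4}"
      using \<delta> by (auto simp: field_simps)
    then have "x \<in> C" unfolding C_def using coords[of x] by (force intro: image_eqI[where x="(sc x, tc x)"])
    then show False using x by simp
  qed
qed

text \<open>A mean over the strip of depth between \<epsilon> and \<open>2 * \<epsilon>\<close>. It
  stands in for the trace on the edge: on continuous functions it approximates a weighted edge
  integral as \<epsilon> tends to 0, and it makes sense for every square integrable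
  function.\<close>

definition strip_mean :: "real \<Rightarrow> real \<Rightarrow> (pt \<Rightarrow> real) \<Rightarrow> real" where
  "strip_mean \<delta> \<epsilon> f = (LINT x|lebesgue_on \<Omega>. (bump (sc x / \<delta>) * (bump (tc x / \<epsilon>) / \<epsilon>)) * f x)"

lemma test_weight_bound: "\<bar>test_weight \<delta> \<epsilon> x\<bar> \<le> 2"
proof -
  have "\<bar>smooth_step s - smooth_step t\<bar> \<le> 1" for s t
    using smooth_step_bounds[of s] smooth_step_bounds[of t] by linarith
  then have "\<bar>test_weight \<delta> \<epsilon> x\<bar> \<le> 2 * 1"
    unfolding test_weight_def abs_mult by (intro mult_mono bump_abs_le) auto
  then show ?thesis by simp
qed

lemma weight_bound: "\<epsilon> > 0 \<Longrightarrow> \<bar>bump (sc x / \<delta>) * (bump (tc x / \<epsilon>) / \<epsilon>)\<bar> \<le> 2 * (2 / \<epsilon>)"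
  unfolding abs_mult abs_divide
  by (intro mult_mono bump_abs_le frac_le) (auto intro: bump_abs_le)

lemma continuous_test_weight: "0 < \<delta> \<Longrightarrow> 0 < \<epsilon> \<Longrightarrow> continuous_on UNIV (test_weight \<delta> \<epsilon>)"
  unfolding test_weight_def[abs_def]
  by (intro continuous_intros continuous_on_compose2[OF continuous_on_bump[of UNIV]]
        continuous_on_compose2[OF continuous_on_smooth_step[of UNIV]]) auto

lemma continuous_weight:
  "0 < \<delta> \<Longrightarrow> 0 < \<epsilon> \<Longrightarrow> continuous_on UNIV (\<lambda>x. bump (sc x / \<delta>) * (bump (tc x / \<epsilon>) / \<epsilon>))"
  by (intro continuous_intros continuous_on_compose2[OF continuous_on_bump[of UNIV]]) auto

lemma integrable_weight:
  assumes "square_integrable \<Omega> f" "0 < \<delta>" "0 < \<epsilon>"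
  shows "integrable (lebesgue_on \<Omega>) (\<lambda>x. (bump (sc x / \<delta>) * (bump (tc x / \<epsilon>) / \<epsilon>)) * f x)"
  using integrable_bounded_mult[OF assms(1) continuous_measurable[OF continuous_weight]
      weight_bound lmeasurable_domain] assms by simp

text \<open>The fundamental theorem of calculus in the direction \<open>w\<close>, averaged: the
  weak gradient is tested with \<open>test_weight\<close>, and pairing with \<open>w\<close> leaves
  only the coefficient of \<tau>, since \<open>w\<close> is orthogonal to \<sigma>.\<close>

lemma strip_mean_identity:
  assumes H: "H1_with_gradient \<Omega> f g"
    and \<delta>: "0 < \<delta>" "\<delta> \<le> 1/8" and \<epsilon>: "0 < \<epsilon>" "\<epsilon> \<le> 1/16"
  shows "strip_mean \<delta> \<epsilon> f = strip_mean \<delta> (1/8) f - (LINT x|lebesgue_on \<Omega>. test_weight \<delta> \<epsilon> x * (g x \<bullet> w))"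
proof -
  have f: "square_integrable \<Omega> f" and g: "square_integrable \<Omega> g" and W: "weak_gradient \<Omega> f g"
    using H by (auto simp: H1_with_gradient_def)
  note tf = test_function_weight[OF \<delta> \<epsilon>]
  have W': "(LINT x|lebesgue_on \<Omega>. f x *\<^sub>R test_gradient \<delta> \<epsilon> x) = - (LINT x|lebesgue_on \<Omega>. test_weight \<delta> \<epsilon> x *\<^sub>R g x)"
    using W tf by (auto simp: weak_gradient_def)
  have i2: "integrable (lebesgue_on \<Omega>) (\<lambda>x. test_weight \<delta> \<epsilon> x *\<^sub>R g x)"
    by (rule integrable_bounded_mult[OF g continuous_measurable[OF continuous_test_weight] test_weight_bound lmeasurable_domain])
      (use \<delta> \<epsilon> in auto)
  have "\<exists>B. \<forall>x. norm (bump' (sc x / \<delta>) / \<delta>) \<le> B"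
  proof -
    have "bounded (bump' ` {1..2})"
      by (intro compact_imp_bounded compact_continuous_image continuous_intros) auto
    then obtain B where B: "\<And>t. t \<in> {1..2} \<Longrightarrow> norm (bump' t) \<le> B"
      unfolding bounded_iff by blast
    have "bump' t = 0" if "t \<notin> {1..2}" for t
      using that by (auto simp: bump'_def trunc_pow_def max_def power2_eq_square power3_eq_cube algebra_simps)
    moreover have "B \<ge> 0" using B[of 1] norm_ge_zero[of "bump' 1"] by auto
    ultimately have B': "norm (bump' t) \<le> B" for t using B[of t] by (cases "t \<in> {1..2}") auto
    show ?thesis
      using B' \<delta> by (intro exI[of _ "B / \<delta>"]) (auto intro: divide_right_mono)
  qed
  then obtain B where B: "\<And>x. \<bar>bump' (sc x / \<delta>) / \<delta>\<bar> \<le> B" by auto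
  have B0: "0 \<le> B" using B[of undefined] by linarith
  have i1: "integrable (lebesgue_on \<Omega>) (\<lambda>x. f x *\<^sub>R test_gradient \<delta> \<epsilon> x)"
  proof -
    have "integrable (lebesgue_on \<Omega>) (\<lambda>x. (bump' (sc x / \<delta>) / \<delta> * (smooth_step (tc x / \<epsilon>) - smooth_step (tc x / (1/8)))) *\<^sub>R f x)"
    proof (rule integrable_bounded_mult[OF f continuous_measurable _ lmeasurable_domain])
      show "continuous_on UNIV (\<lambda>x. bump' (sc x / \<delta>) / \<delta> * (smooth_step (tc x / \<epsilon>) - smooth_step (tc x / (1/8))))"
        by (intro continuous_intros
          continuous_on_compose2[OF continuous_on_bump'[of UNIV]]
          continuous_on_compose2[OF continuous_on_smooth_step[of UNIV]]) (use \<delta> \<epsilon> in auto)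
      fix x
      have "\<bar>smooth_step s - smooth_step t\<bar> \<le> 1" for s t
        using smooth_step_bounds[of s] smooth_step_bounds[of t] by linarith
      then show "\<bar>bump' (sc x / \<delta>) / \<delta> * (smooth_step (tc x / \<epsilon>) - smooth_step (tc x / (1/8)))\<bar> \<le> B * 1"
        unfolding abs_mult by (intro mult_mono B B0) auto
    qed
    moreover have "integrable (lebesgue_on \<Omega>) (\<lambda>x. (bump (sc x / \<delta>) * (bump (tc x / \<epsilon>) / \<epsilon>)) * f x
        - (bump (sc x / \<delta>) * (bump (tc x / (1/8)) / (1/8))) * f x)"
      by (intro Bochner_Integration.integrable_diff integrable_weight f \<delta> \<epsilon>) auto
    ultimately have "integrable (lebesgue_on \<Omega>) (\<lambda>x.
      ((bump' (sc x / \<delta>) / \<delta> * (smooth_step (tc x / \<epsilon>) - smooth_step (tc x / (1/8)))) *\<^sub>R f x) *\<^sub>R \<sigma> +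
      ((bump (sc x / \<delta>) * (bump (tc x / \<epsilon>) / \<epsilon>)) * f x
        - (bump (sc x / \<delta>) * (bump (tc x / (1/8)) / (1/8))) * f x) *\<^sub>R \<tau>)"
      by (intro Bochner_Integration.integrable_add integrable_scaleR_left)
    then show ?thesis
      by (rule Bochner_Integration.integrable_cong[THEN iffD1, rotated 2])
        (auto simp: test_gradient_def algebra_simps)
  qed
  have tw: "test_gradient \<delta> \<epsilon> x \<bullet> w = bump (sc x / \<delta>) * (bump (tc x / \<epsilon>) / \<epsilon> - bump (tc x / (1/8)) / (1/8))" for x
    using dual by (simp add: test_gradient_def inner_add_right inner_commute[of _ w])
  have "(LINT x|lebesgue_on \<Omega>. (f x *\<^sub>R test_gradient \<delta> \<epsilon> x) \<bullet> w) = - (LINT x|lebesgue_on \<Omega>. (test_weight \<delta> \<epsilon> x *\<^sub>R g x) \<bullet> w)"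
    using W' integral_inner_left[of w, OF i1] integral_inner_left[of w, OF i2] by simp
  also have "(LINT x|lebesgue_on \<Omega>. (f x *\<^sub>R test_gradient \<delta> \<epsilon> x) \<bullet> w) =
     (LINT x|lebesgue_on \<Omega>. (bump (sc x / \<delta>) * (bump (tc x / \<epsilon>) / \<epsilon>)) * f x
        - (bump (sc x / \<delta>) * (bump (tc x / (1/8)) / (1/8))) * f x)"
    by (rule Bochner_Integration.integral_cong) (auto simp: tw algebra_simps)
  also have "\<dots> = strip_mean \<delta> \<epsilon> f - strip_mean \<delta> (1/8) f"
    unfolding strip_mean_def
    by (intro Bochner_Integration.integral_diff integrable_weight f \<delta> \<epsilon>) auto
  finally show ?thesis by simp
qed

text \<open>Exact for every admissible \<epsilon>, without a limit: the support lies in the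
  triangle, and in oblique coordinates the mollifier integrates to 1 on each line in direction
  \<open>w\<close>.\<close>

lemma strip_integral:
  assumes q: "continuous_on UNIV q" "\<And>s. 0 \<le> q s" "\<And>s. s \<notin> {\<delta>..2*\<delta>} \<Longrightarrow> q s = 0"
    and \<delta>: "0 < \<delta>" "\<delta> \<le> 1/8" and \<epsilon>: "0 < \<epsilon>" "\<epsilon> \<le> 1/16"
  shows "(LINT x|lebesgue_on \<Omega>. q (sc x) * (bump (tc x / \<epsilon>) / \<epsilon>)) = \<bar>cross2 u w\<bar> * (LINT s|lborel. q s)"
proof -
  define H where "H x = q (sc x) * (bump (tc x / \<epsilon>) / \<epsilon>)" for x
  have cH: "continuous_on UNIV H"
    unfolding H_def[abs_def]
    by (intro continuous_intros continuous_on_compose2[OF q(1)]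
        continuous_on_compose2[OF continuous_on_bump[of UNIV]]) (use \<epsilon> in auto)
  have H0: "0 \<le> H x" for x
    unfolding H_def using q(2) bump_nonneg \<epsilon> by simp
  have out: "H x = 0" if "x \<notin> \<Omega>" for x
  proof (rule ccontr)
    assume "H x \<noteq> 0"
    then have "q (sc x) \<noteq> 0" "bump (tc x / \<epsilon>) \<noteq> 0" by (auto simp: H_def)
    then have "sc x \<in> {\<delta>..2*\<delta>}" "1 < tc x / \<epsilon>" "tc x / \<epsilon> < 2"
      using q(3) bump_outside[of "tc x / \<epsilon>"] by force+
    then have "0 < sc x" "sc x \<le> 1/4" "0 < tc x" "tc x < 1/4" using \<delta> \<epsilon> by (auto simp: field_simps)
    then show False using in_domain[of x] that by simp
  qed
  have [measurable]: "q \<in> borel_measurable borel" "H \<in> borel_measurable borel" "bump \<in> borel_measurable borel"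
    using q(1) cH by (auto intro: borel_measurable_continuous_onI continuous_intros)
  have "(LINT x|lebesgue_on \<Omega>. H x) = enn2real (\<integral>\<^sup>+x. H x \<partial>lebesgue_on \<Omega>)"
    by (rule integral_eq_nn_integral[OF continuous_measurable[OF cH]]) (simp add: H0)
  also have "(\<integral>\<^sup>+x. H x \<partial>lebesgue_on \<Omega>) = (\<integral>\<^sup>+x. ennreal (H x) * indicator \<Omega> x \<partial>lebesgue)"
    using open_domain by (intro nn_integral_restrict_space) auto
  also have "\<dots> = (\<integral>\<^sup>+x. H x \<partial>lborel)"
    unfolding nn_integral_completion
    by (intro nn_integral_cong) (auto simp: indicator_def out)
  also have "\<dots> = ennreal \<bar>cross2 u w\<bar> * (\<integral>\<^sup>+s. \<integral>\<^sup>+t. H (a + s *\<^sub>R u + t *\<^sub>R w) \<partial>lborel \<partial>lborel)"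
    by (rule nn_integral_parallelogram[OF _ cross_ne]) measurable
  also have "(\<integral>\<^sup>+s. \<integral>\<^sup>+t. H (a + s *\<^sub>R u + t *\<^sub>R w) \<partial>lborel \<partial>lborel) =
     (\<integral>\<^sup>+s. (\<integral>\<^sup>+t. ennreal (q s) * ennreal (bump (t / \<epsilon>) / \<epsilon>) \<partial>lborel) \<partial>lborel)"
    unfolding H_def sc_coords using q(2) by (intro nn_integral_cong) (simp only: ennreal_mult')
  also have "\<dots> = (\<integral>\<^sup>+s. q s \<partial>lborel)"
    using nn_integral_bump[OF \<epsilon>(1)] by (subst nn_integral_cmult) auto
  also have "enn2real (ennreal \<bar>cross2 u w\<bar> * (\<integral>\<^sup>+s. q s \<partial>lborel)) = \<bar>cross2 u w\<bar> * (LINT s|lborel. q s)"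
    using q(2) by (subst integral_eq_nn_integral) (auto simp: enn2real_mult)
  finally show ?thesis by (simp add: H_def)
qed

text \<open>A trace inequality in disguise. The constants are free of \<epsilon> because the
  identity above moves the mean to the fixed depth 1/8; the number 32 is
  \<open>2 * (2 / (1/8))\<close>, the bound of the weight at that depth.\<close>

lemma strip_mean_diff_le:
  assumes f: "H1_with_gradient \<Omega> f g" and f': "H1_with_gradient \<Omega> f' g'"
    and \<delta>: "0 < \<delta>" "\<delta> \<le> 1/8" and \<epsilon>: "0 < \<epsilon>" "\<epsilon> \<le> 1/16"
  shows "\<bar>strip_mean \<delta> \<epsilon> f - strip_mean \<delta> \<epsilon> f'\<bar> \<le>
     32 * sqrt (measure lebesgue \<Omega>) * sqrt (LINT x|lebesgue_on \<Omega>. (f x - f' x)\<^sup>2) +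
     2 * norm w * sqrt (measure lebesgue \<Omega>) * sqrt (LINT x|lebesgue_on \<Omega>. (norm (g x - g' x))\<^sup>2)"
proof -
  have sf: "square_integrable \<Omega> f" "square_integrable \<Omega> f'" "square_integrable \<Omega> g" "square_integrable \<Omega> g'"
    using f f' by (auto simp: H1_with_gradient_def)
  have h1: "square_integrable \<Omega> (\<lambda>x. f x - f' x)" and h2: "square_integrable \<Omega> (\<lambda>x. g x - g' x)"
    using sf by (auto intro: square_integrable_diff)
  have h3: "square_integrable \<Omega> (\<lambda>x. norm (g x - g' x))"
    using h2 by (auto simp: square_integrable_def)
  have tw: "test_weight \<delta> \<epsilon> \<in> borel_measurable (lebesgue_on \<Omega>)"
    by (intro continuous_measurable continuous_test_weight \<delta> \<epsilon>)
  have iw: "integrable (lebesgue_on \<Omega>) (\<lambda>x. test_weight \<delta> \<epsilon> x * (g x \<bullet> w))" if "square_integrable \<Omega> g" for g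
  proof -
    have "integrable (lebesgue_on \<Omega>) (\<lambda>x. (test_weight \<delta> \<epsilon> x *\<^sub>R g x) \<bullet> w)"
      by (intro integrable_inner_left integrable_bounded_mult[OF that tw test_weight_bound lmeasurable_domain])
    then show ?thesis by simp
  qed
  have "strip_mean \<delta> (1/8) f - strip_mean \<delta> (1/8) f' =
     (LINT x|lebesgue_on \<Omega>. (bump (sc x / \<delta>) * (bump (tc x / (1/8)) / (1/8))) * (f x - f' x))"
    unfolding strip_mean_def using sf \<delta>
    by (subst Bochner_Integration.integral_diff[symmetric])
      ((intro integrable_weight; simp)+, intro Bochner_Integration.integral_cong, auto simp: algebra_simps)
  also have "\<bar>\<dots>\<bar> \<le> 2 * (2 / (1/8)) * sqrt (measure lebesgue \<Omega>) * sqrt (LINT x|lebesgue_on \<Omega>. (f x - f' x)\<^sup>2)"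
    by (rule integral_bounded_mult_le[OF h1 continuous_measurable[OF continuous_weight] weight_bound lmeasurable_domain])
      (use \<delta> in auto)
  finally have 1: "\<bar>strip_mean \<delta> (1/8) f - strip_mean \<delta> (1/8) f'\<bar> \<le>
     32 * sqrt (measure lebesgue \<Omega>) * sqrt (LINT x|lebesgue_on \<Omega>. (f x - f' x)\<^sup>2)" by simp
  have "(LINT x|lebesgue_on \<Omega>. test_weight \<delta> \<epsilon> x * (g x \<bullet> w)) - (LINT x|lebesgue_on \<Omega>. test_weight \<delta> \<epsilon> x * (g' x \<bullet> w)) =
     (LINT x|lebesgue_on \<Omega>. test_weight \<delta> \<epsilon> x * ((g x - g' x) \<bullet> w))"
    using sf by (subst Bochner_Integration.integral_diff[symmetric])
      ((intro iw; simp)+, intro Bochner_Integration.integral_cong, auto simp: algebra_simps)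
  also have "\<bar>\<dots>\<bar> \<le> (LINT x|lebesgue_on \<Omega>. (2 * norm w) * norm (g x - g' x))"
  proof (rule integral_abs_bound_integral)
    show "integrable (lebesgue_on \<Omega>) (\<lambda>x. test_weight \<delta> \<epsilon> x * ((g x - g' x) \<bullet> w))" by (rule iw[OF h2])
    show "integrable (lebesgue_on \<Omega>) (\<lambda>x. (2 * norm w) * norm (g x - g' x))"
      using integrable_bounded_mult[OF h3, of "\<lambda>_. 1" 1] lmeasurable_domain by simp
    fix x
    have "\<bar>test_weight \<delta> \<epsilon> x * ((g x - g' x) \<bullet> w)\<bar> \<le> 2 * (norm (g x - g' x) * norm w)"
      unfolding abs_mult by (intro mult_mono test_weight_bound Cauchy_Schwarz_ineq2) auto
    then show "\<bar>test_weight \<delta> \<epsilon> x * ((g x - g' x) \<bullet> w)\<bar> \<le> (2 * norm w) * norm (g x - g' x)"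
      by (simp add: mult_ac)
  qed
  also have "\<dots> \<le> \<bar>LINT x|lebesgue_on \<Omega>. (2 * norm w) * norm (g x - g' x)\<bar>" by simp
  also have "\<dots> \<le> 2 * norm w * sqrt (measure lebesgue \<Omega>) * sqrt (LINT x|lebesgue_on \<Omega>. (norm (g x - g' x))\<^sup>2)"
    by (rule integral_bounded_mult_le[OF h3 _ _ lmeasurable_domain]) auto
  finally have 2: "\<bar>(LINT x|lebesgue_on \<Omega>. test_weight \<delta> \<epsilon> x * (g x \<bullet> w)) - (LINT x|lebesgue_on \<Omega>. test_weight \<delta> \<epsilon> x * (g' x \<bullet> w))\<bar>
     \<le> 2 * norm w * sqrt (measure lebesgue \<Omega>) * sqrt (LINT x|lebesgue_on \<Omega>. (norm (g x - g' x))\<^sup>2)" .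
  show ?thesis
    using 1 2 strip_mean_identity[OF f \<delta> \<epsilon>] strip_mean_identity[OF f' \<delta> \<epsilon>] by linarith
qed

text \<open>Uniform continuity replaces \<open>f\<close> on a thin strip by its edge values up to
  \<eta>. The threshold \<epsilon>0 depends on \<open>f\<close>, which dictates the order of choices
  in the limit argument.\<close>

lemma strip_mean_upper:
  assumes f: "square_integrable \<Omega> f" "continuous_on (closure \<Omega>) f" and \<delta>: "0 < \<delta>" "\<delta> \<le> 1/8" and \<eta>: "\<eta> > 0"
  shows "\<exists>\<epsilon>0>0. \<forall>\<epsilon>. 0 < \<epsilon> \<longrightarrow> \<epsilon> \<le> \<epsilon>0 \<longrightarrow> \<epsilon> \<le> 1/16 \<longrightarrow>
     \<bar>strip_mean \<delta> \<epsilon> f\<bar> \<le> \<bar>cross2 u w\<bar> * (2 * sqrt (LINT s|lebesgue_on {0..1}. (f (a + s *\<^sub>R u))\<^sup>2) + 2 * \<eta>)"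
proof -
  have "uniformly_continuous_on (closure \<Omega>) f"
    using f bounded_domain by (intro compact_uniformly_continuous) auto
  then obtain d where d: "d > 0" "\<And>x x'. x \<in> closure \<Omega> \<Longrightarrow> x' \<in> closure \<Omega> \<Longrightarrow> dist x' x < d \<Longrightarrow> dist (f x') (f x) < \<eta>"
    using \<eta> unfolding uniformly_continuous_on_def by metis
  have w0: "w \<noteq> 0" using dual by auto
  \<comment> \<open>The strip has depth at most \<open>2 * \<epsilon>0\<close>, so its points are
    within d/2 of their edge points.\<close>
  define \<epsilon>0 where "\<epsilon>0 = d / (4 * norm w)"
  have "\<epsilon>0 > 0" using d w0 by (simp add: \<epsilon>0_def)
  \<comment> \<open>The clamp continues the edge values to the whole line, because the strip formula
    asks for a globally continuous \<open>q\<close>.\<close>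
  define F where "F s = \<bar>f (a + (max 0 (min 1 s)) *\<^sub>R u)\<bar>" for s
  have cF: "continuous_on UNIV F"
    unfolding F_def by (intro continuous_intros continuous_on_compose2[OF f(2)]) (auto intro: edge)
  define q where "q s = bump (s / \<delta>) * (F s + \<eta>)" for s
  have q: "continuous_on UNIV q" "0 \<le> q s" "s \<notin> {\<delta>..2*\<delta>} \<Longrightarrow> q s = 0" for s
    unfolding q_def using \<delta> \<eta>
      apply (intro continuous_intros cF continuous_on_compose2[OF continuous_on_bump[of UNIV]]; auto)
     apply (auto simp: F_def intro!: mult_nonneg_nonneg bump_nonneg add_nonneg_nonneg less_imp_le[OF \<eta>])
    using bump_outside[of "s / \<delta>"] \<delta> by (auto simp: field_simps not_le)
  show ?thesis
  proof (intro exI[of _ \<epsilon>0] conjI allI impI \<open>\<epsilon>0 > 0\<close>)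
    fix \<epsilon> assume \<epsilon>: "0 < \<epsilon>" "\<epsilon> \<le> \<epsilon>0" "\<epsilon> \<le> 1/16"
    have cQ: "continuous_on UNIV (\<lambda>x. q (sc x) * (bump (tc x / \<epsilon>) / \<epsilon>))"
      by (intro continuous_intros continuous_on_compose2[OF q(1)]
        continuous_on_compose2[OF continuous_on_bump[of UNIV]]) (use \<epsilon> in auto)
    have "\<exists>B. \<forall>s. \<bar>q s\<bar> \<le> B"
    proof -
      have "bounded (q ` {\<delta>..2*\<delta>})"
        by (intro compact_imp_bounded compact_continuous_image continuous_on_subset[OF q(1)]) auto
      then obtain B where B: "\<And>s. s \<in> {\<delta>..2*\<delta>} \<Longrightarrow> norm (q s) \<le> B"
        unfolding bounded_iff by blast
      have "B \<ge> 0" using B[of \<delta>] \<delta> norm_ge_zero[of "q \<delta>"] by auto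
      then show ?thesis using B q(3) by (intro exI[of _ B] allI) (metis abs_zero real_norm_def)
    qed
    then obtain B where B: "\<And>s. \<bar>q s\<bar> \<le> B" by blast
    have iQ: "integrable (lebesgue_on \<Omega>) (\<lambda>x. q (sc x) * (bump (tc x / \<epsilon>) / \<epsilon>))"
    proof (rule Bochner_Integration.integrable_bound[OF integrable_lebesgue_on_const[OF lmeasurable_domain, of "B * (2 / \<epsilon>)"]])
      have "norm (q (sc x) * (bump (tc x / \<epsilon>) / \<epsilon>)) \<le> norm (B * (2 / \<epsilon>))" for x
      proof -
        have "0 \<le> B" using B[of 0] by linarith
        have "\<bar>q (sc x)\<bar> * (\<bar>bump (tc x / \<epsilon>)\<bar> / \<bar>\<epsilon>\<bar>) \<le> \<bar>B\<bar> * (2 / \<bar>\<epsilon>\<bar>)"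
          using \<epsilon> \<open>0 \<le> B\<close> by (intro mult_mono frac_le bump_abs_le) (use B in auto)
        then show ?thesis by (simp add: abs_mult)
      qed
      then show "AE x in lebesgue_on \<Omega>. norm (q (sc x) * (bump (tc x / \<epsilon>) / \<epsilon>)) \<le> norm (B * (2 / \<epsilon>))"
        by simp
    qed (intro continuous_measurable cQ)
    have "\<bar>strip_mean \<delta> \<epsilon> f\<bar> \<le> (LINT x|lebesgue_on \<Omega>. q (sc x) * (bump (tc x / \<epsilon>) / \<epsilon>))"
      unfolding strip_mean_def
    proof (rule integral_abs_bound_integral[OF integrable_weight[OF f(1) \<delta>(1) \<epsilon>(1)] iQ])
      fix x assume "x \<in> space (lebesgue_on \<Omega>)"
      then have x: "x \<in> \<Omega>" by simp
      show "\<bar>bump (sc x / \<delta>) * (bump (tc x / \<epsilon>) / \<epsilon>) * f x\<bar> \<le> q (sc x) * (bump (tc x / \<epsilon>) / \<epsilon>)"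
      proof (cases "bump (sc x / \<delta>) = 0 \<or> bump (tc x / \<epsilon>) = 0")
        case True
        then show ?thesis by (auto simp: q_def)
      next
        case False
        then have "1 < sc x / \<delta>" "sc x / \<delta> < 2" "1 < tc x / \<epsilon>" "tc x / \<epsilon> < 2"
          using bump_outside[of "sc x / \<delta>"] bump_outside[of "tc x / \<epsilon>"] by force+
        then have s: "0 < sc x" "sc x < 1" and t: "0 < tc x" "tc x < 2 * \<epsilon>"
          using \<delta> \<epsilon> by (auto simp: field_simps)
        have "dist x (a + sc x *\<^sub>R u) = norm (tc x *\<^sub>R w)"
          using coords[of x] by (metis add_diff_cancel_left' dist_norm)
        also have "\<dots> \<le> 2 * \<epsilon>0 * norm w" using t \<epsilon> by (auto intro!: mult_right_mono)
        also have "\<dots> < d" using d w0 by (simp add: \<epsilon>0_def)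
        finally have "dist (f x) (f (a + sc x *\<^sub>R u)) < \<eta>"
          using d(2)[of "a + sc x *\<^sub>R u" x] x s edge closure_subset by fastforce
        then have "\<bar>f x\<bar> \<le> F (sc x) + \<eta>" using s by (auto simp: F_def dist_real_def)
        then have "bump (sc x / \<delta>) * (bump (tc x / \<epsilon>) / \<epsilon>) * \<bar>f x\<bar> \<le>
            bump (sc x / \<delta>) * (bump (tc x / \<epsilon>) / \<epsilon>) * (F (sc x) + \<eta>)"
          using bump_nonneg \<epsilon> by (intro mult_left_mono) auto
        then show ?thesis using bump_nonneg \<epsilon> by (simp add: q_def abs_mult mult_ac)
      qed
    qed
    also have "\<dots> = \<bar>cross2 u w\<bar> * (LINT s|lborel. q s)"
      by (rule strip_integral[OF q \<delta> \<epsilon>(1,3)])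
    also have "(LINT s|lborel. q s) \<le> 2 * sqrt (LINT s|lebesgue_on {0..1}. (f (a + s *\<^sub>R u))\<^sup>2) + 2 * \<eta>"
    proof -
      have int1: "integrable (lebesgue_on {0..1}) k" if "continuous_on {0..1} k" for k :: "real \<Rightarrow> real"
        using that by (rule continuous_imp_integrable_real)
      have cfu: "continuous_on {0..1} (\<lambda>s. f (a + s *\<^sub>R u))"
        by (intro continuous_on_compose2[OF f(2)] continuous_intros) (auto intro: edge)
      have mq: "q \<in> borel_measurable borel"
        by (intro borel_measurable_continuous_onI q)
      have "(LINT s|lborel. q s) = (LINT s|lebesgue. q s)"
        using mq by (subst integral_completion) auto
      also have "\<dots> = (LINT s|lebesgue. indicator {0..1} s *\<^sub>R q s)"
      proof (rule Bochner_Integration.integral_cong[OF refl])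
        fix s show "q s = indicator {0..1} s *\<^sub>R q s"
          using q(3)[of s] \<delta> by (cases "s \<in> {0..1}") auto
      qed
      also have "\<dots> = (LINT s|lebesgue_on {0..1}. q s)"
        by (subst integral_restrict_space) auto
      also have "\<dots> \<le> (LINT s|lebesgue_on {0..1}. 2 * \<bar>f (a + s *\<^sub>R u)\<bar> + 2 * \<eta>)"
      proof (rule integral_mono)
        show "integrable (lebesgue_on {0..1}) q"
          by (intro int1 continuous_on_subset[OF q(1)]) auto
        show "integrable (lebesgue_on {0..1}) (\<lambda>s. 2 * \<bar>f (a + s *\<^sub>R u)\<bar> + 2 * \<eta>)"
          by (intro int1 continuous_intros cfu)
        fix s :: real assume "s \<in> space (lebesgue_on {0..1})"
        then have "F s = \<bar>f (a + s *\<^sub>R u)\<bar>" by (auto simp: F_def)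
        moreover have "bump (s / \<delta>) * (F s + \<eta>) \<le> 2 * (F s + \<eta>)"
          using \<eta> by (intro mult_right_mono bump_le) (auto simp: F_def)
        ultimately show "q s \<le> 2 * \<bar>f (a + s *\<^sub>R u)\<bar> + 2 * \<eta>"
          by (simp add: q_def)
      qed
      also have "\<dots> = 2 * (LINT s|lebesgue_on {0..1}. \<bar>f (a + s *\<^sub>R u)\<bar>) + 2 * \<eta>"
        by (subst Bochner_Integration.integral_add)
          (auto intro!: int1 continuous_intros cfu simp: measure_restrict_space)
      also have "(LINT s|lebesgue_on {0..1}. \<bar>f (a + s *\<^sub>R u)\<bar>) \<le> sqrt (LINT s|lebesgue_on {0..1}. (f (a + s *\<^sub>R u))\<^sup>2)"
      proof -
        have "(LINT s|lebesgue_on {0..1}. 1 * \<bar>f (a + s *\<^sub>R u)\<bar>)\<^sup>2 \<le>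
          (LINT s|lebesgue_on {0..1::real}. 1\<^sup>2) * (LINT s|lebesgue_on {0..1}. \<bar>f (a + s *\<^sub>R u)\<bar>\<^sup>2)"
          by (rule integral_Cauchy_Schwarz) (auto intro!: int1 continuous_intros cfu)
        then have "(LINT s|lebesgue_on {0..1}. \<bar>f (a + s *\<^sub>R u)\<bar>)\<^sup>2 \<le> (LINT s|lebesgue_on {0..1}. (f (a + s *\<^sub>R u))\<^sup>2)"
          by (simp add: measure_restrict_space)
        then show ?thesis by (rule real_le_rsqrt)
      qed
      finally show ?thesis by simp
    qed
    finally show "\<bar>strip_mean \<delta> \<epsilon> f\<bar> \<le>
       \<bar>cross2 u w\<bar> * (2 * sqrt (LINT s|lebesgue_on {0..1}. (f (a + s *\<^sub>R u))\<^sup>2) + 2 * \<eta>)"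
      by (simp add: mult_left_mono)
  qed
qed

text \<open>If \<open>v a\<close> were nonzero, the strip means of \<open>v\<close> near
  \<open>a\<close> would be bounded below uniformly in \<epsilon>. Those of \<open>\<phi> m\<close>
  are controlled by an edge integral that tends to 0, once \<epsilon> is small depending on
  \<open>m\<close>. Both differ by an H^1 distance times a constant free of \<epsilon>, so
  \<epsilon> may be chosen after \<open>m\<close>.\<close>

lemma zero_trace_corner:
  assumes v: "H1_with_gradient \<Omega> v g" "continuous_on (closure \<Omega>) v"
    and \<phi>: "\<And>m::nat. H1_with_gradient \<Omega> (\<phi> m) (\<psi> m)" "\<And>m. continuous_on (closure \<Omega>) (\<phi> m)"
    and lim1: "(\<lambda>m. LINT x|lebesgue_on \<Omega>. (\<phi> m x - v x)\<^sup>2) \<longlonglongrightarrow> 0"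
    and lim2: "(\<lambda>m. LINT x|lebesgue_on \<Omega>. (norm (\<psi> m x - g x))\<^sup>2) \<longlonglongrightarrow> 0"
    and seg: "(\<lambda>m. LINT s|lebesgue_on {0..1}. (\<phi> m (a + s *\<^sub>R u))\<^sup>2) \<longlonglongrightarrow> 0"
  shows "v a = 0"
proof (rule ccontr)
  assume "v a \<noteq> 0"
  define c where "c = \<bar>v a\<bar> / 2"
  have c: "c > 0" using \<open>v a \<noteq> 0\<close> by (simp add: c_def)
  have a: "a \<in> closure \<Omega>" using edge[of 0] by simp
  obtain d where d: "d > 0" "\<And>x. x \<in> closure \<Omega> \<Longrightarrow> dist x a < d \<Longrightarrow> dist (v x) (v a) < c"
    using v(2) a c unfolding continuous_on_iff by metis
  \<comment> \<open>With these widths the support stays within d/2 of \<open>a\<close>, where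
    \<open>v\<close> differs from \<open>v a\<close> by less than half the modulus of
    \<open>v a\<close>.\<close>
  define \<delta> where "\<delta> = min (1/8) (d / (8 * (norm u + 1)))"
  define \<epsilon>1 where "\<epsilon>1 = min (1/16) (d / (8 * (norm w + 1)))"
  have \<delta>: "0 < \<delta>" "\<delta> \<le> 1/8" unfolding \<delta>_def using d(1) min.cobounded1
    by (simp add: add_nonneg_pos, blast)
  have \<epsilon>1: "0 < \<epsilon>1" "\<epsilon>1 \<le> 1/16" unfolding \<epsilon>1_def using d(1) min.cobounded1
    by (simp add: add_nonneg_pos, blast)
  have du: "2 * \<delta> * norm u \<le> d / 4"
  proof -
    have "\<delta> * norm u \<le> (d / (8 * (norm u + 1))) * (norm u + 1)"
      using \<delta> d by (intro mult_mono) (auto simp: \<delta>_def)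
    also have "\<dots> = d / 8" using add_nonneg_pos[OF norm_ge_zero[of u] zero_less_one] by (simp add: divide_simps)
    finally show ?thesis by simp
  qed
  have dw: "2 * \<epsilon>1 * norm w \<le> d / 4"
  proof -
    have "\<epsilon>1 * norm w \<le> (d / (8 * (norm w + 1))) * (norm w + 1)"
      using \<epsilon>1 d by (intro mult_mono) (auto simp: \<epsilon>1_def)
    also have "\<dots> = d / 8" using add_nonneg_pos[OF norm_ge_zero[of w] zero_less_one] by (simp add: divide_simps)
    finally show ?thesis by simp
  qed
  define q where "q s = c * bump (s / \<delta>)" for s
  have q: "continuous_on UNIV q" "0 \<le> q s" "s \<notin> {\<delta>..2*\<delta>} \<Longrightarrow> q s = 0" for s
    unfolding q_def using \<delta> c
      apply (intro continuous_intros continuous_on_compose2[OF continuous_on_bump[of UNIV]]; auto)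
     apply (auto intro!: mult_nonneg_nonneg bump_nonneg less_imp_le[OF c])
    using bump_outside[of "s / \<delta>"] \<delta> by (auto simp: field_simps not_le)
  have [measurable]: "bump \<in> borel_measurable borel"
    by (intro borel_measurable_continuous_onI continuous_intros)
  have qint: "(LINT s|lborel. q s) = c * \<delta>"
  proof -
    have "(LINT s|lborel. bump (s / \<delta>) / \<delta>) = 1"
      using nn_integral_bump[OF \<delta>(1)] bump_nonneg \<delta> by (subst integral_eq_nn_integral) auto
    then show ?thesis using \<delta> by (simp add: q_def)
  qed
  have lower: "c * \<delta> * \<bar>cross2 u w\<bar> \<le> \<bar>strip_mean \<delta> \<epsilon> v\<bar>" if \<epsilon>: "0 < \<epsilon>" "\<epsilon> \<le> \<epsilon>1" for \<epsilon>
  proof -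
    have sv: "square_integrable \<Omega> v" using v by (simp add: H1_with_gradient_def)
    have "integrable (lebesgue_on \<Omega>) (\<lambda>x. (bump (sc x / \<delta>) * (bump (tc x / \<epsilon>) / \<epsilon>)) *\<^sub>R c)"
    proof (rule integrable_bounded_mult[OF _ continuous_measurable[OF continuous_weight] weight_bound lmeasurable_domain])
      show "square_integrable \<Omega> (\<lambda>x. c)"
        using integrable_lebesgue_on_const[OF lmeasurable_domain] by (auto simp: square_integrable_def)
    qed (use \<delta> \<epsilon> in auto)
    then have iq: "integrable (lebesgue_on \<Omega>) (\<lambda>x. q (sc x) * (bump (tc x / \<epsilon>) / \<epsilon>))"
      by (simp add: q_def mult_ac)
    have "c * \<delta> * \<bar>cross2 u w\<bar> = (LINT x|lebesgue_on \<Omega>. q (sc x) * (bump (tc x / \<epsilon>) / \<epsilon>))"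
      using strip_integral[OF q \<delta>, of \<epsilon>] \<epsilon> \<epsilon>1 qint by simp
    also have "\<dots> \<le> (LINT x|lebesgue_on \<Omega>. sgn (v a) * ((bump (sc x / \<delta>) * (bump (tc x / \<epsilon>) / \<epsilon>)) * v x))"
    proof (rule integral_mono[OF iq])
      show "integrable (lebesgue_on \<Omega>) (\<lambda>x. sgn (v a) * ((bump (sc x / \<delta>) * (bump (tc x / \<epsilon>) / \<epsilon>)) * v x))"
        by (intro integrable_mult_right integrable_weight sv \<delta> \<epsilon>)
      fix x assume "x \<in> space (lebesgue_on \<Omega>)"
      then have x: "x \<in> \<Omega>" by simp
      show "q (sc x) * (bump (tc x / \<epsilon>) / \<epsilon>) \<le> sgn (v a) * ((bump (sc x / \<delta>) * (bump (tc x / \<epsilon>) / \<epsilon>)) * v x)"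
      proof (cases "bump (sc x / \<delta>) = 0 \<or> bump (tc x / \<epsilon>) = 0")
        case True
        then show ?thesis by (auto simp: q_def)
      next
        case False
        then have "1 < sc x / \<delta>" "sc x / \<delta> < 2" "1 < tc x / \<epsilon>" "tc x / \<epsilon> < 2"
          using bump_outside[of "sc x / \<delta>"] bump_outside[of "tc x / \<epsilon>"] by force+
        then have s: "0 < sc x" "sc x < 2 * \<delta>" and t: "0 < tc x" "tc x < 2 * \<epsilon>"
          using \<delta> \<epsilon> by (auto simp: field_simps)
        have "dist x a = norm (sc x *\<^sub>R u + tc x *\<^sub>R w)"
          using coords[of x] by (metis add.assoc add_diff_cancel_left' dist_norm)
        also have "\<dots> \<le> sc x * norm u + tc x * norm w"
          using norm_triangle_ineq[of "sc x *\<^sub>R u" "tc x *\<^sub>R w"] s t by simp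
        also have "\<dots> \<le> 2 * \<delta> * norm u + 2 * \<epsilon>1 * norm w"
          using s t \<epsilon> by (intro add_mono mult_right_mono) auto
        also have "\<dots> < d" using du dw d by linarith
        finally have "\<bar>v x - v a\<bar> < c"
          using d(2)[of x] x closure_subset by (auto simp: dist_real_def)
        then have "c \<le> sgn (v a) * v x"
          by (auto simp: c_def sgn_real_def abs_real_def split: if_splits)
        then have "bump (sc x / \<delta>) * (bump (tc x / \<epsilon>) / \<epsilon>) * c \<le>
            bump (sc x / \<delta>) * (bump (tc x / \<epsilon>) / \<epsilon>) * (sgn (v a) * v x)"
          using bump_nonneg \<epsilon> by (intro mult_left_mono) auto
        then show ?thesis by (simp add: q_def mult_ac)
      qed
    qed
    also have "\<dots> = sgn (v a) * strip_mean \<delta> \<epsilon> v"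
      by (simp add: strip_mean_def)
    also have "\<dots> \<le> \<bar>strip_mean \<delta> \<epsilon> v\<bar>"
      by (auto simp: sgn_real_def)
    finally show ?thesis .
  qed
  define R where "R m = 32 * sqrt (measure lebesgue \<Omega>) * sqrt (LINT x|lebesgue_on \<Omega>. (\<phi> m x - v x)\<^sup>2) +
     2 * norm w * sqrt (measure lebesgue \<Omega>) * sqrt (LINT x|lebesgue_on \<Omega>. (norm (\<psi> m x - g x))\<^sup>2)" for m
  define S where "S m = \<bar>cross2 u w\<bar> * (2 * sqrt (LINT s|lebesgue_on {0..1}. (\<phi> m (a + s *\<^sub>R u))\<^sup>2))" for m
  have "c * \<delta> * \<bar>cross2 u w\<bar> / 2 \<le> S m + R m" for m
  proof -
    have "square_integrable \<Omega> (\<phi> m)" using \<phi>(1)[of m] by (simp add: H1_with_gradient_def)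
    \<comment> \<open>This \<eta> makes the continuity error half of the lower bound.\<close>
    from strip_mean_upper[OF this \<phi>(2) \<delta>, of "c * \<delta> / 4"] c \<delta>
    obtain \<epsilon>0 where e0: "\<epsilon>0 > 0" and up: "\<And>\<epsilon>. 0 < \<epsilon> \<Longrightarrow> \<epsilon> \<le> \<epsilon>0 \<Longrightarrow> \<epsilon> \<le> 1/16 \<Longrightarrow>
     \<bar>strip_mean \<delta> \<epsilon> (\<phi> m)\<bar> \<le> \<bar>cross2 u w\<bar> * (2 * sqrt (LINT s|lebesgue_on {0..1}. (\<phi> m (a + s *\<^sub>R u))\<^sup>2) + 2 * (c * \<delta> / 4))"
      by auto
    define \<epsilon> where "\<epsilon> = min \<epsilon>0 \<epsilon>1"
    have \<epsilon>: "0 < \<epsilon>" "\<epsilon> \<le> \<epsilon>0" "\<epsilon> \<le> \<epsilon>1" "\<epsilon> \<le> 1/16"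
      using e0 \<epsilon>1 by (auto simp: \<epsilon>_def)
    have "c * \<delta> * \<bar>cross2 u w\<bar> \<le> \<bar>strip_mean \<delta> \<epsilon> v\<bar>" by (rule lower) (use \<epsilon> in auto)
    also have "\<dots> \<le> \<bar>strip_mean \<delta> \<epsilon> (\<phi> m)\<bar> + R m"
      using strip_mean_diff_le[OF \<phi>(1) v(1) \<delta> \<epsilon>(1,4), of m] unfolding R_def by linarith
    also have "\<bar>strip_mean \<delta> \<epsilon> (\<phi> m)\<bar> \<le> S m + c * \<delta> * \<bar>cross2 u w\<bar> / 2"
      using up[OF \<epsilon>(1,2,4)] by (simp add: S_def algebra_simps)
    finally show ?thesis by simp
  qed
  moreover have "(\<lambda>m. S m + R m) \<longlonglongrightarrow> \<bar>cross2 u w\<bar> * (2 * sqrt 0) + (32 * sqrt (measure lebesgue \<Omega>) * sqrt 0 +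
     2 * norm w * sqrt (measure lebesgue \<Omega>) * sqrt 0)"
    unfolding S_def R_def by (intro tendsto_intros lim1 lim2 seg)
  ultimately have "c * \<delta> * \<bar>cross2 u w\<bar> / 2 \<le> \<bar>cross2 u w\<bar> * (2 * sqrt 0) + (32 * sqrt (measure lebesgue \<Omega>) * sqrt 0 +
     2 * norm w * sqrt (measure lebesgue \<Omega>) * sqrt 0)"
    by (intro LIMSEQ_le_const) auto
  moreover have "c * \<delta> * \<bar>cross2 u w\<bar> > 0" using c \<delta> cross_ne by simp
  ultimately show False by simp
qed

end

section \<open>Planar linear algebra and convexity\<close>

lemma cross2_dual_basis:
  assumes "cross2 u w \<noteq> 0"
  shows "\<exists>\<sigma> \<tau>. u \<bullet> \<sigma> = 1 \<and> u \<bullet> \<tau> = 0 \<and> w \<bullet> \<sigma> = 0 \<and> w \<bullet> \<tau> = 1 \<and>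
     (\<forall>x. (x \<bullet> \<sigma>) *\<^sub>R u + (x \<bullet> \<tau>) *\<^sub>R w = x)"
proof -
  define d where "d = cross2 u w"
  define \<sigma> \<tau> :: pt where "\<sigma> = vector [w $ 2 / d, - w $ 1 / d]" and "\<tau> = vector [- u $ 2 / d, u $ 1 / d]"
  have d: "d \<noteq> 0" "d = u $ 1 * w $ 2 - u $ 2 * w $ 1" using assms by (auto simp: d_def cross2_def)
  have "(x \<bullet> \<sigma>) *\<^sub>R u + (x \<bullet> \<tau>) *\<^sub>R w = x" for x :: pt
  proof -
    have "d *\<^sub>R ((x \<bullet> \<sigma>) *\<^sub>R u + (x \<bullet> \<tau>) *\<^sub>R w) = d *\<^sub>R x"
      using d(1) unfolding vec_eq_iff forall_2
      by (simp add: \<sigma>_def \<tau>_def inner_vec_def sum_2 field_simps) (simp add: d(2) algebra_simps)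
    then show ?thesis using d by simp
  qed
  moreover have "u \<bullet> \<sigma> = 1" "u \<bullet> \<tau> = 0" "w \<bullet> \<sigma> = 0" "w \<bullet> \<tau> = 1"
    using d(1) by (simp_all add: \<sigma>_def \<tau>_def inner_vec_def sum_2 field_simps) (simp_all add: d(2))
  ultimately show ?thesis by blast
qed

lemma closure_convex_combination_in_open:
  fixes p c :: "'a::euclidean_space"
  assumes "convex \<Omega>" "open \<Omega>" "c \<in> \<Omega>" "p \<in> closure \<Omega>" "0 < t" "t \<le> 1"
  shows "(1 - t) *\<^sub>R p + t *\<^sub>R c \<in> \<Omega>"
  using mem_interior_closure_convex_shrink[of \<Omega> c p t] assms
  by (simp add: interior_open algebra_simps)

lemma exists_off_line:
  assumes "open \<Omega>" "\<Omega> \<noteq> {}" "u \<noteq> 0"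
  shows "\<exists>p\<in>\<Omega>. cross2 u (p - a) \<noteq> 0"
proof -
  obtain p where p: "p \<in> \<Omega>" using assms by auto
  obtain e where e: "e > 0" "ball p e \<subseteq> \<Omega>" using assms p open_contains_ball by blast
  define r :: pt where "r = vector [- u $ 2, u $ 1]"
  have r: "r \<noteq> 0" "cross2 u r \<noteq> 0"
    using assms(3) by (auto simp: r_def vec_eq_iff forall_2 cross2_def sum_squares_eq_zero_iff
      simp flip: power2_eq_square)
  define p' where "p' = p + (e / (2 * norm r)) *\<^sub>R r"
  have "dist p p' < e" using r e by (simp add: p'_def dist_norm)
  then have "p' \<in> \<Omega>" using e by auto
  moreover have "cross2 u (p' - a) = cross2 u (p - a) + (e / (2 * norm r)) * cross2 u r"
    by (simp add: p'_def cross2_def algebra_simps)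
  moreover have "(e / (2 * norm r)) * cross2 u r \<noteq> 0" using r e by simp
  ultimately show ?thesis using p by (metis add_cancel_right_right)
qed

section \<open>The boundary of a convex polygon near an endpoint of the interface\<close>

locale domain_interface =
  fixes \<Omega> :: "pt set" and a b n :: pt
  assumes dom: "convex_polygonal_domain \<Omega>" and ab: "a \<noteq> b"
    and interface: "closed_segment a b \<subseteq> closure \<Omega>"
    and normal: "\<And>x. x \<in> closed_segment a b \<Longrightarrow> outward_unit_normal \<Omega> x n"
begin

lemma domain: "\<Omega> \<noteq> {}" "open \<Omega>" "bounded \<Omega>" "convex \<Omega>" "polytope (closure \<Omega>)"
  using dom by (auto simp: convex_polygonal_domain_def)

lemma norm_n: "norm n = 1"
  using normal[of a] by (auto simp: outward_unit_normal_def)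

lemma normal_closure: "x \<in> closed_segment a b \<Longrightarrow> y \<in> closure \<Omega> \<Longrightarrow> n \<bullet> (y - x) \<le> 0"
proof -
  assume x: "x \<in> closed_segment a b" and y: "y \<in> closure \<Omega>"
  have "closed {y. n \<bullet> (y - x) \<le> 0}"
    by (intro closed_Collect_le continuous_intros)
  moreover have "\<Omega> \<subseteq> {y. n \<bullet> (y - x) \<le> 0}"
    using normal[OF x] by (auto simp: outward_unit_normal_def)
  ultimately show ?thesis using y closure_minimal by blast
qed

text \<open>The normal inequality holds at \<open>a\<close> for the point \<open>b\<close> and at
  \<open>b\<close> for the point \<open>a\<close>, which gives both signs.\<close>

lemma n_orth: "n \<bullet> (b - a) = 0"
proof -
  have "a \<in> closure \<Omega>" "b \<in> closure \<Omega>" using interface by auto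
  with normal_closure[of a b] normal_closure[of b a] show ?thesis
    by (auto simp: inner_diff_right)
qed

lemma n_interface: "x \<in> closed_segment a b \<Longrightarrow> n \<bullet> (x - a) = 0"
  using n_orth by (auto simp: in_segment inner_diff_right inner_add_right left_diff_distrib)

lemma n_closure: "y \<in> closure \<Omega> \<Longrightarrow> n \<bullet> (y - a) \<le> 0"
  using normal_closure[of a y] by simp

lemma n_inside: "y \<in> \<Omega> \<Longrightarrow> n \<bullet> (y - a) < 0"
proof -
  assume y: "y \<in> \<Omega>"
  obtain e where e: "e > 0" "ball y e \<subseteq> \<Omega>" using y domain open_contains_ball by blast
  have "dist y (y + (e/2) *\<^sub>R n) < e" using e norm_n by (simp add: dist_norm)
  then have "y + (e/2) *\<^sub>R n \<in> \<Omega>" using e by auto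
  then have "n \<bullet> (y + (e/2) *\<^sub>R n - a) \<le> 0" using n_closure closure_subset by blast
  moreover have "n \<bullet> n = 1" using norm_n by (simp add: norm_eq_1)
  ultimately show ?thesis using e by (simp add: inner_add_right inner_diff_right)
qed

text \<open>The point \<open>y0\<close> lies just beyond the end \<open>a\<close> of the segment. If
  it is in the closure, it is a boundary point on the supporting line, as happens when the interface
  is only part of a side. Otherwise the way from a nearby inner point to \<open>y0\<close> crosses
  the boundary strictly on the inner side of that line.\<close>

lemma frontier_points_near:
  assumes "r > 0"
  shows "\<exists>y. y \<in> frontier \<Omega> \<and> y \<notin> closed_segment a b \<and> dist y a < r"
proof -
  define s where "s = r / (2 * norm (b - a))"
  have s: "s > 0" using assms ab by (simp add: s_def)
  define y0 where "y0 = a - s *\<^sub>R (b - a)"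
  have dy0: "dist y0 a < r" using s assms ab by (simp add: y0_def dist_norm s_def)
  have y0: "y0 \<notin> closed_segment a b"
  proof
    assume "y0 \<in> closed_segment a b"
    then obtain l where l: "0 \<le> l" "y0 = (1 - l) *\<^sub>R a + l *\<^sub>R b" by (auto simp: in_segment)
    then have "(l + s) *\<^sub>R (b - a) = 0" by (simp add: y0_def algebra_simps)
    then show False using l s ab by simp
  qed
  show ?thesis
  proof (cases "y0 \<in> closure \<Omega>")
    case True
    have "n \<bullet> (y0 - a) = 0" using n_orth by (simp add: y0_def)
    then have "y0 \<notin> \<Omega>" using n_inside by force
    then have "y0 \<in> frontier \<Omega>" using True domain by (simp add: frontier_def interior_open)
    then show ?thesis using y0 dy0 by blast
  next
    case False
    obtain p0 where p0: "p0 \<in> \<Omega>" using domain by auto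
    have p0a: "p0 \<noteq> a" using n_inside[OF p0] by auto
    define l where "l = min 1 (r / (2 * norm (p0 - a)))"
    have l: "0 < l" "l \<le> 1" using assms p0a by (auto simp: l_def)
    define p where "p = (1 - l) *\<^sub>R a + l *\<^sub>R p0"
    have "a \<in> closure \<Omega>" using interface by auto
    then have p: "p \<in> \<Omega>" unfolding p_def
      by (intro closure_convex_combination_in_open domain p0 l)
    have dp: "dist p a < r"
    proof -
      have "dist p a = l * norm (p0 - a)" using l
        by (simp add: p_def dist_norm algebra_simps flip: scaleR_diff_right)
      also have "\<dots> \<le> (r / (2 * norm (p0 - a))) * norm (p0 - a)"
        by (intro mult_right_mono) (auto simp: l_def)
      also have "\<dots> < r" using p0a assms by simp
      finally show ?thesis .
    qed
    have "closed_segment p y0 \<inter> frontier \<Omega> \<noteq> {}"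
    proof (rule connected_Int_frontier)
      show "closed_segment p y0 \<inter> \<Omega> \<noteq> {}" using p by auto
      show "closed_segment p y0 - \<Omega> \<noteq> {}" using False closure_subset by fastforce
    qed auto
    then obtain y where y: "y \<in> closed_segment p y0" "y \<in> frontier \<Omega>" by auto
    then obtain \<theta> where \<theta>: "0 \<le> \<theta>" "\<theta> \<le> 1" "y = (1 - \<theta>) *\<^sub>R p + \<theta> *\<^sub>R y0" by (auto simp: in_segment)
    have "y \<in> closure \<Omega>" using y by (auto simp: frontier_def)
    then have "\<theta> \<noteq> 1" using False \<theta> by auto
    have "n \<bullet> (y - a) = (1 - \<theta>) * (n \<bullet> (p - a)) + \<theta> * (n \<bullet> (y0 - a))"
      by (simp add: \<theta>(3) inner_diff_right inner_add_right algebra_simps)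
    also have "n \<bullet> (y0 - a) = 0" using n_orth by (simp add: y0_def)
    finally have "n \<bullet> (y - a) < 0" using n_inside[OF p] \<theta> \<open>\<theta> \<noteq> 1\<close> by (simp add: mult_pos_neg)
    then have "y \<notin> closed_segment a b" using n_interface by force
    moreover have "dist y a < r"
    proof -
      have "y \<in> ball a r"
        using closed_segment_subset[of p "ball a r" y0] y(1) dp dy0 by (auto simp: dist_commute)
      then show ?thesis by (simp add: dist_commute)
    qed
    ultimately show ?thesis using y by blast
  qed
qed

text \<open>A polygon has finitely many sides, and those that avoid \<open>a\<close> keep a positive
  distance from it, so a boundary point \<open>y\<close> close to \<open>a\<close> shares a side
  with \<open>a\<close>. Since \<open>y\<close> is off the interface and nearer to \<open>a\<close>
  than \<open>b\<close> is, the two segments cannot overlap.\<close>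

lemma boundary_segment_at_endpoint:
  "\<exists>y. y \<noteq> a \<and> closed_segment a y \<subseteq> frontier \<Omega> \<and> closed_segment a y \<inter> closed_segment a b = {a}"
proof -
  have fr: "frontier \<Omega> = \<Union>{F. F facet_of closure \<Omega>}"
  proof -
    have "interior (closure \<Omega>) = \<Omega>"
      using domain by (simp add: convex_interior_closure interior_open)
    then have "rel_interior (closure \<Omega>) = \<Omega>"
      using domain rel_interior_nonempty_interior[of "closure \<Omega>"] by auto
    then have "rel_frontier (closure \<Omega>) = frontier \<Omega>"
      using domain by (simp add: rel_frontier_def frontier_def interior_open)
    then show ?thesis
      using rel_frontier_of_polyhedron[OF polytope_imp_polyhedron[OF domain(5)]] by simp
  qed
  define \<F> where "\<F> = {F. F facet_of closure \<Omega> \<and> a \<notin> F}"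
  have "finite \<F>" unfolding \<F>_def
    by (rule finite_subset[OF _ finite_polytope_facets[OF domain(5)]]) auto
  have "closed (\<Union>\<F>)"
  proof (rule closed_Union[OF \<open>finite \<F>\<close>], rule ballI)
    fix F assume "F \<in> \<F>"
    then have "F face_of closure \<Omega>" by (simp add: \<F>_def facet_of_imp_face_of)
    then show "closed F"
      by (rule face_of_imp_closed[OF convex_closure[OF domain(4)] closed_closure])
  qed
  moreover have "a \<notin> \<Union>\<F>" by (auto simp: \<F>_def)
  ultimately obtain r where r: "r > 0" "ball a r \<subseteq> - \<Union>\<F>"
    using openE[of "- \<Union>\<F>" a] by (auto simp: open_Compl)
  have "min r (norm (b - a)) > 0" using r ab by simp
  from frontier_points_near[OF this] obtain y where y: "y \<in> frontier \<Omega>" "y \<notin> closed_segment a b"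
      "dist y a < r" "dist y a < norm (b - a)" by auto
  from y(1) fr obtain F where F: "F facet_of closure \<Omega>" "y \<in> F" by auto
  have "y \<in> ball a r" using y by (simp add: dist_commute)
  then have "a \<in> F" using F r by (auto simp: \<F>_def)
  have "convex F" using F facet_of_imp_face_of face_of_imp_convex by blast
  then have "closed_segment a y \<subseteq> F" using \<open>a \<in> F\<close> F by (simp add: closed_segment_subset)
  then have 1: "closed_segment a y \<subseteq> frontier \<Omega>" using F fr by auto
  have 2: "closed_segment a y \<inter> closed_segment a b \<subseteq> {a}"
  proof
    fix z assume "z \<in> closed_segment a y \<inter> closed_segment a b"
    then obtain \<theta> l where \<theta>: "0 \<le> \<theta>" "\<theta> \<le> 1" "z = (1 - \<theta>) *\<^sub>R a + \<theta> *\<^sub>R y"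
      and l: "0 \<le> l" "l \<le> 1" "z = (1 - l) *\<^sub>R a + l *\<^sub>R b" by (auto simp: in_segment)
    show "z \<in> {a}"
    proof (rule ccontr)
      assume "z \<notin> {a}"
      then have "\<theta> \<noteq> 0" using \<theta> by auto
      have e: "\<theta> *\<^sub>R (y - a) = l *\<^sub>R (b - a)" using \<theta> l by (simp add: algebra_simps)
      have "y - a = (1 / \<theta>) *\<^sub>R (\<theta> *\<^sub>R (y - a))" using \<open>\<theta> \<noteq> 0\<close> by simp
      also have "\<dots> = (l / \<theta>) *\<^sub>R (b - a)" unfolding e by simp
      finally have ya: "y - a = (l / \<theta>) *\<^sub>R (b - a)" .
      then have "norm (y - a) = l / \<theta> * norm (b - a)" using l \<theta> by simp
      moreover have "norm (y - a) < norm (b - a)" using y by (simp add: dist_norm)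
      ultimately have "l / \<theta> * norm (b - a) < 1 * norm (b - a)" by simp
      then have "l / \<theta> < 1" by (rule mult_right_less_imp_less) simp
      moreover have "0 \<le> l / \<theta>" using l \<theta> by simp
      moreover have "y = (1 - l / \<theta>) *\<^sub>R a + (l / \<theta>) *\<^sub>R b" using ya by (simp add: algebra_simps)
      ultimately have "y \<in> closed_segment a b"
        unfolding in_segment by (intro exI[of _ "l / \<theta>"]) auto
      then show False using y by simp
    qed
  qed
  have "y \<noteq> a" using y by auto
  then show ?thesis using 1 2 by (intro exI[of _ y]) auto
qed

text \<open>The zero trace is prescribed off the interface only. A boundary segment that starts at
  \<open>a\<close> and otherwise misses the interface carries it, and closedness of \<open>S\<close>
  brings in \<open>a\<close> itself.\<close>

lemma zero_trace_endpoint: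
  assumes S: "closed S" "frontier \<Omega> - closed_segment a b \<subseteq> S"
    and tr: "zero_trace_on \<Omega> S v" and v: "continuous_on (closure \<Omega>) v"
  shows "v a = 0"
proof -
  obtain y where y: "y \<noteq> a" "closed_segment a y \<subseteq> frontier \<Omega>" "closed_segment a y \<inter> closed_segment a b = {a}"
    using boundary_segment_at_endpoint by blast
  have "closed_segment a y - {a} \<subseteq> S" using y S by auto
  then have "open_segment a y \<subseteq> S" by (auto simp: open_segment_def)
  then have yS: "closed_segment a y \<subseteq> S"
    using S(1) y(1) closure_open_segment[of a y] closure_minimal[of "open_segment a y" S] by simp
  define u where "u = y - a"
  have u: "u \<noteq> 0" using y by (simp add: u_def)
  obtain p0 where p0: "p0 \<in> \<Omega>" "cross2 u (p0 - a) \<noteq> 0"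
    using exists_off_line[OF domain(2,1) u] by blast
  obtain \<sigma> \<tau> where dual: "u \<bullet> \<sigma> = 1" "u \<bullet> \<tau> = 0" "(p0 - a) \<bullet> \<sigma> = 0" "(p0 - a) \<bullet> \<tau> = 1"
     "\<And>x. (x \<bullet> \<sigma>) *\<^sub>R u + (x \<bullet> \<tau>) *\<^sub>R (p0 - a) = x"
    using cross2_dual_basis[OF p0(2)] by blast
  have edge: "a + s *\<^sub>R u \<in> closure \<Omega>" if "0 \<le> s" "s \<le> 1" for s
  proof -
    have "a + s *\<^sub>R u \<in> closed_segment a y"
      unfolding in_segment u_def using that by (intro exI[of _ s]) (auto simp: algebra_simps)
    then show ?thesis using y(2) by (auto simp: frontier_def)
  qed
  interpret boundary_strip \<Omega> a u "p0 - a" \<sigma> \<tau>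
  proof
    fix s t :: real assume st: "0 < s" "0 < t" "s + t < 1"
    \<comment> \<open>The point is a convex combination, with weights 1 - t and t, of an edge point
      and the inner point \<open>p0\<close>.\<close>
    have "a + (s / (1 - t)) *\<^sub>R u \<in> closure \<Omega>" using st by (intro edge) auto
    then have "(1 - t) *\<^sub>R (a + (s / (1 - t)) *\<^sub>R u) + t *\<^sub>R p0 \<in> \<Omega>"
      using st by (intro closure_convex_combination_in_open domain p0) auto
    also have "(1 - t) *\<^sub>R (a + (s / (1 - t)) *\<^sub>R u) + t *\<^sub>R p0 = a + s *\<^sub>R u + t *\<^sub>R (p0 - a)"
    proof -
      have "(1 - t) *\<^sub>R ((s / (1 - t)) *\<^sub>R u) = s *\<^sub>R u" using st by simp
      then show ?thesis by (simp only: scaleR_add_right) (simp add: algebra_simps)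
    qed
    finally show "a + s *\<^sub>R u + t *\<^sub>R (p0 - a) \<in> \<Omega>" .
  qed (use domain p0 dual edge in auto)
  from tr obtain g \<phi> \<psi> where *: "H1_with_gradient \<Omega> v g"
      "\<And>m::nat. H1_with_gradient \<Omega> (\<phi> m) (\<psi> m)" "\<And>m. continuous_on (closure \<Omega>) (\<phi> m)"
      "(\<lambda>m. LINT x|lebesgue_on \<Omega>. (\<phi> m x - v x)\<^sup>2) \<longlonglongrightarrow> 0"
      "(\<lambda>m. LINT x|lebesgue_on \<Omega>. (norm (\<psi> m x - g x))\<^sup>2) \<longlonglongrightarrow> 0"
      "\<And>p q. closed_segment p q \<subseteq> S \<Longrightarrow>
           (\<lambda>m. segment_integral p q (\<lambda>x. (\<phi> m x)\<^sup>2)) \<longlonglongrightarrow> 0"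
    unfolding zero_trace_on_def by blast
  have "(\<lambda>m. (1 / norm (y - a)) * segment_integral a y (\<lambda>x. (\<phi> m x)\<^sup>2)) \<longlonglongrightarrow> (1 / norm (y - a)) * 0"
    by (intro tendsto_intros *(6) yS)
  moreover have "(1 / norm (y - a)) * segment_integral a y (\<lambda>x. (\<phi> m x)\<^sup>2) =
     (LINT s|lebesgue_on {0..1}. (\<phi> m (a + s *\<^sub>R u))\<^sup>2)" for m
    using y(1) by (simp add: segment_integral_def linepath_def u_def algebra_simps)
  ultimately have "(\<lambda>m. LINT s|lebesgue_on {0..1}. (\<phi> m (a + s *\<^sub>R u))\<^sup>2) \<longlonglongrightarrow> 0" by simp
  from zero_trace_corner[OF *(1) v *(2-5) this] show ?thesis .
qed

end

text \<open>Away from the closure of \<Omega>2 the union of the closures is locally the closure of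
  \<Omega>1, whose interior is \<Omega>1 by convexity.\<close>

lemma frontier_minus_interface_subset:
  assumes "closure \<Omega>1 \<inter> closure \<Omega>2 = \<Gamma>" "open \<Omega>1" "convex \<Omega>1"
  shows "frontier \<Omega>1 - \<Gamma> \<subseteq> frontier (composed_domain \<Omega>1 \<Omega>2) \<inter> frontier \<Omega>1"
proof
  fix x assume x: "x \<in> frontier \<Omega>1 - \<Gamma>"
  then have xc: "x \<in> closure \<Omega>1" "x \<notin> closure \<Omega>2" using assms by (auto simp: frontier_def)
  have "\<Omega>1 \<subseteq> composed_domain \<Omega>1 \<Omega>2" unfolding composed_domain_def
    using closure_subset[of \<Omega>1] assms(2) by (intro interior_maximal) auto
  then have "x \<in> closure (composed_domain \<Omega>1 \<Omega>2)" using xc closure_mono by blast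
  moreover have "x \<notin> composed_domain \<Omega>1 \<Omega>2"
  proof
    assume "x \<in> composed_domain \<Omega>1 \<Omega>2"
    then have "x \<in> interior (closure \<Omega>1 \<union> closure \<Omega>2) \<inter> - closure \<Omega>2"
      using xc by (simp add: composed_domain_def)
    moreover have "interior (closure \<Omega>1 \<union> closure \<Omega>2) \<inter> - closure \<Omega>2 \<subseteq> interior (closure \<Omega>1)"
      using interior_subset[of "closure \<Omega>1 \<union> closure \<Omega>2"] by (intro interior_maximal open_Int) auto
    ultimately have "x \<in> interior (closure \<Omega>1)" by blast
    then show False using x assms by (simp add: convex_interior_closure interior_open frontier_def)
  qed
  ultimately show "x \<in> frontier (composed_domain \<Omega>1 \<Omega>2) \<inter> frontier \<Omega>1"
    using x by (simp add: frontier_def composed_domain_def)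
qed

section \<open>Inverse inequalities for polynomials\<close>

fun extrapolation_const :: "real \<Rightarrow> nat \<Rightarrow> real" where
  "extrapolation_const \<delta> 0 = 1"
| "extrapolation_const \<delta> (Suc m) = 1 + 2 * extrapolation_const \<delta> m / \<delta>"

lemma extrapolation_const_pos: "\<delta> > 0 \<Longrightarrow> extrapolation_const \<delta> m > 0"
  by (induction m) (simp_all add: add_pos_pos)

text \<open>Extrapolation to 0 from m + 1 nodes at mutual distance at least \<delta>. Dividing p -
  p(s) by x - s lowers the degree and costs a factor 2/\<delta> in the values at the remaining
  nodes; this is the recursion of the constant.\<close>

lemma poly_extrapolation:
  assumes "\<delta> > 0" "degree p \<le> m" "\<And>i j. i < j \<Longrightarrow> j \<le> m \<Longrightarrow> \<delta> \<le> \<bar>t i - t j\<bar>"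
    and "\<And>i. i \<le> m \<Longrightarrow> \<bar>t i\<bar> \<le> (1::real)" "\<And>i. i \<le> m \<Longrightarrow> \<bar>poly p (t i)\<bar> \<le> M"
  shows "\<bar>poly p 0\<bar> \<le> extrapolation_const \<delta> m * M"
  using assms(2-)
proof (induction m arbitrary: p M)
  case 0
  then obtain c where "p = [:c:]" by (auto elim: degree_eq_zeroE)
  then show ?case using "0.prems"(4)[of 0] by simp
next
  case (Suc m)
  define s where "s = t (Suc m)"
  have "poly (p - [:poly p s:]) s = 0" by simp
  then obtain g where g: "p - [:poly p s:] = [:- s, 1:] * g"
    unfolding poly_eq_0_iff_dvd by blast
  have eval: "poly p x = poly p s + (x - s) * poly g x" for x
    using arg_cong[OF g, of "\<lambda>q. poly q x"] by (simp add: algebra_simps)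
  have "degree g \<le> m"
  proof (cases "g = 0")
    case False
    then have "degree ([:- s, 1:] * g) = Suc (degree g)" by (subst degree_mult_eq) auto
    then have "Suc (degree g) = degree (p - [:poly p s:])" using g by simp
    also have "\<dots> \<le> Suc m" using Suc.prems(1) by (intro degree_diff_le) auto
    finally show ?thesis by simp
  qed simp
  moreover have "\<bar>poly g (t i)\<bar> \<le> 2 * M / \<delta>" if "i \<le> m" for i
  proof -
    have d: "\<delta> \<le> \<bar>t i - s\<bar>" using Suc.prems(2)[of i "Suc m"] that by (simp add: s_def)
    have "\<delta> * \<bar>poly g (t i)\<bar> \<le> \<bar>t i - s\<bar> * \<bar>poly g (t i)\<bar>" using d by (intro mult_right_mono) auto
    also have "\<dots> = \<bar>poly p (t i) - poly p s\<bar>" using eval[of "t i"] by (simp add: abs_mult)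
    also have "\<dots> \<le> 2 * M" using Suc.prems(4)[of i] Suc.prems(4)[of "Suc m"] that by (simp add: s_def)
    finally show ?thesis using assms(1) by (simp add: field_simps)
  qed
  ultimately have "\<bar>poly g 0\<bar> \<le> extrapolation_const \<delta> m * (2 * M / \<delta>)"
    using Suc.prems(2,3) by (intro Suc.IH) auto
  moreover have "\<bar>poly p 0\<bar> \<le> M + 1 * \<bar>poly g 0\<bar>"
  proof -
    have "\<bar>poly p 0\<bar> \<le> \<bar>poly p s\<bar> + \<bar>s\<bar> * \<bar>poly g 0\<bar>" using eval[of 0] by (simp add: abs_mult[symmetric])
    also have "\<dots> \<le> M + 1 * \<bar>poly g 0\<bar>"
      using Suc.prems(3,4)[of "Suc m"] by (intro add_mono mult_right_mono) (auto simp: s_def)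
    finally show ?thesis .
  qed
  ultimately show ?case by (simp add: algebra_simps)
qed

text \<open>An explicit route to the inverse inequality, in place of compactness: in each of m + 1
  separated intervals the point of least modulus has a value bounded by the mean square there, and
  these values are extrapolated to 0.\<close>

lemma poly_value_le_L2:
  "\<exists>C>0. \<forall>p::real poly. degree p \<le> m \<longrightarrow>
     ennreal ((poly p 0)\<^sup>2) \<le> ennreal C * (\<integral>\<^sup>+s. ennreal ((poly p s)\<^sup>2) * indicator {0..1/2} s \<partial>lborel)"
proof -
  \<comment> \<open>Now \<open>2 * (m + 1)\<close> intervals of length \<delta> fill [0,1/2]; using
    every second one leaves gaps of length \<delta> between the nodes.\<close>
  define \<delta> where "\<delta> = 1 / (4 * (real m + 1))"
  have \<delta>: "\<delta> > 0" by (simp add: \<delta>_def)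
  define E where "E = extrapolation_const \<delta> m"
  have E: "E > 0" unfolding E_def by (rule extrapolation_const_pos[OF \<delta>])
  show ?thesis
  proof (intro exI[of _ "E\<^sup>2 / \<delta>"] conjI allI impI)
    show "E\<^sup>2 / \<delta> > 0" using E \<delta> by simp
    fix p :: "real poly" assume deg: "degree p \<le> m"
    define J where "J = (\<integral>\<^sup>+s. ennreal ((poly p s)\<^sup>2) * indicator {0..1/2} s \<partial>lborel)"
    define I where "I i = {2 * real i * \<delta>..(2 * real i + 1) * \<delta>}" for i
    have "\<exists>x\<in>I i. \<forall>y\<in>I i. (poly p x)\<^sup>2 \<le> (poly p y)\<^sup>2" for i
      using \<delta> by (intro continuous_attains_inf continuous_intros) (auto simp: I_def mult_right_mono)
    then obtain t where t: "\<And>i. t i \<in> I i" "\<And>i y. y \<in> I i \<Longrightarrow> (poly p (t i))\<^sup>2 \<le> (poly p y)\<^sup>2"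
      by metis
    have Isub: "I i \<subseteq> {0..1/2}" if "i \<le> m" for i
    proof -
      have "(2 * real i + 1) * \<delta> \<le> (2 * real m + 2) * \<delta>" using that \<delta> by (intro mult_right_mono) auto
      also have "\<dots> = 1/2" by (simp add: \<delta>_def field_simps)
      finally show ?thesis using \<delta> by (auto simp: I_def intro: order_trans)
    qed
    have val: "ennreal ((poly p (t i))\<^sup>2 * \<delta>) \<le> J" if "i \<le> m" for i
    proof -
      have "ennreal ((poly p (t i))\<^sup>2 * \<delta>) = (\<integral>\<^sup>+s. ennreal ((poly p (t i))\<^sup>2) * indicator (I i) s \<partial>lborel)"
        using \<delta> by (subst nn_integral_cmult_indicator) (auto simp: I_def ennreal_mult algebra_simps)
      also have "\<dots> \<le> J" unfolding J_def
        using t(2) Isub[OF that] by (intro nn_integral_mono) (auto simp: indicator_def intro!: ennreal_leI)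
      finally show ?thesis .
    qed
    show "ennreal ((poly p 0)\<^sup>2) \<le> ennreal (E\<^sup>2 / \<delta>) * J"
    proof (cases J)
      case (real j)
      have "\<bar>poly p 0\<bar> \<le> extrapolation_const \<delta> m * sqrt (j / \<delta>)"
      proof (rule poly_extrapolation[OF \<delta> deg, of t])
        fix i j :: nat assume ij: "i < j" "j \<le> m"
        have "t i \<le> (2 * real i + 1) * \<delta>" "2 * real j * \<delta> \<le> t j" using t(1)[of i] t(1)[of j] by (auto simp: I_def)
        moreover have "(2 * real i + 2) * \<delta> \<le> 2 * real j * \<delta>" using ij \<delta> by (intro mult_right_mono) auto
        ultimately have "t i + \<delta> \<le> t j" by (simp add: algebra_simps)
        then show "\<delta> \<le> \<bar>t i - t j\<bar>" by linarith
      next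
        fix i assume i: "i \<le> m"
        show "\<bar>t i\<bar> \<le> 1" using t(1)[of i] Isub[OF i] by fastforce
        have "(poly p (t i))\<^sup>2 * \<delta> \<le> j" using val[OF i] real by simp
        then have "(poly p (t i))\<^sup>2 \<le> j / \<delta>" using \<delta> by (simp add: field_simps)
        then show "\<bar>poly p (t i)\<bar> \<le> sqrt (j / \<delta>)" by (simp add: real_le_rsqrt)
      qed
      then have "\<bar>poly p 0\<bar>\<^sup>2 \<le> (E * sqrt (j / \<delta>))\<^sup>2" unfolding E_def[symmetric] by (intro power_mono) auto
      also have "\<dots> = E\<^sup>2 / \<delta> * j" using real \<delta> by (simp add: power_mult_distrib)
      finally show ?thesis using real \<delta> by (simp add: ennreal_mult[symmetric])
    next
      case top
      then show ?thesis using E \<delta> by (simp add: ennreal_mult_top)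
    qed
  qed
qed

text \<open>The form in which a bivariate polynomial meets the one-dimensional inverse
  inequality.\<close>

definition poly_on_lines :: "nat \<Rightarrow> (pt \<Rightarrow> real) \<Rightarrow> bool" where
  "poly_on_lines m f \<longleftrightarrow> (\<forall>x \<nu>. \<exists>q. degree q \<le> m \<and> (\<forall>t. f (x + t *\<^sub>R \<nu>) = poly q t))"

text \<open>The one-dimensional estimate is applied on every line in direction \<open>w\<close> from
  the base and integrated along the base; the parallelogram formula turns the double integral into
  one over \<open>K\<close>.\<close>

lemma poly_on_lines_trace:
  assumes C: "\<And>p::real poly. degree p \<le> m \<Longrightarrow>
     ennreal ((poly p 0)\<^sup>2) \<le> ennreal C * (\<integral>\<^sup>+s. ennreal ((poly p s)\<^sup>2) * indicator {0..1/2} s \<partial>lborel)"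
    and f: "poly_on_lines m f" "continuous_on UNIV f" and K: "closed K"
    and cr: "cross2 u w \<noteq> 0"
    and sub: "\<And>t s. t1 \<le> t \<Longrightarrow> t \<le> t2 \<Longrightarrow> 0 \<le> s \<Longrightarrow> s \<le> 1/2 \<Longrightarrow> x0 + t *\<^sub>R u + s *\<^sub>R w \<in> K"
  shows "ennreal \<bar>cross2 u w\<bar> * (\<integral>\<^sup>+t. ennreal ((f (x0 + t *\<^sub>R u))\<^sup>2) * indicator {t1..t2} t \<partial>lborel) \<le>
     ennreal C * (\<integral>\<^sup>+x. ennreal ((f x)\<^sup>2) * indicator K x \<partial>lborel)"
proof -
  have [measurable]: "f \<in> borel_measurable borel" "K \<in> sets borel"
    using f K by (auto intro: borel_measurable_continuous_onI)
  let ?A = "\<integral>\<^sup>+t. \<integral>\<^sup>+s. ennreal ((f (x0 + t *\<^sub>R u + s *\<^sub>R w))\<^sup>2) * indicator K (x0 + t *\<^sub>R u + s *\<^sub>R w) \<partial>lborel \<partial>lborel"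
  have "(\<integral>\<^sup>+t. ennreal ((f (x0 + t *\<^sub>R u))\<^sup>2) * indicator {t1..t2} t \<partial>lborel) \<le>
    (\<integral>\<^sup>+t. ennreal C * (\<integral>\<^sup>+s. ennreal ((f (x0 + t *\<^sub>R u + s *\<^sub>R w))\<^sup>2) * indicator K (x0 + t *\<^sub>R u + s *\<^sub>R w) \<partial>lborel) \<partial>lborel)"
  proof (rule nn_integral_mono)
    fix t
    show "ennreal ((f (x0 + t *\<^sub>R u))\<^sup>2) * indicator {t1..t2} t \<le>
       ennreal C * (\<integral>\<^sup>+s. ennreal ((f (x0 + t *\<^sub>R u + s *\<^sub>R w))\<^sup>2) * indicator K (x0 + t *\<^sub>R u + s *\<^sub>R w) \<partial>lborel)"
    proof (cases "t \<in> {t1..t2}")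
      case True
      obtain q where q: "degree q \<le> m" "\<And>s. f (x0 + t *\<^sub>R u + s *\<^sub>R w) = poly q s"
        using f(1) unfolding poly_on_lines_def by blast
      have "ennreal ((f (x0 + t *\<^sub>R u))\<^sup>2) = ennreal ((poly q 0)\<^sup>2)" using q(2)[of 0] by simp
      also have "\<dots> \<le> ennreal C * (\<integral>\<^sup>+s. ennreal ((poly q s)\<^sup>2) * indicator {0..1/2} s \<partial>lborel)"
        by (rule C[OF q(1)])
      also have "\<dots> \<le> ennreal C * (\<integral>\<^sup>+s. ennreal ((f (x0 + t *\<^sub>R u + s *\<^sub>R w))\<^sup>2) * indicator K (x0 + t *\<^sub>R u + s *\<^sub>R w) \<partial>lborel)"
        using sub True by (intro mult_left_mono nn_integral_mono) (auto simp: indicator_def q(2))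
      finally show ?thesis using True by simp
    qed simp
  qed
  also have "\<dots> = ennreal C * ?A" by (rule nn_integral_cmult) measurable
  finally have "ennreal \<bar>cross2 u w\<bar> * (\<integral>\<^sup>+t. ennreal ((f (x0 + t *\<^sub>R u))\<^sup>2) * indicator {t1..t2} t \<partial>lborel) \<le>
     ennreal \<bar>cross2 u w\<bar> * (ennreal C * ?A)" by (rule mult_left_mono) simp
  also have "\<dots> = ennreal C * (ennreal \<bar>cross2 u w\<bar> * ?A)" by (simp only: mult.left_commute)
  also have "ennreal \<bar>cross2 u w\<bar> * ?A = (\<integral>\<^sup>+x. ennreal ((f x)\<^sup>2) * indicator K x \<partial>lborel)"
    by (rule nn_integral_parallelogram[OF _ cr, symmetric]) measurable
  finally show ?thesis .
qed

text \<open>The edge is halved, so that over each half a parallelogram fits into the triangle.\<close>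

lemma poly_on_lines_edge_trace:
  assumes C: "\<And>p::real poly. degree p \<le> m \<Longrightarrow>
     ennreal ((poly p 0)\<^sup>2) \<le> ennreal C * (\<integral>\<^sup>+s. ennreal ((poly p s)\<^sup>2) * indicator {0..1/2} s \<partial>lborel)"
    and f: "poly_on_lines m f" "continuous_on UNIV f" and t12: "t1 < t2"
    and cr: "cross2 u (z - x0) \<noteq> 0"
    and K: "K = convex hull {x0 + t1 *\<^sub>R u, x0 + t2 *\<^sub>R u, z}"
  shows "ennreal \<bar>cross2 u (z - x0)\<bar> * (\<integral>\<^sup>+t. ennreal ((f (x0 + t *\<^sub>R u))\<^sup>2) * indicator {t1..t2} t \<partial>lborel) \<le>
     ennreal (2 * C) * (\<integral>\<^sup>+x. ennreal ((f x)\<^sup>2) * indicator K x \<partial>lborel)"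
proof -
  define tm where "tm = (t1 + t2) / 2"
  have tm: "t1 < tm" "tm < t2" using t12 by (auto simp: tm_def)
  have [measurable]: "f \<in> borel_measurable borel"
    using f by (auto intro: borel_measurable_continuous_onI)
  have clK: "closed K" unfolding K by (intro compact_imp_closed finite_imp_compact_convex_hull) auto
  have cr': "cross2 u (z - (x0 + t *\<^sub>R u)) = cross2 u (z - x0)" for t
    by (simp add: cross2_def algebra_simps)
  have hull: "(1 - \<alpha> - \<beta>) *\<^sub>R p + \<alpha> *\<^sub>R q + \<beta> *\<^sub>R z \<in> convex hull {p, q, z}"
    if "0 \<le> \<alpha>" "0 \<le> \<beta>" "\<alpha> + \<beta> \<le> 1" for \<alpha> \<beta> and p q :: pt
    unfolding convex_hull_3 using that by (intro CollectI exI[of _ "1 - \<alpha> - \<beta>"] exI[of _ \<alpha>] exI[of _ \<beta>]) auto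
  have sub1: "x0 + t *\<^sub>R u + s *\<^sub>R (z - (x0 + t1 *\<^sub>R u)) \<in> K" if "t1 \<le> t" "t \<le> tm" "0 \<le> s" "s \<le> 1/2" for t s
  proof -
    define \<alpha> where "\<alpha> = (t - t1) / (t2 - t1)"
    have \<alpha>: "0 \<le> \<alpha>" "\<alpha> \<le> 1/2" using that t12 by (auto simp: \<alpha>_def tm_def field_simps)
    have t: "t = t1 + \<alpha> * (t2 - t1)" using t12 by (simp add: \<alpha>_def)
    have "(1 - \<alpha> - s) *\<^sub>R (x0 + t1 *\<^sub>R u) + \<alpha> *\<^sub>R (x0 + t2 *\<^sub>R u) + s *\<^sub>R z \<in> K"
      unfolding K using \<alpha> that by (intro hull) auto
    also have "(1 - \<alpha> - s) *\<^sub>R (x0 + t1 *\<^sub>R u) + \<alpha> *\<^sub>R (x0 + t2 *\<^sub>R u) + s *\<^sub>R z =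
       x0 + t *\<^sub>R u + s *\<^sub>R (z - (x0 + t1 *\<^sub>R u))"
      unfolding t by (simp add: algebra_simps)
    finally show ?thesis .
  qed
  have sub2: "x0 + t *\<^sub>R u + s *\<^sub>R (z - (x0 + t2 *\<^sub>R u)) \<in> K" if "tm \<le> t" "t \<le> t2" "0 \<le> s" "s \<le> 1/2" for t s
  proof -
    define \<alpha> where "\<alpha> = (t2 - t) / (t2 - t1)"
    have \<alpha>: "0 \<le> \<alpha>" "\<alpha> \<le> 1/2" using that t12 by (auto simp: \<alpha>_def tm_def field_simps)
    have t: "t = t2 - \<alpha> * (t2 - t1)" using t12 by (simp add: \<alpha>_def)
    have "(1 - \<alpha> - s) *\<^sub>R (x0 + t2 *\<^sub>R u) + \<alpha> *\<^sub>R (x0 + t1 *\<^sub>R u) + s *\<^sub>R z \<in> K"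
      using hull[of \<alpha> s "x0 + t2 *\<^sub>R u" "x0 + t1 *\<^sub>R u"] \<alpha> that
      by (simp add: K insert_commute)
    also have "(1 - \<alpha> - s) *\<^sub>R (x0 + t2 *\<^sub>R u) + \<alpha> *\<^sub>R (x0 + t1 *\<^sub>R u) + s *\<^sub>R z =
       x0 + t *\<^sub>R u + s *\<^sub>R (z - (x0 + t2 *\<^sub>R u))"
      unfolding t by (simp add: algebra_simps)
    finally show ?thesis .
  qed
  let ?I = "\<lambda>A. \<integral>\<^sup>+t. ennreal ((f (x0 + t *\<^sub>R u))\<^sup>2) * indicator A t \<partial>lborel"
  let ?c = "ennreal \<bar>cross2 u (z - x0)\<bar>" let ?J = "\<integral>\<^sup>+x. ennreal ((f x)\<^sup>2) * indicator K x \<partial>lborel"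
  have 1: "?c * ?I {t1..tm} \<le> ennreal C * ?J"
    using poly_on_lines_trace[OF C f clK _ sub1] cr by (simp add: cr')
  have 2: "?c * ?I {tm..t2} \<le> ennreal C * ?J"
    using poly_on_lines_trace[OF C f clK _ sub2] cr by (simp add: cr')
  have "?I {t1..t2} \<le> ?I {t1..tm} + ?I {tm..t2}"
    by (subst nn_integral_add[symmetric]) (auto intro!: nn_integral_mono simp: indicator_def)
  then have "?c * ?I {t1..t2} \<le> ?c * ?I {t1..tm} + ?c * ?I {tm..t2}"
    unfolding distrib_left[symmetric] by (rule mult_left_mono) simp
  also have "\<dots> \<le> ennreal C * ?J + ennreal C * ?J" by (rule add_mono[OF 1 2])
  also have "\<dots> = ennreal (2 * C) * ?J"
  proof -
    have "ennreal (2 * C) = 2 * ennreal C" by (subst ennreal_mult') auto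
    then show ?thesis by (simp only: mult_2 distrib_right)
  qed
  finally show ?thesis .
qed

text \<open>Base times height: \<open>n\<close> is a unit normal to \<open>u\<close>, so
  \<open>\<bar>n \<bullet> w\<bar>\<close> is the height of the parallelogram over
  \<open>u\<close>.\<close>

lemma cross2_normal:
  assumes "norm n = 1" "n \<bullet> u = 0"
  shows "\<bar>cross2 u w\<bar> = norm u * \<bar>n \<bullet> w\<bar>"
proof -
  have n: "n $ 1 * n $ 1 + n $ 2 * n $ 2 = 1" and o: "n $ 1 * u $ 1 + n $ 2 * u $ 2 = 0"
    using assms by (auto simp: norm_eq_1 inner_vec_def sum_2)
  have "(cross2 u w)\<^sup>2 = (u \<bullet> u) * (n \<bullet> w)\<^sup>2"
    using n o unfolding cross2_def inner_vec_def sum_2 inner_real_def power2_eq_square by algebra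
  also have "\<dots> = (norm u * \<bar>n \<bullet> w\<bar>)\<^sup>2"
    by (simp add: power_mult_distrib dot_square_norm)
  finally have "\<bar>cross2 u w\<bar>\<^sup>2 = (norm u * \<bar>n \<bullet> w\<bar>)\<^sup>2" by simp
  then show ?thesis by (rule power2_eq_imp_eq) auto
qed

section \<open>One-sided gradients of piecewise polynomials\<close>

lemma has_derivative_within_convex_unique:
  fixes f :: "'a::euclidean_space \<Rightarrow> 'b::real_normed_vector"
  assumes D: "(f has_derivative F) (at x within S)" "(f has_derivative G) (at x within S)"
    and S: "convex S" "x \<in> S" "interior S \<noteq> {}"
  shows "F = G"
proof -
  interpret F: bounded_linear F using D(1) by (rule has_derivative_bounded_linear)
  interpret G: bounded_linear G using D(2) by (rule has_derivative_bounded_linear)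
  have eq: "F (y - x) = G (y - x)" if y: "y \<in> S" for y
  proof -
    let ?l = "\<lambda>t::real. x + t *\<^sub>R (y - x)"
    have sub: "?l ` {0..1} \<subseteq> S"
    proof safe
      fix t :: real assume "t \<in> {0..1}"
      then have "(1 - t) *\<^sub>R x + t *\<^sub>R y \<in> S" using S y by (intro convexD_alt) auto
      then show "?l t \<in> S" by (simp add: algebra_simps)
    qed
    have l: "(?l has_derivative (\<lambda>t. t *\<^sub>R (y - x))) (at 0 within {0..1})"
      by (auto intro!: derivative_eq_intros)
    have "((f \<circ> ?l) has_derivative (F \<circ> (\<lambda>t. t *\<^sub>R (y - x)))) (at 0 within {0..1})"
      by (rule diff_chain_within[OF l]) (use has_derivative_subset[OF D(1) sub] in simp)
    then have v1: "((f \<circ> ?l) has_vector_derivative F (y - x)) (at 0 within {0..1})"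
      by (simp add: has_vector_derivative_def o_def F.scaleR)
    have "((f \<circ> ?l) has_derivative (G \<circ> (\<lambda>t. t *\<^sub>R (y - x)))) (at 0 within {0..1})"
      by (rule diff_chain_within[OF l]) (use has_derivative_subset[OF D(2) sub] in simp)
    then have v2: "((f \<circ> ?l) has_vector_derivative G (y - x)) (at 0 within {0..1})"
      by (simp add: has_vector_derivative_def o_def G.scaleR)
    show ?thesis
      by (rule vector_derivative_unique_within[OF _ v1 v2])
        (simp add: trivial_limit_within islimpt_Icc)
  qed
  \<comment> \<open>Every direction is, up to a factor, the difference of two points of a ball in
    \<open>S\<close>, so agreement on all \<open>y - x\<close> with \<open>y\<close> in
    \<open>S\<close> is enough.\<close>
  obtain c e where e: "e > 0" "ball c e \<subseteq> S"
    using S(3) mem_interior by blast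
  show "F = G"
  proof
    fix h
    show "F h = G h"
    proof (cases "h = 0")
      case True
      then show ?thesis by (simp add: F.zero G.zero)
    next
      case False
      define r where "r = e / (2 * norm h)"
      have r: "r > 0" using e False by (simp add: r_def)
      have "c \<in> S" "c + r *\<^sub>R h \<in> S"
        using e False by (auto simp: dist_norm r_def intro!: subsetD[OF e(2)])
      then have "F (c + r *\<^sub>R h - x) - F (c - x) = G (c + r *\<^sub>R h - x) - G (c - x)" by (simp add: eq)
      then have "F (r *\<^sub>R h) = G (r *\<^sub>R h)" by (simp add: F.diff[symmetric] G.diff[symmetric])
      then show ?thesis using r by (simp add: F.scaleR G.scaleR)
    qed
  qed
qed

text \<open>\<open>grad_on\<close> goes through a chosen derivative. At boundary points of
  \<open>S\<close> only uniqueness relative to a convex set with interior identifies it.\<close>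

lemma grad_on_eqI:
  assumes D: "(w has_derivative (\<lambda>h. G \<bullet> h)) (at x within S)"
    and S: "convex S" "x \<in> S" "interior S \<noteq> {}"
  shows "grad_on S w x = G"
proof -
  have "w differentiable (at x within S)" using D by (auto simp: differentiable_def)
  then have "(w has_derivative frechet_derivative w (at x within S)) (at x within S)"
    by (simp add: frechet_derivative_works[symmetric])
  from has_derivative_within_convex_unique[OF this D S]
  show ?thesis by (simp add: grad_on_def vec_eq_iff inner_axis)
qed

lemma polys_gradient:
  assumes "p \<in> polys k"
  shows "(p has_derivative (\<lambda>h. grad_on UNIV p x \<bullet> h)) (at x)"
    and "continuous_on UNIV (grad_on UNIV p)"
    and "poly_on_lines k (\<lambda>x. grad_on UNIV p x $ i)"
proof -
  obtain c :: "nat \<Rightarrow> nat \<Rightarrow> real" where p: "\<And>x. p x = (\<Sum>i\<le>k. \<Sum>j\<le>k - i. c i j * (x $ 1) ^ i * (x $ 2) ^ j)"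
    using assms by (auto simp: polys_def)
  \<comment> \<open>At exponent 0 the truncated subtraction is harmless, because its factor
    \<open>real i\<close> or \<open>real j\<close> is 0.\<close>
  define G :: "pt \<Rightarrow> pt" where "G x = vector
    [\<Sum>i\<le>k. \<Sum>j\<le>k - i. c i j * (real i * (x $ 1) ^ (i - 1)) * (x $ 2) ^ j,
     \<Sum>i\<le>k. \<Sum>j\<le>k - i. c i j * (x $ 1) ^ i * (real j * (x $ 2) ^ (j - 1))]" for x
  have D: "(p has_derivative (\<lambda>h. G x \<bullet> h)) (at x)" for x
    unfolding p[abs_def]
    by (rule derivative_eq_intros refl has_derivative_sum bounded_linear.has_derivative[OF bounded_linear_vec_nth])+
      (auto simp: G_def inner_vec_def sum_2 sum_distrib_right sum_distrib_left sum.distrib[symmetric] algebra_simps fun_eq_iff intro!: sum.cong)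
  have G: "grad_on UNIV p x = G x" for x
    by (rule grad_on_eqI) (use D in auto)
  show "(p has_derivative (\<lambda>h. grad_on UNIV p x \<bullet> h)) (at x)" using D by (simp add: G)
  have c12: "continuous_on UNIV (\<lambda>x. G x $ 1)" "continuous_on UNIV (\<lambda>x. G x $ 2)"
    unfolding G_def vector_2 by (intro continuous_intros)+
  have "G = (\<lambda>x. \<chi> i. G x $ i)" by simp
  moreover have "continuous_on UNIV (\<lambda>x. \<chi> i. G x $ i)"
  proof (rule continuous_on_vec_lambda)
    fix i :: 2
    show "continuous_on UNIV (\<lambda>x. G x $ i)" using exhaust_2[of i] c12 by (elim disjE) simp_all
  qed
  ultimately show "continuous_on UNIV (grad_on UNIV p)" unfolding G[abs_def] by simp
  show "poly_on_lines k (\<lambda>x. grad_on UNIV p x $ i)"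
    unfolding poly_on_lines_def G
  proof (intro allI)
    fix x \<nu> :: pt
    define q1 q2 where "q1 = (\<Sum>i\<le>k. \<Sum>j\<le>k - i. smult (c i j * real i) ([:x $ 1, \<nu> $ 1:] ^ (i - 1) * [:x $ 2, \<nu> $ 2:] ^ j))"
      and "q2 = (\<Sum>i\<le>k. \<Sum>j\<le>k - i. smult (c i j * real j) ([:x $ 1, \<nu> $ 1:] ^ i * [:x $ 2, \<nu> $ 2:] ^ (j - 1)))"
    have pw: "degree ([:r, s:] ^ n) \<le> n" for r s :: real and n
      by (rule order_trans[OF degree_power_le]) simp
    have dd: "degree (smult d ([:x $ 1, \<nu> $ 1:] ^ i * [:x $ 2, \<nu> $ 2:] ^ j)) \<le> k" if "i + j \<le> k" for d i j
      using degree_smult_le[of d "[:x $ 1, \<nu> $ 1:] ^ i * [:x $ 2, \<nu> $ 2:] ^ j"]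
        degree_mult_le[of "[:x $ 1, \<nu> $ 1:] ^ i" "[:x $ 2, \<nu> $ 2:] ^ j"]
        pw[of "x $ 1" "\<nu> $ 1" i] pw[of "x $ 2" "\<nu> $ 2" j] that by linarith
    have "degree q1 \<le> k" "degree q2 \<le> k"
      unfolding q1_def q2_def by (rule degree_sum_le, simp, rule degree_sum_le, simp, rule dd, simp)+
    moreover have "G (x + t *\<^sub>R \<nu>) $ 1 = poly q1 t" "G (x + t *\<^sub>R \<nu>) $ 2 = poly q2 t" for t
      by (simp_all add: G_def q1_def q2_def poly_sum mult.assoc mult.left_commute[of "real _"])
    ultimately show "\<exists>q. degree q \<le> k \<and> (\<forall>t. G (x + t *\<^sub>R \<nu>) $ i = poly q t)"
      using exhaust_2[of i] by (elim disjE) (simp_all, blast+)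
  qed
qed

lemma grad_on_piece:
  assumes S: "convex S" "x \<in> S" "interior S \<noteq> {}" and e: "e > 0" "S \<inter> ball x e \<subseteq> K"
    and p: "p \<in> polys k" "\<And>y. y \<in> K \<Longrightarrow> w y = p y"
  shows "grad_on S w x = grad_on UNIV p x"
    and "(w has_derivative (\<lambda>h. grad_on UNIV p x \<bullet> h)) (at x within S)"
proof -
  have "(p has_derivative (\<lambda>h. grad_on UNIV p x \<bullet> h)) (at x within S)"
    by (rule has_derivative_at_withinI[OF polys_gradient(1)[OF p(1)]])
  then show D: "(w has_derivative (\<lambda>h. grad_on UNIV p x \<bullet> h)) (at x within S)"
    by (rule has_derivative_transform_within[OF _ e(1) S(2)])
      (use e(2) p(2) in \<open>auto simp: dist_commute subset_iff\<close>)
  show "grad_on S w x = grad_on UNIV p x"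
    by (rule grad_on_eqI[OF D S])
qed

section \<open>Triangulations and nodal interpolation\<close>

text \<open>The inradius is a supremum, approached but not known to be attained, hence the factor 2;
  \<open>max 1\<close> keeps the radius positive whatever constants are given.\<close>

lemma has_ball_pos_inradius:
  assumes "convex hull C = K" "finite C" "interior K \<noteq> {}" "diameter K / inradius K \<le> c" "h \<le> c' * diameter K" "h > 0"
  shows "\<exists>p. cball p (h / (2 * max 1 c * max 1 c')) \<subseteq> K"
proof -
  let ?R = "{r. 0 < r \<and> (\<exists>p. cball p r \<subseteq> K)}"
  have "compact K" using assms finite_imp_compact_convex_hull by blast
  then have bK: "bounded K" by (rule compact_imp_bounded)
  have bdd: "bdd_above ?R"
  proof (rule bdd_aboveI)
    fix r assume "r \<in> ?R"
    then obtain p where "0 < r" "cball p r \<subseteq> K" by auto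
    then have "diameter (cball p r) \<le> diameter K" using bK by (intro diameter_subset)
    then show "r \<le> diameter K" using \<open>0 < r\<close> by (simp add: diameter_cball)
  qed
  obtain p r where pr: "r > 0" "cball p r \<subseteq> K" using assms(3) by (meson ex_in_conv mem_interior_cball)
  then have "r \<in> ?R" by auto
  then have "r \<le> inradius K" unfolding inradius_def by (rule cSup_upper[OF _ bdd])
  then have ir: "inradius K > 0" using pr by linarith
  have "diameter K \<ge> 0" using bK by (rule diameter_ge_0)
  have "diameter K \<le> c * inradius K" using assms(4) ir by (simp add: field_simps)
  also have "\<dots> \<le> max 1 c * inradius K" using ir by (intro mult_right_mono) auto
  finally have dK: "diameter K \<le> max 1 c * inradius K" .
  have "h \<le> max 1 c' * diameter K" using assms(5) \<open>diameter K \<ge> 0\<close>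
    by (meson max.cobounded2 mult_right_mono order_trans)
  also have "\<dots> \<le> max 1 c' * (max 1 c * inradius K)" using dK by (intro mult_left_mono) auto
  finally have "h / (2 * max 1 c * max 1 c') \<le> inradius K / 2"
    by (simp add: field_simps)
  also have "\<dots> < inradius K" using ir by simp
  finally have "h / (2 * max 1 c * max 1 c') < Sup ?R" by (simp add: inradius_def)
  then obtain r' where r': "r' \<in> ?R" "h / (2 * max 1 c * max 1 c') < r'"
    using less_cSup_iff[OF _ bdd] \<open>r \<in> ?R\<close> by blast
  then obtain p' where "cball p' r' \<subseteq> K" by auto
  then show ?thesis using r'(2) subset_cball[of _ r' p'] by (meson less_imp_le order_trans)
qed

definition verts :: "pt set \<Rightarrow> pt set" where
  "verts K = {v. v extreme_point_of K}"

text \<open>From here on shape regularity and quasi-uniformity act only through the two lengths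
  \<rho> and \<open>h\<close>, which are proportional in the application.\<close>

locale mesh_interface = domain_interface \<Omega> a b n
  for \<Omega> :: "pt set" and a b n :: pt +
  fixes \<T> :: "pt set set" and \<rho> h :: real
  assumes mesh: "fitted_mesh \<Omega> \<T>"
    and \<rho>_pos: "\<rho> > 0"
    and inball: "\<And>K. K \<in> \<T> \<Longrightarrow> \<exists>p. cball p \<rho> \<subseteq> K"
    and diam: "\<And>K. K \<in> \<T> \<Longrightarrow> diameter K \<le> h"
begin

lemma finite_mesh: "finite \<T>" and mesh_union: "\<Union>\<T> = closure \<Omega>"
  using mesh by (auto simp: fitted_mesh_def triangulation_def)

lemma mesh_face: "K \<in> \<T> \<Longrightarrow> K' \<in> \<T> \<Longrightarrow> (K \<inter> K') face_of K"
  using mesh by (auto simp: fitted_mesh_def triangulation_def)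

lemma verts_props:
  assumes "K \<in> \<T>"
  shows "finite (verts K)" "card (verts K) = 3" "\<not> affine_dependent (verts K)" "convex hull (verts K) = K"
proof -
  have "2 simplex K" using mesh assms by (auto simp: fitted_mesh_def)
  then obtain C where C: "finite C" "\<not> affine_dependent C" "int (card C) = 2 + 1" "K = convex hull C"
    unfolding simplex by blast
  have "verts K = C" unfolding verts_def C(4)
    using extreme_point_of_convex_hull_affine_independent[OF C(2)] by auto
  then show "finite (verts K)" "card (verts K) = 3" "\<not> affine_dependent (verts K)" "convex hull (verts K) = K"
    using C by auto
qed

lemma mesh_compact: "K \<in> \<T> \<Longrightarrow> compact K"
  using verts_props[of K] finite_imp_compact_convex_hull by metis

lemma mesh_convex: "K \<in> \<T> \<Longrightarrow> convex K"
  using verts_props(4)[of K] convex_convex_hull by metis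

lemma mesh_interior: "K \<in> \<T> \<Longrightarrow> interior K \<noteq> {}"
  using inball[of K] \<rho>_pos by (metis ball_subset_cball centre_in_ball empty_iff mem_interior subset_trans)

lemma verts_subset: "K \<in> \<T> \<Longrightarrow> verts K \<subseteq> K"
  using verts_props(4)[of K] hull_subset by metis

lemma mesh_subset: "K \<in> \<T> \<Longrightarrow> K \<subseteq> closure \<Omega>"
  using mesh_union by blast

lemma mesh_interior_subset: "K \<in> \<T> \<Longrightarrow> interior K \<subseteq> \<Omega>"
  using interior_mono[OF mesh_subset, of K] domain by (simp add: convex_interior_closure interior_open)

lemma mesh_dist: "K \<in> \<T> \<Longrightarrow> x \<in> K \<Longrightarrow> y \<in> K \<Longrightarrow> dist x y \<le> h"
  using diameter_bounded_bound[OF compact_imp_bounded[OF mesh_compact], of K x y] diam[of K] by linarith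

text \<open>A face that meets the interior of a triangle is the whole triangle.\<close>

lemma interiors_disjoint:
  assumes "K \<in> \<T>" "K' \<in> \<T>" "y \<in> interior K" "y \<in> interior K'"
  shows "K = K'"
proof -
  have "K \<inter> K' = K" if "K \<in> \<T>" "K' \<in> \<T>" "y \<in> interior K" "y \<in> interior K'" for K K'
    using face_of_disjoint_interior[OF mesh_face[OF that(1,2)]] that interior_subset by blast
  from this[OF assms] this[OF assms(2,1,4,3)] show ?thesis by blast
qed

lemma negligible_off_interiors: "negligible (closure \<Omega> - (\<Union>K\<in>\<T>. interior K))"
proof (rule negligible_subset)
  show "negligible (\<Union>K\<in>\<T>. frontier K)"
    using finite_mesh by (intro negligible_Union) (auto intro: negligible_convex_frontier mesh_convex)
  show "closure \<Omega> - (\<Union>K\<in>\<T>. interior K) \<subseteq> (\<Union>K\<in>\<T>. frontier K)"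
  proof
    fix x assume x: "x \<in> closure \<Omega> - (\<Union>K\<in>\<T>. interior K)"
    then obtain K where "K \<in> \<T>" "x \<in> K" using mesh_union by blast
    then show "x \<in> (\<Union>K\<in>\<T>. frontier K)" using x closure_subset[of K] by (auto simp: frontier_def)
  qed
qed

text \<open>A ball in the triangle rules out collinear vertices: otherwise all of \<open>K\<close>
  would lie on one line.\<close>

lemma three_vertices:
  assumes K: "K \<in> \<T>" and p: "p \<in> verts K"
  obtains q z where "verts K = {p, q, z}" "p \<noteq> q" "p \<noteq> z" "q \<noteq> z" "cross2 (q - p) (z - p) \<noteq> 0"
proof -
  obtain q z where v: "verts K = {p, q, z}" "p \<noteq> q" "p \<noteq> z" "q \<noteq> z"
  proof -
    have "card (verts K - {p}) = 2" using verts_props[OF K] p by simp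
    then obtain q z where "verts K - {p} = {q, z}" "q \<noteq> z" by (auto simp: card_2_iff)
    then show thesis using p by (intro that[of q z]) auto
  qed
  have "cross2 (q - p) (z - p) \<noteq> 0"
  proof
    assume c: "cross2 (q - p) (z - p) = 0"
    obtain x where x: "x \<in> interior K" "cross2 (q - p) (x - p) \<noteq> 0"
      using exists_off_line[of "interior K" "q - p" p] mesh_interior[OF K] v by auto
    then have "x \<in> convex hull {p, q, z}" using interior_subset[of K] verts_props(4)[OF K, unfolded v(1)] by blast
    then obtain u w t where "u + w + t = 1" "x = u *\<^sub>R p + w *\<^sub>R q + t *\<^sub>R z" by (auto simp: convex_hull_3)
    then have u: "u = 1 - w - t" and xx: "x = u *\<^sub>R p + w *\<^sub>R q + t *\<^sub>R z" by auto
    have "cross2 (q - p) (x - p) = t * cross2 (q - p) (z - p)"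
      unfolding xx u cross2_def by (simp add: algebra_simps)
    then show False using c x by simp
  qed
  then show thesis using v that by blast
qed

definition affine_interp :: "pt set \<Rightarrow> (pt \<Rightarrow> real) \<Rightarrow> pt \<times> real" where
  "affine_interp K \<alpha> = (SOME gc. \<forall>v\<in>verts K. fst gc \<bullet> v + snd gc = \<alpha> v)"

lemma affine_interp:
  assumes "K \<in> \<T>" "v \<in> verts K"
  shows "fst (affine_interp K \<alpha>) \<bullet> v + snd (affine_interp K \<alpha>) = \<alpha> v"
proof -
  obtain p where "p \<in> verts K" using assms by auto
  then obtain q z where v: "verts K = {p, q, z}" "cross2 (q - p) (z - p) \<noteq> 0"
    using three_vertices[OF assms(1)] by metis
  from cross2_dual_basis[OF v(2)] obtain \<sigma> \<tau> where d: "(q - p) \<bullet> \<sigma> = 1" "(q - p) \<bullet> \<tau> = 0"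
     "(z - p) \<bullet> \<sigma> = 0" "(z - p) \<bullet> \<tau> = 1" by blast
  define g where "g = (\<alpha> q - \<alpha> p) *\<^sub>R \<sigma> + (\<alpha> z - \<alpha> p) *\<^sub>R \<tau>"
  have "g \<bullet> (q - p) = \<alpha> q - \<alpha> p" "g \<bullet> (z - p) = \<alpha> z - \<alpha> p"
    using d by (simp_all add: g_def inner_add_left inner_commute[of \<sigma>] inner_commute[of \<tau>])
  then have "\<forall>v\<in>verts K. fst (g, \<alpha> p - g \<bullet> p) \<bullet> v + snd (g, \<alpha> p - g \<bullet> p) = \<alpha> v"
    by (auto simp: v(1) inner_diff_right)
  then have "\<forall>v\<in>verts K. fst (affine_interp K \<alpha>) \<bullet> v + snd (affine_interp K \<alpha>) = \<alpha> v"
    unfolding affine_interp_def by (rule someI)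
  then show ?thesis using assms by blast
qed

definition interp_grad :: "(pt \<Rightarrow> real) \<Rightarrow> pt set \<Rightarrow> pt" where
  "interp_grad \<alpha> K = fst (affine_interp K \<alpha>)"

definition interp_aff :: "(pt \<Rightarrow> real) \<Rightarrow> pt set \<Rightarrow> pt \<Rightarrow> real" where
  "interp_aff \<alpha> K x = fst (affine_interp K \<alpha>) \<bullet> x + snd (affine_interp K \<alpha>)"

text \<open>The chosen triangle is immaterial because neighbours agree on common faces; the
  extension by zero matches the convention of \<open>FE_space\<close>.\<close>

definition interp :: "(pt \<Rightarrow> real) \<Rightarrow> pt \<Rightarrow> real" where
  "interp \<alpha> x = (if x \<in> closure \<Omega> then interp_aff \<alpha> (SOME K. K \<in> \<T> \<and> x \<in> K) x else 0)"

lemma interp_aff_vert: "K \<in> \<T> \<Longrightarrow> v \<in> verts K \<Longrightarrow> interp_aff \<alpha> K v = \<alpha> v"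
  by (simp add: interp_aff_def affine_interp)

lemma interp_aff_diff: "interp_aff \<alpha> K x - interp_aff \<alpha> K y = interp_grad \<alpha> K \<bullet> (x - y)"
  by (simp add: interp_aff_def interp_grad_def inner_diff_right)

text \<open>Two triangles meet in a common face, the hull of its extreme points. These are vertices
  of both triangles, and the set where two affine functions agree is convex.\<close>

lemma interp_aff_consistent:
  assumes "K \<in> \<T>" "K' \<in> \<T>" "x \<in> K" "x \<in> K'"
  shows "interp_aff \<alpha> K x = interp_aff \<alpha> K' x"
proof -
  define F where "F = K \<inter> K'"
  have fK: "F face_of K" and fK': "F face_of K'"
    using mesh_face[OF assms(1,2)] mesh_face[OF assms(2,1)] by (auto simp: F_def Int_commute)
  have F: "compact F" "convex F" unfolding F_def
    using assms mesh_compact mesh_convex by (auto intro: compact_Int convex_Int)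
  define V where "V = {v. v extreme_point_of F}"
  have "F = convex hull V" unfolding V_def by (rule Krein_Milman_Minkowski[OF F])
  moreover have "V \<subseteq> verts K" "V \<subseteq> verts K'"
    using extreme_point_of_face[OF fK] extreme_point_of_face[OF fK'] by (auto simp: V_def verts_def)
  then have "V \<subseteq> {y. interp_aff \<alpha> K y - interp_aff \<alpha> K' y = 0}"
    using assms by (auto simp: interp_aff_vert subset_iff)
  moreover have "convex {y. interp_aff \<alpha> K y - interp_aff \<alpha> K' y = 0}"
  proof -
    have "{y. interp_aff \<alpha> K y - interp_aff \<alpha> K' y = 0} =
      {y. (interp_grad \<alpha> K - interp_grad \<alpha> K') \<bullet> y = snd (affine_interp K' \<alpha>) - snd (affine_interp K \<alpha>)}"
      by (auto simp: interp_aff_def interp_grad_def inner_diff_left)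
    then show ?thesis by (simp add: convex_hyperplane)
  qed
  ultimately have "F \<subseteq> {y. interp_aff \<alpha> K y - interp_aff \<alpha> K' y = 0}" by (metis hull_minimal)
  then show ?thesis using assms by (auto simp: F_def)
qed

lemma interp_eq: "K \<in> \<T> \<Longrightarrow> x \<in> K \<Longrightarrow> interp \<alpha> x = interp_aff \<alpha> K x"
proof -
  assume K: "K \<in> \<T>" "x \<in> K"
  define K' where "K' = (SOME K. K \<in> \<T> \<and> x \<in> K)"
  have "K' \<in> \<T> \<and> x \<in> K'"
    unfolding K'_def using K by (intro someI[of "\<lambda>K. K \<in> \<T> \<and> x \<in> K"]) auto
  then have "interp_aff \<alpha> K' x = interp_aff \<alpha> K x"
    using K by (intro interp_aff_consistent) auto
  moreover have "x \<in> closure \<Omega>" using mesh_subset K by blast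
  ultimately show ?thesis by (simp add: interp_def K'_def)
qed

lemma interp_outside: "x \<notin> closure \<Omega> \<Longrightarrow> interp \<alpha> x = 0"
  by (simp add: interp_def)

lemma interp_aff_polys: "k \<ge> 1 \<Longrightarrow> interp_aff \<alpha> K \<in> polys k"
proof -
  assume k: "k \<ge> 1"
  define g where "g = fst (affine_interp K \<alpha>)"
  define c :: "nat \<Rightarrow> nat \<Rightarrow> real" where
    "c i j = (if i = 0 \<and> j = 0 then snd (affine_interp K \<alpha>) else if i = 1 \<and> j = 0 then g $ 1 else if i = 0 \<and> j = 1 then g $ 2 else 0)" for i j
  have "interp_aff \<alpha> K x = (\<Sum>i\<le>k. \<Sum>j\<le>k - i. c i j * (x $ 1) ^ i * (x $ 2) ^ j)" for x
  proof -
    have "(\<Sum>i\<le>k. \<Sum>j\<le>k - i. c i j * (x $ 1) ^ i * (x $ 2) ^ j) =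
       (\<Sum>i\<in>{0,1}. \<Sum>j\<le>k - i. c i j * (x $ 1) ^ i * (x $ 2) ^ j)"
      using k by (intro sum.mono_neutral_right) (auto simp: c_def intro!: sum.neutral)
    also have "\<dots> = (\<Sum>j\<le>k. c 0 j * (x $ 2) ^ j) + (\<Sum>j\<le>k - 1. c 1 j * (x $ 1) * (x $ 2) ^ j)"
      by simp
    also have "(\<Sum>j\<le>k. c 0 j * (x $ 2) ^ j) = (\<Sum>j\<in>{0,1}. c 0 j * (x $ 2) ^ j)"
      using k by (intro sum.mono_neutral_right) (auto simp: c_def)
    also have "(\<Sum>j\<le>k - 1. c 1 j * (x $ 1) * (x $ 2) ^ j) = (\<Sum>j\<in>{0}. c 1 j * (x $ 1) * (x $ 2) ^ j)"
      using k by (intro sum.mono_neutral_right) (auto simp: c_def)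
    finally show ?thesis by (simp add: c_def interp_aff_def g_def inner_vec_def sum_2)
  qed
  then show ?thesis by (auto simp: polys_def)
qed

text \<open>Along the diameter of the inscribed ball in the gradient direction the affine function
  grows by 2 \<rho> times the norm of its gradient, while on \<open>K\<close> it stays between the
  bounds of its vertex values.\<close>

lemma interp_grad_norm:
  assumes K: "K \<in> \<T>" and osc: "\<And>v. v \<in> verts K \<Longrightarrow> m \<le> \<alpha> v \<and> \<alpha> v \<le> M"
  shows "norm (interp_grad \<alpha> K) \<le> (M - m) / (2 * \<rho>)"
proof -
  obtain p where p: "cball p \<rho> \<subseteq> K" using inball[OF K] by blast
  have rng: "m \<le> interp_aff \<alpha> K x \<and> interp_aff \<alpha> K x \<le> M" if "x \<in> K" for x
  proof -
    let ?c = "snd (affine_interp K \<alpha>)"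
    have "verts K \<subseteq> {y. interp_grad \<alpha> K \<bullet> y \<ge> m - ?c} \<inter> {y. interp_grad \<alpha> K \<bullet> y \<le> M - ?c}"
      using osc affine_interp[OF K, of _ \<alpha>] by (auto simp: interp_grad_def algebra_simps)
    then have "convex hull verts K \<subseteq> {y. interp_grad \<alpha> K \<bullet> y \<ge> m - ?c} \<inter> {y. interp_grad \<alpha> K \<bullet> y \<le> M - ?c}"
      by (intro hull_minimal convex_Int convex_halfspace_ge convex_halfspace_le)
    then show ?thesis using that verts_props(4)[OF K] by (auto simp: interp_aff_def interp_grad_def algebra_simps)
  qed
  show ?thesis
  proof (cases "interp_grad \<alpha> K = 0")
    case True
    have "p \<in> K" using p \<rho>_pos by auto
    then have "m \<le> M" using rng by force
    then show ?thesis using True \<rho>_pos by simp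
  next
    case False
    define e where "e = interp_grad \<alpha> K /\<^sub>R norm (interp_grad \<alpha> K)"
    have e: "norm e = 1" using False by (simp add: e_def)
    have "p + \<rho> *\<^sub>R e \<in> K" "p - \<rho> *\<^sub>R e \<in> K"
      using p e \<rho>_pos by (auto simp: dist_norm intro!: subsetD[OF p])
    then have "interp_aff \<alpha> K (p + \<rho> *\<^sub>R e) - interp_aff \<alpha> K (p - \<rho> *\<^sub>R e) \<le> M - m"
      using rng by (meson diff_mono)
    moreover have "interp_aff \<alpha> K (p + \<rho> *\<^sub>R e) - interp_aff \<alpha> K (p - \<rho> *\<^sub>R e) = 2 * \<rho> * norm (interp_grad \<alpha> K)"
      unfolding interp_aff_diff using False
      by (simp add: e_def algebra_simps dot_square_norm power2_eq_square flip: scaleR_2)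
    ultimately show ?thesis using \<rho>_pos by (simp add: field_simps)
  qed
qed

text \<open>The nodal function of \<open>p\<close> falls from 1 to 0 between the two vertices with
  slope at most 1/(2 \<rho>).\<close>

lemma verts_dist:
  assumes K: "K \<in> \<T>" and v: "p \<in> verts K" "q \<in> verts K" "p \<noteq> q"
  shows "2 * \<rho> \<le> dist p q"
proof -
  define \<alpha> :: "pt \<Rightarrow> real" where "\<alpha> x = (if x = p then 1 else 0)" for x
  have N: "norm (interp_grad \<alpha> K) \<le> (1 - 0) / (2 * \<rho>)" by (rule interp_grad_norm[OF K]) (auto simp: \<alpha>_def)
  have "1 = interp_aff \<alpha> K p - interp_aff \<alpha> K q" using v K by (simp add: interp_aff_vert \<alpha>_def)
  also have "\<dots> \<le> norm (interp_grad \<alpha> K) * norm (p - q)" unfolding interp_aff_diff by (rule norm_cauchy_schwarz)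
  also have "\<dots> \<le> (1 - 0) / (2 * \<rho>) * norm (p - q)" by (intro mult_right_mono N) auto
  finally show ?thesis using \<rho>_pos by (simp add: dist_norm field_simps)
qed

end

section \<open>Triangles at the interface\<close>

lemma AE_lebesgue_on_negligible:
  assumes "negligible (S - A)" "S \<in> sets lebesgue"
  shows "AE x in lebesgue_on S. x \<in> A"
proof -
  have "AE x in lebesgue. x \<notin> S - A"
    using assms(1) by (intro AE_not_in) (simp add: negligible_iff_null_sets)
  then show ?thesis using assms(2) by (subst AE_restrict_space_iff) auto
qed

lemma cross2_eq_0_imp_parallel:
  assumes "u \<noteq> 0" "cross2 u w = 0"
  shows "\<exists>t. w = t *\<^sub>R u"
proof (cases "u $ 1 = 0")
  case True
  then have "u $ 2 \<noteq> 0" using assms(1) by (auto simp: vec_eq_iff forall_2)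
  then show ?thesis using assms(2) True
    by (intro exI[of _ "w $ 2 / u $ 2"]) (auto simp: vec_eq_iff forall_2 cross2_def)
next
  case False
  then show ?thesis using assms(2)
    by (intro exI[of _ "w $ 1 / u $ 1"]) (auto simp: vec_eq_iff forall_2 cross2_def field_simps)
qed

context mesh_interface
begin

definition ipt :: "real \<Rightarrow> pt" where "ipt t = a + t *\<^sub>R (b - a)"

lemma ipt_diff: "ipt s - ipt t = (s - t) *\<^sub>R (b - a)"
  by (simp add: ipt_def algebra_simps)

lemma dist_ipt: "dist (ipt s) (ipt t) = \<bar>s - t\<bar> * norm (b - a)"
  by (simp add: dist_norm ipt_diff)

lemma ipt_inj: "ipt s = ipt t \<longleftrightarrow> s = t"
  using dist_ipt[of s t] ab by auto

lemma n_ipt: "n \<bullet> (ipt t - a) = 0"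
  using n_orth by (simp add: ipt_def)

lemma ipt_mem: "0 \<le> t \<Longrightarrow> t \<le> 1 \<Longrightarrow> ipt t \<in> closed_segment a b"
  unfolding in_segment ipt_def by (intro exI[of _ t]) (auto simp: algebra_simps)

lemma ipt_closure: "0 \<le> t \<Longrightarrow> t \<le> 1 \<Longrightarrow> ipt t \<in> closure \<Omega>"
  using ipt_mem interface by blast

lemma on_line_ipt: "n \<bullet> (x - a) = 0 \<Longrightarrow> \<exists>t. x = ipt t"
proof -
  assume "n \<bullet> (x - a) = 0"
  then have "cross2 (b - a) (x - a) = 0" using cross2_normal[OF norm_n n_orth, of "x - a"] by simp
  then obtain t where "x - a = t *\<^sub>R (b - a)" using cross2_eq_0_imp_parallel[of "b - a"] ab by auto
  then show ?thesis by (intro exI[of _ t]) (simp add: ipt_def algebra_simps)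
qed

text \<open>A side on the line of the interface rather than on the interface itself:
  \<open>t1\<close> and \<open>t2\<close> may leave [0,1], because the interface need not end at
  mesh nodes.\<close>

definition edge :: "pt set \<Rightarrow> real \<Rightarrow> real \<Rightarrow> pt \<Rightarrow> bool" where
  "edge K t1 t2 z \<longleftrightarrow> t1 < t2 \<and> verts K = {ipt t1, ipt t2, z} \<and> n \<bullet> (z - a) < 0"

lemma edge_mem:
  assumes "K \<in> \<T>" "edge K t1 t2 z"
  shows "ipt t1 \<in> verts K" "ipt t2 \<in> verts K" "z \<in> verts K" "ipt t1 \<in> K" "ipt t2 \<in> K" "z \<in> K" "z \<noteq> ipt s"
proof -
  show v: "ipt t1 \<in> verts K" "ipt t2 \<in> verts K" "z \<in> verts K" using assms(2) by (auto simp: edge_def)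
  then show "ipt t1 \<in> K" "ipt t2 \<in> K" "z \<in> K" using verts_subset[OF assms(1)] by auto
  show "z \<noteq> ipt s" using assms(2) n_ipt[of s] by (auto simp: edge_def)
qed

lemma edge_hull: "K \<in> \<T> \<Longrightarrow> edge K t1 t2 z \<Longrightarrow> K = convex hull {ipt t1, ipt t2, z}"
  using verts_props(4)[of K] by (simp add: edge_def)

text \<open>The apex is the only vertex off the line and the order of the parameters fixes the rest.
  So each triangle contributes at most one parameter interval, which makes these sets
  measurable.\<close>

lemma edge_unique:
  assumes "edge K t1 t2 z" "edge K s1 s2 z'"
  shows "t1 = s1" "t2 = s2" "z = z'"
proof -
  have eq: "{ipt t1, ipt t2, z} = {ipt s1, ipt s2, z'}" using assms by (auto simp: edge_def)
  have nz: "z \<noteq> ipt s" "z' \<noteq> ipt s" for s using assms n_ipt[of s] by (auto simp: edge_def)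
  have "z \<in> {ipt s1, ipt s2, z'}" using eq by blast
  then show "z = z'" using nz by simp
  have "ipt t1 \<in> {ipt s1, ipt s2, z'}" "ipt t2 \<in> {ipt s1, ipt s2, z'}"
    "ipt s1 \<in> {ipt t1, ipt t2, z}" "ipt s2 \<in> {ipt t1, ipt t2, z}" using eq by blast+
  then have "t1 = s1 \<or> t1 = s2" "t2 = s1 \<or> t2 = s2" "s1 = t1 \<or> s1 = t2" "s2 = t1 \<or> s2 = t2"
    using nz[symmetric] by (simp_all add: ipt_inj)
  then show "t1 = s1" "t2 = s2" using assms by (auto simp: edge_def)
qed

lemma edge_length:
  assumes "K \<in> \<T>" "edge K t1 t2 z"
  shows "2 * \<rho> \<le> (t2 - t1) * norm (b - a)" "(t2 - t1) * norm (b - a) \<le> h"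
proof -
  have lt: "t1 < t2" using assms(2) by (simp add: edge_def)
  have d: "dist (ipt t2) (ipt t1) = (t2 - t1) * norm (b - a)" using lt by (simp add: dist_ipt)
  show "2 * \<rho> \<le> (t2 - t1) * norm (b - a)"
    using verts_dist[OF assms(1), of "ipt t2" "ipt t1"] edge_mem[OF assms] lt unfolding d by (simp add: ipt_inj)
  show "(t2 - t1) * norm (b - a) \<le> h"
    using mesh_dist[OF assms(1), of "ipt t2" "ipt t1"] edge_mem[OF assms] unfolding d by simp
qed

lemma mesh_not_in_line: "K \<in> \<T> \<Longrightarrow> \<exists>v\<in>verts K. n \<bullet> (v - a) < 0"
proof (rule ccontr)
  assume K: "K \<in> \<T>" and neg: "\<not> (\<exists>v\<in>verts K. n \<bullet> (v - a) < 0)"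
  have "verts K \<subseteq> {y. n \<bullet> y \<ge> n \<bullet> a}" using neg by (auto simp: inner_diff_right not_less)
  then have sub: "convex hull verts K \<subseteq> {y. n \<bullet> y \<ge> n \<bullet> a}" by (intro hull_minimal convex_halfspace_ge)
  obtain x where x: "x \<in> interior K" using mesh_interior[OF K] by auto
  then have "x \<in> convex hull verts K" using verts_props(4)[OF K] interior_subset by blast
  then have "n \<bullet> x \<ge> n \<bullet> a" using sub by auto
  moreover have "n \<bullet> (x - a) < 0" using n_inside mesh_interior_subset[OF K] x by blast
  ultimately show False by (simp add: inner_diff_right)
qed

text \<open>\<open>K\<close> lies between the interface line and its parallel through
  \<open>z\<close>, and this strip has to hold a ball of radius \<rho>.\<close>

lemma edge_height:
  assumes "K \<in> \<T>" "edge K t1 t2 z"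
  shows "2 * \<rho> \<le> - (n \<bullet> (z - a))" "- (n \<bullet> (z - a)) \<le> h"
proof -
  obtain p where p: "cball p \<rho> \<subseteq> K" using inball[OF assms(1)] by blast
  have mem: "p + \<rho> *\<^sub>R n \<in> K" "p - \<rho> *\<^sub>R n \<in> K"
    using norm_n \<rho>_pos by (auto simp: dist_norm intro!: subsetD[OF p])
  have "n \<bullet> (p + \<rho> *\<^sub>R n - a) \<le> 0" using n_closure mem mesh_subset[OF assms(1)] by blast
  moreover have "n \<bullet> z \<le> n \<bullet> (p - \<rho> *\<^sub>R n)"
  proof -
    have "verts K \<subseteq> {y. n \<bullet> y \<ge> n \<bullet> z}"
      using assms(2) n_ipt[of t1] n_ipt[of t2] by (auto simp: edge_def inner_diff_right)
    then have "convex hull verts K \<subseteq> {y. n \<bullet> y \<ge> n \<bullet> z}" by (intro hull_minimal convex_halfspace_ge)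
    then show ?thesis using mem verts_props(4)[OF assms(1)] by auto
  qed
  moreover have "n \<bullet> n = 1" using norm_n by (simp add: norm_eq_1)
  ultimately show "2 * \<rho> \<le> - (n \<bullet> (z - a))"
    by (simp add: inner_diff_right inner_add_right)
  have "- (n \<bullet> (z - a)) = n \<bullet> (ipt t1 - z)" using n_ipt[of t1] by (simp add: inner_diff_right)
  also have "\<dots> \<le> norm n * norm (ipt t1 - z)" by (rule norm_cauchy_schwarz)
  also have "\<dots> \<le> h" using norm_n mesh_dist[OF assms(1), of "ipt t1" z] edge_mem[OF assms] by (simp add: dist_norm)
  finally show "- (n \<bullet> (z - a)) \<le> h" .
qed

definition node_params :: "real set" where
  "node_params = {t. \<exists>K\<in>\<T>. ipt t \<in> verts K}"

lemma finite_node_params: "finite node_params"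
proof (rule finite_imageD)
  have "ipt ` node_params \<subseteq> (\<Union>K\<in>\<T>. verts K)" by (auto simp: node_params_def)
  then show "finite (ipt ` node_params)"
    by (rule finite_subset) (use finite_mesh verts_props(1) in auto)
  show "inj_on ipt node_params" by (auto simp: inj_on_def ipt_inj)
qed

text \<open>The interface line supports \<Omega>, so a point on it with positive weights at
  \<open>p\<close> and \<open>q\<close> forces both onto the line; the third vertex is then off it
  and has weight 0.\<close>

lemma edge_aux:
  assumes K: "K \<in> \<T>" and v: "verts K = {p, q, z}" "p \<noteq> q"
    and x: "ipt t = \<alpha> *\<^sub>R p + \<beta> *\<^sub>R q + \<delta> *\<^sub>R z" "\<alpha> > 0" "\<beta> > 0" "\<delta> \<ge> 0" "\<alpha> + \<beta> + \<delta> = 1"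
  shows "\<exists>t1 t2 z. edge K t1 t2 z \<and> t1 < t \<and> t < t2"
proof -
  have le: "n \<bullet> (p - a) \<le> 0" "n \<bullet> (q - a) \<le> 0" "n \<bullet> (z - a) \<le> 0"
    using v n_closure verts_subset[OF K] mesh_subset[OF K] by auto
  have "ipt t - a = \<alpha> *\<^sub>R (p - a) + \<beta> *\<^sub>R (q - a) + \<delta> *\<^sub>R (z - a)"
    unfolding x(1) using x(5) by (simp add: algebra_simps flip: scaleR_add_left)
  then have "\<alpha> * (n \<bullet> (p - a)) + \<beta> * (n \<bullet> (q - a)) + \<delta> * (n \<bullet> (z - a)) = 0"
    using n_ipt[of t] by (simp add: inner_add_right)
  moreover have "\<alpha> * (n \<bullet> (p - a)) \<le> 0" "\<beta> * (n \<bullet> (q - a)) \<le> 0" "\<delta> * (n \<bullet> (z - a)) \<le> 0"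
    using le x by (auto simp: mult_nonneg_nonpos)
  ultimately have "\<alpha> * (n \<bullet> (p - a)) = 0" "\<beta> * (n \<bullet> (q - a)) = 0" and \<delta>0: "\<delta> * (n \<bullet> (z - a)) = 0" by linarith+
  then have pq: "n \<bullet> (p - a) = 0" "n \<bullet> (q - a) = 0" using x by auto
  have nz: "n \<bullet> (z - a) < 0" using mesh_not_in_line[OF K] v pq by auto
  then have \<delta>: "\<delta> = 0" using \<delta>0 by auto
  obtain s1 s2 where s: "p = ipt s1" "q = ipt s2" using on_line_ipt pq by blast
  have "s1 \<noteq> s2" using s v(2) by auto
  have al: "\<alpha> = 1 - \<beta>" using x(5) \<delta> by simp
  have "ipt t = ipt (\<alpha> * s1 + \<beta> * s2)" using x(1) \<delta> unfolding s al by (simp add: ipt_def algebra_simps)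
  then have t: "t = \<alpha> * s1 + \<beta> * s2" by (simp add: ipt_inj)
  have t1: "t - s1 = \<beta> * (s2 - s1)" and t2: "s2 - t = \<alpha> * (s2 - s1)" unfolding t al by (simp_all add: algebra_simps)
  show ?thesis
  proof (cases "s1 < s2")
    case True
    then have "t - s1 > 0" "s2 - t > 0" unfolding t1 t2 using x by simp_all
    then show ?thesis using True v s nz by (intro exI[of _ s1] exI[of _ s2] exI[of _ z]) (auto simp: edge_def)
  next
    case False
    then have "s2 < s1" using \<open>s1 \<noteq> s2\<close> by simp
    then have "t - s1 < 0" "s2 - t < 0" unfolding t1 t2 using x by (simp_all add: mult_pos_neg)
    then show ?thesis using \<open>s2 < s1\<close> v s nz by (intro exI[of _ s2] exI[of _ s1] exI[of _ z]) (auto simp: edge_def)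
  qed
qed

text \<open>Off the nodes at least two barycentric coordinates are positive; the three cases differ
  by the naming of the vertices.\<close>

lemma edge_exists:
  assumes K: "K \<in> \<T>" and t: "ipt t \<in> K" "t \<notin> node_params"
  shows "\<exists>t1 t2 z. edge K t1 t2 z \<and> t1 < t \<and> t < t2"
proof -
  obtain p where "p \<in> verts K" using verts_props(2)[OF K] by force
  then obtain q z where v: "verts K = {p, q, z}" "p \<noteq> q" "p \<noteq> z" "q \<noteq> z" using three_vertices[OF K] by metis
  have "ipt t \<in> convex hull {p, q, z}" using t verts_props(4)[OF K] v by simp
  then obtain \<alpha> \<beta> \<delta> where c: "0 \<le> \<alpha>" "0 \<le> \<beta>" "0 \<le> \<delta>" "\<alpha> + \<beta> + \<delta> = 1"
    "ipt t = \<alpha> *\<^sub>R p + \<beta> *\<^sub>R q + \<delta> *\<^sub>R z" unfolding convex_hull_3 by blast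
  have nv: "ipt t \<noteq> p" "ipt t \<noteq> q" "ipt t \<noteq> z" using t(2) K v by (auto simp: node_params_def)
  have "\<not> (\<beta> = 0 \<and> \<delta> = 0)" "\<not> (\<alpha> = 0 \<and> \<delta> = 0)" "\<not> (\<alpha> = 0 \<and> \<beta> = 0)"
    using nv c by auto
  then consider "\<alpha> > 0" "\<beta> > 0" | "\<alpha> > 0" "\<delta> > 0" | "\<beta> > 0" "\<delta> > 0" using c by linarith
  then show ?thesis
  proof cases
    case 1
    then show ?thesis using edge_aux[OF K v(1,2) c(5)] c by simp
  next
    case 2
    have "verts K = {p, z, q}" using v by auto
    moreover have "ipt t = \<alpha> *\<^sub>R p + \<delta> *\<^sub>R z + \<beta> *\<^sub>R q" using c by (simp add: algebra_simps)
    ultimately show ?thesis using edge_aux[OF K _ v(3), of q t \<alpha> \<delta> \<beta>] 2 c by simp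
  next
    case 3
    have "verts K = {q, z, p}" using v by auto
    moreover have "ipt t = \<beta> *\<^sub>R q + \<delta> *\<^sub>R z + \<alpha> *\<^sub>R p" using c by (simp add: algebra_simps)
    ultimately show ?thesis using edge_aux[OF K _ v(4), of p t \<beta> \<delta> \<alpha>] 3 c by simp
  qed
qed

lemma edge_cover:
  assumes "0 \<le> t" "t \<le> 1" "t \<notin> node_params"
  obtains K t1 t2 z where "K \<in> \<T>" "edge K t1 t2 z" "t1 < t" "t < t2"
proof -
  obtain K where "K \<in> \<T>" "ipt t \<in> K" using ipt_closure[OF assms(1,2)] mesh_union by blast
  with edge_exists[OF this assms(3)] show thesis using that by blast
qed

text \<open>\<open>\<Omega>\<close> lies on one side of the interface, so near an inner point of an interface edge
  it coincides with the triangle at that edge.\<close>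

lemma edge_neighbourhood:
  assumes K: "K \<in> \<T>" and e: "edge K t1 t2 z" and t: "t1 < t" "t < t2"
  shows "ipt t \<in> K" "\<exists>r>0. closure \<Omega> \<inter> ball (ipt t) r \<subseteq> K"
proof -
  define P u w where "P = ipt t1" and "u = ipt t2 - ipt t1" and "w = z - ipt t1"
  have nz: "n \<bullet> (z - a) < 0" and lt: "t1 < t2" using e by (auto simp: edge_def)
  have u: "u = (t2 - t1) *\<^sub>R (b - a)" by (simp add: u_def ipt_diff)
  have nu: "n \<bullet> u = 0" using n_orth by (simp add: u)
  have nw: "n \<bullet> w = n \<bullet> (z - a)" using n_ipt[of t1] by (simp add: w_def inner_diff_right)
  have "\<bar>cross2 u w\<bar> = norm u * \<bar>n \<bullet> w\<bar>" by (rule cross2_normal[OF norm_n nu])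
  then have cr: "cross2 u w \<noteq> 0" using nz lt ab nw by (auto simp: u)
  obtain \<sigma> \<tau> where d: "u \<bullet> \<sigma> = 1" "u \<bullet> \<tau> = 0" "w \<bullet> \<sigma> = 0" "w \<bullet> \<tau> = 1"
     "\<And>x. (x \<bullet> \<sigma>) *\<^sub>R u + (x \<bullet> \<tau>) *\<^sub>R w = x"
    using cross2_dual_basis[OF cr] by blast
  define \<sigma>0 where "\<sigma>0 = (t - t1) / (t2 - t1)"
  have \<sigma>0: "0 < \<sigma>0" "\<sigma>0 < 1" using t by (auto simp: \<sigma>0_def)
  have xP: "ipt t - P = \<sigma>0 *\<^sub>R u" using lt by (simp add: P_def ipt_diff u \<sigma>0_def)
  have mem: "y \<in> K" if "0 \<le> (y - P) \<bullet> \<sigma>" "0 \<le> (y - P) \<bullet> \<tau>" "(y - P) \<bullet> \<sigma> + (y - P) \<bullet> \<tau> \<le> 1" for y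
  proof -
    let ?s = "(y - P) \<bullet> \<sigma>" let ?t = "(y - P) \<bullet> \<tau>"
    have "y = P + (?s *\<^sub>R u + ?t *\<^sub>R w)" unfolding d(5) by simp
    also have "\<dots> = (1 - ?s - ?t) *\<^sub>R ipt t1 + ?s *\<^sub>R ipt t2 + ?t *\<^sub>R z"
      unfolding u_def w_def P_def by (simp only: scaleR_diff_right scaleR_diff_left scaleR_one) simp
    finally have y: "y = (1 - ?s - ?t) *\<^sub>R ipt t1 + ?s *\<^sub>R ipt t2 + ?t *\<^sub>R z" .
    have "(1 - ?s - ?t) *\<^sub>R ipt t1 + ?s *\<^sub>R ipt t2 + ?t *\<^sub>R z \<in> convex hull {ipt t1, ipt t2, z}"
      unfolding convex_hull_3 using that
      by (intro CollectI exI[of _ "1 - ?s - ?t"] exI[of _ ?s] exI[of _ ?t]) auto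
    then show ?thesis using y edge_hull[OF K e] by simp
  qed
  show "ipt t \<in> K" by (rule mem) (use xP \<sigma>0 d in auto)
  \<comment> \<open>Within the radius built from \<open>m\<close> the coordinate along the edge
    stays in (0,1) with room for the second coordinate, whose sign comes from the supporting
    line.\<close>
  define m where "m = min \<sigma>0 (1 - \<sigma>0)"
  have m: "m > 0" using \<sigma>0 by (simp add: m_def)
  define r where "r = m / (norm \<sigma> + norm \<tau> + 1)"
  have den: "norm \<sigma> + norm \<tau> + 1 > 0" by (simp add: add_nonneg_pos)
  have r: "r > 0" using m den by (simp add: r_def)
  show "\<exists>r>0. closure \<Omega> \<inter> ball (ipt t) r \<subseteq> K"
  proof (intro exI[of _ r] conjI r subsetI)
    fix y assume y: "y \<in> closure \<Omega> \<inter> ball (ipt t) r"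
    define e where "e = y - ipt t"
    have ne: "norm e < r" using y by (simp add: e_def dist_norm norm_minus_commute)
    have yP: "y - P = e + \<sigma>0 *\<^sub>R u" using xP by (simp add: e_def algebra_simps)
    have s: "(y - P) \<bullet> \<sigma> = \<sigma>0 + e \<bullet> \<sigma>" and tt: "(y - P) \<bullet> \<tau> = e \<bullet> \<tau>"
      unfolding yP using d by (simp_all add: inner_add_left)
    have "\<bar>e \<bullet> \<sigma>\<bar> + \<bar>e \<bullet> \<tau>\<bar> \<le> norm e * norm \<sigma> + norm e * norm \<tau>"
      by (intro add_mono Cauchy_Schwarz_ineq2)
    also have "\<dots> \<le> norm e * (norm \<sigma> + norm \<tau> + 1)" by (simp add: algebra_simps)
    also have "\<dots> < r * (norm \<sigma> + norm \<tau> + 1)" using ne den by (intro mult_strict_right_mono)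
    also have "\<dots> = m" using den by (simp add: r_def)
    finally have small: "\<bar>e \<bullet> \<sigma>\<bar> + \<bar>e \<bullet> \<tau>\<bar> < m" .
    have "n \<bullet> (y - P) = ((y - P) \<bullet> \<tau>) * (n \<bullet> w)"
    proof -
      have "n \<bullet> (y - P) = n \<bullet> (((y - P) \<bullet> \<sigma>) *\<^sub>R u + ((y - P) \<bullet> \<tau>) *\<^sub>R w)" unfolding d(5) ..
      also have "\<dots> = ((y - P) \<bullet> \<tau>) * (n \<bullet> w)" unfolding inner_add_right inner_scaleR_right nu by simp
      finally show ?thesis .
    qed
    moreover have "n \<bullet> (y - P) = n \<bullet> (y - a)" using n_ipt[of t1] by (simp add: P_def inner_diff_right)
    moreover have "n \<bullet> (y - a) \<le> 0" using n_closure y by blast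
    ultimately have "0 \<le> (y - P) \<bullet> \<tau>" using nz nw by (auto simp: mult_le_0_iff)
    then show "y \<in> K" using small s tt \<sigma>0 by (intro mem) (auto simp: m_def)
  qed
qed

section \<open>Gradients of piecewise polynomials on the domain and on the interface\<close>

definition piecewise_polys :: "nat \<Rightarrow> (pt \<Rightarrow> real) \<Rightarrow> bool" where
  "piecewise_polys k v \<longleftrightarrow> (\<forall>K\<in>\<T>. \<exists>p\<in>polys k. \<forall>x\<in>K. v x = p x)"

abbreviation grad :: "(pt \<Rightarrow> real) \<Rightarrow> pt \<Rightarrow> pt" where
  "grad v \<equiv> grad_on (closure \<Omega>) v"

lemma interior_closure_domain: "interior (closure \<Omega>) \<noteq> {}"
  using domain by (simp add: convex_interior_closure interior_open)

lemma grad_interior: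
  assumes "K \<in> \<T>" "p \<in> polys k" "\<And>x. x \<in> K \<Longrightarrow> v x = p x" "x \<in> interior K"
  shows "grad v x = grad_on UNIV p x"
proof -
  obtain r where r: "r > 0" "ball x r \<subseteq> K" using assms(4) mem_interior by blast
  have "x \<in> closure \<Omega>" using assms mesh_subset interior_subset by blast
  then show ?thesis
    using r assms by (intro grad_on_piece[of _ _ r K p k]) (auto simp: domain interior_closure_domain convex_closure)
qed

lemma grad_edge:
  assumes K: "K \<in> \<T>" and e: "edge K t1 t2 z" and t: "t1 < t" "t < t2"
    and p: "p \<in> polys k" "\<And>x. x \<in> K \<Longrightarrow> v x = p x"
  shows "grad v (ipt t) = grad_on UNIV p (ipt t)"
    and "(v has_derivative (\<lambda>h. grad v (ipt t) \<bullet> h)) (at (ipt t) within closure \<Omega>)"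
proof -
  obtain r where r: "r > 0" "closure \<Omega> \<inter> ball (ipt t) r \<subseteq> K"
    using edge_neighbourhood(2)[OF K e t] by blast
  have "ipt t \<in> closure \<Omega>" using edge_neighbourhood(1)[OF K e t] mesh_subset[OF K] by blast
  note * = grad_on_piece[OF convex_closure[OF domain(4)] this interior_closure_domain r p]
  show "grad v (ipt t) = grad_on UNIV p (ipt t)" by (rule *(1))
  then show "(v has_derivative (\<lambda>h. grad v (ipt t) \<bullet> h)) (at (ipt t) within closure \<Omega>)"
    using *(2) by simp
qed

lemma domain_sets: "\<Omega> \<in> sets lebesgue" "\<Omega> \<in> lmeasurable"
  using domain by (auto simp: lmeasurable_open)

lemma negligible_domain_off_interiors: "negligible (\<Omega> - (\<Union>K\<in>\<T>. interior K))"
  by (rule negligible_subset[OF negligible_off_interiors]) (use closure_subset in auto)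

lemma negligible_off_edges:
  "negligible ({0..1} - (\<Union>K\<in>\<T>. {t. \<exists>t1 t2 z. edge K t1 t2 z \<and> t1 < t \<and> t < t2}))"
proof (rule negligible_subset[OF negligible_finite[OF finite_node_params]])
  show "{0..1} - (\<Union>K\<in>\<T>. {t. \<exists>t1 t2 z. edge K t1 t2 z \<and> t1 < t \<and> t < t2}) \<subseteq> node_params"
  proof
    fix t assume t: "t \<in> {0..1} - (\<Union>K\<in>\<T>. {t. \<exists>t1 t2 z. edge K t1 t2 z \<and> t1 < t \<and> t < t2})"
    show "t \<in> node_params"
    proof (rule ccontr)
      assume "t \<notin> node_params"
      moreover have "0 \<le> t" "t \<le> 1" using t by auto
      ultimately obtain K t1 t2 z where "K \<in> \<T>" "edge K t1 t2 z" "t1 < t" "t < t2"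
        using edge_cover[of t] by metis
      then show False using t by blast
    qed
  qed
qed

text \<open>Each piece has a bounded gradient on its compact triangle, and finitely many pieces
  cover \<Omega> up to a null set and the interface up to finitely many parameters.\<close>

lemma piecewise_grad_bounded:
  assumes "piecewise_polys k v"
  shows "\<exists>M. (AE x in lebesgue_on \<Omega>. norm (grad v x) \<le> M) \<and>
     (AE t in lebesgue_on {0..1}. norm (grad v (ipt t)) \<le> M)"
    and "grad v \<in> borel_measurable (lebesgue_on \<Omega>)"
    and "(\<lambda>t. grad v (ipt t)) \<in> borel_measurable (lebesgue_on {0..1})"
proof -
  obtain p where p: "\<And>K. K \<in> \<T> \<Longrightarrow> p K \<in> polys k" "\<And>K x. K \<in> \<T> \<Longrightarrow> x \<in> K \<Longrightarrow> v x = p K x"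
    using assms unfolding piecewise_polys_def by metis
  have "\<exists>B. \<forall>x\<in>K. norm (grad_on UNIV (p K) x) \<le> B" if "K \<in> \<T>" for K
  proof -
    have "bounded (grad_on UNIV (p K) ` K)"
      by (intro compact_imp_bounded compact_continuous_image mesh_compact that
          continuous_on_subset[OF polys_gradient(2)[OF p(1)[OF that]]]) auto
    then show ?thesis by (auto simp: bounded_iff)
  qed
  then obtain B where B: "\<And>K x. K \<in> \<T> \<Longrightarrow> x \<in> K \<Longrightarrow> norm (grad_on UNIV (p K) x) \<le> B K" by metis
  define M where "M = (\<Sum>K\<in>\<T>. \<bar>B K\<bar>)"
  have BM: "B K \<le> M" if "K \<in> \<T>" for K
    using member_le_sum[OF that, of "\<lambda>K. \<bar>B K\<bar>"] finite_mesh by (simp add: M_def)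
  have "AE x in lebesgue_on \<Omega>. norm (grad v x) \<le> M"
    using AE_lebesgue_on_negligible[OF negligible_domain_off_interiors domain_sets(1)]
  proof (rule AE_mp, intro AE_I2 impI)
    fix x assume "x \<in> (\<Union>K\<in>\<T>. interior K)"
    then obtain K where K: "K \<in> \<T>" "x \<in> interior K" by auto
    then have "x \<in> K" using interior_subset by blast
    then show "norm (grad v x) \<le> M"
      using grad_interior[OF K(1) p(1)[OF K(1)] p(2)[OF K(1)] K(2)] B[OF K(1)] BM[OF K(1)] by force
  qed
  moreover have "AE t in lebesgue_on {0..1}. norm (grad v (ipt t)) \<le> M"
    using AE_lebesgue_on_negligible[OF negligible_off_edges]
  proof (rule AE_mp)
    show "AE t in lebesgue_on {0..1}. t \<in> (\<Union>K\<in>\<T>. {t. \<exists>t1 t2 z. edge K t1 t2 z \<and> t1 < t \<and> t < t2}) \<longrightarrow> norm (grad v (ipt t)) \<le> M"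
    proof (intro AE_I2 impI)
      fix t assume "t \<in> (\<Union>K\<in>\<T>. {t. \<exists>t1 t2 z. edge K t1 t2 z \<and> t1 < t \<and> t < t2})"
      then obtain K t1 t2 z where K: "K \<in> \<T>" "edge K t1 t2 z" "t1 < t" "t < t2" by auto
      show "norm (grad v (ipt t)) \<le> M"
        using grad_edge(1)[OF K p(1)[OF K(1)] p(2)[OF K(1)]] B[OF K(1) edge_neighbourhood(1)[OF K]] BM[OF K(1)]
        by force
    qed
  qed simp
  ultimately show "\<exists>M. (AE x in lebesgue_on \<Omega>. norm (grad v x) \<le> M) \<and>
     (AE t in lebesgue_on {0..1}. norm (grad v (ipt t)) \<le> M)" by blast
  show "grad v \<in> borel_measurable (lebesgue_on \<Omega>)"
  proof (rule borel_measurable_lebesgue_on_pieces[OF finite_mesh domain_sets(1)])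
    show "negligible (\<Omega> - (\<Union>K\<in>\<T>. interior K))" by (rule negligible_domain_off_interiors)
    show "continuous_on UNIV (grad_on UNIV (p K))" if "K \<in> \<T>" for K
      by (rule polys_gradient(2)[OF p(1)[OF that]])
    show "grad v x = grad_on UNIV (p K) x" if "K \<in> \<T>" "x \<in> interior K" for K x
      by (rule grad_interior[OF that(1) p(1)[OF that(1)] p(2)[OF that(1)] that(2)])
  qed auto
  show "(\<lambda>t. grad v (ipt t)) \<in> borel_measurable (lebesgue_on {0..1})"
  proof (rule borel_measurable_lebesgue_on_pieces[OF finite_mesh _ _ _ _ negligible_off_edges])
    show "continuous_on UNIV (\<lambda>t. grad_on UNIV (p K) (ipt t))" if "K \<in> \<T>" for K
      unfolding ipt_def
      by (intro continuous_on_compose2[OF polys_gradient(2)[OF p(1)[OF that]]] continuous_intros) auto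
    show "grad v (ipt t) = grad_on UNIV (p K) (ipt t)"
      if "K \<in> \<T>" "t \<in> {t. \<exists>t1 t2 z. edge K t1 t2 z \<and> t1 < t \<and> t < t2}" for K t
      using that grad_edge(1)[OF that(1) _ _ _ p(1)[OF that(1)] p(2)[OF that(1)]] by blast
    have "open {t. \<exists>t1 t2 z. edge K t1 t2 z \<and> t1 < t \<and> t < t2}" for K
    proof (cases "\<exists>t1 t2 z. edge K t1 t2 z")
      case True
      then obtain t1 t2 z where e: "edge K t1 t2 z" by blast
      have "{t. \<exists>t1 t2 z. edge K t1 t2 z \<and> t1 < t \<and> t < t2} = {t1<..<t2}"
        by (rule set_eqI) (simp, metis e edge_unique)
      then show ?thesis by simp
    qed simp
    then show "{t. \<exists>t1 t2 z. edge K t1 t2 z \<and> t1 < t \<and> t < t2} \<in> sets lebesgue" for K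
      by auto
  qed auto
qed

lemma piecewise_grad_integrable:
  assumes v: "piecewise_polys k v"
  shows "integrable (lebesgue_on \<Omega>) (\<lambda>x. (norm (grad v x))\<^sup>2)"
    and "integrable (lebesgue_on {0..1}) (\<lambda>t. (norm (grad v (ipt t)))\<^sup>2)"
proof -
  obtain M where M: "AE x in lebesgue_on \<Omega>. norm (grad v x) \<le> M"
     "AE t in lebesgue_on {0..1}. norm (grad v (ipt t)) \<le> M"
    using piecewise_grad_bounded(1)[OF v] by blast
  have sq: "norm ((norm w)\<^sup>2) \<le> M\<^sup>2" if "norm w \<le> M" for w :: pt
    using that by (simp add: power_mono)
  show "integrable (lebesgue_on \<Omega>) (\<lambda>x. (norm (grad v x))\<^sup>2)"
  proof (rule finite_measure.integrable_const_bound[OF finite_measure_lebesgue_on[OF domain_sets(2)], where B="M\<^sup>2"])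
    show "AE x in lebesgue_on \<Omega>. norm ((norm (grad v x))\<^sup>2) \<le> M\<^sup>2"
      using M(1) by (rule AE_mp, intro AE_I2 impI sq)
  qed (use piecewise_grad_bounded(2)[OF v] in measurable)
  show "integrable (lebesgue_on {0..1}) (\<lambda>t. (norm (grad v (ipt t)))\<^sup>2)"
  proof (rule finite_measure.integrable_const_bound[OF finite_measure_lebesgue_on, where B="M\<^sup>2"])
    show "AE t in lebesgue_on {0..1}. norm ((norm (grad v (ipt t)))\<^sup>2) \<le> M\<^sup>2"
      using M(2) by (rule AE_mp, intro AE_I2 impI sq)
  qed (use piecewise_grad_bounded(3)[OF v] in \<open>auto intro!: borel_measurable_power borel_measurable_norm\<close>)
qed

lemma norm_sq_pt: "(norm x)\<^sup>2 = (x $ 1)\<^sup>2 + (x $ 2)\<^sup>2" for x :: pt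
  unfolding power2_norm_eq_inner inner_vec_def sum_2 by (simp add: power2_eq_square)

text \<open>The frontiers of triangles are null and the open triangles are disjoint, so at almost
  every point at most one term of the sum survives.\<close>

lemma nn_integral_sum_over_mesh:
  assumes "\<And>K. K \<in> \<T> \<Longrightarrow> F K \<in> borel_measurable borel"
    and "\<And>K x. K \<in> \<T> \<Longrightarrow> x \<in> interior K \<Longrightarrow> F K x = G x"
  shows "(\<Sum>K\<in>\<T>. \<integral>\<^sup>+x. F K x * indicator K x \<partial>lborel) \<le> (\<integral>\<^sup>+x. G x \<partial>lebesgue_on \<Omega>)"
proof -
  have "(\<Sum>K\<in>\<T>. \<integral>\<^sup>+x. F K x * indicator K x \<partial>lborel) = (\<Sum>K\<in>\<T>. \<integral>\<^sup>+x. F K x * indicator (interior K) x \<partial>lebesgue)"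
  proof (rule sum.cong[OF refl])
    fix K assume K: "K \<in> \<T>"
    have "negligible (frontier K)" by (intro negligible_convex_frontier mesh_convex K)
    then have "AE x in lebesgue. x \<notin> frontier K" by (intro AE_not_in) (simp add: negligible_iff_null_sets)
    moreover have "closed K" by (intro compact_imp_closed mesh_compact K)
    ultimately have "AE x in lebesgue. F K x * indicator K x = F K x * indicator (interior K) x"
      by (elim AE_mp, intro AE_I2) (use interior_subset in \<open>auto simp: frontier_def indicator_def\<close>)
    then have "(\<integral>\<^sup>+x. F K x * indicator K x \<partial>lebesgue) = (\<integral>\<^sup>+x. F K x * indicator (interior K) x \<partial>lebesgue)"
      by (rule nn_integral_cong_AE)
    then show "(\<integral>\<^sup>+x. F K x * indicator K x \<partial>lborel) = (\<integral>\<^sup>+x. F K x * indicator (interior K) x \<partial>lebesgue)"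
      by (simp add: nn_integral_completion)
  qed
  also have "\<dots> = (\<integral>\<^sup>+x. (\<Sum>K\<in>\<T>. F K x * indicator (interior K) x) \<partial>lebesgue)"
  proof (rule nn_integral_sum[symmetric])
    fix K assume K: "K \<in> \<T>"
    have [measurable]: "F K \<in> borel_measurable lebesgue" by (rule measurable_completion) (simp add: assms(1)[OF K])
    show "(\<lambda>x. F K x * indicator (interior K) x) \<in> borel_measurable lebesgue"
      by (intro borel_measurable_times_ennreal borel_measurable_indicator) auto
  qed
  also have "\<dots> \<le> (\<integral>\<^sup>+x. G x * indicator \<Omega> x \<partial>lebesgue)"
  proof (rule nn_integral_mono)
    fix x
    show "(\<Sum>K\<in>\<T>. F K x * indicator (interior K) x) \<le> G x * indicator \<Omega> x"
    proof (cases "\<exists>K\<in>\<T>. x \<in> interior K")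
      case True
      then obtain K where K: "K \<in> \<T>" "x \<in> interior K" by blast
      have "(\<Sum>K\<in>\<T>. F K x * indicator (interior K) x) = (\<Sum>L\<in>{K}. F L x * indicator (interior L) x)"
        using finite_mesh K
        by (intro sum.mono_neutral_right) (auto simp: indicator_def dest: interiors_disjoint[OF K(1) _ K(2)])
      also have "\<dots> = G x * indicator \<Omega> x"
        using K assms(2)[OF K] mesh_interior_subset[OF K(1)] by (auto simp: indicator_def)
      finally show ?thesis by simp
    next
      case False
      then have "(\<Sum>K\<in>\<T>. F K x * indicator (interior K) x) = 0" by (intro sum.neutral) auto
      then show ?thesis by simp
    qed
  qed
  also have "\<dots> = (\<integral>\<^sup>+x. G x \<partial>lebesgue_on \<Omega>)"
    using domain_sets(1) by (intro nn_integral_restrict_space[symmetric]) auto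
  finally show ?thesis .
qed

text \<open>The one-dimensional constant for degree \<open>k\<close> bounds the gradient on each
  interface edge by the gradient on its triangle; a height of at least \<open>2 * \<rho>\<close>
  makes this uniform over the mesh.\<close>

lemma inverse_trace:
  assumes v: "piecewise_polys k v" and C0: "C \<ge> 0"
    and C: "\<And>p::real poly. degree p \<le> k \<Longrightarrow>
     ennreal ((poly p 0)\<^sup>2) \<le> ennreal C * (\<integral>\<^sup>+s. ennreal ((poly p s)\<^sup>2) * indicator {0..1/2} s \<partial>lborel)"
  shows "\<rho> * norm (b - a) * (LINT t|lebesgue_on {0..1}. (norm (grad v (ipt t)))\<^sup>2) \<le>
     C * (LINT x|lebesgue_on \<Omega>. (norm (grad v x))\<^sup>2)"
proof -
  obtain p where p: "\<And>K. K \<in> \<T> \<Longrightarrow> p K \<in> polys k" "\<And>K x. K \<in> \<T> \<Longrightarrow> x \<in> K \<Longrightarrow> v x = p K x"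
    using v unfolding piecewise_polys_def by metis
  define G where "G K x = grad_on UNIV (p K) x" for K x
  have cG: "continuous_on UNIV (G K)" if "K \<in> \<T>" for K
    unfolding G_def[abs_def] by (rule polys_gradient(2)[OF p(1)[OF that]])
  have cGi: "continuous_on UNIV (\<lambda>x. G K x $ i)" if "K \<in> \<T>" for K i
    using cG[OF that] by (intro continuous_intros)
  have mG: "(\<lambda>x. ennreal ((norm (G K x))\<^sup>2)) \<in> borel_measurable borel" if "K \<in> \<T>" for K
    using borel_measurable_continuous_onI[OF cG[OF that]] by measurable
  define E where "E K = {t. \<exists>t1 t2 z. edge K t1 t2 z \<and> t1 \<le> t \<and> t \<le> t2}" for K
  have E: "E K = {t1..t2}" if "edge K t1 t2 z" for K t1 t2 z
    unfolding E_def by (rule set_eqI) (simp, metis that edge_unique)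
  have E0: "E K = {}" if "\<not> (\<exists>t1 t2 z. edge K t1 t2 z)" for K
    using that by (auto simp: E_def)
  have cipt: "continuous_on UNIV ipt" unfolding ipt_def[abs_def] by (intro continuous_intros)
  have mE[measurable]: "E K \<in> sets borel" for K
    using E E0 by (cases "\<exists>t1 t2 z. edge K t1 t2 z") auto
  have mGt: "(\<lambda>t. ennreal ((norm (G K (ipt t)))\<^sup>2) * indicator (E K) t) \<in> borel_measurable borel" if "K \<in> \<T>" for K
    using measurable_compose[OF borel_measurable_continuous_onI[OF cipt] mG[OF that]] mE
    by (intro borel_measurable_times_ennreal borel_measurable_indicator) auto
  let ?c = "\<rho> * norm (b - a)"
  have c0: "?c > 0" using \<rho>_pos ab by simp
  have piece: "ennreal ?c * (\<integral>\<^sup>+t. ennreal ((norm (G K (ipt t)))\<^sup>2) * indicator (E K) t \<partial>lborel) \<le>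
     ennreal C * (\<integral>\<^sup>+x. ennreal ((norm (G K x))\<^sup>2) * indicator K x \<partial>lborel)" if K: "K \<in> \<T>" for K
  proof (cases "\<exists>t1 t2 z. edge K t1 t2 z")
    case False
    then show ?thesis by (simp add: E0)
  next
    case True
    then obtain t1 t2 z where e: "edge K t1 t2 z" by blast
    have lt: "t1 < t2" using e by (simp add: edge_def)
    have cr: "\<bar>cross2 (b - a) (z - a)\<bar> = norm (b - a) * \<bar>n \<bullet> (z - a)\<bar>"
      by (rule cross2_normal[OF norm_n n_orth])
    have "2 * \<rho> * norm (b - a) \<le> - (n \<bullet> (z - a)) * norm (b - a)"
      by (intro mult_right_mono edge_height(1)[OF K e]) auto
    moreover have "n \<bullet> (z - a) < 0" using e by (simp add: edge_def)
    \<comment> \<open>The determinant is the length of the interface times the height of the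
      triangle.\<close>
    ultimately have crge: "2 * ?c \<le> \<bar>cross2 (b - a) (z - a)\<bar>" unfolding cr by (simp add: mult_ac)
    have hull: "K = convex hull {a + t1 *\<^sub>R (b - a), a + t2 *\<^sub>R (b - a), z}"
      using edge_hull[OF K e] by (simp add: ipt_def)
    have comp: "ennreal (2 * ?c) * (\<integral>\<^sup>+t. ennreal ((G K (ipt t) $ i)\<^sup>2) * indicator {t1..t2} t \<partial>lborel) \<le>
       ennreal (2 * C) * (\<integral>\<^sup>+x. ennreal ((G K x $ i)\<^sup>2) * indicator K x \<partial>lborel)" for i
    proof -
      have "ennreal (2 * ?c) * (\<integral>\<^sup>+t. ennreal ((G K (ipt t) $ i)\<^sup>2) * indicator {t1..t2} t \<partial>lborel) \<le>
         ennreal \<bar>cross2 (b - a) (z - a)\<bar> * (\<integral>\<^sup>+t. ennreal ((G K (ipt t) $ i)\<^sup>2) * indicator {t1..t2} t \<partial>lborel)"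
        using crge by (intro mult_right_mono ennreal_leI) auto
      also have "\<dots> \<le> ennreal (2 * C) * (\<integral>\<^sup>+x. ennreal ((G K x $ i)\<^sup>2) * indicator K x \<partial>lborel)"
        unfolding ipt_def
      proof (rule poly_on_lines_edge_trace[OF C _ cGi[OF K] lt _ hull])
        show "poly_on_lines k (\<lambda>x. G K x $ i)" unfolding G_def by (rule polys_gradient(3)[OF p(1)[OF K]])
        show "cross2 (b - a) (z - a) \<noteq> 0" using crge c0 by auto
      qed
      finally show ?thesis .
    qed
    have mi: "(\<lambda>x. ennreal ((G K x $ i)\<^sup>2)) \<in> borel_measurable borel" for i
      using borel_measurable_continuous_onI[OF cGi[OF K]] by measurable
    have mit: "(\<lambda>t. ennreal ((G K (ipt t) $ i)\<^sup>2)) \<in> borel_measurable borel" for i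
      using measurable_compose[OF borel_measurable_continuous_onI[OF cipt] mi] by simp
    have clK: "K \<in> sets borel" using mesh_compact[OF K] by (auto dest: compact_imp_closed)
    have 1: "(\<integral>\<^sup>+t. ennreal ((norm (G K (ipt t)))\<^sup>2) * indicator {t1..t2} t \<partial>lborel) =
      (\<integral>\<^sup>+t. ennreal ((G K (ipt t) $ 1)\<^sup>2) * indicator {t1..t2} t \<partial>lborel) +
      (\<integral>\<^sup>+t. ennreal ((G K (ipt t) $ 2)\<^sup>2) * indicator {t1..t2} t \<partial>lborel)"
      using mit by (subst nn_integral_add[symmetric]) (auto simp: norm_sq_pt distrib_right intro!: nn_integral_cong)
    have 2: "(\<integral>\<^sup>+x. ennreal ((norm (G K x))\<^sup>2) * indicator K x \<partial>lborel) =
      (\<integral>\<^sup>+x. ennreal ((G K x $ 1)\<^sup>2) * indicator K x \<partial>lborel) +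
      (\<integral>\<^sup>+x. ennreal ((G K x $ 2)\<^sup>2) * indicator K x \<partial>lborel)"
      using mi clK by (subst nn_integral_add[symmetric]) (auto simp: norm_sq_pt distrib_right intro!: nn_integral_cong)
    have "ennreal (2 * ?c) * (\<integral>\<^sup>+t. ennreal ((norm (G K (ipt t)))\<^sup>2) * indicator {t1..t2} t \<partial>lborel) \<le>
     ennreal (2 * C) * (\<integral>\<^sup>+x. ennreal ((norm (G K x))\<^sup>2) * indicator K x \<partial>lborel)"
      unfolding 1 2 distrib_left by (rule add_mono[OF comp comp])
    \<comment> \<open>The factor 1/2 removes the 2 from the height on the left and the 2 from the
      halved edge on the right.\<close>
    then have "ennreal (1/2) * (ennreal (2 * ?c) * (\<integral>\<^sup>+t. ennreal ((norm (G K (ipt t)))\<^sup>2) * indicator {t1..t2} t \<partial>lborel)) \<le>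
     ennreal (1/2) * (ennreal (2 * C) * (\<integral>\<^sup>+x. ennreal ((norm (G K x))\<^sup>2) * indicator K x \<partial>lborel))"
      by (rule mult_left_mono) simp
    then show ?thesis unfolding E[OF e] mult.assoc[symmetric] using c0 C0
      by (simp add: ennreal_mult[symmetric] del: ennreal_half)
  qed
  \<comment> \<open>Closed edges may share end points or reach beyond [0,1], which only enlarges the
    sum.\<close>
  have nnt: "(\<integral>\<^sup>+t. ennreal ((norm (grad v (ipt t)))\<^sup>2) \<partial>lebesgue_on {0..1}) \<le>
     (\<Sum>K\<in>\<T>. \<integral>\<^sup>+t. ennreal ((norm (G K (ipt t)))\<^sup>2) * indicator (E K) t \<partial>lborel)"
  proof -
    have "(\<integral>\<^sup>+t. ennreal ((norm (grad v (ipt t)))\<^sup>2) \<partial>lebesgue_on {0..1}) =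
      (\<integral>\<^sup>+t. ennreal ((norm (grad v (ipt t)))\<^sup>2) * indicator {0..1} t \<partial>lebesgue)"
      by (rule nn_integral_restrict_space) auto
    also have "\<dots> \<le> (\<integral>\<^sup>+t. (\<Sum>K\<in>\<T>. ennreal ((norm (G K (ipt t)))\<^sup>2) * indicator (E K) t) \<partial>lebesgue)"
    proof (rule nn_integral_mono_AE)
      have "AE t in lebesgue. t \<notin> node_params"
        using negligible_finite[OF finite_node_params] by (intro AE_not_in) (simp add: negligible_iff_null_sets)
      then show "AE t in lebesgue. ennreal ((norm (grad v (ipt t)))\<^sup>2) * indicator {0..1} t \<le>
          (\<Sum>K\<in>\<T>. ennreal ((norm (G K (ipt t)))\<^sup>2) * indicator (E K) t)"
      proof (rule AE_mp, intro AE_I2 impI)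
        fix t assume t: "t \<notin> node_params"
        show "ennreal ((norm (grad v (ipt t)))\<^sup>2) * indicator {0..1} t \<le>
          (\<Sum>K\<in>\<T>. ennreal ((norm (G K (ipt t)))\<^sup>2) * indicator (E K) t)"
        proof (cases "t \<in> {0..1}")
          case True
          then obtain K t1 t2 z where K: "K \<in> \<T>" "edge K t1 t2 z" "t1 < t" "t < t2"
            using edge_cover[of t] t by (metis atLeastAtMost_iff)
          have "grad v (ipt t) = G K (ipt t)"
            unfolding G_def using grad_edge(1)[OF K p(1)[OF K(1)] p(2)[OF K(1)]] by blast
          then have "ennreal ((norm (grad v (ipt t)))\<^sup>2) * indicator {0..1} t = ennreal ((norm (G K (ipt t)))\<^sup>2) * indicator (E K) t"
            using True K E[OF K(2)] by simp
          also have "\<dots> \<le> (\<Sum>K\<in>\<T>. ennreal ((norm (G K (ipt t)))\<^sup>2) * indicator (E K) t)"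
            by (rule member_le_sum[OF K(1) _ finite_mesh]) simp
          finally show ?thesis .
        qed simp
      qed
    qed
    also have "\<dots> = (\<integral>\<^sup>+t. (\<Sum>K\<in>\<T>. ennreal ((norm (G K (ipt t)))\<^sup>2) * indicator (E K) t) \<partial>lborel)"
      by (simp add: nn_integral_completion)
    also have "\<dots> = (\<Sum>K\<in>\<T>. \<integral>\<^sup>+t. ennreal ((norm (G K (ipt t)))\<^sup>2) * indicator (E K) t \<partial>lborel)"
      by (rule nn_integral_sum) (simp add: mGt)
    finally show ?thesis .
  qed
  have "ennreal ?c * (\<integral>\<^sup>+t. ennreal ((norm (grad v (ipt t)))\<^sup>2) \<partial>lebesgue_on {0..1}) \<le>
    ennreal ?c * (\<Sum>K\<in>\<T>. \<integral>\<^sup>+t. ennreal ((norm (G K (ipt t)))\<^sup>2) * indicator (E K) t \<partial>lborel)"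
    by (rule mult_left_mono[OF nnt]) simp
  also have "\<dots> \<le> ennreal C * (\<Sum>K\<in>\<T>. \<integral>\<^sup>+x. ennreal ((norm (G K x))\<^sup>2) * indicator K x \<partial>lborel)"
    unfolding sum_distrib_left by (intro sum_mono piece)
  also have "\<dots> \<le> ennreal C * (\<integral>\<^sup>+x. ennreal ((norm (grad v x))\<^sup>2) \<partial>lebesgue_on \<Omega>)"
  proof (intro mult_left_mono nn_integral_sum_over_mesh mG)
    fix K x assume K: "K \<in> \<T>" and x: "x \<in> interior K"
    have "grad v x = grad_on UNIV (p K) x"
      by (rule grad_interior[OF K p(1)[OF K] p(2)[OF K] x])
    then show "ennreal ((norm (G K x))\<^sup>2) = ennreal ((norm (grad v x))\<^sup>2)"
      by (simp add: G_def)
  qed simp_all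
  also have "(\<integral>\<^sup>+x. ennreal ((norm (grad v x))\<^sup>2) \<partial>lebesgue_on \<Omega>) = ennreal (LINT x|lebesgue_on \<Omega>. (norm (grad v x))\<^sup>2)"
    by (rule nn_integral_eq_integral[OF piecewise_grad_integrable(1)[OF v]]) simp
  also have "(\<integral>\<^sup>+t. ennreal ((norm (grad v (ipt t)))\<^sup>2) \<partial>lebesgue_on {0..1}) = ennreal (LINT t|lebesgue_on {0..1}. (norm (grad v (ipt t)))\<^sup>2)"
    by (rule nn_integral_eq_integral[OF piecewise_grad_integrable(2)[OF v]]) simp
  finally show ?thesis using c0 C0 by (simp add: ennreal_mult[symmetric])
qed

end

section \<open>Conformity of the nodal interpolant\<close>

lemma lebesgue_integral_translate:
  fixes F :: "pt \<Rightarrow> real"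
  assumes [measurable]: "F \<in> borel_measurable borel"
  shows "(LINT x|lborel. F (x + c)) = (LINT x|lborel. F x)"
proof -
  have "(LINT x|lborel. F x) = (LINT x|distr lborel borel ((+) c). F x)"
    by (simp add: lborel_distr_plus)
  also have "\<dots> = (LINT x|lborel. F (c + x))" by (subst integral_distr) auto
  finally show ?thesis by (simp add: add.commute)
qed

lemma integrable_continuous_compact_support:
  fixes F :: "pt \<Rightarrow> real"
  assumes "continuous_on UNIV F" "\<And>x. norm x > R \<Longrightarrow> F x = 0"
  shows "integrable lborel F"
proof -
  have "integrable lborel (\<lambda>x. indicator (cball 0 R) x *\<^sub>R F x)"
    by (rule borel_integrable_compact) (use assms(1) continuous_on_subset in auto)
  also have "(\<lambda>x. indicator (cball 0 R) x *\<^sub>R F x) = F"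
    using assms(2) by (auto simp: indicator_def fun_eq_iff)
  finally show ?thesis .
qed

text \<open>The integral of a difference quotient vanishes by translation invariance; dominated
  convergence passes to the limit.\<close>

lemma integral_directional_derivative_eq_0:
  fixes F D :: "pt \<Rightarrow> real"
  assumes lip: "\<And>x y. \<bar>F x - F y\<bar> \<le> L * norm (x - y)"
    and supp: "\<And>x. norm x > R \<Longrightarrow> F x = 0"
    and D: "AE x in lebesgue. (\<lambda>m::nat. (F (x + (1 / real (Suc m)) *\<^sub>R e) - F x) * real (Suc m)) \<longlonglongrightarrow> D x"
    and Dm: "D \<in> borel_measurable lebesgue"
  shows "(LINT x|lebesgue. D x) = 0"
proof -
  have cF: "continuous_on UNIV F"
  proof (rule lipschitz_on_continuous_on[where L="\<bar>L\<bar>"], rule lipschitz_onI)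
    fix x y show "dist (F x) (F y) \<le> \<bar>L\<bar> * dist x y"
      using lip[of x y] mult_right_mono[OF abs_ge_self[of L], of "norm (x - y)"] by (simp add: dist_real_def dist_norm)
  qed simp
  define Q where "Q m x = (F (x + (1 / real (Suc m)) *\<^sub>R e) - F x) * real (Suc m)" for m x
  have mF[measurable]: "F \<in> borel_measurable borel" by (rule borel_measurable_continuous_onI[OF cF])
  have mQ: "Q m \<in> borel_measurable borel" for m unfolding Q_def by measurable
  have iF: "integrable lborel F" by (rule integrable_continuous_compact_support[OF cF supp])
  have iFt: "integrable lborel (\<lambda>x. F (x + c))" for c
  proof (rule integrable_continuous_compact_support[where R="R + norm c"])
    show "continuous_on UNIV (\<lambda>x. F (x + c))"
      by (intro continuous_on_compose2[OF cF] continuous_intros) auto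
    fix x :: pt assume "R + norm c < norm x"
    moreover have "norm x \<le> norm (x + c) + norm c" using norm_triangle_ineq4[of "x + c" c] by simp
    ultimately show "F (x + c) = 0" by (intro supp) linarith
  qed
  have Q0: "(LINT x|lebesgue. Q m x) = 0" for m
  proof -
    have "(LINT x|lebesgue. Q m x) = (LINT x|lborel. Q m x)" using mQ by (intro integral_completion) simp
    also have "\<dots> = 0" unfolding Q_def using iF iFt lebesgue_integral_translate[OF mF] by simp
    finally show ?thesis .
  qed
  \<comment> \<open>The steps have length at most \<open>norm e\<close>, so all difference quotients
    vanish off this ball, and the Lipschitz constant bounds them on it.\<close>
  define w where "w x = (L * norm e) * indicator (cball 0 (R + norm e)) x" for x :: pt
  have "integrable lebesgue w" unfolding w_def
    using fmeasurableD2[OF lmeasurable_cball[of 0 "R + norm e"]] fmeasurableD[OF lmeasurable_cball[of 0 "R + norm e"]]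
    by (intro integrable_mult_right integrable_real_indicator) (auto simp: less_top)
  moreover have "norm (Q m x) \<le> w x" for m x
  proof (cases "norm x \<le> R + norm e")
    case True
    have "\<bar>Q m x\<bar> \<le> (L * norm ((1 / real (Suc m)) *\<^sub>R e)) * real (Suc m)"
      unfolding Q_def abs_mult using lip[of "x + (1 / real (Suc m)) *\<^sub>R e" x] by (intro mult_mono) auto
    also have "\<dots> = L * norm e" by (simp add: field_simps)
    finally show ?thesis using True by (simp add: w_def)
  next
    case False
    have "norm ((1 / real (Suc m)) *\<^sub>R e) \<le> norm e" by (simp add: divide_le_eq mult_le_cancel_left1)
    moreover have "norm x \<le> norm (x + (1 / real (Suc m)) *\<^sub>R e) + norm ((1 / real (Suc m)) *\<^sub>R e)"
      using norm_triangle_ineq4[of "x + (1 / real (Suc m)) *\<^sub>R e" "(1 / real (Suc m)) *\<^sub>R e"] by simp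
    moreover have "norm x > R" using False norm_ge_zero[of e] by linarith
    ultimately have "F (x + (1 / real (Suc m)) *\<^sub>R e) = 0" "F x = 0" using False by (auto intro!: supp)
    then show ?thesis using False by (simp add: Q_def w_def)
  qed
  ultimately have "(\<lambda>m. LINT x|lebesgue. Q m x) \<longlonglongrightarrow> (LINT x|lebesgue. D x)"
    using D Dm mQ unfolding Q_def[symmetric]
    by (intro integral_dominated_convergence[where w=w]) (auto intro!: measurable_completion)
  then show ?thesis unfolding Q0 using LIMSEQ_unique tendsto_const by blast
qed

lemma has_derivative_imp_seq_quotient:
  fixes F :: "pt \<Rightarrow> real"
  assumes "(F has_derivative F') (at x)"
  shows "(\<lambda>m::nat. (F (x + (1 / real (Suc m)) *\<^sub>R e) - F x) * real (Suc m)) \<longlonglongrightarrow> F' e"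
proof -
  interpret bounded_linear F' using assms by (rule has_derivative_bounded_linear)
  have "((\<lambda>t. F (x + t *\<^sub>R e)) has_derivative (\<lambda>t. F' (t *\<^sub>R e))) (at 0)"
    by (rule has_derivative_compose[of "\<lambda>t. x + t *\<^sub>R e" "\<lambda>t. t *\<^sub>R e" 0 UNIV F F'])
      (use assms in \<open>auto intro!: derivative_eq_intros\<close>)
  then have "((\<lambda>t. F (x + t *\<^sub>R e)) has_real_derivative F' e) (at 0)"
    by (simp add: has_field_derivative_def scaleR mult_commute_abs)
  then have lim: "((\<lambda>h. (F (x + h *\<^sub>R e) - F x) / h) \<longlongrightarrow> F' e) (at 0)"
    by (simp add: DERIV_def)
  have "filterlim (\<lambda>m. 1 / real (Suc m)) (at 0) sequentially"
    using LIMSEQ_inverse_real_of_nat by (auto simp: filterlim_at inverse_eq_divide simp del: of_nat_Suc)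
  from filterlim_compose[OF lim this] show ?thesis by (simp add: field_simps del: of_nat_Suc)
qed

context mesh_interface
begin

lemma piecewise_continuous:
  assumes "piecewise_polys k v"
  shows "continuous_on (closure \<Omega>) v"
proof -
  have "continuous_on (\<Union>K\<in>\<T>. K) v"
  proof (rule continuous_on_closed_Union[OF finite_mesh])
    fix K assume K: "K \<in> \<T>"
    then show "closed K" by (intro compact_imp_closed mesh_compact)
    obtain p where p: "p \<in> polys k" "\<And>x. x \<in> K \<Longrightarrow> v x = p x"
      using assms K unfolding piecewise_polys_def by blast
    have "continuous_on K p"
      by (rule has_derivative_continuous_on, rule has_derivative_at_withinI, rule polys_gradient(1)[OF p(1)])
    then show "continuous_on K v" by (rule continuous_on_eq) (simp add: p(2))
  qed
  then show ?thesis using mesh_union by simp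
qed

lemma interp_piecewise: "k \<ge> 1 \<Longrightarrow> piecewise_polys k (interp \<alpha>)"
  unfolding piecewise_polys_def using interp_aff_polys interp_eq by metis

lemma interp_aff_derivative: "(interp_aff \<alpha> K has_derivative (\<lambda>h. interp_grad \<alpha> K \<bullet> h)) (at x)"
  unfolding interp_aff_def[abs_def] interp_grad_def by (auto intro!: derivative_eq_intros)

lemma grad_UNIV_interp_aff: "grad_on UNIV (interp_aff \<alpha> K) x = interp_grad \<alpha> K"
  by (rule grad_on_eqI[OF interp_aff_derivative]) auto

lemma interp_grad_interior: "K \<in> \<T> \<Longrightarrow> x \<in> interior K \<Longrightarrow> grad (interp \<alpha>) x = interp_grad \<alpha> K"
  using grad_interior[of K "interp_aff \<alpha> K" 1 "interp \<alpha>" x] interp_aff_polys[of 1 \<alpha> K]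
  by (simp add: interp_eq grad_UNIV_interp_aff)

lemma interp_grad_edge:
  "K \<in> \<T> \<Longrightarrow> edge K t1 t2 z \<Longrightarrow> t1 < t \<Longrightarrow> t < t2 \<Longrightarrow> grad (interp \<alpha>) (ipt t) = interp_grad \<alpha> K"
  using grad_edge(1)[of K t1 t2 z t "interp_aff \<alpha> K" 1 "interp \<alpha>"] interp_aff_polys[of 1 \<alpha> K]
  by (simp add: interp_eq grad_UNIV_interp_aff)

text \<open>A boundary point cannot have positive barycentric weight at a vertex in the open convex
  set \<Omega>, so only vertices with nodal value 0 contribute there.\<close>

lemma interp_zero_off_domain:
  assumes \<alpha>: "\<And>v. v \<notin> \<Omega> \<Longrightarrow> \<alpha> v = 0" and x: "x \<notin> \<Omega>"
  shows "interp \<alpha> x = 0"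
proof (cases "x \<in> closure \<Omega>")
  case False
  then show ?thesis by (rule interp_outside)
next
  case True
  then obtain K where K: "K \<in> \<T>" "x \<in> K" using mesh_union by blast
  obtain p where "p \<in> verts K" using verts_props(2)[OF K(1)] by force
  then obtain q z where v: "verts K = {p, q, z}" using three_vertices[OF K(1)] by metis
  have "x \<in> convex hull {p, q, z}" using K verts_props(4)[OF K(1)] v by simp
  then obtain l1 l2 l3 where c: "0 \<le> l1" "0 \<le> l2" "0 \<le> l3" "l1 + l2 + l3 = 1"
    "x = l1 *\<^sub>R p + l2 *\<^sub>R q + l3 *\<^sub>R z" unfolding convex_hull_3 by blast
  have cl: "p \<in> closure \<Omega>" "q \<in> closure \<Omega>" "z \<in> closure \<Omega>"
    using v verts_subset[OF K(1)] mesh_subset[OF K(1)] by auto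
  have *: "l * \<alpha> v = 0" if l: "0 \<le> l" "0 \<le> l'" "0 \<le> l''" "l + l' + l'' = 1" "x = l *\<^sub>R v + l' *\<^sub>R v' + l'' *\<^sub>R v''"
     and vs: "v' \<in> closure \<Omega>" "v'' \<in> closure \<Omega>" for l l' l'' v v' v''
  proof (rule ccontr)
    assume "l * \<alpha> v \<noteq> 0"
    then have lv: "l > 0" "v \<in> \<Omega>" using \<alpha> l by auto
    show False
    proof (cases "l = 1")
      case True
      then have "l' = 0" "l'' = 0" using l by auto
      then have "x = v" using l(5) True by simp
      then show False using x lv by simp
    next
      case False
      then have l1: "1 - l > 0" using l by auto
      define y where "y = (l' / (1 - l)) *\<^sub>R v' + (l'' / (1 - l)) *\<^sub>R v''"
      have "l' / (1 - l) + l'' / (1 - l) = 1" using l l1 by (simp add: add_divide_distrib[symmetric])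
      then have "y \<in> closure \<Omega>" unfolding y_def using l l1 vs
        by (intro convexD convex_closure domain) auto
      then have "(1 - l) *\<^sub>R y + l *\<^sub>R v \<in> \<Omega>" using l1 lv l
        by (intro closure_convex_combination_in_open domain) auto
      also have "(1 - l) *\<^sub>R y + l *\<^sub>R v = x" using l1 l(5) by (simp add: y_def scaleR_add_right)
      finally show False using x by simp
    qed
  qed
  have "l1 * \<alpha> p = 0" by (rule *[of l1 l2 l3 p q z]) (use c cl in auto)
  moreover have "l2 * \<alpha> q = 0" by (rule *[of l2 l1 l3 q p z]) (use c cl in \<open>auto simp: add_ac\<close>)
  moreover have "l3 * \<alpha> z = 0" by (rule *[of l3 l1 l2 z p q]) (use c cl in \<open>auto simp: add_ac\<close>)
  moreover have "interp_aff \<alpha> K x = l1 * \<alpha> p + l2 * \<alpha> q + l3 * \<alpha> z"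
  proof -
    let ?c = "snd (affine_interp K \<alpha>)"
    have "interp_aff \<alpha> K x = l1 * interp_aff \<alpha> K p + l2 * interp_aff \<alpha> K q + l3 * interp_aff \<alpha> K z + (1 - (l1 + l2 + l3)) * ?c"
      unfolding c(5) interp_aff_def by (simp add: inner_add_right algebra_simps)
    then show ?thesis using c(4) K v by (simp add: interp_aff_vert)
  qed
  ultimately have "interp_aff \<alpha> K x = 0" by linarith
  then show ?thesis using interp_eq[OF K, of \<alpha>] by simp
qed

context
  fixes \<alpha> :: "pt \<Rightarrow> real"
  assumes \<alpha>: "\<And>v. v \<notin> \<Omega> \<Longrightarrow> \<alpha> v = 0"
begin

lemma interp_continuous: "continuous_on UNIV (interp \<alpha>)"
proof -
  have "continuous_on (closure \<Omega> \<union> - \<Omega>) (interp \<alpha>)"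
  proof (rule continuous_on_closed_Un)
    show "continuous_on (closure \<Omega>) (interp \<alpha>)" by (rule piecewise_continuous[OF interp_piecewise[of 1]]) simp
    have "continuous_on (- \<Omega>) (\<lambda>x. 0::real)" by simp
    then show "continuous_on (- \<Omega>) (interp \<alpha>)"
      by (rule continuous_on_eq) (simp add: interp_zero_off_domain[OF \<alpha>])
  qed (use domain in \<open>auto simp: closed_Compl\<close>)
  moreover have "closure \<Omega> \<union> - \<Omega> = UNIV" using closure_subset by auto
  ultimately show ?thesis by simp
qed

text \<open>The segment between two points is covered by finitely many closed sets, the preimages of
  the triangles and of the complement of \<Omega>; on each of them one common Lipschitz constant
  serves, and the bounds are chained along the segment.\<close>

lemma interp_lipschitz: "\<exists>L. \<forall>x y. \<bar>interp \<alpha> x - interp \<alpha> y\<bar> \<le> L * norm (x - y)"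
proof -
  define M where "M = (\<Sum>K\<in>\<T>. norm (interp_grad \<alpha> K))"
  have M: "norm (interp_grad \<alpha> K) \<le> M" if "K \<in> \<T>" for K
    unfolding M_def by (rule member_le_sum[OF that _ finite_mesh]) simp
  have M0: "M \<ge> 0" unfolding M_def by (rule sum_nonneg) simp
  have "\<bar>interp \<alpha> x - interp \<alpha> y\<bar> \<le> M * norm (x - y)" for x y
  proof -
    define l where "l t = x + t *\<^sub>R (y - x)" for t :: real
    have cl: "continuous_on UNIV l" unfolding l_def[abs_def] by (intro continuous_intros)
    have ld: "l s - l t = (s - t) *\<^sub>R (y - x)" for s t by (simp add: l_def algebra_simps)
    have "lipschitz_on (M * norm (y - x)) {0..1} (interp \<alpha> \<circ> l)"
    proof (rule lipschitz_on_closed_Union[of "insert (- \<Omega>) \<T>" _ "\<lambda>K. l -` K"])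
      fix K assume K: "K \<in> insert (- \<Omega>) \<T>"
      have "closed K" using K domain by (auto intro: compact_imp_closed mesh_compact simp: closed_Compl)
      then show "closed (l -` K)" by (rule continuous_closed_vimage) (use cl in \<open>auto simp: continuous_on_eq_continuous_at\<close>)
      show "lipschitz_on (M * norm (y - x)) (l -` K) (interp \<alpha> \<circ> l)"
      proof (rule lipschitz_onI)
        fix s t assume st: "s \<in> l -` K" "t \<in> l -` K"
        show "dist ((interp \<alpha> \<circ> l) s) ((interp \<alpha> \<circ> l) t) \<le> M * norm (y - x) * dist s t"
        proof (cases "K \<in> \<T>")
          case True
          have "interp \<alpha> (l s) - interp \<alpha> (l t) = interp_grad \<alpha> K \<bullet> (l s - l t)"
            using True st by (simp add: interp_eq interp_aff_diff)
          also have "\<bar>\<dots>\<bar> \<le> norm (interp_grad \<alpha> K) * norm (l s - l t)" by (rule Cauchy_Schwarz_ineq2)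
          also have "\<dots> \<le> M * norm (l s - l t)" by (intro mult_right_mono M True) simp
          finally show ?thesis by (simp add: ld dist_real_def mult_ac)
        next
          case False
          then have "K = - \<Omega>" using K by simp
          then show ?thesis using st M0 by (simp add: interp_zero_off_domain[OF \<alpha>])
        qed
      qed (use M0 in simp)
    next
      show "{0..1} \<subseteq> (\<Union>K\<in>insert (- \<Omega>) \<T>. l -` K)"
      proof
        fix t :: real
        show "t \<in> (\<Union>K\<in>insert (- \<Omega>) \<T>. l -` K)"
        proof (cases "l t \<in> \<Omega>")
          case True
          then have "l t \<in> \<Union>\<T>" using mesh_union closure_subset by blast
          then show ?thesis by auto
        qed simp
      qed
    qed (use finite_mesh M0 in auto)
    from lipschitz_onD[OF this, of 0 1] show ?thesis
      by (simp add: l_def dist_real_def norm_minus_commute)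
  qed
  then show ?thesis by blast
qed

lemma interp_square_integrable: "square_integrable \<Omega> (interp \<alpha>)" "square_integrable \<Omega> (grad (interp \<alpha>))"
proof -
  have c: "continuous_on (closure \<Omega>) (interp \<alpha>)" by (rule continuous_on_subset[OF interp_continuous]) simp
  have m: "interp \<alpha> \<in> borel_measurable (lebesgue_on \<Omega>)"
    using domain_sets interp_continuous
    by (intro continuous_imp_measurable_on_sets_lebesgue) (auto intro: continuous_on_subset)
  have "compact (interp \<alpha> ` closure \<Omega>)"
    using c domain by (intro compact_continuous_image) auto
  then obtain B where B: "\<And>x. x \<in> closure \<Omega> \<Longrightarrow> norm (interp \<alpha> x) \<le> B"
    using compact_imp_bounded[of "interp \<alpha> ` closure \<Omega>"] unfolding bounded_iff by blast
  have "integrable (lebesgue_on \<Omega>) (\<lambda>x. (norm (interp \<alpha> x))\<^sup>2)"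
  proof (rule finite_measure.integrable_const_bound[OF finite_measure_lebesgue_on[OF domain_sets(2)], where B="B\<^sup>2"])
    have "norm ((norm (interp \<alpha> x))\<^sup>2) \<le> B\<^sup>2" if "x \<in> \<Omega>" for x
    proof -
      have "norm (interp \<alpha> x) \<le> B" using B that closure_subset by blast
      then have "(norm (interp \<alpha> x))\<^sup>2 \<le> B\<^sup>2" by (intro power_mono) auto
      then show ?thesis by simp
    qed
    then show "AE x in lebesgue_on \<Omega>. norm ((norm (interp \<alpha> x))\<^sup>2) \<le> B\<^sup>2" by (intro AE_I2) simp
  qed (use m in measurable)
  then show "square_integrable \<Omega> (interp \<alpha>)" using m by (simp add: square_integrable_def)
  show "square_integrable \<Omega> (grad (interp \<alpha>))"
    using piecewise_grad_bounded(2)[OF interp_piecewise[of 1]] piecewise_grad_integrable(1)[OF interp_piecewise[of 1]]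
    by (simp add: square_integrable_def)
qed

text \<open>In place of Green's formula on each triangle: the product of the interpolant with a test
  function is Lipschitz with bounded support, and almost everywhere its partial derivatives follow
  the product rule, so the integrals of these vanish.\<close>

lemma interp_weak_gradient: "weak_gradient \<Omega> (interp \<alpha>) (grad (interp \<alpha>))"
  unfolding weak_gradient_def
proof (intro allI impI)
  fix \<phi> \<psi> assume tf: "test_function \<Omega> \<phi> \<psi>"
  let ?v = "interp \<alpha>" let ?g = "grad (interp \<alpha>)"
  obtain C where C: "compact C" "C \<subseteq> \<Omega>" "\<And>x. x \<notin> C \<Longrightarrow> \<phi> x = 0" and
    d\<phi>: "\<And>x. (\<phi> has_derivative (\<lambda>h. h \<bullet> \<psi> x)) (at x)" and c\<psi>: "continuous_on UNIV \<psi>"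
    using tf by (auto simp: test_function_def gderiv_def)
  have \<psi>0: "\<psi> x = 0" if "x \<notin> C" for x
  proof -
    have "((\<lambda>x. 0) has_derivative (\<lambda>h. 0)) (at x)" by simp
    then have "(\<phi> has_derivative (\<lambda>h. 0)) (at x)"
      by (rule has_derivative_transform_within_open[of _ _ _ _ "- C"])
        (use that C compact_imp_closed in \<open>auto simp: open_Compl\<close>)
    from has_derivative_unique[OF this d\<phi>] have "(\<lambda>h. 0) = (\<lambda>h. h \<bullet> \<psi> x)" .
    from fun_cong[OF this, of "\<psi> x"] show ?thesis by simp
  qed
  have bnd: "\<exists>B\<ge>0. \<forall>x. norm (f x) \<le> B" if "continuous_on UNIV f" "\<And>x. x \<notin> C' \<Longrightarrow> f x = 0" "compact C'"
    for f :: "pt \<Rightarrow> 'b::real_normed_vector" and C'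
  proof -
    have "bounded (f ` C')" by (intro compact_imp_bounded compact_continuous_image that continuous_on_subset[OF that(1)]) simp
    then obtain B where "B > 0" "\<And>x. x \<in> C' \<Longrightarrow> norm (f x) \<le> B" unfolding bounded_pos by auto
    then show ?thesis using that(2) by (intro exI[of _ B]) (metis less_imp_le norm_zero)
  qed
  have c\<phi>: "continuous_on UNIV \<phi>" using d\<phi> by (intro has_derivative_continuous_on) auto
  obtain \<Psi> where \<Psi>: "\<Psi> \<ge> 0" "\<And>x. norm (\<psi> x) \<le> \<Psi>" using bnd[OF c\<psi> \<psi>0 C(1)] by blast
  obtain \<Phi> where \<Phi>: "\<Phi> \<ge> 0" "\<And>x. norm (\<phi> x) \<le> \<Phi>" using bnd[OF c\<phi> C(3) C(1)] by blast
  have "?v x = 0" if "x \<notin> closure \<Omega>" for x using that by (rule interp_outside)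
  then obtain V where V: "V \<ge> 0" "\<And>x. norm (?v x) \<le> V"
    using bnd[OF interp_continuous] domain(3) compact_closure by blast
  obtain L where L: "\<And>x y. \<bar>?v x - ?v y\<bar> \<le> L * norm (x - y)" using interp_lipschitz by blast
  have lip\<phi>: "\<bar>\<phi> x - \<phi> y\<bar> \<le> \<Psi> * norm (x - y)" for x y
  proof -
    have "norm (\<phi> x - \<phi> y) \<le> \<Psi> * norm (x - y)"
    proof (rule differentiable_bound[of UNIV])
      fix z show "(\<phi> has_derivative (\<lambda>h. h \<bullet> \<psi> z)) (at z within UNIV)" using d\<phi> by simp
      show "onorm (\<lambda>h. h \<bullet> \<psi> z) \<le> \<Psi>"
      proof (rule onorm_le)
        fix h have "norm (h \<bullet> \<psi> z) \<le> norm h * norm (\<psi> z)" by (simp add: Cauchy_Schwarz_ineq2)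
        also have "\<dots> \<le> norm h * \<Psi>" by (intro mult_left_mono \<Psi>) simp
        finally show "norm (h \<bullet> \<psi> z) \<le> \<Psi> * norm h" by (simp add: mult.commute)
      qed
    qed auto
    then show ?thesis by simp
  qed
  define F where "F x = ?v x * \<phi> x" for x
  have lipF: "\<bar>F x - F y\<bar> \<le> (V * \<Psi> + \<Phi> * L) * norm (x - y)" for x y
  proof -
    have "F x - F y = ?v x * (\<phi> x - \<phi> y) + \<phi> y * (?v x - ?v y)" by (simp add: F_def algebra_simps)
    also have "\<bar>\<dots>\<bar> \<le> \<bar>?v x\<bar> * \<bar>\<phi> x - \<phi> y\<bar> + \<bar>\<phi> y\<bar> * \<bar>?v x - ?v y\<bar>"
      by (simp add: abs_mult[symmetric])
    also have "\<dots> \<le> V * (\<Psi> * norm (x - y)) + \<Phi> * (L * norm (x - y))"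
      using V \<Phi> lip\<phi> L by (intro add_mono mult_mono) auto
    finally show ?thesis by (simp add: algebra_simps)
  qed
  obtain R where R: "\<And>x. x \<in> closure \<Omega> \<Longrightarrow> norm x \<le> R"
    using domain(3) bounded_closure[of \<Omega>] unfolding bounded_iff by blast
  have suppF: "F x = 0" if "norm x > R" for x
  proof -
    have "x \<notin> closure \<Omega>" using R[of x] that by auto
    then show ?thesis by (simp add: F_def interp_outside)
  qed
  have ae: "AE x in lebesgue. x \<in> (\<Union>K\<in>\<T>. interior K) \<or> x \<notin> closure \<Omega>"
  proof -
    have "AE x in lebesgue. x \<notin> closure \<Omega> - (\<Union>K\<in>\<T>. interior K)"
      using negligible_off_interiors by (intro AE_not_in) (simp add: negligible_iff_null_sets)
    then show ?thesis by (rule AE_mp) (auto intro!: AE_I2)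
  qed
  have mg: "?g \<in> borel_measurable (lebesgue_on \<Omega>)" by (rule piecewise_grad_bounded(2)[OF interp_piecewise[of 1]]) simp
  have cm: "f \<in> borel_measurable (lebesgue_on \<Omega>)" if "continuous_on UNIV f" for f :: "pt \<Rightarrow> 'b::euclidean_space"
    using that domain_sets(1) by (intro continuous_imp_measurable_on_sets_lebesgue) (auto intro: continuous_on_subset)
  have comp: "(LINT x|lebesgue_on \<Omega>. (?v x *\<^sub>R \<psi> x) $ i + (\<phi> x *\<^sub>R ?g x) $ i) = 0" for i :: 2
  proof -
    \<comment> \<open>Continued by 0, the derivative of \<open>F\<close> off the closure of
      \<Omega>; the remaining frontier is null.\<close>
    define D where "D x = (if x \<in> \<Omega> then (?v x *\<^sub>R \<psi> x) $ i + (\<phi> x *\<^sub>R ?g x) $ i else 0)" for x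
    have "(LINT x|lebesgue. D x) = 0"
    proof (rule integral_directional_derivative_eq_0[where F=F and e="axis i 1", OF lipF suppF])
      show "AE x in lebesgue. (\<lambda>m. (F (x + (1 / real (Suc m)) *\<^sub>R axis i 1) - F x) * real (Suc m)) \<longlonglongrightarrow> D x"
        using ae
      proof (rule AE_mp, intro AE_I2 impI)
        fix x assume "x \<in> (\<Union>K\<in>\<T>. interior K) \<or> x \<notin> closure \<Omega>"
        then show "(\<lambda>m. (F (x + (1 / real (Suc m)) *\<^sub>R axis i 1) - F x) * real (Suc m)) \<longlonglongrightarrow> D x"
        proof
          assume "x \<in> (\<Union>K\<in>\<T>. interior K)"
          then obtain K where K: "K \<in> \<T>" "x \<in> interior K" by blast
          have "(?v has_derivative (\<lambda>h. interp_grad \<alpha> K \<bullet> h)) (at x)"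
            by (rule has_derivative_transform_within_open[OF interp_aff_derivative, of "interior K"])
              (use K interior_subset[of K] in \<open>auto simp: interp_eq[OF K(1)] subset_iff\<close>)
          from has_derivative_mult[OF this d\<phi>]
          have "(F has_derivative (\<lambda>h. ?v x * (h \<bullet> \<psi> x) + (interp_grad \<alpha> K \<bullet> h) * \<phi> x)) (at x)"
            by (simp add: F_def[abs_def])
          from has_derivative_imp_seq_quotient[OF this, of "axis i 1"]
          show ?thesis using K mesh_interior_subset[OF K(1)] interp_grad_interior[OF K]
            by (auto simp: D_def inner_axis inner_axis' mult.commute)
        next
          assume x: "x \<notin> closure \<Omega>"
          have "((\<lambda>x. 0) has_derivative (\<lambda>h. 0::real)) (at x)" by simp
          then have "(F has_derivative (\<lambda>h. 0)) (at x)"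
            by (rule has_derivative_transform_within_open[of _ _ _ _ "- closure \<Omega>"])
              (use x in \<open>auto simp: F_def interp_outside\<close>)
          moreover have "x \<notin> \<Omega>" using x closure_subset by blast
          ultimately show ?thesis using has_derivative_imp_seq_quotient[of F "\<lambda>h. 0" x "axis i 1"]
            by (simp add: D_def)
        qed
      qed
      have "(\<lambda>x. (?v x *\<^sub>R \<psi> x) $ i + (\<phi> x *\<^sub>R ?g x) $ i) \<in> borel_measurable (lebesgue_on \<Omega>)"
      proof -
        have "(\<lambda>x. (?v x *\<^sub>R \<psi> x) \<bullet> axis i 1 + (\<phi> x *\<^sub>R ?g x) \<bullet> axis i 1) \<in> borel_measurable (lebesgue_on \<Omega>)"
          by (intro borel_measurable_add borel_measurable_inner borel_measurable_scaleR borel_measurable_const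
              mg cm interp_continuous c\<psi> c\<phi>)
        then show ?thesis by (simp add: inner_axis)
      qed
      then show "D \<in> borel_measurable lebesgue" unfolding D_def
        using domain_sets(1) by (subst borel_measurable_if)
    qed
    also have "(LINT x|lebesgue. D x) = (LINT x|lebesgue. indicator \<Omega> x *\<^sub>R ((?v x *\<^sub>R \<psi> x) $ i + (\<phi> x *\<^sub>R ?g x) $ i))"
      by (intro Bochner_Integration.integral_cong) (auto simp: D_def)
    also have "\<dots> = (LINT x|lebesgue_on \<Omega>. (?v x *\<^sub>R \<psi> x) $ i + (\<phi> x *\<^sub>R ?g x) $ i)"
      using domain_sets(1) by (subst integral_restrict_space) auto
    finally show ?thesis .
  qed
  have i1: "integrable (lebesgue_on \<Omega>) (\<lambda>x. ?v x *\<^sub>R \<psi> x)"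
    by (rule finite_measure.integrable_const_bound[OF finite_measure_lebesgue_on[OF domain_sets(2)], where B="V * \<Psi>"])
      (use V \<Psi> in \<open>auto intro!: AE_I2 mult_mono cm continuous_on_scaleR interp_continuous c\<psi>\<close>)
  have i2: "integrable (lebesgue_on \<Omega>) (\<lambda>x. \<phi> x *\<^sub>R ?g x)"
    using \<Phi> by (intro integrable_bounded_mult[OF interp_square_integrable(2) cm[OF c\<phi>] _ domain_sets(2)]) auto
  show "(LINT x|lebesgue_on \<Omega>. ?v x *\<^sub>R \<psi> x) = - (LINT x|lebesgue_on \<Omega>. \<phi> x *\<^sub>R ?g x)"
    unfolding vec_eq_iff
  proof
    fix i
    have "(LINT x|lebesgue_on \<Omega>. (?v x *\<^sub>R \<psi> x) \<bullet> axis i 1) + (LINT x|lebesgue_on \<Omega>. (\<phi> x *\<^sub>R ?g x) \<bullet> axis i 1) = 0"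
      using comp[of i] integrable_inner_left[of "axis i 1", OF i1] integrable_inner_left[of "axis i 1", OF i2]
      by (subst Bochner_Integration.integral_add[symmetric]) (simp_all add: inner_axis)
    then show "(LINT x|lebesgue_on \<Omega>. ?v x *\<^sub>R \<psi> x) $ i = (- (LINT x|lebesgue_on \<Omega>. \<phi> x *\<^sub>R ?g x)) $ i"
      using i1 i2 by (simp only: integral_inner_left) (simp add: inner_axis)
  qed
qed

text \<open>The interpolant is continuous and vanishes on the frontier, so the constant sequence
  witnesses its zero trace on any part of the boundary.\<close>

lemma interp_FE_space:
  assumes "k \<ge> 1"
  shows "interp \<alpha> \<in> FE_space k \<Omega>' \<Omega> \<T>"
proof -
  have H: "H1_with_gradient \<Omega> (interp \<alpha>) (grad (interp \<alpha>))"
    by (simp add: H1_with_gradient_def interp_square_integrable interp_weak_gradient)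
  have "zero_trace_on \<Omega> (frontier \<Omega>' \<inter> frontier \<Omega>) (interp \<alpha>)"
    unfolding zero_trace_on_def
  proof (intro exI[of _ "grad (interp \<alpha>)"] exI[of _ "\<lambda>m. interp \<alpha>"] exI[of _ "\<lambda>m. grad (interp \<alpha>)"] conjI allI impI H)
    show "continuous_on (closure \<Omega>) (interp \<alpha>)" by (rule continuous_on_subset[OF interp_continuous]) simp
    fix p q assume pq: "closed_segment p q \<subseteq> frontier \<Omega>' \<inter> frontier \<Omega>"
    have "interp \<alpha> (linepath p q t) = 0" if "t \<in> {0..1}" for t
    proof (rule interp_zero_off_domain[OF \<alpha>])
      have "linepath p q t \<in> closed_segment p q" using that by (auto simp: linepath_in_path)
      then show "linepath p q t \<notin> \<Omega>" using pq domain by (auto simp: frontier_def interior_open)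
    qed
    then have "segment_integral p q (\<lambda>x. (interp \<alpha> x)\<^sup>2) = 0"
      unfolding segment_integral_def by (subst Bochner_Integration.integral_cong[where g="\<lambda>_. 0"]) auto
    then show "(\<lambda>m. segment_integral p q (\<lambda>x. (interp \<alpha> x)\<^sup>2)) \<longlonglongrightarrow> 0" by simp
  qed simp_all
  then show ?thesis
    using H interp_piecewise[OF assms] interp_outside
    by (auto simp: FE_space_def V_space_def H1_def piecewise_polys_def)
qed

end

lemma zero_FE_space: "(\<lambda>_. 0) \<in> FE_space k \<Omega>' \<Omega> \<T>"
proof -
  have H: "H1_with_gradient \<Omega> (\<lambda>_. 0) (\<lambda>_. 0)"
    by (simp add: H1_with_gradient_def square_integrable_def weak_gradient_def)
  have "zero_trace_on \<Omega> (frontier \<Omega>' \<inter> frontier \<Omega>) (\<lambda>_. 0)"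
    unfolding zero_trace_on_def
    by (intro exI[of _ "\<lambda>_. 0"] exI[of _ "\<lambda>_ _. 0"] conjI allI impI H) (simp_all add: segment_integral_def)
  moreover have "(\<lambda>_. 0) \<in> polys k" unfolding polys_def by (intro CollectI exI[of _ "\<lambda>_ _. 0"]) simp
  ultimately show ?thesis using H by (auto simp: FE_space_def V_space_def H1_def)
qed

text \<open>The value at \<open>a\<close> is all the trace information about \<open>u\<close> that
  the jump estimate takes from the space.\<close>

lemma FE_space_props:
  assumes "v \<in> FE_space k \<Omega>' \<Omega> \<T>" and "frontier \<Omega> - closed_segment a b \<subseteq> frontier \<Omega>'"
  shows "piecewise_polys k v" "continuous_on (closure \<Omega>) v" "v a = 0"
proof -
  show p: "piecewise_polys k v" using assms by (auto simp: FE_space_def piecewise_polys_def)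
  show c: "continuous_on (closure \<Omega>) v" by (rule piecewise_continuous[OF p])
  show "v a = 0"
    by (rule zero_trace_endpoint[of "frontier \<Omega>' \<inter> frontier \<Omega>"])
      (use assms c in \<open>auto simp: FE_space_def V_space_def closed_Int\<close>)
qed

end

section \<open>Patches on the interface\<close>

text \<open>This will place the apexes inside \<Omega>. The point \<open>z\<close> is written as a
  convex combination of a fixed inner point \<open>p\<close> and a point \<open>y\<close> of the
  interface line, with a weight given by the ratio of their depths; the distance from both endpoints
  keeps \<open>y\<close> on the segment. One constant serves all scales, so the required distance is
  proportional to \<open>r\<close>.\<close>

lemma (in domain_interface) near_interface_in_domain:
  "\<exists>C>0. \<forall>s r z. 0 \<le> s \<longrightarrow> s \<le> 1 \<longrightarrow> z \<in> closure \<Omega> \<longrightarrow> n \<bullet> (z - a) < 0 \<longrightarrow>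
      dist z (a + s *\<^sub>R (b - a)) \<le> r \<longrightarrow> C * r \<le> s * norm (b - a) \<longrightarrow> C * r \<le> (1 - s) * norm (b - a) \<longrightarrow> z \<in> \<Omega>"
proof -
  obtain p where p: "p \<in> \<Omega>" using domain by auto
  define q L D where "q = - (n \<bullet> (p - a))" and "L = norm (b - a)" and "D = norm (p - a) + L"
  have q: "q > 0" using n_inside[OF p] by (simp add: q_def)
  have L: "L > 0" using ab by (simp add: L_def)
  have D: "D > 0" using L norm_ge_zero[of "p - a"] unfolding D_def by linarith
  \<comment> \<open>The first summand gives a weight \<theta> of at most 1/2, the second bounds the
    distance of \<open>y\<close> from the base point.\<close>
  define C where "C = 2 * L / q + 2 * (1 + D / q)"
  have C: "C > 0" "C \<ge> 2 * L / q" "C \<ge> 2 * (1 + D / q)"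
    unfolding C_def using divide_pos_pos[OF L q] divide_pos_pos[OF D q] by (simp_all)
  show ?thesis
  proof (intro exI[of _ C] conjI C(1) allI impI)
    fix s r z
    assume s: "0 \<le> s" "s \<le> 1" and z: "z \<in> closure \<Omega>" "n \<bullet> (z - a) < 0"
      and zr: "dist z (a + s *\<^sub>R (b - a)) \<le> r" and Cr: "C * r \<le> s * norm (b - a)" "C * r \<le> (1 - s) * norm (b - a)"
    define x where "x = a + s *\<^sub>R (b - a)"
    have nx: "n \<bullet> (x - a) = 0" using n_orth by (simp add: x_def)
    have r0: "r \<ge> 0" using zr zero_le_dist order_trans by blast
    have "n \<bullet> (x - z) \<le> norm n * norm (x - z)" by (rule norm_cauchy_schwarz)
    also have "\<dots> \<le> r" using zr norm_n by (simp add: x_def dist_norm norm_minus_commute)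
    finally have nzr: "- (n \<bullet> (z - a)) \<le> r" using nx by (simp add: inner_diff_right)
    define \<theta> where "\<theta> = - (n \<bullet> (z - a)) / q"
    have \<theta>0: "0 < \<theta>" using z q by (simp add: \<theta>_def divide_neg_pos)
    have \<theta>r: "\<theta> \<le> r / q" unfolding \<theta>_def using nzr q by (intro divide_right_mono) auto
    have "2 * L / q * r \<le> C * r" using C r0 by (intro mult_right_mono)
    also have "\<dots> \<le> 1 * L"
      using order_trans[OF Cr(1)[folded L_def] mult_right_mono[of s 1 L]] s L by simp
    finally have "r / q \<le> 1 / 2" using L q by (simp add: field_simps)
    then have \<theta>h: "\<theta> \<le> 1 / 2" using \<theta>r by linarith
    define y where "y = (1 / (1 - \<theta>)) *\<^sub>R (z - \<theta> *\<^sub>R p)"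
    have zy: "z = (1 - \<theta>) *\<^sub>R y + \<theta> *\<^sub>R p" using \<theta>h by (simp add: y_def)
    have "n \<bullet> (z - a) = (1 - \<theta>) * (n \<bullet> (y - a)) + \<theta> * (n \<bullet> (p - a))"
      by (subst zy) (simp add: inner_diff_right inner_add_right algebra_simps)
    moreover have "\<theta> * (n \<bullet> (p - a)) = n \<bullet> (z - a)" using q by (simp add: \<theta>_def q_def)
    ultimately have ny: "n \<bullet> (y - a) = 0" using \<theta>h by simp
    have "cross2 (b - a) (y - a) = 0" using cross2_normal[OF norm_n n_orth, of "y - a"] ny by simp
    then obtain \<sigma> where \<sigma>: "y - a = \<sigma> *\<^sub>R (b - a)" using cross2_eq_0_imp_parallel[of "b - a"] ab by auto
    have "(1 - \<theta>) *\<^sub>R (y - x) = (z - x) - \<theta> *\<^sub>R (p - x)" by (subst zy) (simp add: algebra_simps)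
    moreover have "norm ((1 - \<theta>) *\<^sub>R (y - x)) = (1 - \<theta>) * norm (y - x)" using \<theta>h by simp
    ultimately have "(1 - \<theta>) * norm (y - x) = norm ((z - x) - \<theta> *\<^sub>R (p - x))" by simp
    also have "\<dots> \<le> norm (z - x) + norm (\<theta> *\<^sub>R (p - x))" by (rule norm_triangle_ineq4)
    also have "\<dots> \<le> r + r / q * D"
    proof (rule add_mono)
      show "norm (z - x) \<le> r" using zr by (simp add: x_def dist_norm)
      have "norm (p - x) \<le> norm (p - a) + norm (s *\<^sub>R (b - a))"
        unfolding x_def using norm_triangle_ineq4[of "p - a" "s *\<^sub>R (b - a)"] by (simp add: algebra_simps)
      also have "\<dots> \<le> D" using s L by (simp add: D_def L_def mult_left_le_one_le)
      finally have "\<theta> * norm (p - x) \<le> r / q * D" using \<theta>0 \<theta>r r0 q by (intro mult_mono) auto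
      then show "norm (\<theta> *\<^sub>R (p - x)) \<le> r / q * D" using \<theta>0 by simp
    qed
    finally have "(1 - \<theta>) * norm (y - x) \<le> r * (1 + D / q)" by (simp add: algebra_simps)
    moreover have "1 / 2 * norm (y - x) \<le> (1 - \<theta>) * norm (y - x)" using \<theta>h by (intro mult_right_mono) auto
    ultimately have "norm (y - x) \<le> 2 * (r * (1 + D / q))" by linarith
    then have "norm (y - x) \<le> 2 * (1 + D / q) * r" by (simp only: mult_ac)
    also have "\<dots> \<le> C * r" using C r0 by (intro mult_right_mono)
    finally have yx: "norm (y - x) \<le> C * r" .
    have "y - x = (\<sigma> - s) *\<^sub>R (b - a)" using \<sigma> by (simp add: x_def algebra_simps)
    then have "\<bar>\<sigma> - s\<bar> * L \<le> C * r" using yx by (simp add: L_def)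
    then have "\<bar>\<sigma> - s\<bar> * L \<le> s * L" "\<bar>\<sigma> - s\<bar> * L \<le> (1 - s) * L" using Cr unfolding L_def by linarith+
    then have "\<bar>\<sigma> - s\<bar> \<le> s" "\<bar>\<sigma> - s\<bar> \<le> 1 - s" using L by simp_all
    then have "0 \<le> \<sigma>" "\<sigma> \<le> 1" by linarith+
    moreover have "y = (1 - \<sigma>) *\<^sub>R a + \<sigma> *\<^sub>R b" using \<sigma> by (simp add: algebra_simps)
    ultimately have "y \<in> closed_segment a b" by (auto simp: in_segment)
    then show "z \<in> \<Omega>" unfolding zy using interface \<theta>0 \<theta>h p
      by (intro closure_convex_combination_in_open domain) auto
  qed
qed

section \<open>Variation of a function on an interval and on its patches\<close>

lemma square_diff_le_integral:
  fixes w w' :: "real \<Rightarrow> real"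
  assumes "s \<le> t" and I: "(w' has_integral (w t - w s)) {s..t}"
    and m: "w' \<in> borel_measurable (lebesgue_on {s..t})" and i2: "integrable (lebesgue_on {s..t}) (\<lambda>r. (w' r)\<^sup>2)"
  shows "(w t - w s)\<^sup>2 \<le> (t - s) * integral {s..t} (\<lambda>r. (w' r)\<^sup>2)"
proof -
  have i0: "integrable (lebesgue_on {s..t}) (\<lambda>r. 1 :: real)"
    by (intro finite_measure.integrable_const finite_measure_lebesgue_on) auto
  have i1: "integrable (lebesgue_on {s..t}) w'"
  proof (rule Bochner_Integration.integrable_bound)
    show "integrable (lebesgue_on {s..t}) (\<lambda>r. 1 + (w' r)\<^sup>2)" using i0 i2 by (rule Bochner_Integration.integrable_add)
    have "norm (w' r) \<le> norm (1 + (w' r)\<^sup>2)" for r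
    proof -
      have "2 * \<bar>w' r\<bar> \<le> 1 + \<bar>w' r\<bar>\<^sup>2" using zero_le_power2[of "\<bar>w' r\<bar> - 1"] by (simp add: power2_diff)
      then show ?thesis by simp
    qed
    then show "AE r in lebesgue_on {s..t}. norm (w' r) \<le> norm (1 + (w' r)\<^sup>2)" by simp
  qed (rule m)
  have "(LINT r|lebesgue_on {s..t}. w' r) = w t - w s"
    using lebesgue_integral_eq_integral[OF i1] I by (simp add: integral_unique)
  moreover have "(LINT r|lebesgue_on {s..t}. 1 * w' r)\<^sup>2 \<le> (LINT r|lebesgue_on {s..t}. 1\<^sup>2) * (LINT r|lebesgue_on {s..t}. (w' r)\<^sup>2)"
    using i0 i1 i2 by (intro integral_Cauchy_Schwarz) auto
  moreover have "(LINT r|lebesgue_on {s..t}. (w' r)\<^sup>2) = integral {s..t} (\<lambda>r. (w' r)\<^sup>2)"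
    by (rule lebesgue_integral_eq_integral[OF i2]) simp
  ultimately show ?thesis using \<open>s \<le> t\<close> by (simp add: measure_restrict_space)
qed

lemma sum_integral_patches:
  fixes f :: "real \<Rightarrow> real"
  assumes f: "f integrable_on {0..1}" and N: "N > 0"
  shows "(\<Sum>j<N. integral {real j / real N..real (Suc j) / real N} f) = integral {0..1} f"
proof -
  have "(\<Sum>j<k. integral {real j / real N..real (Suc j) / real N} f) = integral {0..real k / real N} f" if "k \<le> N" for k
    using that
  proof (induction k)
    case (Suc k)
    have "real (Suc k) / real N \<le> 1" using Suc.prems N by simp
    then have "f integrable_on {0..real (Suc k) / real N}"
      by (intro integrable_subinterval_real[OF f]) auto
    then have "integral {0..real k / real N} f + integral {real k / real N..real (Suc k) / real N} f =
       integral {0..real (Suc k) / real N} f"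
      by (intro Henstock_Kurzweil_Integration.integral_combine) (auto simp: divide_right_mono)
    then show ?case using Suc by simp
  qed simp
  from this[of N] show ?thesis using N by simp
qed

text \<open>The jump has kinks at the nodes of both meshes, so its derivative is recorded in
  integrated form.\<close>

locale jump_data =
  fixes w w' :: "real \<Rightarrow> real"
  assumes ftc: "\<And>s t. 0 \<le> s \<Longrightarrow> s \<le> t \<Longrightarrow> t \<le> 1 \<Longrightarrow> (w' has_integral (w t - w s)) {s..t}"
    and w'm: "w' \<in> borel_measurable (lebesgue_on {0..1})"
    and w'2: "integrable (lebesgue_on {0..1}) (\<lambda>r. (w' r)\<^sup>2)"
    and cw: "continuous_on {0..1} w"
begin

lemma w'2_integrable_on: "(\<lambda>r. (w' r)\<^sup>2) integrable_on {0..1}"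
  by (rule integrable_on_lebesgue_on[OF w'2]) simp

lemma w2_integrable_on: "(\<lambda>r. (w r)\<^sup>2) integrable_on {0..1}"
  by (intro integrable_continuous_real continuous_intros cw)

lemma w'2_sub: "0 \<le> s \<Longrightarrow> t \<le> 1 \<Longrightarrow> (\<lambda>r. (w' r)\<^sup>2) integrable_on {s..t}"
  by (rule integrable_subinterval_real[OF w'2_integrable_on]) auto

lemma w2_sub: "0 \<le> s \<Longrightarrow> t \<le> 1 \<Longrightarrow> (\<lambda>r. (w r)\<^sup>2) integrable_on {s..t}"
  by (rule integrable_subinterval_real[OF w2_integrable_on]) auto

lemma variation:
  assumes "0 \<le> c" "d \<le> 1" "s \<in> {c..d}" "t \<in> {c..d}"
  shows "(w t - w s)\<^sup>2 \<le> (d - c) * integral {c..d} (\<lambda>r. (w' r)\<^sup>2)"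
proof -
  have *: "(w t - w s)\<^sup>2 \<le> (d - c) * integral {c..d} (\<lambda>r. (w' r)\<^sup>2)" if st: "s \<le> t" "s \<in> {c..d}" "t \<in> {c..d}" for s t
  proof -
    have sub: "{s..t} \<subseteq> {0..1}" using st assms by auto
    have "(w t - w s)\<^sup>2 \<le> (t - s) * integral {s..t} (\<lambda>r. (w' r)\<^sup>2)"
    proof (rule square_diff_le_integral[OF st(1)])
      show "(w' has_integral (w t - w s)) {s..t}" using st assms by (intro ftc) auto
      show "w' \<in> borel_measurable (lebesgue_on {s..t})"
        by (rule measurable_restrict_mono[OF w'm sub])
      show "integrable (lebesgue_on {s..t}) (\<lambda>r. (w' r)\<^sup>2)"
        using integrable_subinterval[OF w'2, of s t] sub by simp
    qed
    also have "\<dots> \<le> (d - c) * integral {c..d} (\<lambda>r. (w' r)\<^sup>2)"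
      using st assms by (intro mult_mono integral_subset_le w'2_sub integral_nonneg) auto
    finally show ?thesis .
  qed
  show ?thesis
  proof (cases "s \<le> t")
    case True then show ?thesis using * assms by blast
  next
    case False
    then show ?thesis using *[of t s] assms by (simp add: power2_commute)
  qed
qed

text \<open>For meshes too coarse for a patch: the zero at the endpoint takes the place of the
  centre values.\<close>

lemma L2_le_variation:
  assumes "w 0 = 0"
  shows "integral {0..1} (\<lambda>r. (w r)\<^sup>2) \<le> integral {0..1} (\<lambda>r. (w' r)\<^sup>2)"
proof -
  have "integral {0..1} (\<lambda>r. (w r)\<^sup>2) \<le> integral {0..1} (\<lambda>_::real. integral {0..1} (\<lambda>r. (w' r)\<^sup>2))"
    using variation[of 0 1 0] assms by (intro integral_le w2_integrable_on) auto
  then show ?thesis by simp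
qed

text \<open>On each patch the function is compared with its centre value. For the deviation,
  Cauchy-Schwarz on an interval of length 1/N yields one factor 1/N and integration over the patch a
  second one.\<close>

lemma L2_le_patches:
  assumes N: "N > 0"
  shows "integral {0..1} (\<lambda>r. (w r)\<^sup>2) \<le> 2 / real N * (\<Sum>j<N. (w ((real j + 1/2) / real N))\<^sup>2) +
     2 / (real N)\<^sup>2 * integral {0..1} (\<lambda>r. (w' r)\<^sup>2)"
proof -
  let ?P = "\<lambda>j. {real j / real N..real (Suc j) / real N}"
  let ?E = "\<lambda>j. integral (?P j) (\<lambda>r. (w' r)\<^sup>2)"
  let ?c = "\<lambda>j. (real j + 1/2) / real N"
  have "integral {0..1} (\<lambda>r. (w r)\<^sup>2) = (\<Sum>j<N. integral (?P j) (\<lambda>r. (w r)\<^sup>2))"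
    by (rule sum_integral_patches[OF w2_integrable_on N, symmetric])
  also have "\<dots> \<le> (\<Sum>j<N. 2 / real N * (w (?c j))\<^sup>2 + 2 / (real N)\<^sup>2 * ?E j)"
  proof (rule sum_mono)
    fix j assume j: "j \<in> {..<N}"
    have P: "0 \<le> real j / real N" "real (Suc j) / real N \<le> 1" using j N by auto
    have len: "real (Suc j) / real N - real j / real N = 1 / real N" by (simp add: add_divide_distrib)
    have cP: "?c j \<in> ?P j" by (auto simp: divide_right_mono)
    have "integral (?P j) (\<lambda>r. (w r)\<^sup>2) \<le> integral (?P j) (\<lambda>_. 2 * (w (?c j))\<^sup>2 + 2 * (1 / real N * ?E j))"
    proof (rule integral_le[OF w2_sub[OF P]])
      fix r assume r: "r \<in> ?P j"
      have v: "(w r - w (?c j))\<^sup>2 \<le> 1 / real N * ?E j"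
        using variation[OF P cP r] unfolding len .
      have "(w r)\<^sup>2 \<le> 2 * (w (?c j))\<^sup>2 + 2 * (w r - w (?c j))\<^sup>2"
        using zero_le_power2[of "w r - 2 * w (?c j)"] by (simp add: power2_eq_square algebra_simps)
      then show "(w r)\<^sup>2 \<le> 2 * (w (?c j))\<^sup>2 + 2 * (1 / real N * ?E j)" using v by linarith
    qed auto
    also have "\<dots> = 1 / real N * (2 * (w (?c j))\<^sup>2 + 2 * (1 / real N * ?E j))"
      using len by (simp add: divide_right_mono)
    also have "\<dots> = 2 / real N * (w (?c j))\<^sup>2 + 2 / (real N)\<^sup>2 * ?E j"
      using N by (simp add: field_simps power2_eq_square)
    finally show "integral (?P j) (\<lambda>r. (w r)\<^sup>2) \<le> 2 / real N * (w (?c j))\<^sup>2 + 2 / (real N)\<^sup>2 * ?E j" .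
  qed
  also have "\<dots> = 2 / real N * (\<Sum>j<N. (w (?c j))\<^sup>2) + 2 / (real N)\<^sup>2 * (\<Sum>j<N. ?E j)"
    by (simp add: sum.distrib sum_distrib_left)
  also have "(\<Sum>j<N. ?E j) = integral {0..1} (\<lambda>r. (w' r)\<^sup>2)"
    by (rule sum_integral_patches[OF w'2_integrable_on N])
  finally show ?thesis .
qed

end

section \<open>Choice of the patches and flux of the test function\<close>

context mesh_interface
begin

lemma ipt_not_domain: "ipt t \<notin> \<Omega>"
  using n_inside[of "ipt t"] n_ipt[of t] by auto

lemma h_pos: "h > 0"
proof -
  have "infinite {0<..<1::real}" by simp
  then have "\<not> {0<..<1} \<subseteq> node_params" using finite_node_params finite_subset by blast
  then obtain t where "t \<in> {0<..<1}" "t \<notin> node_params" by blast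
  then obtain K t1 t2 z where "K \<in> \<T>" "edge K t1 t2 z" using edge_cover[of t] by (metis greaterThanLessThan_iff less_imp_le)
  then show ?thesis using edge_height[of K t1 t2 z] \<rho>_pos by linarith
qed

text \<open>The tangential derivative is 0, so the gradient is a multiple of \<open>n\<close>, and
  its size is the rise from edge to apex divided by the signed height. The nodal value thus fixes
  the sign, whatever the shape of the triangle.\<close>

lemma interp_grad_edge_normal:
  assumes K: "K \<in> \<T>" and e: "edge K s1 s2 y" and \<alpha>: "\<alpha> (ipt s1) = 0" "\<alpha> (ipt s2) = 0"
  shows "interp_grad \<alpha> K \<bullet> n = \<alpha> y / (n \<bullet> (y - a))"
proof -
  let ?G = "interp_grad \<alpha> K"
  note v = edge_mem[OF K e]
  have lt: "s1 < s2" and ny: "n \<bullet> (y - a) < 0" using e by (auto simp: edge_def)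
  have "?G \<bullet> (ipt s2 - ipt s1) = 0"
    using interp_aff_diff[of \<alpha> K "ipt s2" "ipt s1"] v K \<alpha> by (simp add: interp_aff_vert)
  then have G0: "?G \<bullet> (b - a) = 0" using lt by (simp add: ipt_diff)
  have Gy: "?G \<bullet> (y - ipt s1) = \<alpha> y"
    using interp_aff_diff[of \<alpha> K y "ipt s1"] v K \<alpha> by (simp add: interp_aff_vert)
  define d where "d = y - ipt s1 - (n \<bullet> (y - a)) *\<^sub>R n"
  have nn: "n \<bullet> n = 1" using norm_n by (simp add: norm_eq_1)
  have "n \<bullet> d = 0" using n_ipt[of s1] nn by (simp add: d_def inner_diff_right)
  then have "cross2 (b - a) d = 0" using cross2_normal[OF norm_n n_orth, of d] by simp
  then obtain t where "d = t *\<^sub>R (b - a)" using cross2_eq_0_imp_parallel[of "b - a"] ab by auto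
  then have "?G \<bullet> d = 0" using G0 by simp
  then have "\<alpha> y = (n \<bullet> (y - a)) * (?G \<bullet> n)" using Gy by (simp add: d_def inner_diff_right)
  then show ?thesis using ny by (simp add: field_simps)
qed

text \<open>A patch has length at least \<open>2 * C + 7\<close> times \<open>h\<close>. The part
  with \<open>C\<close> keeps the chosen edge far enough from both ends of the interface for its
  apex to lie in \<Omega>. The rest keeps all edges with this apex inside the patch, since the test
  function has flux on them too, and separates the apexes by more than \<open>h\<close>, so that no
  triangle contains two of them.\<close>

lemma patches:
  assumes C: "C > 0" "\<forall>s r z. 0 \<le> s \<longrightarrow> s \<le> 1 \<longrightarrow> z \<in> closure \<Omega> \<longrightarrow> n \<bullet> (z - a) < 0 \<longrightarrow>
      dist z (a + s *\<^sub>R (b - a)) \<le> r \<longrightarrow> C * r \<le> s * norm (b - a) \<longrightarrow> C * r \<le> (1 - s) * norm (b - a) \<longrightarrow> z \<in> \<Omega>"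
    and N: "N > 0" "(2 * C + 7) * h \<le> norm (b - a) / real N"
  shows "\<exists>K t1 t2 z. \<forall>j<N. K j \<in> \<T> \<and> edge (K j) (t1 j) (t2 j) (z j) \<and> z j \<in> \<Omega> \<and>
     (\<forall>K' s1 s2. K' \<in> \<T> \<and> edge K' s1 s2 (z j) \<longrightarrow> real j / real N \<le> s1 \<and> s2 \<le> real (Suc j) / real N) \<and>
     (\<forall>i<N. i \<noteq> j \<longrightarrow> h < dist (z i) (z j))"
proof -
  define L where "L = norm (b - a)"
  have L: "L > 0" using ab by (simp add: L_def)
  define \<epsilon> where "\<epsilon> = h / L"
  have hL: "h = \<epsilon> * L" using L by (simp add: \<epsilon>_def)
  have \<epsilon>: "\<epsilon> > 0" using h_pos L by (simp add: \<epsilon>_def)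
  have "((2 * C + 7) * \<epsilon>) * L \<le> (1 / real N) * L" using N(2) unfolding hL L_def[symmetric] by (simp add: mult_ac)
  then have small: "(2 * C + 7) * \<epsilon> \<le> 1 / real N" using L by (rule mult_right_le_imp_le)
  have C\<epsilon>: "C * \<epsilon> > 0" using C \<epsilon> by simp
  define N' where "N' = 1 / real N"
  have N': "N' > 0" "2 * (C * \<epsilon>) + 7 * \<epsilon> \<le> N'" using N small by (auto simp: N'_def algebra_simps)
  define c where "c j = (real j + 1/2) * N'" for j
  have ex: "\<exists>K t1 t2 z t. K \<in> \<T> \<and> edge K t1 t2 z \<and> t1 < t \<and> t < t2 \<and> c j < t \<and> t < c j + \<epsilon>" if "j < N" for j
  proof -
    \<comment> \<open>The centre may be a mesh node; some parameter slightly to its right is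
      not.\<close>
    have "infinite {c j<..<c j + \<epsilon>}" using \<epsilon> by simp
    then have "\<not> {c j<..<c j + \<epsilon>} \<subseteq> node_params" using finite_node_params finite_subset by blast
    then obtain t where "t \<in> {c j<..<c j + \<epsilon>}" "t \<notin> node_params" by blast
    then have t: "c j < t" "t < c j + \<epsilon>" "t \<notin> node_params" by auto
    have "0 \<le> c j" using N' by (simp add: c_def)
    moreover have "c j + \<epsilon> \<le> 1"
    proof -
      have "c j + \<epsilon> \<le> (real j + 1/2) * N' + 1/2 * N'" using N' C\<epsilon> \<epsilon> unfolding c_def by linarith
      also have "\<dots> = real (Suc j) * N'" by (simp add: algebra_simps)
      also have "\<dots> \<le> real N * N'" using that N' by (intro mult_right_mono) auto
      finally show ?thesis using N by (simp add: N'_def)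
    qed
    ultimately obtain K t1 t2 z where "K \<in> \<T>" "edge K t1 t2 z" "t1 < t" "t < t2"
      using edge_cover[of t] t by (metis less_imp_le order_trans)
    then show ?thesis using t by blast
  qed
  then obtain K t1 t2 z t where P: "\<And>j. j < N \<Longrightarrow> K j \<in> \<T> \<and> edge (K j) (t1 j) (t2 j) (z j) \<and> t1 j < t j \<and> t j < t2 j \<and> c j < t j \<and> t j < c j + \<epsilon>"
    by metis
  have dz: "dist (z j) (ipt (t j)) \<le> h" if "j < N" for j
    using mesh_dist[of "K j" "z j" "ipt (t j)"] edge_mem(6)[of "K j"] edge_neighbourhood(1)[of "K j"] P[OF that] by blast
  have rng: "real j * N' \<le> c j - N' / 2" "c j + N' / 2 = real (Suc j) * N'" for j
    by (simp_all add: c_def algebra_simps)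
  have ins: "z j \<in> \<Omega>" if j: "j < N" for j
  proof (rule C(2)[rule_format, of "t j" "z j" h])
    have "real (Suc j) * N' \<le> real N * N'" using j N' by (intro mult_right_mono) auto
    then have le1: "c j + N' / 2 \<le> 1" using N rng(2)[of j] by (simp add: N'_def)
    have ge: "c j \<ge> N' / 2" using N' by (simp add: c_def algebra_simps)
    show "0 \<le> t j" "t j \<le> 1" using P[OF j] ge le1 N' C\<epsilon> \<epsilon> by linarith+
    show "z j \<in> closure \<Omega>" using edge_mem(6)[of "K j"] P[OF j] mesh_subset by blast
    show "n \<bullet> (z j - a) < 0" using P[OF j] by (simp add: edge_def)
    show "dist (z j) (a + t j *\<^sub>R (b - a)) \<le> h" using dz[OF j] by (simp add: ipt_def)
    have "C * \<epsilon> \<le> t j" using P[OF j] ge N' C\<epsilon> \<epsilon> by linarith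
    then have "(C * \<epsilon>) * L \<le> t j * L" using L by (intro mult_right_mono) auto
    then show "C * h \<le> t j * norm (b - a)" by (simp add: hL L_def mult_ac)
    have "C * \<epsilon> \<le> 1 - t j" using P[OF j] le1 N' C\<epsilon> \<epsilon> by linarith
    then have "(C * \<epsilon>) * L \<le> (1 - t j) * L" using L by (intro mult_right_mono) auto
    then show "C * h \<le> (1 - t j) * norm (b - a)" by (simp add: hL L_def mult_ac)
  qed
  have loc: "real j / real N \<le> s1 \<and> s2 \<le> real (Suc j) / real N"
    if j: "j < N" and K': "K' \<in> \<T>" "edge K' s1 s2 (z j)" for j K' s1 s2
  proof -
    have near: "\<bar>s - t j\<bar> \<le> 2 * \<epsilon>" if "ipt s \<in> K'" for s
    proof -
      have "dist (ipt s) (ipt (t j)) \<le> dist (ipt s) (z j) + dist (z j) (ipt (t j))" by (rule dist_triangle)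
      also have "\<dots> \<le> h + h" using mesh_dist[OF K'(1) that edge_mem(6)[OF K']] dz[OF j] by linarith
      finally have "\<bar>s - t j\<bar> * L \<le> (2 * \<epsilon>) * L" by (simp add: dist_ipt hL L_def)
      then show ?thesis using L by (rule mult_right_le_imp_le)
    qed
    have "real j * N' \<le> s1" "s2 \<le> real (Suc j) * N'"
      using near[OF edge_mem(4)[OF K']] near[OF edge_mem(5)[OF K']] P[OF j] rng[of j] N' C\<epsilon> \<epsilon> by linarith+
    then show ?thesis by (simp add: N'_def)
  qed
  have sep: "h < dist (z i) (z j)" if ij: "i < N" "j < N" "i \<noteq> j" for i j
  proof -
    have "c i - c j = (real i - real j) * N'" by (simp add: c_def algebra_simps)
    then have "\<bar>c i - c j\<bar> = \<bar>real i - real j\<bar> * N'" using N' by (simp add: abs_mult)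
    moreover have "1 \<le> \<bar>real i - real j\<bar>" using ij by linarith
    ultimately have "N' \<le> \<bar>c i - c j\<bar>" using N' by simp
    \<comment> \<open>Patch length at least \<open>7 * \<epsilon>\<close>, and each \<open>t\<close>
      lies less than \<epsilon> to the right of its centre.\<close>
    then have "6 * \<epsilon> \<le> \<bar>t i - t j\<bar>" using P[OF ij(1)] P[OF ij(2)] N' C\<epsilon> \<epsilon> by linarith
    then have "(6 * \<epsilon>) * L \<le> \<bar>t i - t j\<bar> * L" using L by (intro mult_right_mono) auto
    then have "6 * h \<le> dist (ipt (t i)) (ipt (t j))" by (simp add: dist_ipt hL L_def)
    also have "\<dots> \<le> dist (z i) (ipt (t i)) + dist (z i) (z j) + dist (z j) (ipt (t j))"
      using dist_triangle[of "ipt (t i)" "ipt (t j)" "z i"] dist_triangle[of "z i" "ipt (t j)" "z j"]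
      by (simp add: dist_commute)
    also have "\<dots> \<le> 2 * h + dist (z i) (z j)" using dz[OF ij(1)] dz[OF ij(2)] by linarith
    finally show ?thesis using h_pos by linarith
  qed
  show ?thesis
  proof (rule exI[of _ K], rule exI[of _ t1], rule exI[of _ t2], rule exI[of _ z], intro allI impI)
    fix j assume j: "j < N"
    show "K j \<in> \<T> \<and> edge (K j) (t1 j) (t2 j) (z j) \<and> z j \<in> \<Omega> \<and>
     (\<forall>K' s1 s2. K' \<in> \<T> \<and> edge K' s1 s2 (z j) \<longrightarrow> real j / real N \<le> s1 \<and> s2 \<le> real (Suc j) / real N) \<and>
     (\<forall>i<N. i \<noteq> j \<longrightarrow> h < dist (z i) (z j))"
      using P[OF j] ins[OF j] loc[OF j] sep[OF _ j] by auto
  qed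
qed

text \<open>The minus sign in the nodal values compensates the negative signed height of the apex,
  so that the outward normal derivative on the edge is a positive multiple of \<open>W j\<close>. As
  the apexes are distinct, at most one term of the sum is active at a point.\<close>

context
  fixes N :: nat and K :: "nat \<Rightarrow> pt set" and t1 t2 :: "nat \<Rightarrow> real" and z :: "nat \<Rightarrow> pt"
    and W :: "nat \<Rightarrow> real" and \<alpha> :: "pt \<Rightarrow> real"
  assumes N_pos: "N > 0"
    and patch_edge: "\<And>j. j < N \<Longrightarrow> K j \<in> \<T>" "\<And>j. j < N \<Longrightarrow> edge (K j) (t1 j) (t2 j) (z j)"
    and patch_inside: "\<And>j. j < N \<Longrightarrow> z j \<in> \<Omega>"
    and patch_local: "\<And>j K' s1 s2. j < N \<Longrightarrow> K' \<in> \<T> \<Longrightarrow> edge K' s1 s2 (z j) \<Longrightarrow>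
        real j / real N \<le> s1 \<and> s2 \<le> real (Suc j) / real N"
    and patch_sep: "\<And>i j. i < N \<Longrightarrow> j < N \<Longrightarrow> i \<noteq> j \<Longrightarrow> h < dist (z i) (z j)"
  defines "\<alpha> \<equiv> \<lambda>y. \<Sum>j<N. if y = z j then - W j else 0"
begin

lemma nodal_z: "j < N \<Longrightarrow> \<alpha> (z j) = - W j"
proof -
  assume j: "j < N"
  have "(if z j = z i then - W i else 0) = (if i = j then - W j else 0)" if "i < N" for i
    using patch_sep[OF that j] h_pos by (cases "i = j") auto
  then have "\<alpha> (z j) = (\<Sum>i<N. if i = j then - W j else 0)"
    unfolding \<alpha>_def by (intro sum.cong) auto
  then show ?thesis using j by simp
qed

lemma nodal_other: "(\<And>j. j < N \<Longrightarrow> y \<noteq> z j) \<Longrightarrow> \<alpha> y = 0"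
  unfolding \<alpha>_def by (intro sum.neutral) auto

lemma nodal_off_domain: "y \<notin> \<Omega> \<Longrightarrow> \<alpha> y = 0"
  using patch_inside by (intro nodal_other) auto

lemma nodal_ipt: "\<alpha> (ipt s) = 0"
  by (rule nodal_off_domain[OF ipt_not_domain])

lemma nodal_grad_normal:
  assumes "K' \<in> \<T>" "edge K' s1 s2 y"
  shows "interp_grad \<alpha> K' \<bullet> n = \<alpha> y / (n \<bullet> (y - a))"
  by (rule interp_grad_edge_normal[where \<alpha>=\<alpha>, OF assms nodal_ipt nodal_ipt])

text \<open>Under the apex \<open>z j\<close> the normal derivative is \<open>W j\<close> divided by
  a height between \<open>2 * \<rho>\<close> and \<open>h\<close>, and \<open>W j * r\<close> is at
  least half of the square of \<open>W j\<close> up to half the squared deviation. Elsewhere in the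
  patch it is 0: an edge whose apex is some \<open>z i\<close> lies in patch \<open>i\<close>, which
  forces \<open>i = j\<close>.\<close>

lemma flux_pointwise:
  assumes j: "j < N" and t: "real j / real N < t" "t < real (Suc j) / real N"
    and K': "K' \<in> \<T>" "edge K' s1 s2 y" "s1 < t" "t < s2"
    and var: "(r - W j)\<^sup>2 \<le> E"
  shows "(if y = z j then (W j)\<^sup>2 / (2 * h) else 0) - E / (4 * \<rho>) \<le> (grad (interp \<alpha>) (ipt t) \<bullet> n) * r"
proof -
  have E: "E \<ge> 0" using var zero_le_power2 order_trans by blast
  have g: "grad (interp \<alpha>) (ipt t) \<bullet> n = \<alpha> y / (n \<bullet> (y - a))"
    using interp_grad_edge[OF K'] nodal_grad_normal[OF K'(1,2)] by simp
  define H where "H = - (n \<bullet> (y - a))"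
  have H: "2 * \<rho> \<le> H" "H \<le> h" unfolding H_def using edge_height[OF K'(1,2)] by auto
  then have H0: "H > 0" using \<rho>_pos by linarith
  show ?thesis
  proof (cases "\<exists>i<N. y = z i")
    case True
    then obtain i where i: "i < N" "y = z i" by blast
    have loc: "real i / real N \<le> s1" "s2 \<le> real (Suc i) / real N"
      using patch_local[OF i(1) K'(1)] K'(2) i(2) by auto
    have "i = j"
    proof -
      have "real i / real N < real (Suc j) / real N" "real j / real N < real (Suc i) / real N"
        using loc t K'(3,4) by linarith+
      then have "real i < real (Suc j)" "real j < real (Suc i)" using N_pos by (simp_all add: divide_less_cancel)
      then show ?thesis by linarith
    qed
    then have y: "y = z j" using i by simp
    have "grad (interp \<alpha>) (ipt t) \<bullet> n * r = (W j * r) / H"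
      unfolding g using nodal_z[OF j] by (simp add: H_def y)
    moreover have "(W j * r) / H \<ge> ((W j)\<^sup>2 / 2 - E / 2) / H"
    proof (rule divide_right_mono)
      \<comment> \<open>Polarization; the term \<open>r\<^sup>2 / 2\<close> is dropped
        afterwards.\<close>
      have "W j * r = (W j)\<^sup>2 / 2 + r\<^sup>2 / 2 - (r - W j)\<^sup>2 / 2" by (simp add: power2_eq_square field_simps)
      then show "(W j)\<^sup>2 / 2 - E / 2 \<le> W j * r" using var zero_le_power2[of r] by linarith
    qed (use H0 in simp)
    moreover have "(W j)\<^sup>2 / 2 / h \<le> (W j)\<^sup>2 / 2 / H" using H H0 by (intro divide_left_mono) auto
    moreover have "E / 2 / H \<le> E / 2 / (2 * \<rho>)" using H H0 E \<rho>_pos by (intro divide_left_mono) auto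
    ultimately show ?thesis using y by (simp add: diff_divide_distrib)
  next
    case False
    then have "\<alpha> y = 0" "y \<noteq> z j" using j by (auto intro!: nodal_other)
    then show ?thesis unfolding g using E \<rho>_pos by simp
  qed
qed

lemma nodal_piecewise: "piecewise_polys 1 (interp \<alpha>)"
  by (rule interp_piecewise) simp

lemma flux_integrable:
  assumes "continuous_on {0..1} r"
  shows "integrable (lebesgue_on {0..1}) (\<lambda>t. (grad (interp \<alpha>) (ipt t) \<bullet> n) * r t)"
proof -
  obtain M where M: "AE t in lebesgue_on {0..1}. norm (grad (interp \<alpha>) (ipt t)) \<le> M"
    using piecewise_grad_bounded(1)[OF nodal_piecewise] by blast
  have "compact (r ` {0..1})" using assms by (intro compact_continuous_image) auto
  then obtain B where B: "\<And>t. t \<in> {0..1} \<Longrightarrow> norm (r t) \<le> B"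
    using compact_imp_bounded[of "r ` {0..1}"] unfolding bounded_iff by blast
  show ?thesis
  proof (rule finite_measure.integrable_const_bound[OF finite_measure_lebesgue_on, where B="M * B"])
    show "AE t in lebesgue_on {0..1}. norm ((grad (interp \<alpha>) (ipt t) \<bullet> n) * r t) \<le> M * B"
      using M
    proof (rule AE_mp, intro AE_I2 impI)
      fix t assume t: "t \<in> space (lebesgue_on {0..1::real})" "norm (grad (interp \<alpha>) (ipt t)) \<le> M"
      have "\<bar>grad (interp \<alpha>) (ipt t) \<bullet> n\<bar> \<le> norm (grad (interp \<alpha>) (ipt t)) * norm n" by (rule Cauchy_Schwarz_ineq2)
      then have "\<bar>grad (interp \<alpha>) (ipt t) \<bullet> n\<bar> \<le> M" using t norm_n by simp
      then have "\<bar>grad (interp \<alpha>) (ipt t) \<bullet> n\<bar> * \<bar>r t\<bar> \<le> M * B"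
        using B[of t] t by (intro mult_mono) (auto intro: order_trans[OF abs_ge_zero])
      then show "norm ((grad (interp \<alpha>) (ipt t) \<bullet> n) * r t) \<le> M * B" by (simp add: abs_mult)
    qed
    have "r \<in> borel_measurable (lebesgue_on {0..1})"
      using assms by (intro continuous_imp_measurable_on_sets_lebesgue) auto
    then show "(\<lambda>t. (grad (interp \<alpha>) (ipt t) \<bullet> n) * r t) \<in> borel_measurable (lebesgue_on {0..1})"
      using piecewise_grad_bounded(3)[OF nodal_piecewise] by (intro borel_measurable_times borel_measurable_inner) auto
  qed simp
qed

text \<open>An edge of length at least \<open>2 * \<rho>\<close> takes up at least
  \<open>2 * \<rho> / norm (b - a)\<close> in the parameter; times
  \<open>(W j)\<^sup>2 / (2 * h)\<close> this is the main term. The error is the variation on a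
  patch, with one factor 1/N from Cauchy-Schwarz and one from integration.\<close>

lemma flux_lower_bound:
  assumes "jump_data w w'" and W: "\<And>j. j < N \<Longrightarrow> W j = w ((real j + 1/2) / real N)"
  shows "\<rho> / (h * norm (b - a)) * (\<Sum>j<N. (W j)\<^sup>2) - 1 / (4 * \<rho> * (real N)\<^sup>2) * integral {0..1} (\<lambda>r. (w' r)\<^sup>2)
     \<le> integral {0..1} (\<lambda>t. (grad (interp \<alpha>) (ipt t) \<bullet> n) * w t)"
proof -
  interpret jump_data w w' by fact
  let ?P = "\<lambda>j. {real j / real N..real (Suc j) / real N}"
  let ?E = "\<lambda>j. integral (?P j) (\<lambda>r. (w' r)\<^sup>2)"
  let ?\<Phi> = "\<lambda>t. (grad (interp \<alpha>) (ipt t) \<bullet> n) * w t"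
  let ?L = "norm (b - a)"
  have L: "?L > 0" using ab by simp
  have \<Phi>: "?\<Phi> integrable_on {0..1}" by (rule integrable_on_lebesgue_on[OF flux_integrable[OF cw]]) simp
  have piece: "\<rho> / (h * ?L) * (W j)\<^sup>2 - 1 / (4 * \<rho> * (real N)\<^sup>2) * ?E j \<le> integral (?P j) ?\<Phi>" if j: "j < N" for j
  proof -
    have P: "0 \<le> real j / real N" "real (Suc j) / real N \<le> 1" using j N_pos by auto
    have len: "real (Suc j) / real N - real j / real N = 1 / real N" by (simp add: add_divide_distrib)
    have cP: "(real j + 1/2) / real N \<in> ?P j" by (auto simp: divide_right_mono)
    define E where "E = 1 / real N * ?E j"
    note e = patch_edge[OF j]
    have loc: "real j / real N \<le> t1 j" "t2 j \<le> real (Suc j) / real N" using patch_local[OF j e] by auto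
    have lt: "t1 j < t2 j" using e(2) by (simp add: edge_def)
    have var: "(w t - W j)\<^sup>2 \<le> E" if "t \<in> ?P j" for t
      using variation[OF P cP that] unfolding len W[OF j] E_def .
    define low where "low t = (if t \<in> {t1 j..t2 j} then (W j)\<^sup>2 / (2 * h) else 0) - E / (4 * \<rho>)" for t
    define bad where "bad = node_params \<union> {real j / real N, real (Suc j) / real N, t1 j, t2 j}"
    define \<Psi> where "\<Psi> t = (if t \<in> bad then low t else ?\<Phi> t)" for t
    have "finite bad" using finite_node_params by (simp add: bad_def)
    have "((\<lambda>t. if t \<in> {t1 j..t2 j} then (W j)\<^sup>2 / (2 * h) else 0) has_integral ((t2 j - t1 j) * ((W j)\<^sup>2 / (2 * h)))) (?P j)"
      using loc lt has_integral_const_real[of "(W j)\<^sup>2 / (2 * h)" "t1 j" "t2 j"]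
      by (subst has_integral_restrict) auto
    moreover have "((\<lambda>t. E / (4 * \<rho>)) has_integral ((1 / real N) * (E / (4 * \<rho>)))) (?P j)"
      using has_integral_const_real[of "E / (4 * \<rho>)" "real j / real N" "real (Suc j) / real N"] len by (simp add: divide_right_mono)
    ultimately have low: "(low has_integral ((t2 j - t1 j) * ((W j)\<^sup>2 / (2 * h)) - (1 / real N) * (E / (4 * \<rho>)))) (?P j)"
      unfolding low_def by (rule has_integral_diff)
    have \<Phi>P: "?\<Phi> integrable_on ?P j" by (rule integrable_subinterval_real[OF \<Phi>]) (use P in auto)
    then have \<Psi>P: "(\<Psi> has_integral integral (?P j) ?\<Phi>) (?P j)"
      by (intro has_integral_spike_finite[OF \<open>finite bad\<close> _ integrable_integral]) (auto simp: \<Psi>_def)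
    have "low t \<le> \<Psi> t" if t: "t \<in> ?P j" for t
    proof (cases "t \<in> bad")
      case False
      then have tj: "real j / real N < t" "t < real (Suc j) / real N" "t \<notin> node_params" "t \<noteq> t1 j" "t \<noteq> t2 j"
        using t by (auto simp: bad_def)
      have "low t \<le> ?\<Phi> t"
      proof (cases "t \<in> {t1 j..t2 j}")
        case True
        then have "t1 j < t" "t < t2 j" using tj by auto
        from flux_pointwise[OF j tj(1,2) e this var[OF t]] True show ?thesis by (simp add: low_def)
      next
        case False
        obtain K' s1 s2 y where K': "K' \<in> \<T>" "edge K' s1 s2 y" "s1 < t" "t < s2"
          using edge_cover[of t] tj P by (metis less_imp_le order_trans)
        have "0 \<le> (if y = z j then (W j)\<^sup>2 / (2 * h) else 0)" using h_pos by simp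
        then show ?thesis using flux_pointwise[OF j tj(1,2) K' var[OF t]] False by (simp only: low_def if_False)
      qed
      then show ?thesis using False by (simp add: \<Psi>_def)
    qed (simp add: \<Psi>_def)
    then have "(t2 j - t1 j) * ((W j)\<^sup>2 / (2 * h)) - (1 / real N) * (E / (4 * \<rho>)) \<le> integral (?P j) ?\<Phi>"
      by (rule has_integral_le[OF low \<Psi>P])
    moreover have "\<rho> / (h * ?L) * (W j)\<^sup>2 \<le> (t2 j - t1 j) * ((W j)\<^sup>2 / (2 * h))"
    proof -
      have "2 * \<rho> / ?L \<le> t2 j - t1 j" using edge_length(1)[OF e] L by (simp add: pos_divide_le_eq)
      then have "2 * \<rho> / ?L * ((W j)\<^sup>2 / (2 * h)) \<le> (t2 j - t1 j) * ((W j)\<^sup>2 / (2 * h))"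
        using h_pos by (intro mult_right_mono) auto
      then show ?thesis by (simp add: mult_ac)
    qed
    moreover have "(1 / real N) * (E / (4 * \<rho>)) = 1 / (4 * \<rho> * (real N)\<^sup>2) * ?E j"
      by (simp add: E_def power2_eq_square)
    ultimately show ?thesis by linarith
  qed
  have "\<rho> / (h * ?L) * (\<Sum>j<N. (W j)\<^sup>2) - 1 / (4 * \<rho> * (real N)\<^sup>2) * integral {0..1} (\<lambda>r. (w' r)\<^sup>2) =
    \<rho> / (h * ?L) * (\<Sum>j<N. (W j)\<^sup>2) - 1 / (4 * \<rho> * (real N)\<^sup>2) * (\<Sum>j<N. ?E j)"
    by (simp only: sum_integral_patches[OF w'2_integrable_on N_pos])
  also have "\<dots> = (\<Sum>j<N. \<rho> / (h * ?L) * (W j)\<^sup>2 - 1 / (4 * \<rho> * (real N)\<^sup>2) * ?E j)"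
    by (simp only: sum_distrib_left sum_subtractf)
  also have "\<dots> \<le> (\<Sum>j<N. integral (?P j) ?\<Phi>)" by (intro sum_mono piece) simp
  also have "\<dots> = integral {0..1} ?\<Phi>" by (rule sum_integral_patches[OF \<Phi> N_pos])
  finally show ?thesis .
qed

text \<open>Each triangle has at most one of the apexes among its vertices, so its gradient is at
  most \<open>\<bar>W j\<bar> / (2 * \<rho>)\<close>, and it lies in the disc of radius
  \<open>h\<close> about that apex. Summing over these discs gives the factor pi.\<close>

lemma nodal_grad_bound:
  "(LINT x|lebesgue_on \<Omega>. (norm (grad (interp \<alpha>) x))\<^sup>2) \<le> pi * (h / (2 * \<rho>))\<^sup>2 * (\<Sum>j<N. (W j)\<^sup>2)"
proof -
  let ?b = "\<lambda>j x. (W j / (2 * \<rho>))\<^sup>2 * indicator (cball (z j) h) x :: real"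
  have ib: "integrable (lebesgue_on \<Omega>) (?b j)" for j
  proof (rule finite_measure.integrable_const_bound[OF finite_measure_lebesgue_on[OF domain_sets(2)], where B="(W j / (2 * \<rho>))\<^sup>2"])
    show "?b j \<in> borel_measurable (lebesgue_on \<Omega>)"
      by (intro borel_measurable_times borel_measurable_const measurable_restrict_space1 borel_measurable_indicator) auto
  qed (auto intro!: AE_I2 simp: indicator_def)
  have pointwise: "(norm (grad (interp \<alpha>) x))\<^sup>2 \<le> (\<Sum>j<N. ?b j x)" if x: "x \<in> (\<Union>K\<in>\<T>. interior K)" for x
  proof -
    obtain K' where K': "K' \<in> \<T>" "x \<in> interior K'" using x by blast
    have g: "grad (interp \<alpha>) x = interp_grad \<alpha> K'" by (rule interp_grad_interior[OF K'])
    show ?thesis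
    proof (cases "\<exists>j<N. z j \<in> verts K'")
      case True
      then obtain j where j: "j < N" "z j \<in> verts K'" by blast
      have "\<alpha> v = (if v = z j then - W j else 0)" if v: "v \<in> verts K'" for v
      proof (cases "v = z j")
        case False
        have "v \<noteq> z i" if "i < N" for i
        proof
          assume "v = z i"
          then have "i \<noteq> j" using False by auto
          then have "h < dist (z i) (z j)" using patch_sep that j by auto
          moreover have "dist (z i) (z j) \<le> h" using mesh_dist[OF K'(1)] verts_subset[OF K'(1)] v j \<open>v = z i\<close> by blast
          ultimately show False by simp
        qed
        then show ?thesis using False nodal_other by auto
      qed (simp add: nodal_z j)
      then have "norm (interp_grad \<alpha> K') \<le> (max 0 (- W j) - min 0 (- W j)) / (2 * \<rho>)"
        by (intro interp_grad_norm[OF K'(1)]) auto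
      also have "max 0 (- W j) - min 0 (- W j) = \<bar>W j\<bar>" by auto
      finally have "(norm (interp_grad \<alpha> K'))\<^sup>2 \<le> (\<bar>W j\<bar> / (2 * \<rho>))\<^sup>2" by (intro power_mono) auto
      also have "\<dots> = ?b j x"
      proof -
        have "x \<in> K'" "z j \<in> K'" using K' interior_subset verts_subset[OF K'(1)] j by auto
        then have "x \<in> cball (z j) h" using mesh_dist[OF K'(1)] by simp
        then show ?thesis by (simp add: power_divide)
      qed
      also have "\<dots> \<le> (\<Sum>j<N. ?b j x)"
        using j(1) by (intro member_le_sum) auto
      finally show ?thesis by (simp add: g)
    next
      case False
      then have "\<alpha> v = 0" if "v \<in> verts K'" for v using that by (intro nodal_other) auto
      then have "norm (interp_grad \<alpha> K') \<le> (0 - 0) / (2 * \<rho>)"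
        by (intro interp_grad_norm[OF K'(1)]) auto
      then have "interp_grad \<alpha> K' = 0" by simp
      then show ?thesis by (simp add: g sum_nonneg)
    qed
  qed
  have "(LINT x|lebesgue_on \<Omega>. (norm (grad (interp \<alpha>) x))\<^sup>2) \<le> (LINT x|lebesgue_on \<Omega>. (\<Sum>j<N. ?b j x))"
  proof (rule integral_mono_AE[OF piecewise_grad_integrable(1)[OF nodal_piecewise]])
    show "integrable (lebesgue_on \<Omega>) (\<lambda>x. \<Sum>j<N. ?b j x)" by (intro Bochner_Integration.integrable_sum ib)
    show "AE x in lebesgue_on \<Omega>. (norm (grad (interp \<alpha>) x))\<^sup>2 \<le> (\<Sum>j<N. ?b j x)"
      using AE_lebesgue_on_negligible[OF negligible_domain_off_interiors domain_sets(1)]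
      by (rule AE_mp, intro AE_I2 impI pointwise)
  qed
  also have "\<dots> = (\<Sum>j<N. LINT x|lebesgue_on \<Omega>. ?b j x)"
    by (rule Bochner_Integration.integral_sum) (rule ib)
  also have "\<dots> \<le> (\<Sum>j<N. (W j / (2 * \<rho>))\<^sup>2 * (pi * h\<^sup>2))"
  proof (rule sum_mono)
    fix j
    have "(LINT x|lebesgue_on \<Omega>. ?b j x) = (W j / (2 * \<rho>))\<^sup>2 * measure lebesgue (cball (z j) h \<inter> \<Omega>)"
      using domain_sets(1) by (simp add: measure_restrict_space)
    also have "measure lebesgue (cball (z j) h \<inter> \<Omega>) \<le> measure lebesgue (cball (z j) h)"
      using domain_sets by (intro measure_mono_fmeasurable) auto
    also have "\<dots> = pi * h\<^sup>2"
      using content_cball[of h "z j"] h_pos by (simp add: unit_ball_vol_2)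
    finally show "(LINT x|lebesgue_on \<Omega>. ?b j x) \<le> (W j / (2 * \<rho>))\<^sup>2 * (pi * h\<^sup>2)"
      by (simp add: mult_left_mono)
  qed
  also have "\<dots> = pi * (h / (2 * \<rho>))\<^sup>2 * (\<Sum>j<N. (W j)\<^sup>2)"
    by (simp add: sum_distrib_left sum_divide_distrib power_divide mult_ac)
  finally show ?thesis .
qed

text \<open>The quotient by the norm of the test function carries information only if this norm is
  positive.\<close>

lemma nodal_grad_pos:
  assumes "j < N" "W j \<noteq> 0"
  shows "(LINT x|lebesgue_on \<Omega>. (norm (grad (interp \<alpha>) x))\<^sup>2) > 0"
proof (rule ccontr)
  assume "\<not> ?thesis"
  then have "(LINT x|lebesgue_on \<Omega>. (norm (grad (interp \<alpha>) x))\<^sup>2) = 0"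
    by (simp add: antisym_conv integral_nonneg_AE not_less)
  then have "AE x in lebesgue_on \<Omega>. (norm (grad (interp \<alpha>) x))\<^sup>2 = 0"
    by (subst (asm) integral_nonneg_eq_0_iff_AE[OF piecewise_grad_integrable(1)[OF nodal_piecewise]]) auto
  then have ae: "AE x in lebesgue. x \<in> \<Omega> \<longrightarrow> grad (interp \<alpha>) x = 0"
    using domain_sets(1) by (subst (asm) AE_restrict_space_iff) auto
  note e = patch_edge[OF assms(1)]
  have "n \<bullet> (z j - a) \<noteq> 0" using e(2) by (simp add: edge_def)
  then have "interp_grad \<alpha> (K j) \<bullet> n \<noteq> 0"
    using nodal_grad_normal[OF e] nodal_z[OF assms(1)] assms(2) by simp
  then have nz: "interp_grad \<alpha> (K j) \<noteq> 0" by auto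
  have "AE x in lebesgue. x \<notin> interior (K j)"
    using ae
  proof (rule AE_mp, intro AE_I2 impI notI)
    fix x assume x: "x \<in> \<Omega> \<longrightarrow> grad (interp \<alpha>) x = 0" "x \<in> interior (K j)"
    then show False using interp_grad_interior[OF e(1) x(2), of \<alpha>] mesh_interior_subset[OF e(1)] nz by auto
  qed
  then have "negligible (interior (K j))"
    by (simp add: negligible_iff_null_sets AE_iff_null_sets)
  then show False using open_not_negligible[OF open_interior mesh_interior[OF e(1)]] by blast
qed

end

end

section \<open>The inf-sup estimate\<close>

text \<open>\<open>G\<close> stands for the gradient part of the norm of \<open>u\<close>,
  \<open>M\<close> for the size of the centre values, \<open>T\<close> for the norm of
  \<open>u\<close>, \<open>A\<close> and \<open>S\<close> for the form at (u, v) and the norm of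
  \<open>v\<close>. Either \<open>G\<close> controls \<open>T\<close>, and \<open>u\<close> is its
  own test function, or \<open>M\<close> dominates and absorbs the terms with \<open>G\<close>.
  \<open>A\<close> and \<open>S\<close> are quantified inside because \<open>v\<close> is
  constructed only for positive \<open>M\<close>.\<close>

lemma inf_sup_constant:
  fixes B1 B2 B3 c d :: real
  assumes B: "B1 > 0" "B2 \<ge> 0" "B3 > 0" and cd: "c \<ge> 0" "d \<ge> 0"
  shows "\<exists>\<beta>>0. \<forall>G M T. 0 \<le> G \<longrightarrow> 0 \<le> M \<longrightarrow> 0 \<le> T \<longrightarrow> T\<^sup>2 \<le> (1 + d) * G\<^sup>2 + c * M\<^sup>2 \<longrightarrow>
     \<beta> * T\<^sup>2 \<le> G\<^sup>2 \<or>
     (0 < M \<and> (\<forall>A S. B1 * M\<^sup>2 - B2 * G\<^sup>2 - B3 * G * M \<le> A \<longrightarrow> 0 \<le> S \<longrightarrow> S \<le> B3 * M \<longrightarrow> \<beta> * T * S \<le> A))"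
proof -
  \<comment> \<open>If \<open>G < \<epsilon> * M\<close>, the negative terms are at most
    \<open>(B2 + B3) * \<epsilon> * M\<^sup>2\<close>; this \<epsilon> leaves half of the main
    term.\<close>
  define \<epsilon> where "\<epsilon> = min 1 (B1 / (2 * (B2 + B3)))"
  have BB: "B2 + B3 > 0" using B by simp
  have \<epsilon>: "0 < \<epsilon>" "\<epsilon> \<le> 1" "(B2 + B3) * \<epsilon> \<le> B1 / 2"
  proof -
    show "0 < \<epsilon>" "\<epsilon> \<le> 1" using B BB by (auto simp: \<epsilon>_def)
    have "(B2 + B3) * \<epsilon> \<le> (B2 + B3) * (B1 / (2 * (B2 + B3)))"
      using BB by (intro mult_left_mono) (auto simp: \<epsilon>_def)
    also have "\<dots> = B1 / 2"
    proof -
      have "X * (B1 / (2 * X)) = B1 / 2" if "X > 0" for X using that by simp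
      from this[OF BB] show ?thesis .
    qed
    finally show "(B2 + B3) * \<epsilon> \<le> B1 / 2" .
  qed
  define D1 where "D1 = 1 + d + c / \<epsilon>\<^sup>2"
  define D2 where "D2 = sqrt (1 + d + c)"
  have D1: "D1 > 0" using cd \<epsilon> by (auto simp: D1_def intro: add_pos_nonneg)
  have D2: "D2 > 0" using cd by (simp add: D2_def)
  define \<beta> where "\<beta> = min (1 / D1) (B1 / (2 * D2 * B3))"
  have \<beta>: "\<beta> > 0" using D1 D2 B by (simp add: \<beta>_def)
  show ?thesis
  proof (intro exI[of _ \<beta>] conjI \<beta> allI impI)
    fix G M T :: real
    assume G: "0 \<le> G" and M: "0 \<le> M" and T: "0 \<le> T" and TT: "T\<^sup>2 \<le> (1 + d) * G\<^sup>2 + c * M\<^sup>2"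
    show "\<beta> * T\<^sup>2 \<le> G\<^sup>2 \<or>
     (0 < M \<and> (\<forall>A S. B1 * M\<^sup>2 - B2 * G\<^sup>2 - B3 * G * M \<le> A \<longrightarrow> 0 \<le> S \<longrightarrow> S \<le> B3 * M \<longrightarrow> \<beta> * T * S \<le> A))"
    proof (cases "\<epsilon> * M \<le> G")
      case True
      have "(\<epsilon> * M)\<^sup>2 \<le> G\<^sup>2" using True \<epsilon> M by (intro power_mono) auto
      then have "M\<^sup>2 \<le> G\<^sup>2 / \<epsilon>\<^sup>2" using \<epsilon> by (simp add: power_mult_distrib field_simps)
      then have "c * M\<^sup>2 \<le> c * (G\<^sup>2 / \<epsilon>\<^sup>2)" using cd by (intro mult_left_mono)
      then have "T\<^sup>2 \<le> D1 * G\<^sup>2" using TT by (simp add: D1_def algebra_simps)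
      then have "(1 / D1) * T\<^sup>2 \<le> G\<^sup>2" using D1 by (simp add: field_simps)
      moreover have "\<beta> * T\<^sup>2 \<le> (1 / D1) * T\<^sup>2" by (intro mult_right_mono) (auto simp: \<beta>_def)
      ultimately show ?thesis by linarith
    next
      case False
      then have GM: "G < \<epsilon> * M" by simp
      then have M0: "M > 0" using G M \<epsilon> by (cases "M = 0") auto
      have "\<epsilon> * M \<le> 1 * M" using \<epsilon> M by (intro mult_right_mono)
      then have GleM: "G \<le> M" using GM by simp
      then have G2: "G\<^sup>2 \<le> M\<^sup>2" using G by (intro power_mono)
      have "T\<^sup>2 \<le> (1 + d) * M\<^sup>2 + c * M\<^sup>2"
        using TT mult_left_mono[OF G2, of "1 + d"] cd by linarith
      also have "\<dots> = (D2 * M)\<^sup>2" using cd by (simp add: D2_def power_mult_distrib algebra_simps)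
      finally have TM: "T \<le> D2 * M" by (rule power2_le_imp_le) (use D2 M in simp)
      have "B2 * G\<^sup>2 + B3 * G * M \<le> B2 * (\<epsilon> * M * M) + B3 * (\<epsilon> * M) * M"
      proof (rule add_mono)
        have "G\<^sup>2 \<le> \<epsilon> * M * M" unfolding power2_eq_square using G GM GleM M \<epsilon> by (intro mult_mono) auto
        then show "B2 * G\<^sup>2 \<le> B2 * (\<epsilon> * M * M)" using B by (intro mult_left_mono)
        show "B3 * G * M \<le> B3 * (\<epsilon> * M) * M" using B GM M by (intro mult_right_mono mult_left_mono) auto
      qed
      also have "\<dots> = ((B2 + B3) * \<epsilon>) * M\<^sup>2" by (simp add: power2_eq_square algebra_simps)
      also have "\<dots> \<le> (B1 / 2) * M\<^sup>2" using \<epsilon>(3) by (intro mult_right_mono) auto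
      finally have low: "(B1 / 2) * M\<^sup>2 \<le> B1 * M\<^sup>2 - B2 * G\<^sup>2 - B3 * G * M" by (simp add: algebra_simps)
      have "\<beta> * T * S \<le> A" if A: "B1 * M\<^sup>2 - B2 * G\<^sup>2 - B3 * G * M \<le> A" and S: "0 \<le> S" "S \<le> B3 * M" for A S
      proof -
        have "\<beta> * T * S \<le> (B1 / (2 * D2 * B3)) * (D2 * M) * (B3 * M)"
          using TM T S B D2 \<beta> M by (intro mult_mono) (auto simp: \<beta>_def)
        also have "\<dots> = (B1 / 2) * M\<^sup>2" using D2 B by (simp add: power2_eq_square)
        finally show ?thesis using low A by linarith
      qed
      then show ?thesis using M0 by blast
    qed
  qed
qed

lemma mesh_interfaceI:
  assumes dom: "domain_interface \<Omega> a b n"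
    and T: "fitted_mesh \<Omega> \<T>" "shape_regular c \<T>" "quasi_uniform c' \<T>"
  shows "mesh_interface \<Omega> a b n \<T> (mesh_size \<T> / (2 * max 1 c * max 1 c')) (mesh_size \<T>)"
    and "mesh_size \<T> > 0"
proof -
  interpret domain_interface \<Omega> a b n by fact
  have fin: "finite \<T>" and un: "\<Union>\<T> = closure \<Omega>" using T(1) by (auto simp: fitted_mesh_def triangulation_def)
  have ne: "\<T> \<noteq> {}" using un domain(1) by (metis Sup_empty closure_eq_empty)
  have simp2: "\<exists>C. finite C \<and> convex hull C = K \<and> interior K \<noteq> {}" if "K \<in> \<T>" for K
  proof -
    have "2 simplex K" using T(1) that by (auto simp: fitted_mesh_def)
    then obtain C where C: "finite C" "\<not> affine_dependent C" "int (card C) = 2 + 1" "K = convex hull C"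
      unfolding simplex by blast
    have "card C = Suc (DIM(pt))" using C(3) by simp
    from interior_convex_hull_eq_empty[OF this] C show ?thesis by metis
  qed
  have dle: "diameter K \<le> mesh_size \<T>" if "K \<in> \<T>" for K
    unfolding mesh_size_def using that fin by (intro Max_ge) auto
  show pos: "mesh_size \<T> > 0"
  proof -
    obtain K where K: "K \<in> \<T>" using ne by blast
    then obtain C where C: "finite C" "convex hull C = K" "interior K \<noteq> {}" using simp2 by blast
    then obtain p r where pr: "r > 0" "cball p r \<subseteq> K" by (meson ex_in_conv mem_interior_cball)
    have "bounded K" using C finite_imp_compact_convex_hull compact_imp_bounded by blast
    then have "diameter (cball p r) \<le> diameter K" using pr by (intro diameter_subset)
    then have "diameter K > 0" using pr by (simp add: diameter_cball)
    then show ?thesis using dle[OF K] by linarith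
  qed
  show "mesh_interface \<Omega> a b n \<T> (mesh_size \<T> / (2 * max 1 c * max 1 c')) (mesh_size \<T>)"
  proof
    show "fitted_mesh \<Omega> \<T>" by fact
    show "0 < mesh_size \<T> / (2 * max 1 c * max 1 c')" using pos by simp
    fix K assume K: "K \<in> \<T>"
    obtain C where C: "finite C" "convex hull C = K" "interior K \<noteq> {}" using simp2[OF K] by blast
    show "\<exists>p. cball p (mesh_size \<T> / (2 * max 1 c * max 1 c')) \<subseteq> K"
      using has_ball_pos_inradius[OF C(2,1,3), of c "mesh_size \<T>" c'] T(2,3) K pos
      by (auto simp: shape_regular_def quasi_uniform_def)
    show "diameter K \<le> mesh_size \<T>" by (rule dle[OF K])
  qed
qed

section \<open>From finite element functions to the estimate of the jump\<close>

context mesh_interface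
begin

text \<open>Along the interface \<open>v\<close> is continuous and differentiable off the finitely
  many node parameters. Its derivative is only one-sided, relative to the closure of \<Omega>, which
  is enough because the path stays in that closure.\<close>

lemma trace_ftc:
  assumes v: "piecewise_polys k v" and st: "0 \<le> s" "s \<le> t" "t \<le> 1"
  shows "((\<lambda>r. grad v (ipt r) \<bullet> (b - a)) has_integral (v (ipt t) - v (ipt s))) {s..t}"
proof (rule fundamental_theorem_of_calculus_interior_strong[OF finite_node_params st(2)])
  have "continuous_on {s..t} ipt" unfolding ipt_def[abs_def] by (intro continuous_intros)
  then show "continuous_on {s..t} (\<lambda>r. v (ipt r))"
    using st by (intro continuous_on_compose2[OF piecewise_continuous[OF v]]) (auto intro: ipt_closure)
next
  fix x assume x: "x \<in> {s<..<t} - node_params"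
  then have x01: "0 < x" "x < 1" "x \<notin> node_params" using st by auto
  obtain K t1 t2 z where K: "K \<in> \<T>" "edge K t1 t2 z" "t1 < x" "x < t2"
    by (rule edge_cover[of x]) (use x01 in auto)
  obtain p where p: "p \<in> polys k" "\<And>x. x \<in> K \<Longrightarrow> v x = p x"
    using v K unfolding piecewise_polys_def by blast
  have d: "(v has_derivative (\<lambda>h. grad v (ipt x) \<bullet> h)) (at (ipt x) within closure \<Omega>)"
    by (rule grad_edge(2)[OF K p])
  have i: "(ipt has_derivative (\<lambda>h. h *\<^sub>R (b - a))) (at x within {0<..<1})"
    unfolding ipt_def[abs_def] by (auto intro!: derivative_eq_intros)
  have "(v \<circ> ipt has_derivative (\<lambda>h. grad v (ipt x) \<bullet> h) \<circ> (\<lambda>h. h *\<^sub>R (b - a))) (at x within {0<..<1})"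
    by (rule diff_chain_within[OF i has_derivative_subset[OF d]]) (auto intro: ipt_closure)
  then have "((\<lambda>r. v (ipt r)) has_vector_derivative grad v (ipt x) \<bullet> (b - a)) (at x within {0<..<1})"
    by (simp add: has_vector_derivative_def o_def)
  then show "((\<lambda>r. v (ipt r)) has_vector_derivative grad v (ipt x) \<bullet> (b - a)) (at x)"
    using x01 at_within_open[of x "{0<..<1}"] by simp
qed

lemma grad_zero: "x \<in> closure \<Omega> \<Longrightarrow> grad (\<lambda>_. 0) x = 0"
  by (rule grad_on_eqI) (auto intro: convex_closure domain simp: interior_closure_domain)

lemma linepath_ipt: "linepath a b t = ipt t"
  by (simp add: linepath_def ipt_def algebra_simps)

lemma inner_grad_bound:
  assumes u: "piecewise_polys k u" and v: "piecewise_polys l v"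
  shows "\<bar>LINT x|lebesgue_on \<Omega>. grad u x \<bullet> grad v x\<bar> \<le>
     sqrt (LINT x|lebesgue_on \<Omega>. (norm (grad u x))\<^sup>2) * sqrt (LINT x|lebesgue_on \<Omega>. (norm (grad v x))\<^sup>2)"
proof -
  let ?M = "lebesgue_on \<Omega>"
  have iu: "integrable ?M (\<lambda>x. (norm (grad u x))\<^sup>2)" and iv: "integrable ?M (\<lambda>x. (norm (grad v x))\<^sup>2)"
    using u v by (auto intro: piecewise_grad_integrable)
  have m: "grad u \<in> borel_measurable ?M" "grad v \<in> borel_measurable ?M"
    using u v by (auto intro: piecewise_grad_bounded)
  have ab: "norm (grad u x) * norm (grad v x) \<le> (norm (grad u x))\<^sup>2 + (norm (grad v x))\<^sup>2" for x
    using zero_le_power2[of "norm (grad u x) - norm (grad v x)"] zero_le_power2[of "norm (grad u x)"]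
      zero_le_power2[of "norm (grad v x)"] unfolding power2_diff by linarith
  have ip: "integrable ?M (\<lambda>x. norm (grad u x) * norm (grad v x))"
    by (rule Bochner_Integration.integrable_bound[OF Bochner_Integration.integrable_add[OF iu iv]])
      (use m ab in \<open>auto intro!: AE_I2 borel_measurable_times borel_measurable_norm\<close>)
  have ii: "integrable ?M (\<lambda>x. grad u x \<bullet> grad v x)"
    by (rule Bochner_Integration.integrable_bound[OF ip])
      (use m Cauchy_Schwarz_ineq2 in \<open>auto intro!: AE_I2 borel_measurable_inner simp: abs_mult\<close>)
  have "\<bar>LINT x|?M. grad u x \<bullet> grad v x\<bar> \<le> (LINT x|?M. norm (grad u x) * norm (grad v x))"
    by (rule integral_abs_bound_integral[OF ii ip]) (rule Cauchy_Schwarz_ineq2)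
  also have "\<dots> \<le> sqrt ((LINT x|?M. (norm (grad u x))\<^sup>2) * (LINT x|?M. (norm (grad v x))\<^sup>2))"
    by (rule real_le_rsqrt[OF integral_Cauchy_Schwarz[OF iu iv ip]])
  finally show ?thesis by (simp add: real_sqrt_mult)
qed

end

text \<open>The two meshes share the parametrization of the interface, whatever their normals. The
  tangential derivative of the jump is bounded by the full gradients from both sides, to which the
  inverse trace inequality applies.\<close>

lemma jump_data_FE:
  assumes M1: "mesh_interface \<Omega>1 a b n \<T>1 \<rho>1 h1" and M2: "mesh_interface \<Omega>2 a b m \<T>2 \<rho>2 h2"
    and u1: "mesh_interface.piecewise_polys \<T>1 k u1" and u2: "mesh_interface.piecewise_polys \<T>2 k u2"
  shows "jump_data (\<lambda>t. u1 (linepath a b t) - u2 (linepath a b t))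
      (\<lambda>t. (grad_on (closure \<Omega>1) u1 (linepath a b t) - grad_on (closure \<Omega>2) u2 (linepath a b t)) \<bullet> (b - a))"
    and "(LINT t|lebesgue_on {0..1}. ((grad_on (closure \<Omega>1) u1 (linepath a b t) - grad_on (closure \<Omega>2) u2 (linepath a b t)) \<bullet> (b - a))\<^sup>2)
      \<le> 2 * (norm (b - a))\<^sup>2 * ((LINT t|lebesgue_on {0..1}. (norm (grad_on (closure \<Omega>1) u1 (linepath a b t)))\<^sup>2) +
          (LINT t|lebesgue_on {0..1}. (norm (grad_on (closure \<Omega>2) u2 (linepath a b t)))\<^sup>2))"
proof -
  interpret M1: mesh_interface \<Omega>1 a b n \<T>1 \<rho>1 h1 by fact
  interpret M2: mesh_interface \<Omega>2 a b m \<T>2 \<rho>2 h2 by fact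
  let ?g1 = "\<lambda>t. grad_on (closure \<Omega>1) u1 (linepath a b t)"
  let ?g2 = "\<lambda>t. grad_on (closure \<Omega>2) u2 (linepath a b t)"
  let ?w' = "\<lambda>t. (?g1 t - ?g2 t) \<bullet> (b - a)"
  have m1: "?g1 \<in> borel_measurable (lebesgue_on {0..1})" unfolding M1.linepath_ipt by (rule M1.piecewise_grad_bounded(3)[OF u1])
  have m2: "?g2 \<in> borel_measurable (lebesgue_on {0..1})" unfolding M1.linepath_ipt by (rule M2.piecewise_grad_bounded(3)[OF u2])
  have i1: "integrable (lebesgue_on {0..1}) (\<lambda>t. (norm (?g1 t))\<^sup>2)" unfolding M1.linepath_ipt by (rule M1.piecewise_grad_integrable(2)[OF u1])
  have i2: "integrable (lebesgue_on {0..1}) (\<lambda>t. (norm (?g2 t))\<^sup>2)" unfolding M1.linepath_ipt by (rule M2.piecewise_grad_integrable(2)[OF u2])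
  have mw: "?w' \<in> borel_measurable (lebesgue_on {0..1})"
    by (intro borel_measurable_inner borel_measurable_diff borel_measurable_const m1 m2)
  let ?B = "\<lambda>t. 2 * (norm (b - a))\<^sup>2 * ((norm (?g1 t))\<^sup>2 + (norm (?g2 t))\<^sup>2)"
  have iB: "integrable (lebesgue_on {0..1}) ?B"
    by (intro integrable_mult_right Bochner_Integration.integrable_add i1 i2)
  have wB: "(?w' t)\<^sup>2 \<le> ?B t" for t
  proof -
    have "\<bar>?w' t\<bar> \<le> norm (?g1 t - ?g2 t) * norm (b - a)" by (rule Cauchy_Schwarz_ineq2)
    also have "\<dots> \<le> (norm (?g1 t) + norm (?g2 t)) * norm (b - a)" by (intro mult_right_mono norm_triangle_ineq4) auto
    finally have "\<bar>?w' t\<bar>\<^sup>2 \<le> ((norm (?g1 t) + norm (?g2 t)) * norm (b - a))\<^sup>2" by (intro power_mono) auto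
    also have "\<dots> = (norm (b - a))\<^sup>2 * (norm (?g1 t) + norm (?g2 t))\<^sup>2" by (simp add: power_mult_distrib)
    also have "\<dots> \<le> (norm (b - a))\<^sup>2 * (2 * ((norm (?g1 t))\<^sup>2 + (norm (?g2 t))\<^sup>2))"
      using zero_le_power2[of "norm (?g1 t) - norm (?g2 t)"]
      by (intro mult_left_mono) (auto simp: power2_eq_square algebra_simps)
    finally show ?thesis by (simp only: mult_ac power2_abs)
  qed
  have iw: "integrable (lebesgue_on {0..1}) (\<lambda>t. (?w' t)\<^sup>2)"
    by (rule Bochner_Integration.integrable_bound[OF iB])
      (use mw wB in \<open>auto intro!: AE_I2 borel_measurable_power intro: order_trans\<close>)
  show "jump_data (\<lambda>t. u1 (linepath a b t) - u2 (linepath a b t)) ?w'"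
  proof
    fix s t :: real assume st: "0 \<le> s" "s \<le> t" "t \<le> 1"
    show "(?w' has_integral (u1 (linepath a b t) - u2 (linepath a b t) - (u1 (linepath a b s) - u2 (linepath a b s)))) {s..t}"
      using has_integral_diff[OF M1.trace_ftc[OF u1 st] M2.trace_ftc[OF u2 st]]
      by (simp add: M1.linepath_ipt inner_diff_left algebra_simps)
  next
    have "continuous_on {0..1} (linepath a b)" by (rule continuous_on_linepath)
    moreover have "linepath a b ` {0..1} \<subseteq> closure \<Omega>1" "linepath a b ` {0..1} \<subseteq> closure \<Omega>2"
      using M1.ipt_closure M2.ipt_closure by (auto simp: M1.linepath_ipt)
    ultimately show "continuous_on {0..1} (\<lambda>t. u1 (linepath a b t) - u2 (linepath a b t))"
      by (intro continuous_on_diff continuous_on_compose2[OF M1.piecewise_continuous[OF u1]]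
        continuous_on_compose2[OF M2.piecewise_continuous[OF u2]])
  qed (use mw iw in auto)
  have "(LINT t|lebesgue_on {0..1}. (?w' t)\<^sup>2) \<le> (LINT t|lebesgue_on {0..1}. ?B t)"
    by (rule integral_mono[OF iw iB]) (rule wB)
  also have "\<dots> = 2 * (norm (b - a))\<^sup>2 * ((LINT t|lebesgue_on {0..1}. (norm (?g1 t))\<^sup>2) + (LINT t|lebesgue_on {0..1}. (norm (?g2 t))\<^sup>2))"
    using i1 i2 by simp
  finally show "(LINT t|lebesgue_on {0..1}. (?w' t)\<^sup>2) \<le> 2 * (norm (b - a))\<^sup>2 * ((LINT t|lebesgue_on {0..1}. (norm (?g1 t))\<^sup>2) + (LINT t|lebesgue_on {0..1}. (norm (?g2 t))\<^sup>2))" .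
qed

text \<open>\<open>M\<close> will be the root of the sum of squared jumps at the patch centres, or 0
  if the interface is shorter than \<open>C1 * h1\<close>. \<open>A1\<close> collects the inverse
  trace constants of both meshes, with \<open>r\<close> for passing from \<open>h2\<close> to
  \<open>h1\<close> and the smaller diffusivity for passing from gradients to the energy
  \<open>G2\<close>.\<close>

lemma jump_estimate:
  fixes \<kappa> r C C0 \<mu>1 \<mu>2 h1 h2 :: real
  assumes M1: "mesh_interface \<Omega>1 a b n \<T>1 (h1 / \<kappa>) h1" and M2: "mesh_interface \<Omega>2 a b m \<T>2 (h2 / \<kappa>) h2"
    and pos: "\<kappa> > 0" "h1 > 0" "h2 > 0" "\<mu>1 > 0" "\<mu>2 > 0" "r \<ge> 1" "C \<ge> 0" "C0 > 0"
    and ratio: "h1 \<le> r * h2"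
    and C: "\<And>p::real poly. degree p \<le> k \<Longrightarrow>
     ennreal ((poly p 0)\<^sup>2) \<le> ennreal C * (\<integral>\<^sup>+s. ennreal ((poly p s)\<^sup>2) * indicator {0..1/2} s \<partial>lborel)"
    and C0: "\<forall>s r z. 0 \<le> s \<longrightarrow> s \<le> 1 \<longrightarrow> z \<in> closure \<Omega>1 \<longrightarrow> n \<bullet> (z - a) < 0 \<longrightarrow>
      dist z (a + s *\<^sub>R (b - a)) \<le> r \<longrightarrow> C0 * r \<le> s * norm (b - a) \<longrightarrow> C0 * r \<le> (1 - s) * norm (b - a) \<longrightarrow> z \<in> \<Omega>1"
    and u1: "mesh_interface.piecewise_polys \<T>1 k u1" "u1 a = 0" and u2: "mesh_interface.piecewise_polys \<T>2 k u2" "u2 a = 0"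
    and G2: "G2 = \<mu>1 * (LINT x|lebesgue_on \<Omega>1. (norm (grad_on (closure \<Omega>1) u1 x))\<^sup>2) +
       \<mu>2 * (LINT x|lebesgue_on \<Omega>2. (norm (grad_on (closure \<Omega>2) u2 x))\<^sup>2)"
    and C1: "C1 = 2 * C0 + 7" and A1: "A1 = 2 * C * \<kappa> * r / min \<mu>1 \<mu>2"
  shows "\<exists>M\<ge>0. (\<mu>1 / h1) * (norm (b - a) * (LINT t|lebesgue_on {0..1}. (u1 (linepath a b t) - u2 (linepath a b t))\<^sup>2))
        \<le> 8 * \<mu>1 * A1 * C1\<^sup>2 * G2 + 4 * \<mu>1 * C1 * M\<^sup>2 \<and>
     (M > 0 \<longrightarrow> (\<exists>\<alpha>. (\<forall>y. y \<notin> \<Omega>1 \<longrightarrow> \<alpha> y = 0) \<and>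
        0 < (LINT x|lebesgue_on \<Omega>1. (norm (grad_on (closure \<Omega>1) (mesh_interface.interp \<Omega>1 \<T>1 \<alpha>) x))\<^sup>2) \<and>
        (LINT x|lebesgue_on \<Omega>1. (norm (grad_on (closure \<Omega>1) (mesh_interface.interp \<Omega>1 \<T>1 \<alpha>) x))\<^sup>2) \<le> pi * (\<kappa> / 2)\<^sup>2 * M\<^sup>2 \<and>
        M\<^sup>2 / \<kappa> - \<kappa> * C1\<^sup>2 * A1 * G2 \<le> norm (b - a) * (LINT t|lebesgue_on {0..1}.
          (grad_on (closure \<Omega>1) (mesh_interface.interp \<Omega>1 \<T>1 \<alpha>) (linepath a b t) \<bullet> n) * (u1 (linepath a b t) - u2 (linepath a b t)))))"
proof -
  interpret M1: mesh_interface \<Omega>1 a b n \<T>1 "h1 / \<kappa>" h1 by fact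
  interpret M2: mesh_interface \<Omega>2 a b m \<T>2 "h2 / \<kappa>" h2 by fact
  define L where "L = norm (b - a)"
  have L: "L > 0" using M1.ab by (simp add: L_def)
  define w where "w = (\<lambda>t. u1 (linepath a b t) - u2 (linepath a b t))"
  define w' where "w' = (\<lambda>t. (grad_on (closure \<Omega>1) u1 (linepath a b t) - grad_on (closure \<Omega>2) u2 (linepath a b t)) \<bullet> (b - a))"
  have jd: "jump_data w w'" unfolding w_def w'_def by (rule jump_data_FE(1)[OF M1 M2 u1(1) u2(1)])
  interpret jump_data w w' by fact
  define D1 D2 where "D1 = (LINT x|lebesgue_on \<Omega>1. (norm (grad_on (closure \<Omega>1) u1 x))\<^sup>2)"
    and "D2 = (LINT x|lebesgue_on \<Omega>2. (norm (grad_on (closure \<Omega>2) u2 x))\<^sup>2)"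
  define T1 T2 where "T1 = (LINT t|lebesgue_on {0..1}. (norm (grad_on (closure \<Omega>1) u1 (linepath a b t)))\<^sup>2)"
    and "T2 = (LINT t|lebesgue_on {0..1}. (norm (grad_on (closure \<Omega>2) u2 (linepath a b t)))\<^sup>2)"
  define E where "E = integral {0..1} (\<lambda>r. (w' r)\<^sup>2)"
  have nonneg: "D1 \<ge> 0" "D2 \<ge> 0" "T1 \<ge> 0" "T2 \<ge> 0" unfolding D1_def D2_def T1_def T2_def by (auto intro: integral_nonneg_AE)
  have G2': "G2 = \<mu>1 * D1 + \<mu>2 * D2" by (simp add: G2 D1_def D2_def)
  have G20: "G2 \<ge> 0" using nonneg pos by (simp add: G2')
  have \<mu>m: "min \<mu>1 \<mu>2 > 0" using pos by simp
  have A1m: "A1 * min \<mu>1 \<mu>2 = 2 * C * \<kappa> * r"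
    unfolding A1 using less_imp_neq[OF \<mu>m] by (simp only: nonzero_eq_divide_eq[symmetric] times_divide_eq_left) simp
  have A10: "A1 \<ge> 0" using pos \<mu>m by (simp add: A1)
  have C1p: "C1 > 0" using pos by (simp add: C1)
  \<comment> \<open>The inverse trace inequality on both sides; the one on the second mesh carries
    \<open>h2\<close> and is brought to \<open>h1\<close> by the ratio.\<close>
  have E_le: "h1 * E \<le> L * (A1 * G2)"
  proof -
    have t1: "h1 * (L * T1) \<le> \<kappa> * C * D1"
      using M1.inverse_trace[OF u1(1) pos(7) C] pos
      unfolding T1_def D1_def L_def M1.linepath_ipt by (simp add: field_simps)
    have t2: "h2 * (L * T2) \<le> \<kappa> * C * D2"
      using M2.inverse_trace[OF u2(1) pos(7) C] pos
      unfolding T2_def D2_def L_def M1.linepath_ipt by (simp add: field_simps)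
    have "h1 * (L * T2) \<le> (r * h2) * (L * T2)" using ratio L nonneg by (intro mult_right_mono) auto
    also have "\<dots> \<le> r * (\<kappa> * C * D2)" using t2 pos by (simp add: mult.assoc mult_left_mono)
    finally have t2': "h1 * (L * T2) \<le> r * (\<kappa> * C * D2)" .
    have "1 * (\<kappa> * C * D1) \<le> r * (\<kappa> * C * D1)" using pos nonneg by (intro mult_right_mono) auto
    then have t12: "h1 * (L * (T1 + T2)) \<le> r * (\<kappa> * C) * (D1 + D2)"
      using t1 t2' by (simp add: algebra_simps)
    have "E = (LINT t|lebesgue_on {0..1}. (w' t)\<^sup>2)"
      unfolding E_def by (rule lebesgue_integral_eq_integral[symmetric]) (use w'2 in auto)
    also have "\<dots> \<le> 2 * L\<^sup>2 * (T1 + T2)"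
      unfolding w'_def L_def T1_def T2_def by (rule jump_data_FE(2)[OF M1 M2 u1(1) u2(1)])
    finally have "h1 * E \<le> h1 * (2 * L\<^sup>2 * (T1 + T2))" using pos by (intro mult_left_mono) auto
    also have "\<dots> = (2 * L) * (h1 * (L * (T1 + T2)))" by (simp add: power2_eq_square)
    also have "\<dots> \<le> (2 * L) * (r * (\<kappa> * C) * (D1 + D2))" using t12 L by (intro mult_left_mono) auto
    also have "\<dots> = L * ((A1 * min \<mu>1 \<mu>2) * (D1 + D2))"
      unfolding A1m by (simp only: mult_ac)
    also have "\<dots> = L * (A1 * (min \<mu>1 \<mu>2 * (D1 + D2)))" by (simp only: mult.assoc)
    also have "\<dots> \<le> L * (A1 * G2)"
    proof (intro mult_left_mono)
      have "min \<mu>1 \<mu>2 * D1 \<le> \<mu>1 * D1" "min \<mu>1 \<mu>2 * D2 \<le> \<mu>2 * D2"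
        using nonneg by (auto intro!: mult_right_mono)
      then show "min \<mu>1 \<mu>2 * (D1 + D2) \<le> G2" by (simp add: G2' distrib_left)
    qed (use L A10 in auto)
    finally show ?thesis .
  qed
  have IW: "(LINT t|lebesgue_on {0..1}. (w t)\<^sup>2) = integral {0..1} (\<lambda>r. (w r)\<^sup>2)"
    by (rule lebesgue_integral_eq_integral) (auto intro!: continuous_imp_integrable_real continuous_intros cw)
  define I where "I = integral {0..1} (\<lambda>r. (w r)\<^sup>2)"
  have hE: "E \<le> (L / h1) * (A1 * G2)" using E_le pos by (simp add: field_simps)
  have main: "\<exists>M\<ge>0. (\<mu>1 / h1) * (L * I) \<le> 8 * \<mu>1 * A1 * C1\<^sup>2 * G2 + 4 * \<mu>1 * C1 * M\<^sup>2 \<and>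
     (M > 0 \<longrightarrow> (\<exists>\<alpha>. (\<forall>y. y \<notin> \<Omega>1 \<longrightarrow> \<alpha> y = 0) \<and>
        0 < (LINT x|lebesgue_on \<Omega>1. (norm (M1.grad (M1.interp \<alpha>) x))\<^sup>2) \<and>
        (LINT x|lebesgue_on \<Omega>1. (norm (M1.grad (M1.interp \<alpha>) x))\<^sup>2) \<le> pi * (\<kappa> / 2)\<^sup>2 * M\<^sup>2 \<and>
        M\<^sup>2 / \<kappa> - \<kappa> * C1\<^sup>2 * A1 * G2 \<le> L * (LINT t|lebesgue_on {0..1}. (M1.grad (M1.interp \<alpha>) (linepath a b t) \<bullet> n) * w t)))"
  proof (cases "L < C1 * h1")
    case True
    \<comment> \<open>No room for a patch: the zero at the endpoint bounds the jump, and
      \<open>L / h1\<close> stays below \<open>C1\<close>.\<close>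
    have "w 0 = 0" using u1 u2 by (simp add: w_def linepath_def)
    then have "I \<le> E" unfolding I_def E_def by (rule L2_le_variation)
    then have "(\<mu>1 / h1) * (L * I) \<le> (\<mu>1 / h1) * (L * ((L / h1) * (A1 * G2)))"
      using hE pos L by (intro mult_left_mono) auto
    also have "\<dots> = (L / h1)\<^sup>2 * (\<mu>1 * (A1 * G2))" using pos by (simp add: power2_eq_square field_simps)
    also have "\<dots> \<le> C1\<^sup>2 * (\<mu>1 * (A1 * G2))"
      using True pos L A10 G20 by (intro mult_right_mono power_mono) (auto simp: field_simps)
    also have "\<dots> \<le> 8 * (C1\<^sup>2 * (\<mu>1 * (A1 * G2)))" using pos A10 G20 by simp
    finally show ?thesis by (intro exI[of _ 0]) (simp add: mult_ac)
  next
    case False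
    \<comment> \<open>\<open>N\<close> is the largest number of patches of length at least
      \<open>C1 * h1\<close>, and \<open>q\<close> is their length in units of \<open>h1\<close>.
      Since \<open>y\<close> is at least 1, rounding down loses at most a factor 2, so
      \<open>q\<close> is at most \<open>2 * C1\<close>.\<close>
    define y where "y = L / (C1 * h1)"
    have y1: "y \<ge> 1" using False C1p pos by (simp add: y_def field_simps)
    define N where "N = nat \<lfloor>y\<rfloor>"
    have "1 \<le> \<lfloor>y\<rfloor>" using y1 by simp
    then have "real N = of_int \<lfloor>y\<rfloor>" "N > 0" "1 \<le> real_of_int \<lfloor>y\<rfloor>" by (auto simp: N_def)
    then have N: "N > 0" "real N \<le> y" "y \<le> 2 * real N" using floor_correct[of y] by linarith+
    define q where "q = L / (real N * h1)"
    have q: "C1 \<le> q" "q \<le> 2 * C1"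
    proof -
      have "real N * (C1 * h1) \<le> y * (C1 * h1)" "y * (C1 * h1) \<le> 2 * real N * (C1 * h1)"
        using N C1p pos by (auto intro!: mult_right_mono)
      moreover have "y * (C1 * h1) = L" using C1p pos by (simp add: y_def)
      ultimately show "C1 \<le> q" "q \<le> 2 * C1" using N pos by (auto simp: q_def field_simps)
    qed
    have q2: "q\<^sup>2 \<le> 4 * C1\<^sup>2" using power_mono[OF q(2), of 2] q(1) C1p by (simp add: power_mult_distrib)
    have "C1 * h1 \<le> L / real N" using q(1) pos N by (simp add: q_def field_simps)
    then obtain K t1 t2 z where P: "\<forall>j<N. K j \<in> \<T>1 \<and> M1.edge (K j) (t1 j) (t2 j) (z j) \<and> z j \<in> \<Omega>1 \<and>
     (\<forall>K' s1 s2. K' \<in> \<T>1 \<and> M1.edge K' s1 s2 (z j) \<longrightarrow> real j / real N \<le> s1 \<and> s2 \<le> real (Suc j) / real N) \<and>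
     (\<forall>i<N. i \<noteq> j \<longrightarrow> h1 < dist (z i) (z j))"
      using M1.patches[OF pos(8) C0 N(1)] unfolding C1 L_def by blast
    define W where "W j = w ((real j + 1/2) / real N)" for j :: nat
    define \<alpha> where "\<alpha> = (\<lambda>y. \<Sum>j<N. if y = z j then - W j else 0)"
    define M where "M = sqrt (\<Sum>j<N. (W j)\<^sup>2)"
    have MM: "M\<^sup>2 = (\<Sum>j<N. (W j)\<^sup>2)" by (simp add: M_def sum_nonneg)
    have P': "\<And>j. j < N \<Longrightarrow> K j \<in> \<T>1" "\<And>j. j < N \<Longrightarrow> M1.edge (K j) (t1 j) (t2 j) (z j)" "\<And>j. j < N \<Longrightarrow> z j \<in> \<Omega>1"
      "\<And>j K' s1 s2. j < N \<Longrightarrow> K' \<in> \<T>1 \<Longrightarrow> M1.edge K' s1 s2 (z j) \<Longrightarrow> real j / real N \<le> s1 \<and> s2 \<le> real (Suc j) / real N"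
      "\<And>i j. i < N \<Longrightarrow> j < N \<Longrightarrow> i \<noteq> j \<Longrightarrow> h1 < dist (z i) (z j)"
      using P by blast+
    have J: "(\<mu>1 / h1) * (L * I) \<le> 8 * \<mu>1 * A1 * C1\<^sup>2 * G2 + 4 * \<mu>1 * C1 * M\<^sup>2"
    proof -
      have "I \<le> 2 / real N * M\<^sup>2 + 2 / (real N)\<^sup>2 * E"
        unfolding I_def E_def MM W_def by (rule L2_le_patches[OF N(1)])
      also have "\<dots> \<le> 2 / real N * M\<^sup>2 + 2 / (real N)\<^sup>2 * ((L / h1) * (A1 * G2))"
        using hE by (intro add_left_mono mult_left_mono) auto
      finally have "(\<mu>1 / h1) * (L * I) \<le> (\<mu>1 / h1) * (L * (2 / real N * M\<^sup>2 + 2 / (real N)\<^sup>2 * ((L / h1) * (A1 * G2))))"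
        using pos L by (intro mult_left_mono) auto
      also have "\<dots> = 2 * \<mu>1 * q * M\<^sup>2 + 2 * \<mu>1 * A1 * G2 * q\<^sup>2"
        unfolding q_def using pos N by (simp add: power2_eq_square field_simps)
      also have "\<dots> \<le> 2 * \<mu>1 * (2 * C1) * M\<^sup>2 + 2 * \<mu>1 * A1 * G2 * (4 * C1\<^sup>2)"
        using q q2 pos A10 G20 by (intro add_mono mult_right_mono mult_left_mono) auto
      finally show ?thesis by (simp add: mult_ac)
    qed
    have "\<exists>\<alpha>. (\<forall>y. y \<notin> \<Omega>1 \<longrightarrow> \<alpha> y = 0) \<and>
        0 < (LINT x|lebesgue_on \<Omega>1. (norm (M1.grad (M1.interp \<alpha>) x))\<^sup>2) \<and>
        (LINT x|lebesgue_on \<Omega>1. (norm (M1.grad (M1.interp \<alpha>) x))\<^sup>2) \<le> pi * (\<kappa> / 2)\<^sup>2 * M\<^sup>2 \<and>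
        M\<^sup>2 / \<kappa> - \<kappa> * C1\<^sup>2 * A1 * G2 \<le> L * (LINT t|lebesgue_on {0..1}. (M1.grad (M1.interp \<alpha>) (linepath a b t) \<bullet> n) * w t)"
      if M: "M > 0"
    proof (intro exI[of _ \<alpha>] conjI allI impI)
      show "\<alpha> y = 0" if "y \<notin> \<Omega>1" for y
        unfolding \<alpha>_def by (rule M1.nodal_off_domain[where N=N and K=K and z=z and W=W, OF N(1) P' that])
      have "\<exists>j<N. W j \<noteq> 0"
      proof (rule ccontr)
        assume "\<not> ?thesis"
        then have "(\<Sum>j<N. (W j)\<^sup>2) = 0" by (intro sum.neutral) auto
        then show False using M by (simp add: M_def)
      qed
      then obtain j where j: "j < N" "W j \<noteq> 0" by blast
      show "0 < (LINT x|lebesgue_on \<Omega>1. (norm (M1.grad (M1.interp \<alpha>) x))\<^sup>2)"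
        unfolding \<alpha>_def by (rule M1.nodal_grad_pos[where N=N and K=K and z=z and W=W, OF N(1) P' j])
      have "(LINT x|lebesgue_on \<Omega>1. (norm (M1.grad (M1.interp \<alpha>) x))\<^sup>2) \<le> pi * (h1 / (2 * (h1 / \<kappa>)))\<^sup>2 * (\<Sum>j<N. (W j)\<^sup>2)"
        unfolding \<alpha>_def by (rule M1.nodal_grad_bound[where N=N and K=K and z=z and W=W, OF N(1) P'])
      then show "(LINT x|lebesgue_on \<Omega>1. (norm (M1.grad (M1.interp \<alpha>) x))\<^sup>2) \<le> pi * (\<kappa> / 2)\<^sup>2 * M\<^sup>2"
        using pos by (simp add: MM)
      have "(LINT t|lebesgue_on {0..1}. (M1.grad (M1.interp \<alpha>) (linepath a b t) \<bullet> n) * w t) =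
          integral {0..1} (\<lambda>t. (M1.grad (M1.interp \<alpha>) (M1.ipt t) \<bullet> n) * w t)"
        unfolding M1.linepath_ipt \<alpha>_def
        by (rule lebesgue_integral_eq_integral[OF M1.flux_integrable[where N=N and K=K and z=z and W=W, OF N(1) P' cw]]) simp_all
      also have "\<dots> \<ge> (h1 / \<kappa>) / (h1 * L) * M\<^sup>2 - 1 / (4 * (h1 / \<kappa>) * (real N)\<^sup>2) * E"
        unfolding L_def E_def MM \<alpha>_def by (rule M1.flux_lower_bound[where N=N and K=K and z=z and W=W, OF N(1) P' jd]) (simp_all add: W_def)
      finally have "L * ((h1 / \<kappa>) / (h1 * L) * M\<^sup>2 - 1 / (4 * (h1 / \<kappa>) * (real N)\<^sup>2) * E) \<le>
         L * (LINT t|lebesgue_on {0..1}. (M1.grad (M1.interp \<alpha>) (linepath a b t) \<bullet> n) * w t)"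
        using L by (intro mult_left_mono) auto
      moreover have "L * ((h1 / \<kappa>) / (h1 * L) * M\<^sup>2 - 1 / (4 * (h1 / \<kappa>) * (real N)\<^sup>2) * E) =
         M\<^sup>2 / \<kappa> - (L * \<kappa> / (4 * h1 * (real N)\<^sup>2)) * E"
        using L pos by (simp add: field_simps)
      moreover have "(L * \<kappa> / (4 * h1 * (real N)\<^sup>2)) * E \<le> \<kappa> * C1\<^sup>2 * A1 * G2"
      proof -
        have "(L * \<kappa> / (4 * h1 * (real N)\<^sup>2)) * E \<le> (L * \<kappa> / (4 * h1 * (real N)\<^sup>2)) * ((L / h1) * (A1 * G2))"
          using hE L pos by (intro mult_left_mono) auto
        also have "\<dots> = (\<kappa> / 4 * (A1 * G2)) * q\<^sup>2"
          unfolding q_def using pos N by (simp add: power2_eq_square field_simps)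
        also have "\<dots> \<le> (\<kappa> / 4 * (A1 * G2)) * (4 * C1\<^sup>2)"
          using q2 pos A10 G20 by (intro mult_left_mono) auto
        finally show ?thesis by (simp add: mult_ac)
      qed
      ultimately show "M\<^sup>2 / \<kappa> - \<kappa> * C1\<^sup>2 * A1 * G2 \<le> L * (LINT t|lebesgue_on {0..1}. (M1.grad (M1.interp \<alpha>) (linepath a b t) \<bullet> n) * w t)"
        by linarith
    qed
    moreover have "M \<ge> 0" by (simp add: M_def sum_nonneg)
    ultimately show ?thesis using J by blast
  qed
  show ?thesis using main unfolding I_def IW[symmetric] unfolding L_def w_def .
qed

lemma (in mesh_interface) integral_grad_zero:
  fixes f :: "pt \<Rightarrow> pt \<Rightarrow> real"
  assumes "\<And>x. f 0 x = 0"
  shows "(LINT x|lebesgue_on \<Omega>. f (grad (\<lambda>_. 0) x) x) = 0"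
proof -
  have "f (grad (\<lambda>_. 0) x) x = 0" if "x \<in> \<Omega>" for x
  proof -
    have "x \<in> closure \<Omega>" using that closure_subset by blast
    then show ?thesis using grad_zero assms by simp
  qed
  then show ?thesis
    by (subst Bochner_Integration.integral_cong[where g="\<lambda>_. 0"]) auto
qed

section \<open>Evaluation of the norm and the form, and the conclusion\<close>

lemma gamma_coeff_le:
  assumes "\<mu>1 > 0" "\<mu>2 > 0" "h1 > 0" "h2 > 0"
  shows "gamma_coeff \<mu>1 \<mu>2 h1 h2 \<le> \<mu>1 / h1" "gamma_coeff \<mu>1 \<mu>2 h1 h2 > 0"
proof -
  have "\<mu>1 * \<mu>2 / (h1 * \<mu>2 + h2 * \<mu>1) \<le> \<mu>1 * \<mu>2 / (h1 * \<mu>2)"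
    using assms by (intro divide_left_mono mult_pos_pos add_pos_pos) auto
  then show "gamma_coeff \<mu>1 \<mu>2 h1 h2 \<le> \<mu>1 / h1" using assms by (simp add: gamma_coeff_def)
  show "gamma_coeff \<mu>1 \<mu>2 h1 h2 > 0" using assms by (simp add: gamma_coeff_def add_pos_pos)
qed

lemma nitsche_form_diagonal:
  "nitsche_form \<Omega>1 \<Omega>2 a b n \<mu>1 \<mu>2 h1 h2 u u =
     \<mu>1 * (LINT x|lebesgue_on \<Omega>1. (norm (grad_on (closure \<Omega>1) (fst u) x))\<^sup>2) +
     \<mu>2 * (LINT x|lebesgue_on \<Omega>2. (norm (grad_on (closure \<Omega>2) (snd u) x))\<^sup>2)"
  by (simp add: nitsche_form_def dot_square_norm)

lemma triple_norm_eq: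
  assumes "\<mu>1 > 0" "\<mu>2 > 0" "h1 > 0" "h2 > 0"
  shows "triple_norm \<Omega>1 \<Omega>2 a b \<mu>1 \<mu>2 h1 h2 w = sqrt (
     \<mu>1 * (LINT x|lebesgue_on \<Omega>1. (norm (grad_on (closure \<Omega>1) (fst w) x))\<^sup>2) +
     \<mu>2 * (LINT x|lebesgue_on \<Omega>2. (norm (grad_on (closure \<Omega>2) (snd w) x))\<^sup>2) +
     gamma_coeff \<mu>1 \<mu>2 h1 h2 * (norm (b - a) * (LINT t|lebesgue_on {0..1}. (jump w (linepath a b t))\<^sup>2)))"
  using assms gamma_coeff_le(2)[OF assms]
  by (simp add: triple_norm_def segment_integral_def power_mult_distrib mult_ac)

theorem theorem2p5:
  fixes \<Omega>1 \<Omega>2 :: "pt set" and a b n :: pt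
    and \<mu>1 \<mu>2 c_shape c_unif c_ratio :: real and k :: nat
  assumes "convex_polygonal_domain \<Omega>1" and "convex_polygonal_domain \<Omega>2"
    and "\<Omega>1 \<inter> \<Omega>2 = {}"
    and "closure \<Omega>1 \<inter> closure \<Omega>2 = closed_segment a b" and "a \<noteq> b"
    and "\<forall>x \<in> closed_segment a b. outward_unit_normal \<Omega>1 x n \<and> outward_unit_normal \<Omega>2 x (- n)"
    and "\<mu>1 > 0" and "\<mu>2 > 0" and "k \<ge> 1"
  shows "\<exists>\<beta>>0. \<forall>\<T>1 \<T>2 h1 h2 Vh.
    fitted_mesh \<Omega>1 \<T>1 \<and> shape_regular c_shape \<T>1 \<and> quasi_uniform c_unif \<T>1 \<and>
    fitted_mesh \<Omega>2 \<T>2 \<and> shape_regular c_shape \<T>2 \<and> quasi_uniform c_unif \<T>2 \<and>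
    h1 = mesh_size \<T>1 \<and> h2 = mesh_size \<T>2 \<and>
    \<mu>2 * h1 \<ge> \<mu>1 * h2 \<and> h1 \<le> c_ratio * h2 \<and>
    Vh = FE_product k \<Omega>1 \<Omega>2 \<T>1 \<T>2 \<and> (\<exists>v\<in>Vh. v \<noteq> zero_pair) \<longrightarrow>
    (\<forall>u\<in>Vh.
       ereal (\<beta> * triple_norm \<Omega>1 \<Omega>2 a b \<mu>1 \<mu>2 h1 h2 u) \<le>
       (SUP v \<in> {v \<in> Vh. v \<noteq> zero_pair}.
          ereal (nitsche_form \<Omega>1 \<Omega>2 a b n \<mu>1 \<mu>2 h1 h2 u v /
                 triple_norm \<Omega>1 \<Omega>2 a b \<mu>1 \<mu>2 h1 h2 v)))"
proof -
  have di1: "domain_interface \<Omega>1 a b n" and di2: "domain_interface \<Omega>2 a b (- n)"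
    using assms by (auto intro!: domain_interface.intro)
  interpret I1: domain_interface \<Omega>1 a b n by (rule di1)
  interpret I2: domain_interface \<Omega>2 a b "- n" by (rule di2)
  obtain C0 where C0: "C0 > 0" "\<forall>s r z. 0 \<le> s \<longrightarrow> s \<le> 1 \<longrightarrow> z \<in> closure \<Omega>1 \<longrightarrow> n \<bullet> (z - a) < 0 \<longrightarrow>
      dist z (a + s *\<^sub>R (b - a)) \<le> r \<longrightarrow> C0 * r \<le> s * norm (b - a) \<longrightarrow> C0 * r \<le> (1 - s) * norm (b - a) \<longrightarrow> z \<in> \<Omega>1"
    using I1.near_interface_in_domain by blast
  obtain C where C: "C > 0" "\<And>p::real poly. degree p \<le> k \<Longrightarrow>
     ennreal ((poly p 0)\<^sup>2) \<le> ennreal C * (\<integral>\<^sup>+s. ennreal ((poly p s)\<^sup>2) * indicator {0..1/2} s \<partial>lborel)"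
    using poly_value_le_L2[of k] by blast
  \<comment> \<open>\<kappa> is the ratio of the mesh size to the radius of the inscribed balls, the
    same for both meshes.\<close>
  define \<kappa> r where "\<kappa> = 2 * max 1 c_shape * max 1 c_unif" and "r = max 1 c_ratio"
  define C1 A1 where "C1 = 2 * C0 + 7" and "A1 = 2 * C * \<kappa> * r / min \<mu>1 \<mu>2"
  \<comment> \<open>\<open>B1\<close> has the factor 1/2 from the lower bound of the weight.
    \<open>B2\<close> comes from the variation of the jump in the flux estimate.
    \<open>B3 * M\<close> bounds the norm of the test function, with pi from the area of a disc and
    \<kappa>/2 from h/(2 \<rho>).\<close>
  define B1 B2 B3 where "B1 = \<mu>1 / (2 * \<kappa>)" and "B2 = \<mu>1 * (\<kappa> * C1\<^sup>2 * A1)" and "B3 = sqrt (\<mu>1 * pi) * (\<kappa> / 2)"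
  have \<kappa>: "\<kappa> > 0" and r: "r \<ge> 1" by (auto simp: \<kappa>_def r_def)
  have C1: "C1 > 0" using C0 by (simp add: C1_def)
  have A1: "A1 > 0" using C \<kappa> r assms(7,8) by (auto simp: A1_def intro!: divide_pos_pos mult_pos_pos)
  have B: "B1 > 0" "B2 \<ge> 0" "B3 > 0" using \<kappa> assms(7) A1 by (auto simp: B1_def B2_def B3_def)
  have cd: "4 * \<mu>1 * C1 \<ge> 0" "8 * \<mu>1 * A1 * C1\<^sup>2 \<ge> 0" using assms(7) C1 A1 by auto
  obtain \<beta> where \<beta>: "\<beta> > 0" and alt: "\<And>G M T. 0 \<le> G \<Longrightarrow> 0 \<le> M \<Longrightarrow> 0 \<le> T \<Longrightarrow>
     T\<^sup>2 \<le> (1 + 8 * \<mu>1 * A1 * C1\<^sup>2) * G\<^sup>2 + (4 * \<mu>1 * C1) * M\<^sup>2 \<Longrightarrow>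
     \<beta> * T\<^sup>2 \<le> G\<^sup>2 \<or>
     (0 < M \<and> (\<forall>A S. B1 * M\<^sup>2 - B2 * G\<^sup>2 - B3 * G * M \<le> A \<longrightarrow> 0 \<le> S \<longrightarrow> S \<le> B3 * M \<longrightarrow> \<beta> * T * S \<le> A))"
    using inf_sup_constant[OF B cd] by blast
  show ?thesis
  proof (intro exI[of _ \<beta>] conjI \<beta> allI impI ballI)
    fix \<T>1 \<T>2 h1 h2 Vh u
    assume H: "fitted_mesh \<Omega>1 \<T>1 \<and> shape_regular c_shape \<T>1 \<and> quasi_uniform c_unif \<T>1 \<and>
      fitted_mesh \<Omega>2 \<T>2 \<and> shape_regular c_shape \<T>2 \<and> quasi_uniform c_unif \<T>2 \<and>
      h1 = mesh_size \<T>1 \<and> h2 = mesh_size \<T>2 \<and>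
      \<mu>2 * h1 \<ge> \<mu>1 * h2 \<and> h1 \<le> c_ratio * h2 \<and>
      Vh = FE_product k \<Omega>1 \<Omega>2 \<T>1 \<T>2 \<and> (\<exists>v\<in>Vh. v \<noteq> zero_pair)" and u: "u \<in> Vh"
    let ?A = "nitsche_form \<Omega>1 \<Omega>2 a b n \<mu>1 \<mu>2 h1 h2"
    let ?N = "triple_norm \<Omega>1 \<Omega>2 a b \<mu>1 \<mu>2 h1 h2"
    have h: "h1 > 0" "h2 > 0" using mesh_interfaceI(2)[OF di1] mesh_interfaceI(2)[OF di2] H by auto
    have M1: "mesh_interface \<Omega>1 a b n \<T>1 (h1 / \<kappa>) h1"
      using mesh_interfaceI(1)[OF di1, of \<T>1 c_shape c_unif] H by (simp add: \<kappa>_def)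
    have M2: "mesh_interface \<Omega>2 a b (- n) \<T>2 (h2 / \<kappa>) h2"
      using mesh_interfaceI(1)[OF di2, of \<T>2 c_shape c_unif] H by (simp add: \<kappa>_def)
    interpret M1: mesh_interface \<Omega>1 a b n \<T>1 "h1 / \<kappa>" h1 by (rule M1)
    interpret M2: mesh_interface \<Omega>2 a b "- n" \<T>2 "h2 / \<kappa>" h2 by (rule M2)
    have ratio: "h1 \<le> r * h2"
    proof -
      have "c_ratio * h2 \<le> r * h2" using h by (intro mult_right_mono) (auto simp: r_def)
      then show ?thesis using H by linarith
    qed
    let ?\<Omega> = "composed_domain \<Omega>1 \<Omega>2"
    have Vh: "Vh = FE_space k ?\<Omega> \<Omega>1 \<T>1 \<times> FE_space k ?\<Omega> \<Omega>2 \<T>2"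
      using H by (simp add: FE_product_def)
    have fr1: "frontier \<Omega>1 - closed_segment a b \<subseteq> frontier ?\<Omega>"
      using frontier_minus_interface_subset[OF assms(4)] I1.domain by blast
    have fr2: "frontier \<Omega>2 - closed_segment a b \<subseteq> frontier ?\<Omega>"
    proof -
      have "closure \<Omega>2 \<inter> closure \<Omega>1 = closed_segment a b" using assms(4) by blast
      from frontier_minus_interface_subset[OF this] show ?thesis
        using I2.domain by (auto simp: composed_domain_def Un_commute)
    qed
    obtain u1 u2 where uu: "u = (u1, u2)" by (cases u)
    have u1: "u1 \<in> FE_space k ?\<Omega> \<Omega>1 \<T>1" and u2: "u2 \<in> FE_space k ?\<Omega> \<Omega>2 \<T>2" using u Vh uu by auto
    note p1 = M1.FE_space_props[OF u1 fr1] note p2 = M2.FE_space_props[OF u2 fr2]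
    define D1 D2 where "D1 = (LINT x|lebesgue_on \<Omega>1. (norm (grad_on (closure \<Omega>1) u1 x))\<^sup>2)"
      and "D2 = (LINT x|lebesgue_on \<Omega>2. (norm (grad_on (closure \<Omega>2) u2 x))\<^sup>2)"
    have D0: "D1 \<ge> 0" "D2 \<ge> 0" unfolding D1_def D2_def by (auto intro: integral_nonneg_AE)
    define G where "G = sqrt (\<mu>1 * D1 + \<mu>2 * D2)"
    have G0: "G \<ge> 0" and GG: "G\<^sup>2 = \<mu>1 * D1 + \<mu>2 * D2" using D0 assms(7,8) by (auto simp: G_def)
    define J where "J = norm (b - a) * (LINT t|lebesgue_on {0..1}. (u1 (linepath a b t) - u2 (linepath a b t))\<^sup>2)"
    have J0: "J \<ge> 0" unfolding J_def by (intro mult_nonneg_nonneg integral_nonneg_AE) auto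
    define T where "T = ?N u"
    have T: "T = sqrt (G\<^sup>2 + gamma_coeff \<mu>1 \<mu>2 h1 h2 * J)"
      unfolding T_def triple_norm_eq[OF assms(7,8) h] uu by (simp add: GG D1_def D2_def J_def jump_def)
    have g: "gamma_coeff \<mu>1 \<mu>2 h1 h2 \<le> \<mu>1 / h1" "gamma_coeff \<mu>1 \<mu>2 h1 h2 > 0"
      using gamma_coeff_le[OF assms(7,8) h] by auto
    have T0: "T \<ge> 0" and TT: "T\<^sup>2 = G\<^sup>2 + gamma_coeff \<mu>1 \<mu>2 h1 h2 * J"
      using g J0 by (auto simp: T)
    have Auu: "?A u u = G\<^sup>2" unfolding nitsche_form_diagonal uu by (simp add: GG D1_def D2_def)
    let ?SUP = "SUP v \<in> {v \<in> Vh. v \<noteq> zero_pair}. ereal (?A u v / ?N v)"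
    have upper: "ereal (\<beta> * T) \<le> ?SUP" if "v \<in> Vh" "v \<noteq> zero_pair" "\<beta> * T \<le> ?A u v / ?N v" for v
      using that by (intro SUP_upper2[of v]) auto
    have "ereal (\<beta> * T) \<le> ?SUP"
    proof (cases "u = zero_pair")
      case True
      have z1: "grad_on (closure \<Omega>1) (\<lambda>_. 0) x = 0" if "x \<in> closure \<Omega>1" for x by (rule M1.grad_zero[OF that])
      have z2: "grad_on (closure \<Omega>2) (\<lambda>_. 0) x = 0" if "x \<in> closure \<Omega>2" for x by (rule M2.grad_zero[OF that])
      have u0: "u1 = (\<lambda>_. 0)" "u2 = (\<lambda>_. 0)" using True uu by auto
      note i1 = M1.integral_grad_zero and i2 = M2.integral_grad_zero
      have flux0: "flux_average \<Omega>1 \<Omega>2 n \<mu>1 \<mu>2 h1 h2 u (linepath a b t) = 0" if "t \<in> {0..1}" for t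
        using that z1 z2 M1.ipt_closure M2.ipt_closure by (simp add: flux_average_def uu u0 M1.linepath_ipt)
      have T00: "T = 0"
        using i1[of "\<lambda>g _. (norm g)\<^sup>2"] i2[of "\<lambda>g _. (norm g)\<^sup>2"]
        by (simp add: T GG D1_def D2_def J_def u0)
      \<comment> \<open>The zero pair is not an admissible test function; at any other one the form
        vanishes, and so does the left-hand side.\<close>
      obtain v where v: "v \<in> Vh" "v \<noteq> zero_pair" using H by blast
      have "?A u v = 0"
      proof -
        have "segment_integral a b (\<lambda>x. flux_average \<Omega>1 \<Omega>2 n \<mu>1 \<mu>2 h1 h2 u x * jump v x) = 0"
          unfolding segment_integral_def using flux0
          by (subst Bochner_Integration.integral_cong[where g="\<lambda>_. 0"]) auto
        moreover have "segment_integral a b (\<lambda>x. flux_average \<Omega>1 \<Omega>2 n \<mu>1 \<mu>2 h1 h2 v x * jump u x) = 0"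
          by (simp add: segment_integral_def jump_def uu u0)
        ultimately show ?thesis
          unfolding nitsche_form_def
          using i1[of "\<lambda>g x. g \<bullet> grad_on (closure \<Omega>1) (fst v) x"]
            i2[of "\<lambda>g x. g \<bullet> grad_on (closure \<Omega>2) (snd v) x"]
          by (simp add: uu u0)
      qed
      then show ?thesis using upper[OF v] T00 by simp
    next
      case False
      show ?thesis
      proof (cases "T = 0")
        case True
        \<comment> \<open>Division by 0 yields 0, so \<open>u\<close> itself attains the
          bound.\<close>
        then show ?thesis using upper[OF u False] by (simp add: T_def[symmetric])
      next
        case T_ne: False
        then have Tp: "T > 0" using T0 by simp
        obtain M where M0: "M \<ge> 0" and MJ: "(\<mu>1 / h1) * J \<le> 8 * \<mu>1 * A1 * C1\<^sup>2 * G\<^sup>2 + 4 * \<mu>1 * C1 * M\<^sup>2"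
          and ex: "M > 0 \<Longrightarrow> \<exists>\<alpha>. (\<forall>y. y \<notin> \<Omega>1 \<longrightarrow> \<alpha> y = 0) \<and>
        0 < (LINT x|lebesgue_on \<Omega>1. (norm (grad_on (closure \<Omega>1) (M1.interp \<alpha>) x))\<^sup>2) \<and>
        (LINT x|lebesgue_on \<Omega>1. (norm (grad_on (closure \<Omega>1) (M1.interp \<alpha>) x))\<^sup>2) \<le> pi * (\<kappa> / 2)\<^sup>2 * M\<^sup>2 \<and>
        M\<^sup>2 / \<kappa> - \<kappa> * C1\<^sup>2 * A1 * G\<^sup>2 \<le> norm (b - a) * (LINT t|lebesgue_on {0..1}.
          (grad_on (closure \<Omega>1) (M1.interp \<alpha>) (linepath a b t) \<bullet> n) * (u1 (linepath a b t) - u2 (linepath a b t)))"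
          using jump_estimate[OF M1 M2 \<kappa> h assms(7,8) r less_imp_le[OF C(1)] C0(1) ratio C(2) C0(2) p1(1,3) p2(1,3)
              GG[unfolded D1_def D2_def] C1_def A1_def]
          unfolding J_def by blast
        \<comment> \<open>The jump estimate is scaled by \<open>\<mu>1 / h1\<close>, which dominates
          \<gamma>.\<close>
        have "gamma_coeff \<mu>1 \<mu>2 h1 h2 * J \<le> (\<mu>1 / h1) * J" using g J0 by (intro mult_right_mono)
        then have "T\<^sup>2 \<le> (1 + 8 * \<mu>1 * A1 * C1\<^sup>2) * G\<^sup>2 + (4 * \<mu>1 * C1) * M\<^sup>2"
          using MJ by (simp add: TT algebra_simps)
        from alt[OF G0 M0 T0 this] show ?thesis
        proof
          assume "\<beta> * T\<^sup>2 \<le> G\<^sup>2"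
          then have "\<beta> * T \<le> ?A u u / ?N u"
            unfolding Auu T_def[symmetric] using Tp by (simp add: field_simps power2_eq_square)
          then show ?thesis using upper[OF u False] by simp
        next
          assume "0 < M \<and> (\<forall>A S. B1 * M\<^sup>2 - B2 * G\<^sup>2 - B3 * G * M \<le> A \<longrightarrow> 0 \<le> S \<longrightarrow> S \<le> B3 * M \<longrightarrow> \<beta> * T * S \<le> A)"
          then have Mp: "M > 0" and fin: "\<And>A S. B1 * M\<^sup>2 - B2 * G\<^sup>2 - B3 * G * M \<le> A \<Longrightarrow> 0 \<le> S \<Longrightarrow> S \<le> B3 * M \<Longrightarrow> \<beta> * T * S \<le> A"
            by blast+
          from ex[OF Mp] obtain \<alpha> where \<alpha>: "\<And>y. y \<notin> \<Omega>1 \<Longrightarrow> \<alpha> y = 0"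
            and Dv0: "0 < (LINT x|lebesgue_on \<Omega>1. (norm (grad_on (closure \<Omega>1) (M1.interp \<alpha>) x))\<^sup>2)"
            and Dvle: "(LINT x|lebesgue_on \<Omega>1. (norm (grad_on (closure \<Omega>1) (M1.interp \<alpha>) x))\<^sup>2) \<le> pi * (\<kappa> / 2)\<^sup>2 * M\<^sup>2"
            and fl: "M\<^sup>2 / \<kappa> - \<kappa> * C1\<^sup>2 * A1 * G\<^sup>2 \<le> norm (b - a) * (LINT t|lebesgue_on {0..1}.
          (grad_on (closure \<Omega>1) (M1.interp \<alpha>) (linepath a b t) \<bullet> n) * (u1 (linepath a b t) - u2 (linepath a b t)))"
            by blast
          define v1 where "v1 = M1.interp \<alpha>"
          define Dv where "Dv = (LINT x|lebesgue_on \<Omega>1. (norm (grad_on (closure \<Omega>1) v1 x))\<^sup>2)"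
          define F where "F = norm (b - a) * (LINT t|lebesgue_on {0..1}.
             (grad_on (closure \<Omega>1) v1 (linepath a b t) \<bullet> n) * (u1 (linepath a b t) - u2 (linepath a b t)))"
          \<comment> \<open>This \<open>v\<close> has no jump and no gradient on \<Omega>2: of the
            flux terms only the one with the flux of \<open>v\<close> survives, and only its first
            part.\<close>
          define v where "v = (v1, (\<lambda>_. 0) :: pt \<Rightarrow> real)"
          have Dv: "0 < Dv" "Dv \<le> pi * (\<kappa> / 2)\<^sup>2 * M\<^sup>2" using Dv0 Dvle by (simp_all add: Dv_def v1_def)
          have F: "M\<^sup>2 / \<kappa> - \<kappa> * C1\<^sup>2 * A1 * G\<^sup>2 \<le> F" using fl by (simp add: F_def v1_def)
          have vV: "v \<in> Vh"
            using M1.interp_FE_space[OF \<alpha> assms(9)] M2.zero_FE_space by (simp add: Vh v_def v1_def)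
          have v10: "v1 (linepath a b t) = 0" for t
            unfolding v1_def M1.linepath_ipt by (rule M1.interp_zero_off_domain[OF \<alpha> M1.ipt_not_domain])
          have z2: "grad_on (closure \<Omega>2) (\<lambda>_. 0) x = 0" if "x \<in> closure \<Omega>2" for x by (rule M2.grad_zero[OF that])
          have jv: "jump v (linepath a b t) = 0" for t by (simp add: jump_def v_def v10)
          note i2 = M2.integral_grad_zero
          have Nv: "?N v = sqrt (\<mu>1 * Dv)"
            unfolding triple_norm_eq[OF assms(7,8) h] using i2[of "\<lambda>g _. (norm g)\<^sup>2"]
            by (simp add: v_def Dv_def jv[unfolded v_def])
          have Nv0: "?N v > 0" using Nv Dv assms(7) by simp
          have B3sq: "B3\<^sup>2 = \<mu>1 * (pi * (\<kappa> / 2)\<^sup>2)" using assms(7) unfolding B3_def power_mult_distrib by simp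
          have "(?N v)\<^sup>2 = \<mu>1 * Dv" using Nv Dv assms(7) by simp
          also have "\<dots> \<le> \<mu>1 * (pi * (\<kappa> / 2)\<^sup>2 * M\<^sup>2)" using Dv assms(7) by (intro mult_left_mono) auto
          also have "\<dots> = (B3 * M)\<^sup>2" by (simp only: power_mult_distrib B3sq mult.assoc)
          finally have NvB: "?N v \<le> B3 * M" by (rule power2_le_imp_le) (use B M0 in simp)
          define P where "P = (LINT x|lebesgue_on \<Omega>1. grad_on (closure \<Omega>1) u1 x \<bullet> grad_on (closure \<Omega>1) v1 x)"
          have "\<bar>P\<bar> \<le> sqrt D1 * sqrt Dv"
            unfolding P_def D1_def Dv_def v1_def by (rule M1.inner_grad_bound[OF p1(1) M1.interp_piecewise[of 1]]) simp
          then have "\<mu>1 * \<bar>P\<bar> \<le> \<mu>1 * (sqrt D1 * sqrt Dv)" using assms(7) by (intro mult_left_mono) auto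
          also have "\<dots> = sqrt (\<mu>1 * D1) * sqrt (\<mu>1 * Dv)" using assms(7) by (simp add: real_sqrt_mult)
          also have "\<dots> \<le> G * (B3 * M)"
          proof (rule mult_mono)
            show "sqrt (\<mu>1 * D1) \<le> G" unfolding G_def using D0 assms(8) by simp
            show "sqrt (\<mu>1 * Dv) \<le> B3 * M" using NvB Nv by simp
          qed (use G0 Dv assms(7) in auto)
          finally have Ple: "\<mu>1 * \<bar>P\<bar> \<le> B3 * G * M" by (simp add: mult_ac)
          define \<omega> where "\<omega> = weight1 \<mu>1 \<mu>2 h1 h2"
          have \<omega>: "1 / 2 \<le> \<omega>" "\<omega> \<le> 1"
          proof -
            have "h1 * \<mu>2 + h2 * \<mu>1 > 0" using h assms(7,8) by (simp add: add_pos_pos)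
            moreover have "\<mu>1 * h2 \<le> \<mu>2 * h1" using H by blast
            moreover have "0 \<le> h2 * \<mu>1" using h assms(7) by simp
            ultimately show "1 / 2 \<le> \<omega>" "\<omega> \<le> 1" by (auto simp: \<omega>_def weight1_def field_simps)
          qed
          have Auv: "?A u v = \<mu>1 * P + \<omega> * \<mu>1 * F"
          proof -
            have s1: "segment_integral a b (\<lambda>x. flux_average \<Omega>1 \<Omega>2 n \<mu>1 \<mu>2 h1 h2 u x * jump v x) = 0"
              by (simp add: segment_integral_def jv)
            have "(LINT t|lebesgue_on {0..1}. flux_average \<Omega>1 \<Omega>2 n \<mu>1 \<mu>2 h1 h2 v (linepath a b t) * jump u (linepath a b t)) =
              (LINT t|lebesgue_on {0..1}. (\<omega> * \<mu>1) * ((grad_on (closure \<Omega>1) v1 (linepath a b t) \<bullet> n) * (u1 (linepath a b t) - u2 (linepath a b t))))"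
              using z2 M2.ipt_closure
              by (intro Bochner_Integration.integral_cong) (auto simp: flux_average_def v_def uu jump_def \<omega>_def M1.linepath_ipt)
            then have s2: "segment_integral a b (\<lambda>x. flux_average \<Omega>1 \<Omega>2 n \<mu>1 \<mu>2 h1 h2 v x * jump u x) = \<omega> * \<mu>1 * F"
              by (simp add: segment_integral_def F_def)
            have s3: "(LINT x|lebesgue_on \<Omega>2. (\<mu>2 *\<^sub>R grad_on (closure \<Omega>2) (snd u) x) \<bullet> grad_on (closure \<Omega>2) (snd v) x) = 0"
              using i2[of "\<lambda>g x. (\<mu>2 *\<^sub>R grad_on (closure \<Omega>2) u2 x) \<bullet> g"] by (simp only: v_def uu fst_conv snd_conv inner_zero_right)
            show ?thesis unfolding nitsche_form_def s1 s2 s3 by (simp add: uu v_def P_def)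
          qed
          have "B1 * M\<^sup>2 - B2 * G\<^sup>2 - B3 * G * M \<le> ?A u v"
          proof -
            define Y where "Y = \<kappa> * C1\<^sup>2 * A1 * G\<^sup>2"
            have Y: "Y \<ge> 0" using \<kappa> A1 by (simp add: Y_def)
            have "(\<omega> * \<mu>1) * (M\<^sup>2 / \<kappa> - Y) \<le> (\<omega> * \<mu>1) * F"
              using F \<omega> assms(7) by (intro mult_left_mono) (auto simp: Y_def)
            \<comment> \<open>The weight is estimated from below by 1/2 on the gain and from above
              by 1 on the loss.\<close>
            moreover have "(1 / 2) * (\<mu>1 * (M\<^sup>2 / \<kappa>)) \<le> \<omega> * (\<mu>1 * (M\<^sup>2 / \<kappa>))" "\<omega> * (\<mu>1 * Y) \<le> 1 * (\<mu>1 * Y)"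
              using \<omega> \<kappa> Y assms(7) by (intro mult_right_mono; simp)+
            moreover have "B1 * M\<^sup>2 = (1 / 2) * (\<mu>1 * (M\<^sup>2 / \<kappa>))" "B2 * G\<^sup>2 = \<mu>1 * Y"
              by (simp_all add: B1_def B2_def Y_def)
            ultimately have "B1 * M\<^sup>2 - B2 * G\<^sup>2 \<le> \<omega> * \<mu>1 * F" by (simp add: algebra_simps)
            moreover have "- (\<mu>1 * \<bar>P\<bar>) \<le> \<mu>1 * P"
              using assms(7) mult_left_mono[of "- \<bar>P\<bar>" P \<mu>1] by simp
            ultimately show ?thesis unfolding Auv using Ple by linarith
          qed
          from fin[OF this less_imp_le[OF Nv0] NvB] have "\<beta> * T \<le> ?A u v / ?N v"
            using Nv0 by (simp add: pos_le_divide_eq)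
          moreover have "v \<noteq> zero_pair"
          proof
            assume "v = zero_pair"
            then have "v1 = (\<lambda>_. 0)" by (simp add: v_def)
            then have "Dv = 0" unfolding Dv_def using M1.integral_grad_zero[of "\<lambda>g _. (norm g)\<^sup>2"] by simp
            then show False using Dv by simp
          qed
          ultimately show ?thesis using upper[OF vV] by simp
        qed
      qed
    qed
    then show "ereal (\<beta> * ?N u) \<le> ?SUP" by (simp add: T_def)
  qed
qed

end
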